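(* Let $p_0\in\mathbb{R}^2$ and let $C$ be a normal curve with start point $p_0$. If $C$ is self-overlapping, then $\sigma(C)=W(C)$, i.e. the minimum homotopy area of $C$ equals its winding area.
   Context: A closed curve is a continuous map $C:[0,1]\to\mathbb{R}^2$ with $C(0)=C(1)$; $[C]$ is its image. $C$ is (piecewise) regular if it is (piecewise) differentiable with nowhere vanishing left and right derivatives. With the parameters $0$ and $1$ identified, an intersection point is a $p\in[C]$ with more than one preimage; it is always assumed that $C(t)\ne C(0)$ for $t\in(0,1)$. An intersection point is a simple crossing point if it has exactly two preimages $t_1\ne t_2$ and the tangent vectors there exist and are linearly independent. $C$ is normal if it is piecewise regular with finitely many intersection points, all simple crossing points. A homotopy from $C$ to the constant curve $p_0=C(0)$ is a continuous $H:[0,1]^2\to\mathbb{R}^2$ with $H(0,t)=C(t)$, $H(1,t)=p_0$, $H(s,0)=H(s,1)=p_0$. $E_H(x)$ is the number of connected components of $H^{-1}(x)$, and $\mathrm{Area}(H)=\int_{\mathbb{R}^2}E_H(x)\,dx$. $\sigma(C)$ is the infimum of $\mathrm{Area}(H)$ over all piecewise differentiable homotopies $H$ from $C$ to $p_0$. $wn(x,C)$ is the winding number of $C$ around $x\in\mathbb{R}^2\setminus[C]$, and the winding area is $W(C)=\int_{\mathbb{R}^2}|wn(x,C)|\,dx$. A regular normal curve $C$ is self-overlapping if it is the restriction to $\partial D^2$ of an immersion $F:D^2\to\mathbb{R}^2$ of the two-disk; a curve that is not regular normal is called self-overlapping if there exists an arbitrarily close approximation $\tilde C$ that is a regular normal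 self-overlapping curve. *)

theory Defs
  imports "HOL-Complex_Analysis.Complex_Analysis"
begin

text \<open>
  The plane is the type \<^typ>\<open>complex\<close>, so that the library's winding number is available. Curves
  are functions on the reals of which only the values on the unit interval matter.
\<close>

section \<open>Closed curves\<close>

definition closed_curve :: "(real \<Rightarrow> complex) \<Rightarrow> bool" where
  "closed_curve c \<longleftrightarrow> path c \<and> pathfinish c = pathstart c"

text \<open>
  The 1-periodic extension makes the identification of the parameters 0 and 1 precise: one-sided
  derivatives and differentiability at the start point are those of the curve as a map on the circle.
\<close>

definition periodic_ext :: "(real \<Rightarrow> complex) \<Rightarrow> real \<Rightarrow> complex" where
  "periodic_ext c t = c (frac t)"

definition piecewise_regular :: "(real \<Rightarrow> complex) \<Rightarrow> bool" where
  "piecewise_regular c \<longleftrightarrow>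
     closed_curve c \<and> c piecewise_differentiable_on {0..1} \<and>
     (\<forall>t. (\<exists>v. v \<noteq> 0 \<and> (periodic_ext c has_vector_derivative v) (at_left t)) \<and>
          (\<exists>v. v \<noteq> 0 \<and> (periodic_ext c has_vector_derivative v) (at_right t)))"

definition regular_curve :: "(real \<Rightarrow> complex) \<Rightarrow> bool" where
  "regular_curve c \<longleftrightarrow>
     closed_curve c \<and>
     (\<forall>t. \<exists>v. v \<noteq> 0 \<and> (periodic_ext c has_vector_derivative v) (at t))"

definition param_preimage :: "(real \<Rightarrow> complex) \<Rightarrow> complex \<Rightarrow> real set" where
  "param_preimage c p = {t \<in> {0..<1}. c t = p}"

definition intersection_points :: "(real \<Rightarrow> complex) \<Rightarrow> complex set" where
  "intersection_points c =
     {p \<in> path_image c. \<exists>t1 \<in> param_preimage c p. \<exists>t2 \<in> param_preimage c p. t1 \<noteq> t2}"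

text \<open>
  The condition \<open>v1 \<noteq> v2\<close> is needed because independence is a property of the set \<open>{v1, v2}\<close>.
\<close>

definition simple_crossing_point :: "(real \<Rightarrow> complex) \<Rightarrow> complex \<Rightarrow> bool" where
  "simple_crossing_point c p \<longleftrightarrow>
     (\<exists>t1 t2 v1 v2. t1 \<noteq> t2 \<and> param_preimage c p = {t1, t2} \<and>
        (periodic_ext c has_vector_derivative v1) (at t1) \<and>
        (periodic_ext c has_vector_derivative v2) (at t2) \<and>
        v1 \<noteq> v2 \<and> independent {v1, v2})"

definition normal_curve :: "(real \<Rightarrow> complex) \<Rightarrow> bool" where
  "normal_curve c \<longleftrightarrow>
     piecewise_regular c \<and> (\<forall>t \<in> {0<..<1}. c t \<noteq> c 0) \<and>
     finite (intersection_points c) \<and>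
     (\<forall>p \<in> intersection_points c. simple_crossing_point c p)"


section \<open>Minimum homotopy area and winding area\<close>

definition unit_square :: "(real \<times> real) set" where
  "unit_square = {0..1} \<times> {0..1}"

text \<open>The first coordinate is the homotopy parameter, the second one the curve parameter.\<close>

definition null_homotopy :: "(real \<Rightarrow> complex) \<Rightarrow> (real \<times> real \<Rightarrow> complex) \<Rightarrow> bool" where
  "null_homotopy c H \<longleftrightarrow>
     continuous_on unit_square H \<and>
     (\<forall>t \<in> {0..1}. H (0, t) = c t) \<and>
     (\<forall>t \<in> {0..1}. H (1, t) = c 0) \<and>
     (\<forall>s \<in> {0..1}. H (s, 0) = c 0 \<and> H (s, 1) = c 0)"

text \<open>
  The pieces are the closed simplices of a triangulation of the square; differentiability is required
  up to the boundary of each of them.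
\<close>

definition piecewise_differentiable_square :: "(real \<times> real \<Rightarrow> complex) \<Rightarrow> bool" where
  "piecewise_differentiable_square H \<longleftrightarrow>
     (\<exists>\<T>. triangulation \<T> \<and> \<Union>\<T> = unit_square \<and> (\<forall>T \<in> \<T>. H differentiable_on T))"

text \<open>Counting measure gives the value \<open>\<infinity>\<close> if there are infinitely many components.\<close>

definition num_preimage_components :: "(real \<times> real \<Rightarrow> complex) \<Rightarrow> complex \<Rightarrow> ennreal" where
  "num_preimage_components H x =
     emeasure (count_space UNIV) (components {z \<in> unit_square. H z = x})"

definition homotopy_area :: "(real \<times> real \<Rightarrow> complex) \<Rightarrow> ennreal" where
  "homotopy_area H = (\<integral>\<^sup>+ x. num_preimage_components H x \<partial>lborel)"

definition min_homotopy_area :: "(real \<Rightarrow> complex) \<Rightarrow> ennreal" where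
  "min_homotopy_area c =
     (INF H \<in> {H. null_homotopy c H \<and> piecewise_differentiable_square H}. homotopy_area H)"

text \<open>The winding number is only meaningful off the curve, hence the restricted domain.\<close>

definition winding_area :: "(real \<Rightarrow> complex) \<Rightarrow> ennreal" where
  "winding_area c =
     (\<integral>\<^sup>+ x \<in> - path_image c. ennreal (cmod (winding_number c x)) \<partial>lborel)"


section \<open>Self-overlapping curves\<close>

text \<open>A \<open>C\<^sup>1\<close> immersion of the closed unit disk; at boundary points the derivative is one-sided.\<close>

definition disk_immersion :: "(complex \<Rightarrow> complex) \<Rightarrow> bool" where
  "disk_immersion F \<longleftrightarrow>
     (\<exists>F' :: complex \<Rightarrow> complex \<Rightarrow>\<^sub>L complex.
        continuous_on (cball 0 1) F' \<and>
        (\<forall>z \<in> cball 0 1. (F has_derivative blinfun_apply (F' z)) (at z within cball 0 1) \<and>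
                         inj (blinfun_apply (F' z))))"

definition bounds_immersed_disk :: "(real \<Rightarrow> complex) \<Rightarrow> bool" where
  "bounds_immersed_disk c \<longleftrightarrow>
     (\<exists>F. disk_immersion F \<and> (\<forall>t \<in> {0..1}. c t = F (cis (2 * pi * t))))"

text \<open>Closeness of curves is uniform closeness.\<close>

definition self_overlapping :: "(real \<Rightarrow> complex) \<Rightarrow> bool" where
  "self_overlapping c \<longleftrightarrow>
     (if regular_curve c \<and> normal_curve c then bounds_immersed_disk c
      else \<forall>\<epsilon>>0. \<exists>c'. regular_curve c' \<and> normal_curve c' \<and> bounds_immersed_disk c' \<and>
                       (\<forall>t \<in> {0..1}. dist (c' t) (c t) < \<epsilon>))"

end

theory Submission imports Defs begin

text \<open>
  The lower bound is a degree argument. A null-homotopy \<open>H\<close> of the curve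
  \<open>c\<close> carries the boundary of the square to a loop that winds around a point
  \<open>x\<close> exactly \<open>- wn(x,c)\<close> times. For almost every \<open>x\<close> the
  preimages of \<open>x\<close> are finitely many interior points with injective derivative, and
  each of them contributes \<open>1\<close> or \<open>-1\<close> to this winding number. Hence
  \<open>x\<close> has at least \<open>|wn(x,c)|\<close> preimages
  (\<open>winding_area_le_homotopy_area\<close>).

  For the upper bound, suppose first that \<open>c\<close> bounds an immersed disk
  \<open>F\<close>. Contracting the disk to a boundary point, along the segments towards it, gives
  a null-homotopy whose number of preimages of \<open>x\<close> off the curve is the number of
  preimages of \<open>x\<close> under \<open>F\<close>. All of these have the same sign, because
  the derivative of \<open>F\<close> is invertible on the connected disk, so their number is
  \<open>|wn(x,c)|\<close> (\<open>card_preimages_of_disk_immersion\<close>).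

  In general only curves \<open>c'\<close> uniformly close to \<open>c\<close> bound an immersed
  disk, and uniform closeness controls neither the length of \<open>c'\<close> nor the area swept
  by a homotopy from \<open>c\<close> to \<open>c'\<close>. What it does control are winding
  numbers around points that stay away from \<open>c\<close>. Everything is therefore pushed onto
  a grid of finitely many horizontal and vertical lines by a map \<open>\<rho>\<close> that
  collapses the complement of one small box per cell onto the grid and expands each box onto its
  cell (\<open>grid_collapse\<close>). If the boxes avoid \<open>c\<close>, then the straight
  homotopy from \<open>c\<close> to a close curve \<open>c'\<close> is carried by
  \<open>\<rho>\<close> into the grid, which has area zero. Contracting \<open>\<rho>(c')\<close>
  along \<open>\<rho>(F)\<close> costs, on each cell, the area of the cell times
  \<open>|wn(\<zeta>,c)|\<close> for the centre \<open>\<zeta>\<close> of its box. Centres can be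
  chosen so that the sum of these costs is at most the integral of \<open>|wn(x,c)|\<close>
  (\<open>exists_grid_representatives_le_integral\<close>).

  It remains to get from \<open>c\<close> to \<open>\<rho>(c)\<close> at small cost. To this end
  \<open>c\<close> itself is swept onto the grid, through a region of small area
  (\<open>normal_curve_sweepable\<close>): \<open>\<rho>\<close> maps each line of the grid to
  itself, so that the end of the sweep can be moved inside the grid to its image under
  \<open>\<rho>\<close>, and from there the image of the sweep under \<open>\<rho>\<close>, run
  backwards, leads to \<open>\<rho>(c)\<close>. The cost of the way back is again a sum over
  cells, so the centres are chosen for the winding number and the multiplicity of the sweep
  together.

  The sweep is built arc by arc. The crossings and corners of a normal curve are finite in number,
  so that short subarcs are differentiable and embedded. Such an arc has area zero, and a thin
  neighbourhood of it contains a rectilinear arc with the same ends that meets it only there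
  (\<open>thin_rectilinear_closing\<close>). The arc need not be rectifiable, so no explicit
  formula sweeps one arc to the other. Instead, the region between them is parametrized by a
  conformal map of the disk, which extends to the boundary by the Caratheodory theorem
  (\<open>Caratheodory_Jordan_domain\<close>). The resulting homotopy is smooth inside but only
  continuous at the boundary. Slow reparametrizations in both directions flatten it so much near
  the boundary that it becomes differentiable there (\<open>strip_between_arcs\<close>). The
  conformal map may move points along the arc in a non-differentiable way, which is first removed
  by smoothing the boundary correspondence (\<open>smoothed_homeomorphism\<close>).
\<close>

section \<open>Conformal maps of Jordan domains\<close>

lemma repeat_translated_path:
  fixes d :: "real \<Rightarrow> complex"
  assumes "path d" and d: "pathfinish d = pathstart d + c" and "n > 0"
  shows "\<exists>e. path e \<and> pathstart e = pathstart d \<and> pathfinish e = pathstart d + of_nat n * c \<and>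
             path_image e \<subseteq> {z + of_nat k * c | z k. z \<in> path_image d \<and> k < n}"
  using \<open>n > 0\<close>
proof (induction n rule: nat_induct_non_zero)
  case 1
  show ?case
    using assms by (intro exI[of _ d]) force
next
  case (Suc n)
  then obtain e where e: "path e" "pathstart e = pathstart d" "pathfinish e = pathstart d + of_nat n * c"
    "path_image e \<subseteq> {z + of_nat k * c | z k. z \<in> path_image d \<and> k < n}"
    by blast
  define d' where "d' = (\<lambda>z. z + of_nat n * c) \<circ> d"
  have d': "path d'" "pathstart d' = pathstart d + of_nat n * c" "pathfinish d' = pathfinish d + of_nat n * c"
    subgoal unfolding d'_def by (rule path_continuous_image[OF \<open>path d\<close>]) (intro continuous_intros)
    by (simp_all add: d'_def pathstart_compose pathfinish_compose)
  have im: "path_image d' = (\<lambda>z. z + of_nat n * c) ` path_image d"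
    by (simp add: d'_def path_image_compose)
  show ?case
  proof (intro exI[of _ "e +++ d'"] conjI)
    show "path (e +++ d')" using e d' by simp
    show "pathstart (e +++ d') = pathstart d" using e by simp
    show "pathfinish (e +++ d') = pathstart d + of_nat (Suc n) * c"
      using d' d by (simp add: algebra_simps)
    have "path_image e \<subseteq> {z + of_nat k * c | z k. z \<in> path_image d \<and> k < Suc n}"
      using e(4) by (smt (verit, best) Collect_mono less_SucI subset_trans)
    moreover have "path_image d' \<subseteq> {z + of_nat k * c | z k. z \<in> path_image d \<and> k < Suc n}"
      unfolding im by blast
    ultimately show "path_image (e +++ d') \<subseteq> {z + of_nat k * c | z k. z \<in> path_image d \<and> k < Suc n}"
      using path_image_join_subset by (meson le_sup_iff subset_trans)
  qed
qed

lemma norm_prod_le_one_small: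
  fixes g :: "'a \<Rightarrow> complex"
  assumes "finite A" "a \<in> A" "norm (g a) \<le> r" "\<And>x. x \<in> A \<Longrightarrow> norm (g x) \<le> M" "0 \<le> r"
  shows "norm (prod g A) \<le> r * M ^ (card A - 1)"
proof -
  have "norm (prod g A) = norm (g a) * (\<Prod>x\<in>A-{a}. norm (g x))"
    using assms by (simp add: prod.remove norm_mult prod_norm)
  also have "\<dots> \<le> r * (\<Prod>x\<in>A-{a}. M)"
    using assms by (intro mult_mono prod_mono prod_nonneg) auto
  also have "\<dots> = r * M ^ (card A - 1)"
    using assms by simp
  finally show ?thesis .
qed

text \<open>
  Koebe's reflection trick. The product of \<open>f\<close> over the rotations by multiples of \<open>2\<pi>/n\<close>, and of the
  conjugated \<open>f\<close> over the same rotations, has modulus \<open>|f(0)|^(2n)\<close> at \<open>0\<close>. Translates of the logarithmic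
  arc \<open>l\<close> and of its mirror image fit together to a loop around \<open>0\<close> on which at all times one factor is
  small and the others are at most \<open>M\<close>, so the maximum principle applies.
\<close>

lemma reflection_bound_aux:
  assumes hol: "f holomorphic_on ball 0 1"
    and M: "\<And>z. z \<in> ball 0 1 \<Longrightarrow> norm (f z) \<le> M"
    and "n > 0" and l: "path l" "\<And>w. w \<in> path_image l \<Longrightarrow> Re w < 0"
    and Im: "Im (pathstart l) = 0" "Im (pathfinish l) = pi / n"
    and small: "\<And>w. w \<in> path_image l \<Longrightarrow> norm (f (exp w)) \<le> r"
  shows "norm (f 0) ^ (2 * n) \<le> r * M ^ (2 * n - 1)"
proof -
  define \<omega> where "\<omega> = cis (2 * pi / n)"
  have n\<omega>: "norm (\<omega> ^ k) = 1" for k by (simp add: \<omega>_def norm_power)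
  have \<omega>n: "\<omega> ^ n = 1" using \<open>n > 0\<close> Complex.DeMoivre[of "2 * pi / n" n] by (simp add: \<omega>_def)
  define \<phi> where "\<phi> = (\<lambda>(k::nat, b) z. if b then f (\<omega> ^ k * z) else cnj (f (cnj (\<omega> ^ k * z))))"
  define A where "A = {..<n} \<times> (UNIV :: bool set)"
  define h where "h = (\<lambda>z. \<Prod>x\<in>A. \<phi> x z)"
  have finA: "finite A" and cardA: "card A = 2 * n"
    by (auto simp: A_def card_cartesian_product)
  have in_ball: "\<omega> ^ k * z \<in> ball 0 1" "cnj (\<omega> ^ k * z) \<in> ball 0 1" if "z \<in> ball 0 1" for k z
    using that n\<omega>[of k] by (simp_all add: norm_mult del: complex_cnj_mult)
  have hol\<phi>: "\<phi> x holomorphic_on ball 0 1" for x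
  proof (cases x)
    case (Pair k b)
    have 1: "(\<lambda>z. f (\<omega> ^ k * z)) holomorphic_on ball 0 1"
      by (rule holomorphic_on_compose_gen[OF _ hol, unfolded o_def])
         (use in_ball in \<open>auto intro!: holomorphic_intros\<close>)
    have "(\<lambda>z. cnj (f (cnj z))) holomorphic_on ball 0 1"
    proof -
      have eq: "cnj ` ball 0 1 = ball 0 1"
      proof -
        have "cnj ` ball 0 1 \<subseteq> ball 0 1" by auto
        moreover have "z \<in> cnj ` ball 0 1" if "z \<in> ball 0 1" for z
          using that by (intro image_eqI[of _ _ "cnj z"]) auto
        ultimately show ?thesis by auto
      qed
      have "cnj \<circ> f \<circ> cnj holomorphic_on (cnj ` ball 0 1)"
        by (rule holomorphic_on_compose_cnj_cnj) (use hol in \<open>simp_all add: eq\<close>)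
      then show ?thesis by (simp add: o_def eq)
    qed
    then have 2: "(\<lambda>z. cnj (f (cnj (\<omega> ^ k * z)))) holomorphic_on ball 0 1"
      by (rule holomorphic_on_compose_gen[rotated, unfolded o_def, where g="\<lambda>z. cnj (f (cnj z))"])
         (use in_ball in \<open>auto intro!: holomorphic_intros\<close>)
    show ?thesis using 1 2 by (cases b) (auto simp: Pair \<phi>_def)
  qed
  then have holh: "h holomorphic_on ball 0 1"
    unfolding h_def by (intro holomorphic_intros) auto
  have \<phi>M: "norm (\<phi> x z) \<le> M" if "z \<in> ball 0 1" for x z
    using M[OF in_ball(1)[OF that]] M[OF in_ball(2)[OF that]] by (cases x) (auto simp: \<phi>_def)
  have h0: "norm (h 0) = norm (f 0) ^ (2 * n)"
  proof -
    have "norm (h 0) = (\<Prod>x\<in>A. norm (\<phi> x 0))" by (simp add: h_def prod_norm)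
    also have "\<dots> = (\<Prod>x\<in>A. norm (f 0))" by (rule prod.cong) (auto simp: \<phi>_def)
    finally show ?thesis by (simp add: cardA)
  qed
  have "r \<ge> 0"
    using small[of "pathstart l"] norm_ge_zero order_trans pathstart_in_path_image by blast
  \<comment> \<open>The reflected arc followed by the arc itself is a fundamental piece of a loop around the origin.\<close>
  define d where "d = reversepath (cnj \<circ> l) +++ l"
  have pc: "path (cnj \<circ> l)" using l(1) by (auto intro!: path_continuous_image continuous_intros)
  have join: "cnj (pathstart l) = pathstart l" using Im(1) by (simp add: complex_eq_iff)
  have d: "path d" "pathstart d = cnj (pathfinish l)" "pathfinish d = pathfinish l"
    using l(1) pc join by (auto simp: d_def pathstart_compose pathfinish_compose)
  have dim: "path_image d = cnj ` path_image l \<union> path_image l"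
    unfolding d_def by (subst path_image_join) (auto simp: pathstart_compose path_image_compose join)
  have "pathfinish d = pathstart d + 2 * pi / n * \<i>"
    using Im(2) by (simp add: d complex_eq_iff)
  from repeat_translated_path[OF d(1) this \<open>n > 0\<close>]
  obtain e where e: "path e" "pathstart e = pathstart d" "pathfinish e = pathstart d + of_nat n * (2 * pi / n * \<i>)"
    "path_image e \<subseteq> {z + of_nat k * (2 * pi / n * \<i>) | z k. z \<in> path_image d \<and> k < n}"
    by blast
  define \<Gamma> where "\<Gamma> = exp \<circ> e"
  have "pathfinish e - pathstart e = 2 * of_real pi * \<i>"
    using e \<open>n > 0\<close> by (simp add: field_simps)
  then have wn: "winding_number \<Gamma> 0 = 1"
    unfolding \<Gamma>_def by (simp add: winding_number_compose_exp[OF e(1)])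
  have path\<Gamma>: "path \<Gamma>" unfolding \<Gamma>_def using e(1) by (intro path_continuous_image continuous_intros)
  have loop: "pathfinish \<Gamma> = pathstart \<Gamma>"
    using e \<open>n > 0\<close> by (simp add: \<Gamma>_def pathfinish_compose pathstart_compose exp_add)
  have on\<Gamma>: "u \<in> ball 0 1 \<and> norm (h u) \<le> r * M ^ (2 * n - 1)" if u: "u \<in> path_image \<Gamma>" for u
  proof -
    obtain z k where z: "z \<in> path_image d" "k < n" "u = exp (z + of_nat k * (2 * pi / n * \<i>))"
      using u e(4) by (auto simp: \<Gamma>_def path_image_compose)
    have "exp (of_nat k * (2 * pi / n * \<i>)) = \<omega> ^ k"
      unfolding exp_of_nat_mult by (simp add: \<omega>_def cis_conv_exp mult.commute)
    then have u_eq: "u = \<omega> ^ k * exp z" using z(3) by (simp add: exp_add)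
    obtain j where j: "j < n" "\<omega> ^ j * \<omega> ^ k = 1"
    proof (cases "k = 0")
      case True then show ?thesis using that[of 0] \<open>n > 0\<close> by simp
    next
      case False
      then show ?thesis using that[of "n - k"] z(2) \<omega>n by (simp flip: power_add)
    qed
    have "\<omega> ^ j * u = exp z" using j(2) by (simp add: u_eq mult.assoc[symmetric])
    have "Re z < 0" using z(1) l(2) dim by auto
    then have ub: "u \<in> ball 0 1" by (simp add: u_eq norm_mult n\<omega>)
    have "\<exists>x\<in>A. norm (\<phi> x u) \<le> r"
    proof (cases "z \<in> path_image l")
      case True
      then show ?thesis
        using small[OF True] j(1) \<open>\<omega> ^ j * u = exp z\<close> by (intro bexI[of _ "(j, True)"]) (auto simp: \<phi>_def A_def)
    next
      case False
      then obtain w where w: "w \<in> path_image l" "z = cnj w" using z(1) dim by auto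
      have "cnj (\<omega> ^ j * u) = exp w" by (simp add: \<open>\<omega> ^ j * u = exp z\<close> w(2) exp_cnj)
      then have "norm (\<phi> (j, False) u) \<le> r" using small[OF w(1)] by (auto simp: \<phi>_def)
      then show ?thesis using j(1) by (auto simp: A_def)
    qed
    then obtain x where "x \<in> A" "norm (\<phi> x u) \<le> r" by blast
    then have "norm (h u) \<le> r * M ^ (card A - 1)"
      unfolding h_def using \<phi>M[OF ub] \<open>r \<ge> 0\<close> by (rule norm_prod_le_one_small[OF finA])
    then show ?thesis using ub cardA by simp
  qed
  have sub: "path_image \<Gamma> \<subseteq> ball 0 1" using on\<Gamma> by blast
  have "0 \<notin> path_image \<Gamma>" by (auto simp: \<Gamma>_def path_image_compose)
  then have 0: "0 \<in> inside (path_image \<Gamma>)"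
    using winding_number_zero_in_outside[OF path\<Gamma> loop, of 0] wn inside_Un_outside[of "path_image \<Gamma>"] by (metis ComplI UnE zero_neq_one)
  have ins: "inside (path_image \<Gamma>) \<subseteq> ball 0 1"
    using outside_subset_convex[OF convex_ball sub] inside_Int_outside[of "path_image \<Gamma>"] by blast
  have clo: "closed (path_image \<Gamma>)" by (simp add: path\<Gamma> closed_path_image)
  have cl: "closure (inside (path_image \<Gamma>)) \<subseteq> ball 0 1"
    using closure_inside_subset[OF clo] ins sub by blast
  have "norm (h 0) \<le> r * M ^ (2 * n - 1)"
  proof (rule maximum_modulus_frontier[OF _ _ _ _ 0])
    show "h holomorphic_on interior (inside (path_image \<Gamma>))"
      using holh ins interior_subset by (metis holomorphic_on_subset order_trans)
    show "continuous_on (closure (inside (path_image \<Gamma>))) h"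
      using holh cl holomorphic_on_imp_continuous_on continuous_on_subset by blast
    show "bounded (inside (path_image \<Gamma>))" using ins bounded_ball bounded_subset by blast
    show "norm (h z) \<le> r * M ^ (2 * n - 1)" if "z \<in> frontier (inside (path_image \<Gamma>))" for z
      using that frontier_inside_subset[OF clo] on\<Gamma> by blast
  qed
  then show ?thesis by (simp add: h0)
qed

text \<open>
  An arc with a larger change of argument contains one with change exactly \<open>\<pi>/n\<close>; a rotation moves its
  starting point to the positive real axis.
\<close>

lemma reflection_bound:
  assumes hol: "f holomorphic_on ball 0 1"
    and M: "\<And>z. z \<in> ball 0 1 \<Longrightarrow> norm (f z) \<le> M"
    and "n > 0" and l: "path l" "\<And>w. w \<in> path_image l \<Longrightarrow> Re w < 0"
    and Im: "\<bar>Im (pathfinish l) - Im (pathstart l)\<bar> \<ge> pi / n"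
    and small: "\<And>w. w \<in> path_image l \<Longrightarrow> norm (f (exp w)) \<le> r"
  shows "norm (f 0) ^ (2 * n) \<le> r * M ^ (2 * n - 1)"
proof -
  have main: ?thesis if l: "path l" "\<And>w. w \<in> path_image l \<Longrightarrow> Re w < 0"
    and Im: "Im (pathfinish l) - Im (pathstart l) \<ge> pi / n"
    and small: "\<And>w. w \<in> path_image l \<Longrightarrow> norm (f (exp w)) \<le> r" for l
  proof -
    define a where "a = Im (pathstart l)"
    have conIm: "continuous_on {0..1} (\<lambda>t. Im (l t))"
      using l(1) by (intro continuous_intros) (simp add: path_def)
    have pos: "pi / n \<ge> 0" by simp
    have "\<exists>t\<ge>0. t \<le> 1 \<and> Im (l t) = a + pi / n"
      by (rule IVT') (use conIm Im pos in \<open>auto simp: a_def pathstart_def pathfinish_def\<close>)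
    then obtain t where t: "0 \<le> t" "t \<le> 1" "Im (l t) = a + pi / n" by blast
    define m where "m = (\<lambda>w. w - \<i> * a) \<circ> subpath 0 t l"
    have m: "path m" unfolding m_def using l(1) t by (intro path_continuous_image continuous_intros) auto
    have imm: "\<exists>u\<in>path_image l. w = u - \<i> * a" if "w \<in> path_image m" for w
      using that t path_image_subpath_subset[of 0 t l] by (auto simp: m_def path_image_compose)
    have rot: "cis a * z \<in> ball 0 1" if "z \<in> ball 0 1" for z using that by (simp add: norm_mult)
    have "norm ((\<lambda>z. f (cis a * z)) 0) ^ (2 * n) \<le> r * M ^ (2 * n - 1)"
    proof (rule reflection_bound_aux[OF _ _ \<open>n > 0\<close> m])
      show "(\<lambda>z. f (cis a * z)) holomorphic_on ball 0 1"
        by (rule holomorphic_on_compose_gen[OF _ hol, unfolded o_def])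
           (use rot in \<open>auto intro!: holomorphic_intros\<close>)
      show "norm (f (cis a * z)) \<le> M" if "z \<in> ball 0 1" for z using M[OF rot[OF that]] .
      show "Re w < 0" if "w \<in> path_image m" for w using imm[OF that] l(2) by auto
      show "Im (pathstart m) = 0" by (simp add: m_def pathstart_compose a_def pathstart_def subpath_def)
      show "Im (pathfinish m) = pi / n" using t by (simp add: m_def pathfinish_compose pathfinish_def subpath_def)
      show "norm (f (cis a * exp w)) \<le> r" if "w \<in> path_image m" for w
      proof -
        from imm[OF that] obtain u where u: "u \<in> path_image l" "w = u - \<i> * a" by blast
        have "cis a * exp w = exp u" by (simp add: u(2) cis_conv_exp exp_diff)
        then show ?thesis using small[OF u(1)] by simp
      qed
    qed
    then show ?thesis by simp
  qed
  show ?thesis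
  proof (cases "Im (pathfinish l) - Im (pathstart l) \<ge> 0")
    case True
    then show ?thesis using main[of l] assms by auto
  next
    case False
    then show ?thesis using main[of "reversepath l"] assms by auto
  qed
qed

lemma norm_cis_diff_le: "norm (cis a - cis b) \<le> \<bar>a - b\<bar>"
proof -
  have "cis a - cis b = cis b * (exp (\<i> * of_real (a - b)) - 1)"
    by (simp add: cis_conv_exp right_diff_distrib exp_diff)
  then have "norm (cis a - cis b) = 2 * \<bar>sin ((a - b) / 2)\<bar>"
    by (simp only: norm_mult dist_exp_i_1) simp
  also have "\<dots> \<le> \<bar>a - b\<bar>" using abs_sin_x_le_abs_x[of "(a - b) / 2"] by simp
  finally show ?thesis .
qed

text \<open>
  If the ends of a curve in the disk are far apart, then either the curve enters a fixed smaller disk,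
  where \<open>R\<close> stays away from \<open>p\<close>, or its argument changes by a definite amount, and then the reflection
  bound prevents \<open>R - p\<close> from being small on it.
\<close>

lemma small_image_imp_close:
  assumes hol: "R holomorphic_on ball 0 1" and bd: "bounded (R ` ball 0 1)"
    and p: "p \<notin> R ` ball 0 1" and "\<epsilon> > 0"
  obtains r where "r > 0"
    "\<And>\<gamma>. \<lbrakk>path \<gamma>; path_image \<gamma> \<subseteq> ball 0 1; R ` path_image \<gamma> \<subseteq> ball p r\<rbrakk>
       \<Longrightarrow> dist (pathstart \<gamma>) (pathfinish \<gamma>) \<le> \<epsilon>"
proof -
  define f where "f = (\<lambda>z. R z - p)"
  have holf: "f holomorphic_on ball 0 1" unfolding f_def by (intro holomorphic_intros hol)
  obtain M where M: "M \<ge> 1" "\<And>z. z \<in> ball 0 1 \<Longrightarrow> norm (f z) \<le> M"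
  proof -
    obtain B where B: "\<And>z. z \<in> ball 0 1 \<Longrightarrow> norm (R z) \<le> B" using bd unfolding bounded_iff by blast
    have "norm (f z) \<le> max 1 (B + norm p)" if "z \<in> ball 0 1" for z
      using B[OF that] norm_triangle_ineq4[of "R z" p] by (simp add: f_def)
    then show ?thesis using that[of "max 1 (B + norm p)"] by simp
  qed
  define d0 where "d0 = norm (f 0)"
  have "d0 > 0" using p unfolding d0_def f_def by (auto simp: image_iff dest: bspec[of _ _ 0])
  define \<epsilon>' where "\<epsilon>' = min (\<epsilon> / 2) (1 / 2)"
  have \<epsilon>': "0 < \<epsilon>'" "\<epsilon>' \<le> \<epsilon> / 2" "\<epsilon>' < 1" using \<open>\<epsilon> > 0\<close> by (auto simp: \<epsilon>'_def)
  obtain n :: nat where n: "n > 0" "pi / n < \<epsilon> / 2"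
  proof -
    obtain n :: nat where "2 * pi / \<epsilon> < n" using reals_Archimedean2 by blast
    moreover have "0 < 2 * pi / \<epsilon>" using \<open>\<epsilon> > 0\<close> by simp
    ultimately show ?thesis using that[of n] \<open>\<epsilon> > 0\<close> by (cases "n = 0") (auto simp: field_simps)
  qed
  have "compact (R ` cball 0 (1 - \<epsilon>'))"
    by (intro compact_continuous_image continuous_on_subset[OF holomorphic_on_imp_continuous_on[OF hol]])
       (use \<epsilon>' in auto)
  moreover have "p \<notin> R ` cball 0 (1 - \<epsilon>')" using p \<epsilon>' by auto
  ultimately obtain r1 where r1: "r1 > 0" "\<And>z. z \<in> cball 0 (1 - \<epsilon>') \<Longrightarrow> r1 \<le> dist p (R z)"
    by (metis compact_imp_closed separate_point_closed imageI)
  define r2 where "r2 = d0 ^ (2 * n) / (2 * M ^ (2 * n - 1))"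
  have "r2 > 0" using \<open>d0 > 0\<close> M(1) by (simp add: r2_def)
  show thesis
  proof (rule that[of "min r1 r2"])
    show "min r1 r2 > 0" using r1 \<open>r2 > 0\<close> by simp
    fix \<gamma> assume \<gamma>: "path \<gamma>" "path_image \<gamma> \<subseteq> ball 0 1" and R: "R ` path_image \<gamma> \<subseteq> ball p (min r1 r2)"
    have big: "1 - \<epsilon>' < norm z" "norm z < 1" if "z \<in> path_image \<gamma>" for z
    proof -
      have "dist p (R z) < r1" using R that by auto
      then show "1 - \<epsilon>' < norm z" using r1(2)[of z] by (cases "norm z \<le> 1 - \<epsilon>'") auto
      show "norm z < 1" using \<gamma>(2) that by auto
    qed
    have "0 \<notin> path_image \<gamma>" using big[of 0] \<epsilon>' by auto
    then obtain l where l: "path l" "\<And>t. t \<in> {0..1} \<Longrightarrow> \<gamma> t = 0 + exp (l t)"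
      using winding_number_as_continuous_log[OF \<gamma>(1)] by blast
    have expl: "exp w \<in> path_image \<gamma>" if "w \<in> path_image l" for w
      using that l(2) by (auto simp: path_image_def)
    have Re: "Re w < 0" if "w \<in> path_image l" for w
      using big(2)[OF expl[OF that]] by simp
    have ends: "exp (pathstart l) = pathstart \<gamma>" "exp (pathfinish l) = pathfinish \<gamma>"
      using l(2) by (auto simp: pathstart_def pathfinish_def)
    have Im: "\<bar>Im (pathfinish l) - Im (pathstart l)\<bar> < pi / n"
    proof (rule ccontr)
      assume "\<not> ?thesis"
      then have "norm (f 0) ^ (2 * n) \<le> r2 * M ^ (2 * n - 1)"
      proof (intro reflection_bound[OF holf M(2) n(1) l(1) Re])
        show "norm (f (exp w)) \<le> r2" if "w \<in> path_image l" for w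
        proof -
          have "R (exp w) \<in> ball p (min r1 r2)" using R expl[OF that] by blast
          then show ?thesis by (simp add: f_def dist_norm norm_minus_commute)
        qed
      qed auto
      then have "d0 ^ (2 * n) \<le> d0 ^ (2 * n) / 2" using M(1) by (simp add: r2_def d0_def field_simps)
      then show False using \<open>d0 > 0\<close> by (smt (verit) field_sum_of_halves zero_less_power)
    qed
    define a b where "a = pathstart l" and "b = pathfinish l"
    have "a \<in> path_image l" "b \<in> path_image l" by (auto simp: a_def b_def)
    then have nab: "norm (exp a) \<le> 1" "\<bar>norm (exp a) - norm (exp b)\<bar> \<le> \<epsilon>'"
      using big[OF expl[of a]] big[OF expl[of b]] by linarith+
    have "norm (exp a - exp b) \<le> norm (exp a - of_real (exp (Re a)) * cis (Im b)) + norm (of_real (exp (Re a)) * cis (Im b) - exp b)"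
      using norm_triangle_ineq[of "exp a - of_real (exp (Re a)) * cis (Im b)" "of_real (exp (Re a)) * cis (Im b) - exp b"]
      by simp
    also have "norm (exp a - of_real (exp (Re a)) * cis (Im b)) = exp (Re a) * norm (cis (Im a) - cis (Im b))"
      by (simp add: exp_eq_polar right_diff_distrib[symmetric] norm_mult)
    also have "\<dots> \<le> 1 * \<bar>Im a - Im b\<bar>"
    proof (intro mult_mono)
      show "exp (Re a) \<le> 1" using nab(1) by simp
      show "norm (cis (Im a) - cis (Im b)) \<le> \<bar>Im a - Im b\<bar>"
        by (rule norm_cis_diff_le)
    qed auto
    also have "norm (of_real (exp (Re a)) * cis (Im b) - exp b) = \<bar>norm (exp a) - norm (exp b)\<bar>"
    proof -
      have "of_real (exp (Re a)) * cis (Im b) - exp b = of_real (exp (Re a) - exp (Re b)) * cis (Im b)"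
        by (simp add: exp_eq_polar[of b] left_diff_distrib)
      then show ?thesis by (simp only: norm_mult norm_of_real norm_cis) simp
    qed
    finally have "norm (exp a - exp b) \<le> \<bar>Im a - Im b\<bar> + \<epsilon>'" using nab by simp
    also have "\<dots> \<le> \<epsilon>" using Im n(2) \<epsilon>'(2) unfolding a_def b_def by argo
    finally show "dist (pathstart \<gamma>) (pathfinish \<gamma>) \<le> \<epsilon>" using ends by (simp add: dist_norm a_def b_def)
  qed
qed

text \<open>
  Janiszewski's theorem, applied to the curve and to the union of its part away from \<open>p\<close> with a small
  circle around \<open>p\<close>: these two sets meet in a connected set, so points separated by neither are not
  separated by their union.
\<close>

lemma inside_Jordan_locally_connected_at_boundary:
  fixes j :: "real \<Rightarrow> complex"
  assumes j: "simple_path j" "pathfinish j = pathstart j" and p: "p \<in> path_image j" and "\<epsilon> > 0"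
  obtains \<delta> where "\<delta> > 0" "\<And>x y. \<lbrakk>x \<in> inside (path_image j); y \<in> inside (path_image j); dist p x < \<delta>; dist p y < \<delta>\<rbrakk> \<Longrightarrow>
    \<exists>\<gamma>. path \<gamma> \<and> pathstart \<gamma> = x \<and> pathfinish \<gamma> = y \<and> path_image \<gamma> \<subseteq> inside (path_image j) \<inter> ball p \<epsilon>"
proof -
  define J where "J = path_image j"
  obtain k where k: "simple_path k" "pathfinish k = pathstart k" "path_image k = J" "pathstart k = p"
  proof -
    obtain a where a: "a \<in> {0..1}" "j a = p" using p by (auto simp: path_image_def)
    show ?thesis
      by (rule that[of "shiftpath a j"])
         (use a j in \<open>auto simp: J_def simple_path_shiftpath path_image_shiftpath pathstart_shiftpath pathfinish_shiftpath\<close>)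
  qed
  have pk: "path k" using k(1) simple_path_imp_path by blast
  have "continuous_on {0..1} k" using pk by (simp add: path_def)
  then have "\<forall>s\<in>{0..1}. \<exists>d>0. \<forall>t\<in>{0..1}. dist t s < d \<longrightarrow> dist (k t) (k s) < \<epsilon>"
    using \<open>\<epsilon> > 0\<close> by (simp add: continuous_on_iff)
  then obtain d0 d1 where d: "d0 > 0" "\<And>t. t \<in> {0..1} \<Longrightarrow> dist t 0 < d0 \<Longrightarrow> dist (k t) (k 0) < \<epsilon>"
     "d1 > 0" "\<And>t. t \<in> {0..1} \<Longrightarrow> dist t 1 < d1 \<Longrightarrow> dist (k t) (k 1) < \<epsilon>"
    by (metis atLeastAtMost_iff order_refl zero_le_one)
  define \<eta> where "\<eta> = min (1/3) (min (d0/2) (d1/2))"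
  have \<eta>: "0 < \<eta>" "\<eta> \<le> 1/3" "\<eta> < d0" "\<eta> < d1" using d by (auto simp: \<eta>_def)
  have k01: "k 0 = p" "k 1 = p" using k by (auto simp: pathstart_def pathfinish_def)
  define J2 where "J2 = k ` {\<eta>..1-\<eta>}"
  have J2: "compact J2" "connected J2" "J2 \<subseteq> J" "p \<notin> J2" "J - J2 \<subseteq> ball p \<epsilon>"
  proof -
    have c: "continuous_on {\<eta>..1-\<eta>} k"
      using \<open>continuous_on {0..1} k\<close> \<eta> by (rule_tac continuous_on_subset) auto
    show "compact J2" "connected J2" unfolding J2_def
      by (intro compact_continuous_image connected_continuous_image c; simp)+
    show "J2 \<subseteq> J" using k(3) \<eta> by (auto simp: J2_def path_image_def)
    show "p \<notin> J2"
    proof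
      assume "p \<in> J2"
      then obtain t where t: "\<eta> \<le> t" "t \<le> 1 - \<eta>" "k t = k 0" using k01 by (auto simp: J2_def)
      have "t \<in> {0..1}" "0 \<in> {0..1::real}" using t \<eta> by auto
      with t(3) k(1) have "t = 0 \<or> t = 0 \<and> 0 = (1::real) \<or> t = 1 \<and> 0 = (0::real)"
        unfolding simple_path_def loop_free_def by blast
      then show False using t \<eta> by auto
    qed
    show "J - J2 \<subseteq> ball p \<epsilon>"
    proof
      fix q assume "q \<in> J - J2"
      then obtain t where t: "t \<in> {0..1}" "q = k t" "t < \<eta> \<or> t > 1 - \<eta>"
        using k(3) by (fastforce simp: path_image_def J2_def)
      then show "q \<in> ball p \<epsilon>" using d(2)[of t] d(4)[of t] \<eta> k01 by (auto simp: dist_commute dist_real_def)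
    qed
  qed
  obtain \<delta>0 where \<delta>0: "\<delta>0 > 0" "\<And>x. x \<in> J2 \<Longrightarrow> \<delta>0 \<le> dist p x"
    using separate_point_closed[of J2 p] J2 compact_imp_closed by blast
  define \<delta> where "\<delta> = min \<delta>0 \<epsilon>"
  show thesis
  proof (rule that[of \<delta>])
    show "\<delta> > 0" using \<delta>0 \<open>\<epsilon> > 0\<close> by (simp add: \<delta>_def)
    fix x y assume xy: "x \<in> inside (path_image j)" "y \<in> inside (path_image j)" "dist p x < \<delta>" "dist p y < \<delta>"
    have Jio: "connected (inside J)" "open (inside J)" "compact J"
      using Jordan_inside_outside[OF j] j by (auto simp: J_def compact_simple_path_image)
    have "connected_component (- (J \<union> (J2 \<union> sphere p \<epsilon>))) x y"
    proof (rule Janiszewski)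
      show "compact J" by fact
      show "closed (J2 \<union> sphere p \<epsilon>)" using J2(1) by (auto intro: compact_imp_closed)
      have "J \<inter> (J2 \<union> sphere p \<epsilon>) = J2" using J2 by (auto simp: subset_eq)
      then show "connected (J \<inter> (J2 \<union> sphere p \<epsilon>))" using J2 by simp
      show "connected_component (- J) x y"
        unfolding connected_component_def using Jio(1) xy(1,2) inside_no_overlap[of J]
        unfolding J_def by (intro exI[of _ "inside (path_image j)"]) blast
      show "connected_component (- (J2 \<union> sphere p \<epsilon>)) x y"
        unfolding connected_component_def using xy \<delta>0(2)
        by (intro exI[of _ "ball p \<delta>"]) (force simp: \<delta>_def)
    qed
    then have "path_component (- (J \<union> (J2 \<union> sphere p \<epsilon>))) x y"
      using Jio(3) J2(1) by (subst open_path_connected_component) (intro open_Compl closed_Un compact_imp_closed closed_sphere; simp)+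
    then obtain \<gamma> where \<gamma>: "path \<gamma>" "path_image \<gamma> \<subseteq> - (J \<union> (J2 \<union> sphere p \<epsilon>))" "pathstart \<gamma> = x" "pathfinish \<gamma> = y"
      by (auto simp: path_component_def)
    have con: "connected (path_image \<gamma>)" "x \<in> path_image \<gamma>" using \<gamma> connected_path_image pathstart_in_path_image by blast+
    have "path_image \<gamma> \<subseteq> inside J"
    proof (rule ccontr)
      assume "\<not> ?thesis"
      then have "path_image \<gamma> \<inter> frontier (inside J) \<noteq> {}"
        using connected_Int_frontier[OF con(1), of "inside J"] con(2) xy(1) by (auto simp: J_def)
      moreover have "frontier (inside J) \<subseteq> J" by (rule frontier_inside_subset) (use Jio(3) compact_imp_closed in blast)
      ultimately show False using \<gamma>(2) by blast
    qed
    moreover have "path_image \<gamma> \<subseteq> ball p \<epsilon>"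
    proof (rule ccontr)
      assume "\<not> ?thesis"
      moreover have "x \<in> ball p \<epsilon>" using xy(3) by (simp add: \<delta>_def)
      ultimately have "path_image \<gamma> \<inter> frontier (ball p \<epsilon>) \<noteq> {}"
        using connected_Int_frontier[OF con(1), of "ball p \<epsilon>"] con(2) by blast
      then show False using \<gamma>(2) \<open>\<epsilon> > 0\<close> by auto
    qed
    ultimately show "\<exists>\<gamma>. path \<gamma> \<and> pathstart \<gamma> = x \<and> pathfinish \<gamma> = y \<and> path_image \<gamma> \<subseteq> inside (path_image j) \<inter> ball p \<epsilon>"
      using \<gamma> by (auto simp: J_def)
  qed
qed

text \<open>
  The product of rotated copies of \<open>G - \<zeta>\<close> about a point \<open>x0\<close> near the arc vanishes on the boundary of a
  neighbourhood of \<open>x0\<close>, since each point of that boundary has a rotate on the arc. By the maximum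
  principle it vanishes at \<open>x0\<close>, although none of its factors does.
\<close>

lemma not_constant_on_boundary_arc:
  assumes j: "simple_path j" "pathfinish j = pathstart j"
    and hol: "g holomorphic_on inside (path_image j)"
    and cont: "continuous_on (closure (inside (path_image j))) G"
    and eq: "\<And>x. x \<in> inside (path_image j) \<Longrightarrow> g x = G x"
    and ne: "\<And>x. x \<in> inside (path_image j) \<Longrightarrow> g x \<noteq> \<zeta>"
    and p: "p \<in> path_image j" and "r > 0"
    and const: "\<And>x. x \<in> path_image j \<Longrightarrow> dist p x < r \<Longrightarrow> G x = \<zeta>"
  shows False
proof -
  define J where "J = path_image j"
  define f where "f = inside J"
  note Jio = Jordan_inside_outside[OF j, folded J_def, folded f_def]
  have of: "open f" "open (outside J)" "frontier f = J" "frontier (outside J) = J" "f \<inter> outside J = {}"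
     "f \<union> outside J = - J"
    using Jio by auto
  have clf: "closure f = f \<union> J" using of(3) closure_Un_frontier by blast
  have "p \<in> closure f" "p \<in> closure (outside J)" using of p by (auto simp: frontier_def J_def)
  then obtain x0 xs where x0: "x0 \<in> f" "dist x0 p < r / 8" and xs: "xs \<in> outside J" "dist xs p < r / 8"
    using \<open>r > 0\<close> by (metis closure_approachable divide_pos_pos zero_less_numeral)
  define \<rho> where "\<rho> = dist x0 xs"
  have \<rho>: "0 < \<rho>" "\<rho> < r / 4"
    using x0 xs of(5) dist_triangle2[of x0 xs p] by (auto simp: \<rho>_def)
  obtain e where e: "e > 0" "ball xs e \<subseteq> outside J" using of(2) xs openE by blast
  obtain n :: nat where n: "n > 0" "\<rho> * (2 * pi / n) < e"
  proof -
    obtain n :: nat where "\<rho> * (2 * pi) / e < n" using reals_Archimedean2 by blast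
    moreover have "0 < \<rho> * (2 * pi) / e" using e \<rho> by simp
    ultimately show ?thesis using that[of n] e by (cases "n = 0") (auto simp: field_simps)
  qed
  define \<omega> where "\<omega> = cis (2 * pi / n)"
  define rot where "rot = (\<lambda>k x. x0 + \<omega> ^ k * (x - x0))"
  have nrot: "dist x0 (rot k x) = dist x0 x" for k x
    by (simp add: rot_def dist_norm norm_mult norm_power \<omega>_def norm_minus_commute)
  \<comment> \<open>Some rotate of every point of the circle around x0 through xs lies outside the curve.\<close>
  have hit: "\<exists>k<n. rot k x \<in> ball xs e" if "dist x0 x = \<rho>" for x
  proof -
    define a b where "a = Arg (xs - x0)" and "b = Arg (x - x0)"
    have a: "xs - x0 = of_real \<rho> * cis a"
      using rcis_cmod_Arg[of "xs - x0"] by (simp add: rcis_def \<rho>_def dist_norm norm_minus_commute a_def)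
    have b: "x - x0 = of_real \<rho> * cis b"
      using rcis_cmod_Arg[of "x - x0"] that[symmetric] by (simp add: rcis_def dist_norm norm_minus_commute b_def)
    define m where "m = \<lfloor>(a - b) / (2 * pi / n)\<rfloor>"
    define k where "k = nat (m mod int n)"
    have k: "k < n" "int k = m mod int n" using n by (auto simp: k_def nat_less_iff)
    have "rot k x - xs = of_real \<rho> * (cis (2 * pi / n * k + b) - cis a)"
    proof -
      have "\<omega> ^ k = cis (2 * pi / n * k)" by (simp add: \<omega>_def Complex.DeMoivre mult.commute)
      moreover have "rot k x - xs = \<omega> ^ k * (x - x0) - (xs - x0)" by (simp add: rot_def)
      ultimately have "rot k x - xs = cis (2 * pi / n * k) * (of_real \<rho> * cis b) - of_real \<rho> * cis a"
        unfolding a b by simp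
      then show ?thesis by (simp only: cis_mult[symmetric]) (simp add: algebra_simps)
    qed
    also have "cis (2 * pi / n * k + b) = cis (2 * pi / n * m + b)"
    proof -
      have "real_of_int m = real n * (m div int n) + k"
        using k(2) by (metis mult_div_mod_eq of_int_add of_int_mult of_int_of_nat_eq)
      then have "2 * pi / n * m + b = (2 * pi / n * k + b) + 2 * pi * (m div int n)"
        using n(1) by (simp add: field_simps)
      then show ?thesis by (simp add: cis_mult[symmetric] cis_multiple_2pi)
    qed
    finally have "norm (rot k x - xs) = \<rho> * norm (cis (2 * pi / n * m + b) - cis a)"
      using \<rho> by (simp add: norm_mult)
    also have "\<dots> \<le> \<rho> * \<bar>2 * pi / n * m + b - a\<bar>"
      using \<rho> by (intro mult_left_mono norm_cis_diff_le) auto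
    also have "\<dots> \<le> \<rho> * (2 * pi / n)"
    proof (intro mult_left_mono)
      have t: "0 < 2 * pi / n" using n by simp
      have "m \<le> (a - b) / (2 * pi / n)" "(a - b) / (2 * pi / n) < m + 1" unfolding m_def by linarith+
      then have "m * (2 * pi / n) \<le> a - b" "a - b < (m + 1) * (2 * pi / n)"
        by (simp_all only: pos_le_divide_eq[OF t] pos_divide_less_eq[OF t] of_int_add of_int_1)
      then have "m * (2 * pi / n) \<le> a - b" "a - b < m * (2 * pi / n) + 2 * pi / n"
        by (simp_all only: distrib_right mult_1_left of_int_add of_int_1)
      moreover have "2 * pi / n * m = m * (2 * pi / n)" by (rule mult.commute)
      ultimately show "\<bar>2 * pi / n * m + b - a\<bar> \<le> 2 * pi / n" by linarith
    qed (use \<rho> in auto)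
    also have "\<dots> < e" by (rule n(2))
    finally show ?thesis using k(1) by (auto simp: dist_norm norm_minus_commute)
  qed
  define U where "U = (\<Inter>k<n. rot k -` f) \<inter> ball x0 \<rho>"
  have controt: "continuous_on A (rot k)" for k A unfolding rot_def by (intro continuous_intros)
  have "open U" unfolding U_def
    by (intro open_Int open_INT ballI open_vimage of(1) controt) auto
  have x0U: "x0 \<in> U" using x0 \<rho> by (auto simp: U_def rot_def)
  have rotcl: "rot k y \<in> closure f" if "y \<in> closure U" "k < n" for k y
  proof -
    have "rot k ` closure U \<subseteq> closure f"
      by (rule image_closure_subset[OF controt]) (use that(2) closure_subset in \<open>auto simp: U_def\<close>)
    then show ?thesis using that by blast
  qed
  define h where "h = (\<lambda>x. \<Prod>k<n. (G (rot k x) - \<zeta>))"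
  have "norm (h x0) \<le> 0"
  proof (rule maximum_modulus_frontier[OF _ _ _ _ x0U])
    have "(\<lambda>x. \<Prod>k<n. (g (rot k x) - \<zeta>)) holomorphic_on U"
    proof (intro holomorphic_intros)
      fix k assume "k \<in> {..<n}"
      show "(\<lambda>x. g (rot k x)) holomorphic_on U"
        by (rule holomorphic_on_compose_gen[OF _ hol, unfolded o_def])
           (use \<open>k \<in> {..<n}\<close> in \<open>auto simp: rot_def U_def f_def J_def intro!: holomorphic_intros\<close>)
    qed
    then have "h holomorphic_on U"
      by (rule holomorphic_transform) (auto simp: h_def U_def f_def J_def eq)
    then show "h holomorphic_on interior U" using \<open>open U\<close> by (simp add: interior_open)
    show "continuous_on (closure U) h" unfolding h_def
    proof (intro continuous_intros)
      fix k assume "k \<in> {..<n}"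
      then show "continuous_on (closure U) (\<lambda>x. G (rot k x))"
        by (intro continuous_on_compose2[OF cont controt]) (use rotcl in \<open>auto simp: f_def J_def\<close>)
    qed
    show "bounded U" unfolding U_def by (rule bounded_subset[OF bounded_ball]) auto
    fix y assume "y \<in> frontier U"
    then have y: "y \<in> closure U" "y \<notin> U" using \<open>open U\<close> by (auto simp: frontier_def interior_open)
    have "closure U \<subseteq> cball x0 \<rho>" by (rule closure_minimal) (auto simp: U_def)
    then have yd: "dist x0 y \<le> \<rho>" using y by auto
    have "\<exists>k<n. rot k y \<notin> f"
    proof (cases "dist x0 y = \<rho>")
      case True
      from hit[OF this] show ?thesis using e(2) of(5) by blast
    next
      case False
      then show ?thesis using y(2) yd by (auto simp: U_def)
    qed
    then obtain k where k: "k < n" "rot k y \<notin> f" by blast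
    then have "rot k y \<in> J" using rotcl[OF y(1)] clf by blast
    moreover have "dist p (rot k y) < r"
    proof -
      have "dist p (rot k y) \<le> dist p x0 + dist x0 (rot k y)" by (rule dist_triangle)
      then show ?thesis using x0(2) \<rho> yd \<open>r > 0\<close> by (simp add: nrot dist_commute)
    qed
    ultimately have "G (rot k y) - \<zeta> = 0" using const by (simp add: J_def)
    then have "h y = 0" unfolding h_def using k(1) by (intro prod_zero) auto
    then show "norm (h y) \<le> 0" by simp
  qed
  then have "h x0 = 0" by simp
  then have "G x0 = \<zeta>" by (auto simp: h_def rot_def)
  then show False using ne[of x0] eq[of x0] x0 by (auto simp: f_def J_def)
qed

text \<open>
  A Riemann map \<open>g\<close> of the inside is uniformly continuous, because nearby points of the inside are joined
  by small curves there, and curves in the disk with small image under the inverse have close ends. So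
  \<open>g\<close> extends to the closure. A fibre of the extension on the curve is connected, since it is a cluster
  set of the inverse; a fibre with two points would contain an arc of the curve, which is impossible.
\<close>

theorem Caratheodory_Jordan_domain:
  assumes j: "simple_path j" "pathfinish j = pathstart j"
  obtains R G where "homeomorphism (cball 0 1) (inside (path_image j) \<union> path_image j) R G"
    "R holomorphic_on ball 0 1" "R ` ball 0 1 = inside (path_image j)" "R ` sphere 0 1 = path_image j"
proof -
  define J where "J = path_image j"
  define f where "f = inside J"
  note Jio = Jordan_inside_outside[OF j, folded J_def, folded f_def]
  have of: "open f" "frontier f = J" "f \<inter> J = {}" "bounded f" "f \<noteq> {}" "connected f"
    using Jio inside_no_overlap[of J] by (auto simp: f_def)
  have clf: "closure f = f \<union> J" using of(2) closure_Un_frontier by blast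
  have cJ: "compact J" using j by (simp add: J_def compact_simple_path_image)
  have "simply_connected f" using simply_connected_inside_simple_path[OF j(1)] by (simp add: f_def J_def)
  moreover have "f \<noteq> UNIV" using of(4) by auto
  ultimately have "\<exists>g R. g holomorphic_on f \<and> R holomorphic_on ball 0 1 \<and> (\<forall>z\<in>f. g z \<in> ball 0 1 \<and> R (g z) = z) \<and>
      (\<forall>z\<in>ball 0 1. R z \<in> f \<and> g (R z) = z)"
    using simply_connected_eq_biholomorphic_to_disc[OF of(1)] of(5) by blast
  then obtain g R where g: "g holomorphic_on f" "R holomorphic_on ball 0 1"
    "\<And>z. z \<in> f \<Longrightarrow> g z \<in> ball 0 1 \<and> R (g z) = z" "\<And>z. z \<in> ball 0 1 \<Longrightarrow> R z \<in> f \<and> g (R z) = z"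
    by blast
  have Rim: "R ` ball 0 1 = f" using g(3,4) by force
  have contg: "continuous_on f g" using g(1) holomorphic_on_imp_continuous_on by blast
  have contR: "continuous_on (ball 0 1) R" using g(2) holomorphic_on_imp_continuous_on by blast
  have loc: "\<exists>\<delta>>0. \<forall>x\<in>f. \<forall>y\<in>f. dist p x < \<delta> \<longrightarrow> dist p y < \<delta> \<longrightarrow> dist (g x) (g y) \<le> \<epsilon>"
    if "p \<in> closure f" "\<epsilon> > 0" for p \<epsilon>
  proof (cases "p \<in> f")
    case True
    then obtain \<delta> where d: "\<delta> > 0" "\<And>x. x \<in> f \<Longrightarrow> dist x p < \<delta> \<Longrightarrow> dist (g x) (g p) < \<epsilon> / 2"
      using contg \<open>\<epsilon> > 0\<close> unfolding continuous_on_iff by (meson half_gt_zero)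
    have "dist (g x) (g y) \<le> \<epsilon>" if "x \<in> f" "y \<in> f" "dist p x < \<delta>" "dist p y < \<delta>" for x y
    proof -
      have "dist (g x) (g p) < \<epsilon> / 2" "dist (g y) (g p) < \<epsilon> / 2"
        using d(2)[of x] d(2)[of y] that by (simp_all add: dist_commute)
      then show ?thesis using dist_triangle_half_l[of "g x" "g p" \<epsilon> "g y"] by linarith
    qed
    then show ?thesis using d(1) by blast
  next
    case False
    then have pJ: "p \<in> path_image j" using that clf by (auto simp: J_def)
    have "bounded (R ` ball 0 1)" "p \<notin> R ` ball 0 1" using of(4) False Rim by auto
    from small_image_imp_close[OF g(2) this \<open>\<epsilon> > 0\<close>]
    obtain r where r: "r > 0" "\<And>\<gamma>. \<lbrakk>path \<gamma>; path_image \<gamma> \<subseteq> ball 0 1; R ` path_image \<gamma> \<subseteq> ball p r\<rbrakk>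
       \<Longrightarrow> dist (pathstart \<gamma>) (pathfinish \<gamma>) \<le> \<epsilon>" by metis
    from inside_Jordan_locally_connected_at_boundary[OF j pJ \<open>r > 0\<close>]
    obtain \<delta> where d: "\<delta> > 0" "\<And>x y. \<lbrakk>x \<in> f; y \<in> f; dist p x < \<delta>; dist p y < \<delta>\<rbrakk> \<Longrightarrow>
      \<exists>\<gamma>. path \<gamma> \<and> pathstart \<gamma> = x \<and> pathfinish \<gamma> = y \<and> path_image \<gamma> \<subseteq> f \<inter> ball p r"
      unfolding f_def J_def by metis
    have "dist (g x) (g y) \<le> \<epsilon>" if "x \<in> f" "y \<in> f" "dist p x < \<delta>" "dist p y < \<delta>" for x y
    proof -
      obtain \<gamma> where \<gamma>: "path \<gamma>" "pathstart \<gamma> = x" "pathfinish \<gamma> = y" "path_image \<gamma> \<subseteq> f \<inter> ball p r"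
        using d(2)[OF \<open>x \<in> f\<close> \<open>y \<in> f\<close> \<open>dist p x < \<delta>\<close> \<open>dist p y < \<delta>\<close>] by blast
      have "dist (pathstart (g \<circ> \<gamma>)) (pathfinish (g \<circ> \<gamma>)) \<le> \<epsilon>"
      proof (rule r(2))
        show "path (g \<circ> \<gamma>)" using \<gamma> contg by (intro path_continuous_image continuous_on_subset[OF contg]) auto
        show "path_image (g \<circ> \<gamma>) \<subseteq> ball 0 1" using \<gamma>(4) g(3) by (auto simp: path_image_compose)
        show "R ` path_image (g \<circ> \<gamma>) \<subseteq> ball p r"
        proof -
          have "R (g u) \<in> ball p r" if "u \<in> path_image \<gamma>" for u using that \<gamma>(4) g(3)[of u] by (metis IntD1 IntD2 subsetD)
          then show ?thesis by (auto simp: path_image_compose)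
        qed
      qed
      then show ?thesis using \<gamma> by (simp add: pathstart_compose pathfinish_compose)
    qed
    then show ?thesis using d(1) by blast
  qed
  have "uniformly_continuous_on f g"
    unfolding uniformly_continuous_on_def
  proof (intro allI impI)
    fix \<epsilon> :: real assume "\<epsilon> > 0"
    then have "\<forall>p\<in>closure f. \<exists>\<delta>>0. \<forall>x\<in>f. \<forall>y\<in>f. dist p x < \<delta> \<longrightarrow> dist p y < \<delta> \<longrightarrow> dist (g x) (g y) \<le> \<epsilon> / 2"
      using loc[of _ "\<epsilon> / 2"] by simp
    then obtain D where D0: "\<forall>p\<in>closure f. D p > 0 \<and>
        (\<forall>x\<in>f. \<forall>y\<in>f. dist p x < D p \<longrightarrow> dist p y < D p \<longrightarrow> dist (g x) (g y) \<le> \<epsilon> / 2)"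
      unfolding bchoice_iff by blast
    then have D: "\<And>p. p \<in> closure f \<Longrightarrow> D p > 0"
      "\<And>p x y. \<lbrakk>p \<in> closure f; x \<in> f; y \<in> f; dist p x < D p; dist p y < D p\<rbrakk> \<Longrightarrow> dist (g x) (g y) \<le> \<epsilon> / 2"
      by blast+
    have "compact (closure f)" using of(4) by simp
    then obtain e where e: "e > 0" "\<And>x. x \<in> closure f \<Longrightarrow> \<exists>G\<in>(\<lambda>p. ball p (D p)) ` closure f. ball x e \<subseteq> G"
    proof (rule Heine_Borel_lemma)
      show "closure f \<subseteq> \<Union> ((\<lambda>p. ball p (D p)) ` closure f)"
      proof
        fix p assume "p \<in> closure f"
        then show "p \<in> \<Union> ((\<lambda>p. ball p (D p)) ` closure f)" using D(1)[of p] by (intro UN_I[of p]) auto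
      qed
    qed auto
    have "dist (g y) (g x) < \<epsilon>" if xy: "x \<in> f" "y \<in> f" "dist y x < e" for x y
    proof -
      obtain p where p: "p \<in> closure f" "ball x e \<subseteq> ball p (D p)"
        using e(2)[OF subsetD[OF closure_subset xy(1)]] by auto
      have "x \<in> ball p (D p)" "y \<in> ball p (D p)" using subsetD[OF p(2), of x] subsetD[OF p(2), of y] xy(3) e(1) by (simp_all add: dist_commute)
      then have "dist (g y) (g x) \<le> \<epsilon> / 2" using D(2)[OF p(1) xy(2,1)] by simp
      then show ?thesis using \<open>\<epsilon> > 0\<close> by linarith
    qed
    then show "\<exists>d>0. \<forall>x\<in>f. \<forall>x'\<in>f. dist x' x < d \<longrightarrow> dist (g x') (g x) < \<epsilon>"
      using e(1) by blast
  qed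
  then obtain G where G: "uniformly_continuous_on (closure f) G" "\<And>x. x \<in> f \<Longrightarrow> g x = G x"
    by (rule uniformly_continuous_on_extension_on_closure) blast
  have contG: "continuous_on (closure f) G" using G(1) uniformly_continuous_imp_continuous by blast
  have Gcb: "G ` closure f \<subseteq> cball 0 1"
    by (rule image_closure_subset[OF contG]) (use g(3) G(2) in \<open>auto simp: less_imp_le\<close>)
  have seq: "\<exists>x. (\<forall>n. x n \<in> f) \<and> x \<longlonglongrightarrow> p" if "p \<in> closure f" for p
    using that unfolding closure_sequential by blast
  have GJ: "norm (G p) = 1" if p: "p \<in> J" for p
  proof (rule ccontr)
    assume "norm (G p) \<noteq> 1"
    then have "G p \<in> ball 0 1" using Gcb p clf by force
    obtain x where x: "\<And>n. x n \<in> f" "x \<longlonglongrightarrow> p" using seq[of p] p clf by blast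
    have "(\<lambda>n. G (x n)) \<longlonglongrightarrow> G p"
      by (rule continuous_on_tendsto_compose[OF contG x(2)]) (use p clf x(1) in \<open>auto intro!: always_eventually\<close>)
    then have "(\<lambda>n. R (G (x n))) \<longlonglongrightarrow> R (G p)"
      by (rule continuous_on_tendsto_compose[OF contR _ \<open>G p \<in> ball 0 1\<close>])
         (use g(3) G(2) x(1) in \<open>auto intro!: always_eventually\<close>)
    moreover have "R (G (x n)) = x n" for n using g(3)[OF x(1)] G(2)[OF x(1)] by simp
    ultimately have "p = R (G p)" using x(2) LIMSEQ_unique by auto
    then show False using g(4)[OF \<open>G p \<in> ball 0 1\<close>] p of(3) by auto
  qed
  have Gsurj: "G ` closure f = cball 0 1"
  proof
    have "ball 0 1 \<subseteq> G ` closure f"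
    proof
      fix z :: complex assume "z \<in> ball 0 1"
      then show "z \<in> G ` closure f" using g(4)[of z] G(2)[of "R z"] closure_subset[of f]
        by (intro image_eqI[of _ _ "R z"]) auto
    qed
    moreover have "closed (G ` closure f)"
      using of(4) by (intro compact_imp_closed compact_continuous_image contG) simp
    ultimately have "closure (ball 0 1) \<subseteq> G ` closure f" by (rule closure_minimal)
    then show "cball 0 1 \<subseteq> G ` closure f" by simp
  qed (rule Gcb)
  \<comment> \<open>Fibres of G on the curve are cluster sets of R, hence connected.\<close>
  have fibre: "connected {p \<in> J. G p = \<zeta>}" if "norm \<zeta> = 1" for \<zeta>
  proof -
    define C where "C = (\<lambda>n::nat. closure (R ` (ball 0 1 \<inter> ball \<zeta> (1 / Suc n))))"
    have "{p \<in> J. G p = \<zeta>} = (\<Inter>n. C n)"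
    proof (intro equalityI subsetI)
      fix p assume p: "p \<in> {p \<in> J. G p = \<zeta>}"
      obtain x where x: "\<And>n. x n \<in> f" "x \<longlonglongrightarrow> p" using seq[of p] p clf by blast
      have "(\<lambda>n. G (x n)) \<longlonglongrightarrow> \<zeta>"
        using continuous_on_tendsto_compose[OF contG x(2)] p clf x(1) by (auto intro!: always_eventually)
      then have lim: "\<forall>\<^sub>F k in sequentially. dist (G (x k)) \<zeta> < 1 / Suc n" for n
        by (rule tendstoD) simp
      show "p \<in> (\<Inter>n. C n)"
      proof
        fix n
        have "\<forall>\<^sub>F k in sequentially. x k \<in> C n"
        proof (rule eventually_mono[OF lim[of n]])
          fix k assume "dist (G (x k)) \<zeta> < 1 / Suc n"
          then have "G (x k) \<in> ball 0 1 \<inter> ball \<zeta> (1 / Suc n)" "x k = R (G (x k))"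
            using g(3)[OF x(1)] G(2)[OF x(1)] by (auto simp: dist_commute)
          then show "x k \<in> C n" unfolding C_def by (intro subsetD[OF closure_subset] image_eqI[of _ _ "G (x k)"])
        qed
        then show "p \<in> C n" by (rule Lim_in_closed_set[rotated]) (auto simp: C_def x(2))
      qed
    next
      fix p assume p: "p \<in> (\<Inter>n. C n)"
      have "\<exists>z. z \<in> ball 0 1 \<and> dist \<zeta> z < 1 / Suc n \<and> dist (R z) p < 1 / Suc n" for n
      proof -
        have "p \<in> C n" using p by blast
        then obtain y where "y \<in> R ` (ball 0 1 \<inter> ball \<zeta> (1 / Suc n))" "dist y p < 1 / Suc n"
          unfolding C_def closure_approachable by (metis of_nat_0_less_iff zero_less_Suc zero_less_divide_1_iff)
        then show ?thesis by auto
      qed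
      then have "\<forall>n. \<exists>z. z \<in> ball 0 1 \<and> dist \<zeta> z < 1 / Suc n \<and> dist (R z) p < 1 / Suc n" by blast
      then obtain z where "\<forall>n. z n \<in> ball 0 1 \<and> dist \<zeta> (z n) < 1 / Suc n \<and> dist (R (z n)) p < 1 / Suc n"
        unfolding choice_iff by blast
      then have z: "\<And>n. z n \<in> ball 0 1" "\<And>n. dist \<zeta> (z n) < 1 / Suc n" "\<And>n. dist (R (z n)) p < 1 / Suc n"
        by blast+
      have lim0: "(\<lambda>n. 1 / real (Suc n)) \<longlonglongrightarrow> 0" by (rule lim_1_over_n[THEN LIMSEQ_Suc])
      have Rp: "(\<lambda>n. R (z n)) \<longlonglongrightarrow> p"
        by (rule metric_tendsto_imp_tendsto[OF lim0]) (use z(3) in \<open>auto intro!: always_eventually less_imp_le\<close>)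
      have zz: "z \<longlonglongrightarrow> \<zeta>"
        by (rule metric_tendsto_imp_tendsto[OF lim0]) (use z(2) in \<open>auto intro!: always_eventually less_imp_le simp: dist_commute\<close>)
      have Rf: "R (z n) \<in> f" "G (R (z n)) = z n" for n using g(4)[OF z(1)] G(2)[of "R (z n)"] by auto
      have pcl: "p \<in> closure f" unfolding closure_sequential using Rp Rf(1) by (intro exI[of _ "\<lambda>n. R (z n)"]) simp
      have "(\<lambda>n. G (R (z n))) \<longlonglongrightarrow> G p"
        by (rule continuous_on_tendsto_compose[OF contG Rp pcl]) (use Rf subsetD[OF closure_subset] in \<open>auto intro!: always_eventually\<close>)
      then have "G p = \<zeta>" using Rf zz LIMSEQ_unique by auto
      moreover have "p \<notin> f" using g(3)[of p] G(2)[of p] \<open>G p = \<zeta>\<close> that by auto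
      ultimately show "p \<in> {p \<in> J. G p = \<zeta>}" using pcl clf by auto
    qed
    moreover have "connected (\<Inter>n. C n)"
    proof (rule connected_nest)
      show "compact (C n)" for n unfolding C_def
        by (rule compact_closure[THEN iffD2], rule bounded_subset[OF of(4)]) (use Rim in auto)
      show "connected (C n)" for n unfolding C_def
        by (intro connected_imp_connected_closure connected_continuous_image continuous_on_subset[OF contR] convex_connected convex_Int) auto
      show "m \<le> n \<Longrightarrow> C n \<subseteq> C m" for m n unfolding C_def
      proof (intro closure_mono image_mono Int_mono order_refl subset_ball)
        assume "m \<le> n" then show "1 / real (Suc n) \<le> 1 / real (Suc m)" by (simp add: frac_le)
      qed
    qed
    ultimately show ?thesis by simp
  qed
  have injJ: "p = q" if pq: "p \<in> J" "q \<in> J" "G p = G q" for p q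
  proof (rule ccontr)
    assume "p \<noteq> q"
    define \<zeta> where "\<zeta> = G p"
    define P where "P = {p \<in> J. G p = \<zeta>}"
    have "norm \<zeta> = 1" using GJ pq by (simp add: \<zeta>_def)
    then have conP: "connected P" unfolding P_def by (rule fibre)
    obtain a d where ad: "arc a" "arc d" "pathstart a = p" "pathfinish a = q" "pathstart d = q" "pathfinish d = p"
      "path_image a \<inter> path_image d = {p, q}" "path_image a \<union> path_image d = J"
      using exists_double_arc[OF j, of p q] pq \<open>p \<noteq> q\<close> unfolding J_def by metis
    have noarc: "\<exists>s\<in>{0<..<1}. b s \<notin> P" if b: "arc b" "arc b'" "path_image b \<inter> path_image b' = {p, q}" "path_image b \<union> path_image b' = J"
      "{pathstart b, pathfinish b} = {p, q}" for b b'
    proof (rule ccontr)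
      assume "\<not> ?thesis"
      then have inP: "b s \<in> P" if "s \<in> {0<..<1}" for s using that by blast
      define x where "x = b (1/2)"
      have inj: "inj_on b {0..1}" using b(1) by (simp add: arc_def)
      have x: "x \<in> path_image b" "x \<notin> path_image b'"
      proof -
        show "x \<in> path_image b" by (auto simp: x_def path_image_def)
        have "x \<noteq> b 0" "x \<noteq> b 1" unfolding x_def using inj_onD[OF inj, of "1/2" 0] inj_onD[OF inj, of "1/2" 1] by auto
        then show "x \<notin> path_image b'" using b(3,5) \<open>x \<in> path_image b\<close> by (auto simp: pathstart_def pathfinish_def)
      qed
      obtain r where r: "r > 0" "\<And>y. y \<in> path_image b' \<Longrightarrow> r \<le> dist x y"
        using separate_point_closed[of "path_image b'" x] x(2) b(2) closed_arc_image by blast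
      show False
      proof (rule not_constant_on_boundary_arc[OF j, of g G \<zeta> x r])
        show "g holomorphic_on inside (path_image j)" "continuous_on (closure (inside (path_image j))) G"
          using g(1) contG by (auto simp: f_def J_def)
        show "g y = G y" "g y \<noteq> \<zeta>" if "y \<in> inside (path_image j)" for y
          using that G(2) g(3)[of y] \<open>norm \<zeta> = 1\<close> by (auto simp: f_def J_def)
        show "x \<in> path_image j" using x(1) b(4) by (auto simp: J_def)
        show "r > 0" by fact
        show "G y = \<zeta>" if y: "y \<in> path_image j" "dist x y < r" for y
        proof -
          have "y \<notin> path_image b'" using r(2)[of y] y(2) by auto
          then have "y \<in> path_image b" using y(1) b(4) by (auto simp: J_def)
          then obtain s where s: "s \<in> {0..1}" "y = b s" by (auto simp: path_image_def)
          have "b 0 \<in> path_image b'" "b 1 \<in> path_image b'"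
            using b(3,5) by (auto simp: pathstart_def pathfinish_def)
          then have "s \<noteq> 0" "s \<noteq> 1" using s(2) \<open>y \<notin> path_image b'\<close> by blast+
          then have "s \<in> {0<..<1}" using s(1) by simp
          then have "y \<in> P" using inP s(2) by blast
          then show ?thesis by (simp add: P_def)
        qed
      qed
    qed
    obtain s where s: "s \<in> {0<..<1}" "a s \<notin> P" using noarc[of a d] ad by auto
    obtain t where t: "t \<in> {0<..<1}" "d t \<notin> P" using noarc[of d a] ad by (auto simp: Int_commute Un_commute insert_commute)
    define A where "A = a ` {0..s} \<union> d ` {t..1}"
    define B where "B = a ` {s..1} \<union> d ` {0..t}"
    have cad: "continuous_on {0..1} a" "continuous_on {0..1} d" using ad by (auto simp: arc_def path_def)
    have "compact A" unfolding A_def using s t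
      by (intro compact_Un compact_continuous_image continuous_on_subset[OF cad(1)] continuous_on_subset[OF cad(2)]) auto
    moreover have "compact B" unfolding B_def using s t
      by (intro compact_Un compact_continuous_image continuous_on_subset[OF cad(1)] continuous_on_subset[OF cad(2)]) auto
    ultimately have clAB: "closed A" "closed B" by (auto intro: compact_imp_closed)
    have ends: "a 0 = p" "a 1 = q" "d 0 = q" "d 1 = p" using ad by (auto simp: pathstart_def pathfinish_def)
    have inj: "inj_on a {0..1}" "inj_on d {0..1}" using ad by (auto simp: arc_def)
    have AB: "A \<inter> B \<subseteq> {a s, d t}"
    proof
      fix y assume y: "y \<in> A \<inter> B"
      have "y \<in> {a s, d t}" if "u \<in> {0..s}" "v \<in> {s..1}" "y = a u" "y = a v" for u v
      proof -
        have "u = v" using that s by (intro inj_onD[OF inj(1), of u v]) auto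
        then have "u = s" using that by simp
        then show ?thesis using that by simp
      qed
      moreover have "y \<in> {a s, d t}" if "u \<in> {t..1}" "v \<in> {0..t}" "y = d u" "y = d v" for u v
      proof -
        have "u = v" using that t by (intro inj_onD[OF inj(2), of u v]) auto
        then have "u = t" using that by simp
        then show ?thesis using that by simp
      qed
      moreover have False if "u \<in> {0..s}" "v \<in> {0..t}" "y = a u" "y = d v" for u v
      proof -
        have uv: "u \<in> {0..1}" "v \<in> {0..1}" using that s t by auto
        have "y \<in> path_image a" "y \<in> path_image d" unfolding path_image_def using uv that(3,4) by blast+
        then consider "y = p" | "y = q" using ad(7) by blast
        then show False
        proof cases
          case 1
          then have "v = 1" using uv that(4) ends(4) inj_onD[OF inj(2), of v 1] by simp
          then show False using that(2) t by simp
        next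
          case 2
          then have "u = 1" using uv that(3) ends(2) inj_onD[OF inj(1), of u 1] by simp
          then show False using that(1) s by simp
        qed
      qed
      moreover have False if "u \<in> {t..1}" "v \<in> {s..1}" "y = d u" "y = a v" for u v
      proof -
        have uv: "u \<in> {0..1}" "v \<in> {0..1}" using that s t by auto
        have "y \<in> path_image a" "y \<in> path_image d" unfolding path_image_def using uv that(3,4) by blast+
        then consider "y = p" | "y = q" using ad(7) by blast
        then show False
        proof cases
          case 1
          then have "v = 0" using uv that(4) ends(1) inj_onD[OF inj(1), of v 0] by simp
          then show False using that(2) s by simp
        next
          case 2
          then have "u = 0" using uv that(3) ends(3) inj_onD[OF inj(2), of u 0] by simp
          then show False using that(1) t by simp
        qed
      qed
      ultimately show "y \<in> {a s, d t}" using y unfolding A_def B_def by blast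
    qed
    have cov: "P \<subseteq> A \<union> B"
    proof
      fix y assume "y \<in> P"
      then have "y \<in> path_image a \<union> path_image d" using ad(8) by (auto simp: P_def)
      then consider u where "u \<in> {0..1}" "y = a u" | u where "u \<in> {0..1}" "y = d u" by (auto simp: path_image_def)
      then show "y \<in> A \<union> B"
      proof cases
        case 1 then show ?thesis by (cases "u \<le> s") (auto simp: A_def B_def)
      next
        case 2 then show ?thesis by (cases "u \<le> t") (auto simp: A_def B_def)
      qed
    qed
    have "a 0 \<in> A" "a 1 \<in> B" unfolding A_def B_def using s by (intro UnI1 imageI; simp)+
    then have "p \<in> A" "q \<in> B" by (simp_all add: ends)
    moreover have "p \<in> P" "q \<in> P" using pq by (auto simp: P_def \<zeta>_def)
    moreover have "A \<inter> B \<inter> P = {}" using AB s t by auto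
    ultimately show False using conP clAB cov unfolding connected_closed by (metis disjoint_iff)
  qed
  have injG: "inj_on G (closure f)"
  proof (rule inj_onI)
    fix x y assume xy: "x \<in> closure f" "y \<in> closure f" "G x = G y"
    have inf: "norm (G z) < 1" "R (G z) = z" if "z \<in> f" for z using g(3)[OF that] G(2)[OF that] by auto
    have J1: "norm (G z) = 1" if "z \<in> J" for z using GJ that .
    consider "x \<in> f" "y \<in> f" | "x \<in> f" "y \<in> J" | "x \<in> J" "y \<in> f" | "x \<in> J" "y \<in> J" using xy clf by blast
    then show "x = y"
    proof cases
      case 1 then show ?thesis using inf(2)[of x] inf(2)[of y] xy(3) by metis
    next
      case 2 then show ?thesis using inf(1)[of x] J1[of y] xy(3) by simp
    next
      case 3 then show ?thesis using inf(1)[of y] J1[of x] xy(3) by simp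
    next
      case 4 then show ?thesis using injJ xy(3) by blast
    qed
  qed
  have "compact (closure f)" using of(4) by simp
  then obtain R' where R': "homeomorphism (closure f) (cball 0 1) G R'"
    using homeomorphism_compact[OF _ contG Gsurj injG] by blast
  have R'eq: "R' z = R z" if "z \<in> ball 0 1" for z
  proof -
    have "R z \<in> f" "G (R z) = z" using g(4)[OF that] G(2)[of "R z"] by auto
    moreover have "R z \<in> closure f" using subsetD[OF closure_subset \<open>R z \<in> f\<close>] .
    ultimately show ?thesis using homeomorphism_apply1[OF R', of "R z"] by simp
  qed
  have "R' ` sphere 0 1 = J"
  proof (intro equalityI subsetI)
    fix w assume "w \<in> R' ` sphere 0 1"
    then obtain z where z: "norm z = 1" "w = R' z" by auto
    have "z \<in> cball 0 1" using z by simp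
    then have w: "w \<in> closure f" "G w = z"
      using homeomorphism_image2[OF R'] homeomorphism_apply2[OF R'] z(2) by blast+
    have "w \<notin> f"
    proof
      assume "w \<in> f"
      then show False using z(1) w(2) g(3)[of w] G(2)[of w] by simp
    qed
    then show "w \<in> J" using w(1) clf by blast
  next
    fix w assume "w \<in> J"
    then have "norm (G w) = 1" "R' (G w) = w" using GJ homeomorphism_apply1[OF R', of w] clf by blast+
    then show "w \<in> R' ` sphere 0 1" by (metis imageI mem_sphere_0)
  qed
  moreover have "R' ` ball 0 1 = f" using R'eq Rim by simp
  moreover have "R' holomorphic_on ball 0 1" using R'eq by (intro holomorphic_transform[OF g(2)]) simp
  moreover have "homeomorphism (cball 0 1) (inside (path_image j) \<union> path_image j) R' G"
    using homeomorphism_symD[OF R'[unfolded clf]] unfolding f_def J_def .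
  ultimately show thesis using that[of R' G] unfolding f_def J_def by blast
qed

text \<open>
  Moebius transformations of the disk that fix \<open>1\<close> and \<open>-1\<close>.
\<close>

lemma disc_automorphism_real:
  fixes c :: real
  assumes c: "\<bar>c\<bar> < 1"
  defines "\<mu> \<equiv> \<lambda>c (z::complex). (z + of_real c) / (1 + of_real c * z)"
  shows "homeomorphism (cball 0 1) (cball 0 1) (\<mu> c) (\<mu> (-c))" "\<mu> c holomorphic_on ball 0 1"
    "\<mu> c ` ball 0 1 \<subseteq> ball 0 1" "\<mu> (-c) ` ball 0 1 \<subseteq> ball 0 1"
proof -
  have nz: "1 + of_real d * z \<noteq> 0" if "norm z \<le> 1" "\<bar>d\<bar> < 1" for z :: complex and d :: real
  proof
    assume "1 + of_real d * z = 0"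
    then have "of_real d * z = - 1" by (metis add.commute add_eq_0_iff)
    then have "norm (of_real d * z) = 1" by simp
    moreover have "norm (of_real d * z) < 1"
    proof -
      have "norm (of_real d * z) = \<bar>d\<bar> * norm z" by (simp add: norm_mult)
      also have "\<dots> \<le> \<bar>d\<bar> * 1" using that by (intro mult_left_mono) auto
      finally show ?thesis using that by simp
    qed
    ultimately show False by simp
  qed
  have key: "(norm (1 + of_real d * z))\<^sup>2 - (norm (z + of_real d))\<^sup>2 = (1 - d\<^sup>2) * (1 - (norm z)\<^sup>2)" for z :: complex and d :: real
    by (simp only: cmod_power2) (simp add: power2_eq_square algebra_simps)
  have le: "norm (\<mu> d z) \<le> 1" "norm z < 1 \<Longrightarrow> norm (\<mu> d z) < 1" if z: "norm z \<le> 1" and d: "\<bar>d\<bar> < 1" for z d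
  proof -
    have p: "0 < norm (1 + of_real d * z)" using nz[OF z d] by simp
    have d1: "0 < 1 - d\<^sup>2" using d by (simp add: abs_square_less_1)
    have "0 \<le> (1 - d\<^sup>2) * (1 - (norm z)\<^sup>2)"
      using d1 z by (intro mult_nonneg_nonneg) (auto simp: power_le_one)
    then have "(norm (z + of_real d))\<^sup>2 \<le> (norm (1 + of_real d * z))\<^sup>2" using key[of d z] by linarith
    then show "norm (\<mu> d z) \<le> 1" using p by (simp add: \<mu>_def norm_divide power2_le_iff_abs_le)
    assume "norm z < 1"
    then have "0 < (1 - d\<^sup>2) * (1 - (norm z)\<^sup>2)"
      using d1 by (intro mult_pos_pos) (auto simp: abs_square_less_1)
    then have "(norm (z + of_real d))\<^sup>2 < (norm (1 + of_real d * z))\<^sup>2" using key[of d z] by linarith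
    then have "norm (z + of_real d) < norm (1 + of_real d * z)" by (rule power_less_imp_less_base) simp
    then show "norm (\<mu> d z) < 1" using p by (simp add: \<mu>_def norm_divide)
  qed
  have inv: "\<mu> (-d) (\<mu> d z) = z" if z: "norm z \<le> 1" and d: "\<bar>d\<bar> < 1" for z d
  proof -
    define e where "e = complex_of_real d"
    have n1: "1 + e * z \<noteq> 0" using nz[OF z d] by (simp add: e_def)
    have n2: "1 - e * e \<noteq> 0"
    proof -
      have "1 - d * d \<noteq> 0" using d by (simp add: abs_square_eq_1 flip: power2_eq_square)
      then have "complex_of_real (1 - d * d) \<noteq> 0" by (simp only: of_real_eq_0_iff not_False_eq_True)
      then show ?thesis by (simp add: e_def)
    qed
    have A: "(z + e) / (1 + e * z) - e = z * (1 - e * e) / (1 + e * z)" using n1 by (simp add: field_simps)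
    have B: "1 - e * ((z + e) / (1 + e * z)) = (1 - e * e) / (1 + e * z)" using n1 by (simp add: field_simps)
    have "\<mu> (-d) (\<mu> d z) = ((z + e) / (1 + e * z) - e) / (1 - e * ((z + e) / (1 + e * z)))"
      by (simp add: \<mu>_def e_def)
    also have "\<dots> = z" unfolding A B using n1 n2 by simp
    finally show ?thesis .
  qed
  have c': "\<bar>- c\<bar> < 1" using c by simp
  have con: "continuous_on (cball 0 1) (\<mu> d)" if "\<bar>d\<bar> < 1" for d
    unfolding \<mu>_def by (intro continuous_intros) (use nz[OF _ that] in auto)
  show "homeomorphism (cball 0 1) (cball 0 1) (\<mu> c) (\<mu> (-c))"
  proof (rule homeomorphismI)
    show "\<mu> c ` cball 0 1 \<subseteq> cball 0 1" "\<mu> (-c) ` cball 0 1 \<subseteq> cball 0 1"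
      using le(1)[OF _ c] le(1)[OF _ c'] by auto
    show "\<And>x. x \<in> cball 0 1 \<Longrightarrow> \<mu> (-c) (\<mu> c x) = x" using inv[OF _ c] by simp
    show "\<And>x. x \<in> cball 0 1 \<Longrightarrow> \<mu> c (\<mu> (-c) x) = x" using inv[OF _ c'] by simp
  qed (intro con c c')+
  show "\<mu> c holomorphic_on ball 0 1"
    unfolding \<mu>_def by (intro holomorphic_intros) (use nz[OF _ c] in auto)
  show "\<mu> c ` ball 0 1 \<subseteq> ball 0 1" "\<mu> (-c) ` ball 0 1 \<subseteq> ball 0 1"
    using le(2)[OF _ c] le(2)[OF _ c'] by auto
qed

text \<open>
  A rotation makes the two points symmetric to the real axis; a real automorphism then makes them
  antipodal. The constant is the tangent of half the angle that has to be made up.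
\<close>

lemma disc_automorphism_antipodal:
  assumes e: "norm e0 = 1" "norm e1 = 1" "e0 \<noteq> e1"
  obtains M N where "homeomorphism (cball 0 1) (cball 0 1) M N" "M holomorphic_on ball 0 1"
    "M ` ball 0 1 = ball 0 (1::real)" "M 1 = e0" "M (-1) = e1"
proof -
  define \<delta> where "\<delta> = Arg2pi (e1 / e0) / 2"
  have n: "norm (e1 / e0) = 1" using e by (simp add: norm_divide)
  have rot: "e1 = e0 * cis (2 * \<delta>)"
    using Arg2pi_eq[of "e1 / e0"] n e by (simp add: \<delta>_def cis_conv_exp field_simps) force
  have \<delta>: "0 < \<delta>" "\<delta> < pi"
  proof -
    have "\<delta> \<noteq> 0" using rot e(3) by auto
    then show "0 < \<delta>" "\<delta> < pi" using Arg2pi_ge_0[of "e1 / e0"] Arg2pi_lt_2pi[of "e1 / e0"] by (auto simp: \<delta>_def)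
  qed
  define w where "w = e0 * cis \<delta>"
  have nw: "norm w = 1" using e by (simp add: w_def norm_mult)
  define c where "c = cos \<delta> / (1 + sin \<delta>)"
  have s: "0 < sin \<delta>" using \<delta> by (rule sin_gt_zero)
  have c: "\<bar>c\<bar> < 1"
  proof -
    have "\<bar>1 + sin \<delta>\<bar> = 1 + sin \<delta>" using s by simp
    moreover have "\<bar>cos \<delta>\<bar> < 1 + sin \<delta>" using s abs_cos_le_one[of \<delta>] by linarith
    ultimately show ?thesis using s by (simp add: c_def abs_divide pos_divide_less_eq)
  qed
  define \<mu> where "\<mu> = (\<lambda>c (z::complex). (z + of_real c) / (1 + of_real c * z))"
  have aut: "homeomorphism (cball 0 1) (cball 0 1) (\<mu> c) (\<mu> (-c))" "\<mu> c holomorphic_on ball 0 1"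
    "\<mu> c ` ball 0 1 \<subseteq> ball 0 1" "\<mu> (-c) ` ball 0 1 \<subseteq> ball 0 1"
    using disc_automorphism_real[OF c] unfolding \<mu>_def .
  have val: "\<mu> c (- \<i>) = cis (- \<delta>)" "\<mu> c \<i> = cis \<delta>"
  proof -
    have s1: "1 + sin \<delta> \<noteq> 0" using s by simp
    have cs: "c * (1 + sin \<delta>) = cos \<delta>" using s1 by (simp add: c_def)
    have nz: "1 - \<i> * of_real c \<noteq> 0" "1 + \<i> * of_real c \<noteq> 0" by (auto simp: complex_eq_iff)
    have r1: "cos \<delta> + c * sin \<delta> * 0 - sin \<delta> * c = c" "sin \<delta> + c * cos \<delta> = 1"
    proof -
      show "cos \<delta> + c * sin \<delta> * 0 - sin \<delta> * c = c" using cs by (simp add: algebra_simps)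
      have "c * cos \<delta> * (1 + sin \<delta>) = (c * (1 + sin \<delta>)) * cos \<delta>" by (simp only: mult.assoc mult.commute[of "cos \<delta>"])
      also have "\<dots> = (cos \<delta>)\<^sup>2" unfolding cs by (simp add: power2_eq_square)
      also have "\<dots> = (1 - sin \<delta>) * (1 + sin \<delta>)" by (simp add: cos_squared_eq power2_eq_square algebra_simps)
      finally have "c * cos \<delta> = 1 - sin \<delta>" using s1 by simp
      then show "sin \<delta> + c * cos \<delta> = 1" by simp
    qed
    have "of_real c - \<i> = cis (- \<delta>) * (1 - \<i> * of_real c)" "of_real c + \<i> = cis \<delta> * (1 + \<i> * of_real c)"
      using r1 by (auto simp: complex_eq_iff algebra_simps)
    then show "\<mu> c (- \<i>) = cis (- \<delta>)" "\<mu> c \<i> = cis \<delta>"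
      unfolding \<mu>_def using nz by (simp_all add: field_simps)
  qed
  define M where "M = (\<lambda>z. w * \<mu> c (- \<i> * z))"
  define N where "N = (\<lambda>z. \<i> * \<mu> (-c) (cnj w * z))"
  have ww: "w * cnj w = 1" using nw complex_norm_square[of w] by simp
  have cw: "cnj w * (w * z) = z" "w * (cnj w * z) = z" for z
    using ww by (simp_all flip: mult.assoc) (simp add: mult.commute)
  show thesis
  proof (rule that[of M N])
    have h1: "homeomorphism (cball 0 1) (cball 0 1) (\<lambda>z. - \<i> * z) (\<lambda>z. \<i> * z)"
      by (rule homeomorphismI) (auto intro!: continuous_intros simp: norm_mult)
    have h2: "homeomorphism (cball 0 1) (cball 0 1) (\<lambda>z. w * z) (\<lambda>z. cnj w * z)"
      by (rule homeomorphismI) (auto intro!: continuous_intros simp: norm_mult nw cw)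
    show "homeomorphism (cball 0 1) (cball 0 1) M N"
      using homeomorphism_compose[OF homeomorphism_compose[OF h1 aut(1)] h2] unfolding M_def N_def by (simp add: o_def)
    have "(\<lambda>z. \<mu> c (- \<i> * z)) holomorphic_on ball 0 1"
      by (rule holomorphic_on_compose_gen[OF _ aut(2), unfolded o_def])
         (auto intro!: holomorphic_intros simp: norm_mult)
    then show "M holomorphic_on ball 0 1" unfolding M_def by (intro holomorphic_intros)
    show "M ` ball 0 1 = ball 0 1"
    proof
      show "M ` ball 0 1 \<subseteq> ball 0 1"
        using aut(3) by (auto simp: M_def norm_mult nw image_subset_iff)
      show "ball 0 1 \<subseteq> M ` ball 0 1"
      proof
        fix z :: complex assume z: "z \<in> ball 0 1"
        have "N z \<in> ball 0 1" using aut(4) z by (auto simp: N_def norm_mult nw image_subset_iff)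
        moreover have "M (N z) = z"
        proof -
          have "cnj w * z \<in> cball 0 1" using z by (simp add: norm_mult nw)
          then have "\<mu> c (\<mu> (-c) (cnj w * z)) = cnj w * z" using homeomorphism_apply2[OF aut(1)] by blast
          moreover have "- \<i> * (\<i> * x) = x" for x by simp
          ultimately show ?thesis unfolding M_def N_def by (simp only: cw)
        qed
        ultimately show "z \<in> M ` ball 0 1" by (metis imageI)
      qed
    qed
    show "M 1 = e0" by (simp add: M_def val w_def mult.assoc cis_mult)
    show "M (- 1) = e1" by (simp add: M_def val w_def mult.assoc cis_mult rot)
  qed
qed

lemma Caratheodory_Jordan_domain_two_points:
  assumes j: "simple_path j" "pathfinish j = pathstart j"
    and P: "P0 \<in> path_image j" "P1 \<in> path_image j" "P0 \<noteq> P1"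
  obtains R G where "homeomorphism (cball 0 1) (inside (path_image j) \<union> path_image j) R G"
    "R holomorphic_on ball 0 1" "R ` ball 0 1 = inside (path_image j)" "R 1 = P0" "R (-1) = P1"
proof -
  obtain R G where R: "homeomorphism (cball 0 1) (inside (path_image j) \<union> path_image j) R G"
    "R holomorphic_on ball 0 1" "R ` ball 0 1 = inside (path_image j)" "R ` sphere 0 1 = path_image j"
    using Caratheodory_Jordan_domain[OF j] .
  obtain e0 e1 where e: "norm e0 = 1" "norm e1 = 1" "R e0 = P0" "R e1 = P1"
    using P R(4) by (auto simp: image_iff set_eq_iff) (metis mem_sphere_0)
  have "e0 \<noteq> e1" using e P by auto
  then obtain M N where M: "homeomorphism (cball 0 1) (cball 0 1) M N" "M holomorphic_on ball 0 1"
    "M ` ball 0 1 = ball 0 (1::real)" "M 1 = e0" "M (-1) = e1"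
    using disc_automorphism_antipodal[OF e(1,2)] by blast
  show thesis
  proof (rule that)
    show "homeomorphism (cball 0 1) (inside (path_image j) \<union> path_image j) (R \<circ> M) (N \<circ> G)"
      by (rule homeomorphism_compose[OF M(1) R(1)])
    show "R \<circ> M holomorphic_on ball 0 1"
      by (rule holomorphic_on_compose_gen[OF M(2) R(2)]) (use M(3) in auto)
    show "(R \<circ> M) ` ball 0 1 = inside (path_image j)" by (simp only: image_comp[symmetric] M(3) R(3))
    show "(R \<circ> M) 1 = P0" "(R \<circ> M) (- 1) = P1" using M e by auto
  qed
qed

section \<open>Differentiable sweeps between two arcs\<close>

text \<open>
  The distance \<open>D(s)\<close> from \<open>(s,0)\<close> to the compact set of pairs \<open>(s,v)\<close> for which \<open>\<phi>(v,t)\<close> differs from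
  its boundary value by at least \<open>s\<^sup>2\<close> for some \<open>t\<close> is a positive continuous function of \<open>s > 0\<close>. Its integral is a
  differentiable increasing function slow enough at \<open>0\<close>; symmetrizing handles \<open>1\<close> as well.
\<close>

lemma slow_reparametrization:
  fixes \<phi> :: "real \<times> real \<Rightarrow> complex"
  assumes cont: "continuous_on ({0..1} \<times> {0..1}) \<phi>"
  obtains h h' C where "h 0 = 0" "h 1 = (1::real)" "strict_mono_on {0..1} h"
    "\<And>s. s \<in> {0..1} \<Longrightarrow> (h has_real_derivative h' s) (at s within {0..1})"
    "\<And>s t. \<lbrakk>s \<in> {0..1}; t \<in> {0..1}\<rbrakk> \<Longrightarrow> norm (\<phi> (h s, t) - \<phi> (0, t)) \<le> C * s\<^sup>2"
    "\<And>s t. \<lbrakk>s \<in> {0..1}; t \<in> {0..1}\<rbrakk> \<Longrightarrow> norm (\<phi> (h s, t) - \<phi> (1, t)) \<le> C * (1 - s)\<^sup>2"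
proof -
  define I where "I = {0..1::real}"
  have I: "compact I" by (simp add: I_def)
  define bad where "bad = {x \<in> I \<times> (I \<times> I). (fst x)\<^sup>2 \<le> norm (\<phi> (fst (snd x), snd (snd x)) - \<phi> (0, snd (snd x)))}
     \<union> {x \<in> I \<times> (I \<times> I). (fst x)\<^sup>2 \<le> norm (\<phi> (1 - fst (snd x), snd (snd x)) - \<phi> (1, snd (snd x)))}"
  have cc: "continuous_on (I \<times> (I \<times> I)) (\<lambda>x. \<phi> (p (fst (snd x)), snd (snd x)))"
    if "continuous_on I p" "p ` I \<subseteq> I" for p
    by (rule continuous_on_compose2[OF cont])
       (use that in \<open>auto simp: I_def intro!: continuous_intros continuous_on_compose2[OF that(1), of _ "\<lambda>x. fst (snd x)"]\<close>)
  have ids: "continuous_on I (\<lambda>x. x)" "(\<lambda>x. x) ` I \<subseteq> I" "continuous_on I (\<lambda>x::real. 0::real)" "(\<lambda>x::real. 0::real) ` I \<subseteq> I"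
    "continuous_on I (\<lambda>x. 1 - x)" "(\<lambda>x. 1 - x) ` I \<subseteq> I" "continuous_on I (\<lambda>x::real. 1::real)" "(\<lambda>x::real. 1::real) ` I \<subseteq> I"
    by (auto simp: I_def intro!: continuous_intros)
  have comp: "compact {x \<in> I \<times> (I \<times> I). (fst x)\<^sup>2 \<le> \<psi> x}" if "continuous_on (I \<times> (I \<times> I)) \<psi>" for \<psi>
  proof -
    have "closed (I \<times> (I \<times> I))" by (simp add: I_def closed_Times)
    then have "closed {x \<in> I \<times> (I \<times> I). (fst x)\<^sup>2 \<le> \<psi> x}"
      by (intro continuous_on_closed_Collect_le[OF _ that] continuous_intros)
    moreover have "bounded (I \<times> (I \<times> I))" by (simp add: I_def bounded_Times)
    then have "bounded {x \<in> I \<times> (I \<times> I). (fst x)\<^sup>2 \<le> \<psi> x}"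
      by (rule bounded_subset) blast
    ultimately show ?thesis by (simp add: compact_eq_bounded_closed)
  qed
  have "compact bad" unfolding bad_def
    by (intro compact_Un comp continuous_on_norm continuous_on_diff cc[OF ids(1,2)] cc[OF ids(3,4)] cc[OF ids(5,6)] cc[OF ids(7,8)])
  define K where "K = (\<lambda>x. (fst x, fst (snd x))) ` bad"
  have "compact K" unfolding K_def using \<open>compact bad\<close> by (intro compact_continuous_image continuous_intros)
  have "(0, (0, 0)) \<in> bad" by (auto simp: bad_def I_def)
  then have "(0, 0) \<in> K" unfolding K_def by force
  define D where "D = (\<lambda>s. infdist (s, 0) K)"
  have D0: "0 \<le> D s" for s by (simp add: D_def infdist_nonneg)
  have Ds: "D s \<le> \<bar>s\<bar>" for s
    using infdist_le[OF \<open>(0,0) \<in> K\<close>, of "(s, 0)"] by (simp add: D_def dist_Pair_Pair)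
  have Dpos: "0 < D s" if "0 < s" for s
  proof -
    have "(s, 0) \<notin> K" using that by (auto simp: K_def bad_def I_def)
    then show ?thesis using \<open>compact K\<close> \<open>(0,0) \<in> K\<close> unfolding D_def
      by (intro infdist_pos_not_in_closed compact_imp_closed) auto
  qed
  have good: "norm (\<phi> (v, t) - \<phi> (0, t)) \<le> s\<^sup>2 \<and> norm (\<phi> (1 - v, t) - \<phi> (1, t)) \<le> s\<^sup>2"
    if "s \<in> I" "v \<in> I" "t \<in> I" "v < D s" for s v t
  proof -
    have "(s, v) \<notin> K"
    proof
      assume "(s, v) \<in> K"
      from infdist_le[OF this, of "(s, 0)"] that(2,4) show False by (simp add: D_def dist_Pair_Pair I_def)
    qed
    then have "(s, (v, t)) \<notin> bad" unfolding K_def by force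
    then show ?thesis using that by (auto simp: bad_def)
  qed
  have contD: "continuous_on A D" for A unfolding D_def by (intro continuous_intros)
  define G where "G = (\<lambda>s. integral {0..s} D)"
  have Dint: "D integrable_on {a..b}" for a b using contD integrable_continuous_real by blast
  have Gder: "(G has_real_derivative D s) (at s within {0..1})" if "s \<in> {0..1}" for s
    unfolding G_def by (rule integral_has_real_derivative[OF contD that])
  have Gmono: "G s < G s'" if "0 \<le> s" "s < s'" for s s'
  proof -
    have "G s' = G s + integral {s..s'} D"
      unfolding G_def using that by (intro Henstock_Kurzweil_Integration.integral_combine[symmetric] Dint) auto
    moreover have "0 < integral {s..s'} D"
    proof -
      have "0 \<le> integral {s..s'} D" by (rule integral_nonneg[OF Dint]) (use D0 in auto)
      moreover have "integral {s..s'} D \<noteq> 0"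
      proof
        assume "integral {s..s'} D = 0"
        then have "D s' = 0" using integral_eq_0_iff[OF contD that(2)] D0 that by auto
        then show False using Dpos[of s'] that by simp
      qed
      ultimately show ?thesis by simp
    qed
    ultimately show ?thesis by simp
  qed
  have G0: "G 0 = 0" by (simp add: G_def)
  have Gpos: "0 < G s" if "0 < s" for s using Gmono[of 0 s] that G0 by simp
  have Gle: "\<exists>u\<in>{0..s}. G s \<le> s * D u" if s0: "0 \<le> s" for s
  proof -
    have "\<exists>x\<in>{0..s}. \<forall>y\<in>{0..s}. D y \<le> D x"
      by (rule continuous_attains_sup) (use contD s0 in auto)
    then obtain u where u: "u \<in> {0..s}" "\<And>x. x \<in> {0..s} \<Longrightarrow> D x \<le> D u" by blast
    have "G s \<le> integral {0..s} (\<lambda>_. D u)"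
      unfolding G_def by (rule integral_le[OF Dint]) (use u in auto)
    then show ?thesis using u(1) s0 by (intro bexI[of _ u]) auto
  qed
  define \<kappa> where "\<kappa> = (\<lambda>s. G s + G (1 - s))"
  define \<gamma> where "\<gamma> = G (1/2)"
  have \<gamma>: "0 < \<gamma>" using Gpos by (simp add: \<gamma>_def)
  have Gnn: "0 \<le> G s" if "0 \<le> s" for s using Gpos[of s] G0 that by (cases "s = 0") auto
  have \<kappa>: "\<gamma> \<le> \<kappa> s" if "s \<in> {0..1}" for s
  proof (cases "s \<le> 1/2")
    case True
    then have "\<gamma> \<le> G (1 - s)"
    proof (cases "s = 1/2")
      case True show ?thesis unfolding True \<gamma>_def by simp
    next
      case False then show ?thesis using Gmono[of "1/2" "1 - s"] \<open>s \<le> 1/2\<close> by (simp add: \<gamma>_def)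
    qed
    then show ?thesis using Gnn[of s] that by (simp add: \<kappa>_def)
  next
    case False
    then have "\<gamma> \<le> G s" using Gmono[of "1/2" s] by (simp add: \<gamma>_def)
    then show ?thesis using Gnn[of "1 - s"] that by (simp add: \<kappa>_def)
  qed
  define h where "h = (\<lambda>s. G s / \<kappa> s)"
  have h01: "h 0 = 0" "h 1 = 1" using Gpos[of 1] by (auto simp: h_def \<kappa>_def G0)
  have hsym: "1 - h s = h (1 - s)" if "s \<in> {0..1}" for s
    using \<kappa>[OF that] \<gamma> by (simp add: h_def \<kappa>_def field_simps)
  have hI: "h s \<in> I" if "s \<in> {0..1}" for s
    using \<kappa>[OF that] \<gamma> Gnn[of s] Gnn[of "1 - s"] that by (simp add: h_def I_def \<kappa>_def divide_simps)
  have hmono: "h s < h s'" if "s \<in> {0..1}" "s' \<in> {0..1}" "s < s'" for s s'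
  proof -
    have "G s * G (1 - s') < G s' * G (1 - s)"
    proof -
      have "G s * G (1 - s') \<le> G s * G (1 - s)"
        using that Gmono[of "1 - s'" "1 - s"] Gnn by (intro mult_left_mono) auto
      also have "\<dots> < G s' * G (1 - s)"
        using that Gmono[of s s'] Gpos[of "1 - s"] by (intro mult_strict_right_mono) auto
      finally show ?thesis .
    qed
    then have "G s * \<kappa> s' < G s' * \<kappa> s" by (simp add: \<kappa>_def algebra_simps)
    moreover have "0 < \<kappa> s" "0 < \<kappa> s'" using \<kappa>[OF that(1)] \<kappa>[OF that(2)] \<gamma> by auto
    ultimately show ?thesis by (simp add: h_def divide_simps)
  qed
  obtain B where B: "\<And>x. x \<in> I \<times> I \<Longrightarrow> norm (\<phi> x) \<le> B"
  proof -
    have "compact (\<phi> ` (I \<times> I))" using cont I by (intro compact_continuous_image compact_Times) (auto simp: I_def)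
    then show ?thesis using that compact_imp_bounded bounded_iff by (metis imageI)
  qed
  have "0 \<le> B" by (rule order_trans[OF norm_ge_zero B[of "(0,0)"]]) (simp add: I_def)
  define C where "C = max 1 (2 * B / \<gamma>\<^sup>2)"
  have bound: "norm (\<phi> (h s, t) - \<phi> (0, t)) \<le> C * s\<^sup>2 \<and> norm (\<phi> (1 - h s, t) - \<phi> (1, t)) \<le> C * s\<^sup>2"
    if s: "s \<in> {0..1}" and t: "t \<in> {0..1}" for s t
  proof (cases "0 < s \<and> s < \<gamma>")
    case True
    obtain u where u: "u \<in> {0..s}" "G s \<le> s * D u" using Gle[of s] s by auto
    have "0 < D u" using u(2) Gpos[of s] True by (smt (verit) mult_nonneg_nonpos)
    have "h s \<le> G s / \<gamma>" unfolding h_def using \<kappa>[OF s] \<gamma> Gnn s by (intro divide_left_mono) auto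
    also have "\<dots> \<le> s * D u / \<gamma>" using u \<gamma> by (intro divide_right_mono) auto
    also have "\<dots> < D u" using True \<gamma> \<open>0 < D u\<close> by (simp add: divide_simps)
    finally have "h s < D u" .
    moreover have "u \<in> I" using u s by (auto simp: I_def)
    ultimately have "norm (\<phi> (h s, t) - \<phi> (0, t)) \<le> u\<^sup>2 \<and> norm (\<phi> (1 - h s, t) - \<phi> (1, t)) \<le> u\<^sup>2"
      using good[of u "h s" t] hI[OF s] t by (auto simp: I_def)
    moreover have "u\<^sup>2 \<le> C * s\<^sup>2"
    proof -
      have "u\<^sup>2 \<le> 1 * s\<^sup>2" using u(1) by (auto intro: power_mono)
      also have "\<dots> \<le> C * s\<^sup>2" by (intro mult_right_mono) (auto simp: C_def)
      finally show ?thesis .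
    qed
    ultimately show ?thesis by linarith
  next
    case False
    show ?thesis
    proof (cases "s = 0")
      case True then show ?thesis using h01 by simp
    next
      case F: False
      then have "\<gamma> \<le> s" using False s by auto
      have "2 * B \<le> (2 * B / \<gamma>\<^sup>2) * s\<^sup>2"
      proof -
        have "(2 * B / \<gamma>\<^sup>2) * \<gamma>\<^sup>2 \<le> (2 * B / \<gamma>\<^sup>2) * s\<^sup>2"
          using \<open>\<gamma> \<le> s\<close> \<gamma> \<open>0 \<le> B\<close> by (intro mult_left_mono power_mono) auto
        then show ?thesis using \<gamma> by simp
      qed
      also have "\<dots> \<le> C * s\<^sup>2" by (intro mult_right_mono) (auto simp: C_def)
      finally have "2 * B \<le> C * s\<^sup>2" .
      moreover have "norm (\<phi> (v, t) - \<phi> (w, t)) \<le> 2 * B" if "v \<in> I" "w \<in> I" for v w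
        using norm_triangle_ineq4[of "\<phi> (v, t)" "\<phi> (w, t)"] B[of "(v,t)"] B[of "(w,t)"] that t by (auto simp: I_def)
      ultimately show ?thesis using hI[OF s] by (smt (verit) I_def atLeastAtMost_iff)
    qed
  qed
  define h' where "h' = (\<lambda>s. (D s * \<kappa> s - G s * (D s - D (1 - s))) / (\<kappa> s * \<kappa> s))"
  show thesis
  proof (rule that[of h h' C])
    show "strict_mono_on {0..1} h" using hmono by (auto simp: strict_mono_on_def)
    show "(h has_real_derivative h' s) (at s within {0..1})" if s: "s \<in> {0..1}" for s
    proof -
      have "((\<lambda>s. G (1 - s)) has_real_derivative D (1 - s) * (- 1)) (at s within {0..1})"
      proof (rule DERIV_image_chain[of G _ "\<lambda>s. 1 - s", unfolded o_def])
        have "(\<lambda>s. 1 - s) ` {0..1} = {0..1::real}"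
          using image_diff_atLeastAtMost[of "1::real" 0 1] by simp
        then show "(G has_real_derivative D (1 - s)) (at (1 - s) within (\<lambda>s. 1 - s) ` {0..1})"
          using Gder[of "1 - s"] s by simp
      qed (auto intro!: derivative_eq_intros)
      then have "(\<kappa> has_real_derivative D s - D (1 - s)) (at s within {0..1})"
        unfolding \<kappa>_def by (auto intro!: derivative_eq_intros Gder s)
      then show ?thesis
        unfolding h_def h'_def using \<kappa>[OF s] \<gamma> by (intro DERIV_divide Gder s) auto
    qed
    show "norm (\<phi> (h s, t) - \<phi> (0, t)) \<le> C * s\<^sup>2" if "s \<in> {0..1}" "t \<in> {0..1}" for s t
      using bound[OF that] by blast
    show "norm (\<phi> (h s, t) - \<phi> (1, t)) \<le> C * (1 - s)\<^sup>2" if st: "s \<in> {0..1}" "t \<in> {0..1}" for s t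
    proof -
      have "1 - h (1 - s) = h s" using hsym[OF st(1)] by simp
      then show ?thesis using bound[of "1 - s" t] st by simp
    qed
  qed (use h01 in auto)
qed

text \<open>
  The mean of \<open>a\<close> over an interval of length \<open>m\<close>, normalized at the ends, is a difference quotient of a
  primitive of \<open>a\<close> and so differentiable in \<open>(m,t)\<close> for \<open>m > 0\<close>, while it tends to \<open>a\<close> as \<open>m\<close> tends to
  \<open>0\<close>.
\<close>

lemma smoothed_homeomorphism:
  fixes a :: "real \<Rightarrow> real"
  assumes cont: "continuous_on {0..1} a" and mono: "strict_mono_on {0..1} a" and a01: "a 0 = 0" "a 1 = 1"
  obtains Y :: "real \<times> real \<Rightarrow> real" where "continuous_on ({0..1} \<times> {0..1}) Y" "\<And>t. t \<in> {0..1} \<Longrightarrow> Y (0, t) = a t"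
    "\<And>m. m \<in> {0..1} \<Longrightarrow> Y (m, 0) = 0" "\<And>m. m \<in> {0..1} \<Longrightarrow> Y (m, 1) = 1"
    "\<And>m. m \<in> {0..1} \<Longrightarrow> strict_mono_on {0..1} (\<lambda>t. Y (m, t))"
    "\<And>m t. \<lbrakk>m \<in> {0<..<1}; t \<in> {0<..<1}\<rbrakk> \<Longrightarrow> Y differentiable (at (m, t))"
proof -
  define e where "e = (\<lambda>t. if t \<le> 0 then t else if t \<le> 1 then a t else t)"
  have amono: "a s < a t" if "0 \<le> s" "s < t" "t \<le> 1" for s t
    using mono that by (auto simp: strict_mono_on_def)
  have emono: "e s < e t" if "s < t" for s t
  proof -
    have "0 < a u" "u \<le> 1 \<Longrightarrow> a u \<le> 1" if "0 < u" "u \<le> 1" for u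
      using amono[of 0 u] amono[of u 1] that a01 by (auto simp: le_less)
    then show ?thesis using that amono[of s t] unfolding e_def by (auto split: if_splits) (smt (verit))+
  qed
  have conte: "continuous_on A e" for A
  proof -
    have "continuous_on ({..0} \<union> ({0..1} \<union> {1..})) e"
    proof (intro continuous_on_closed_Un)
      show "continuous_on {..0} e" by (rule continuous_on_eq[of _ "\<lambda>t. t"]) (auto simp: e_def)
      show "continuous_on {0..1} e" by (rule continuous_on_eq[OF cont]) (auto simp: e_def a01)
      show "continuous_on {1..} e" by (rule continuous_on_eq[of _ "\<lambda>t. t"]) (auto simp: e_def a01)
    qed auto
    moreover have "{..0} \<union> ({0..1} \<union> {1..}) = (UNIV :: real set)" by auto
    ultimately show ?thesis using continuous_on_subset by (metis subset_UNIV)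
  qed
  define F where "F = (\<lambda>x. integral {-1..x} e)"
  have Fder: "(F has_real_derivative e x) (at x)" if "-1 < x" "x < 3" for x
  proof -
    have "(F has_real_derivative e x) (at x within {-1..3})"
      unfolding F_def using that by (intro integral_has_real_derivative conte) auto
    then show ?thesis using that by (simp add: at_within_Icc_at)
  qed
  define N where "N = (\<lambda>x :: real \<times> real. integral {0..1} (\<lambda>u. e (snd x + fst x * u)))"
  have Nint: "(\<lambda>u. e (t + m * u)) integrable_on {0..1}" for m t
    by (intro integrable_continuous_real continuous_on_compose2[OF conte[of UNIV]] continuous_intros) auto
  have NF: "N (m, t) = (F (t + m) - F t) / m" if "0 < m" "m \<le> 1" "0 \<le> t" "t \<le> 1" for m t
  proof -
    have "((\<lambda>u. e (t + m * u)) has_integral (F (t + m * 1) / m - F (t + m * 0) / m)) {0..1}"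
    proof (rule fundamental_theorem_of_calculus)
      fix u :: real assume u: "u \<in> {0..1}"
      have "0 \<le> m * u" "m * u \<le> 1" using u that by (auto simp: mult_le_one)
      then have "(F has_real_derivative e (t + m * u)) (at (t + m * u))" using that by (intro Fder) auto
      then have "((\<lambda>u. F (t + m * u)) has_real_derivative e (t + m * u) * m) (at u)"
        by (rule DERIV_chain2) (auto intro!: derivative_eq_intros)
      then have "((\<lambda>u. F (t + m * u) / m) has_real_derivative e (t + m * u) * m / m) (at u)"
        by (rule DERIV_cdivide)
      then have "((\<lambda>u. F (t + m * u) / m) has_real_derivative e (t + m * u)) (at u)"
        using that by simp
      then show "((\<lambda>u. F (t + m * u) / m) has_vector_derivative e (t + m * u)) (at u within {0..1})"
        unfolding has_real_derivative_iff_has_vector_derivative using has_vector_derivative_at_within by blast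
    qed simp
    then show ?thesis unfolding N_def by (simp add: integral_unique diff_divide_distrib)
  qed
  have contN: "continuous_on UNIV N"
  proof -
    have "continuous_on (UNIV \<times> cbox 0 1) (\<lambda>(x, u). e (snd x + fst x * u))"
      unfolding split_def by (intro continuous_on_compose2[OF conte[of UNIV]] continuous_intros) auto
    from integral_continuous_on_param[OF this] show ?thesis by (simp add: N_def)
  qed
  have Nmono: "N (m, s) < N (m, t)" if "s < t" for m s t
  proof -
    have "0 < integral {0..1} (\<lambda>u. e (t + m * u) - e (s + m * u))"
    proof -
      have c: "continuous_on {0..1} (\<lambda>u. e (t + m * u) - e (s + m * u))"
        by (intro continuous_intros continuous_on_compose2[OF conte[of UNIV]]) auto
      have p: "0 < e (t + m * u) - e (s + m * u)" for u using emono[of "s + m * u" "t + m * u"] that by simp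
      have "0 \<le> integral {0..1} (\<lambda>u. e (t + m * u) - e (s + m * u))"
        by (rule integral_nonneg[OF integrable_continuous_real[OF c]]) (use p less_imp_le in blast)
      moreover have "integral {0..1} (\<lambda>u. e (t + m * u) - e (s + m * u)) \<noteq> 0"
      proof
        assume "integral {0..1} (\<lambda>u. e (t + m * u) - e (s + m * u)) = 0"
        then have "\<forall>x\<in>{0..1}. e (t + m * x) - e (s + m * x) = 0"
          using integral_eq_0_iff[OF c zero_less_one less_imp_le[OF p]] by blast
        then have "e (t + m * 0) - e (s + m * 0) = 0" by (rule bspec) simp
        then show False using p[of 0] by simp
      qed
      ultimately show ?thesis by simp
    qed
    also have "\<dots> = N (m, t) - N (m, s)"
      unfolding N_def using Nint by (simp add: integral_diff)
    finally show ?thesis by simp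
  qed
  define Y where "Y = (\<lambda>x. (N x - N (fst x, 0)) / (N (fst x, 1) - N (fst x, 0)))"
  have den: "0 < N (m, 1) - N (m, 0)" for m using Nmono[of 0 1 m] by simp
  show thesis
  proof (rule that[of Y])
    show "continuous_on ({0..1} \<times> {0..1}) Y" unfolding Y_def
      by (intro continuous_intros continuous_on_compose2[OF contN]) (use den in \<open>auto simp: less_imp_neq[THEN not_sym]\<close>)
    show "Y (0, t) = a t" if "t \<in> {0..1}" for t
    proof -
      have "N (0, u) = e u" for u by (simp add: N_def)
      moreover have "e 0 = 0" "e 1 = 1" "e t = a t" using that a01 by (auto simp: e_def)
      ultimately show ?thesis by (simp add: Y_def)
    qed
    show "Y (m, 0) = 0" "Y (m, 1) = 1" for m using den[of m] by (auto simp: Y_def)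
    show "strict_mono_on {0..1} (\<lambda>t. Y (m, t))" for m
      unfolding strict_mono_on_def Y_def using den[of m] Nmono by (auto intro!: divide_strict_right_mono)
    show "Y differentiable (at (m, t))" if m: "m \<in> {0<..<1}" and t: "t \<in> {0<..<1}" for m t
    proof -
      have Fd: "F differentiable (at x)" if "-1 < x" "x < 3" for x
        using Fder[OF that] by (auto simp: real_differentiable_def)
      have comp: "(\<lambda>x. F (q x)) differentiable (at (m, t))" if "q differentiable (at (m, t))" "-1 < q (m, t)" "q (m, t) < 3" for q :: "real \<times> real \<Rightarrow> real"
        using differentiable_compose[of F q "(m,t)" UNIV] Fd[of "q (m,t)"] that by simp
      have lin: "(\<lambda>x. snd x + fst x) differentiable (at (m, t))" "(\<lambda>x. snd x) differentiable (at (m, t))"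
        "(\<lambda>x. fst x) differentiable (at (m, t))" "(\<lambda>x. 1 + fst x) differentiable (at (m, t))" for m t :: real
        by (intro differentiable_add bounded_linear_imp_differentiable bounded_linear_fst bounded_linear_snd differentiable_const)+
      define Z where "Z = (\<lambda>x :: real \<times> real. ((F (snd x + fst x) - F (snd x)) / fst x - (F (fst x) - F 0) / fst x) /
           ((F (1 + fst x) - F 1) / fst x - (F (fst x) - F 0) / fst x))"
      have YZ: "Y x = Z x" if "x \<in> {0<..<1} \<times> {0<..<1}" for x
        using that NF[of "fst x" "snd x"] NF[of "fst x" 0] NF[of "fst x" 1] unfolding Y_def Z_def by (cases x) auto
      have "Z differentiable (at (m, t))" unfolding Z_def
      proof (intro differentiable_divide differentiable_diff comp lin differentiable_const)
        show "(F (1 + fst (m, t)) - F 1) / fst (m, t) - (F (fst (m, t)) - F 0) / fst (m, t) \<noteq> 0"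
          using NF[of m 0] NF[of m 1] den[of m] m by auto
      qed (use m t in auto)
      then obtain Z' where "(Z has_derivative Z') (at (m, t))" by (auto simp: differentiable_def)
      then have "(Y has_derivative Z') (at (m, t))"
        by (rule has_derivative_transform_within_open[of _ _ _ _ "{0<..<1} \<times> {0<..<1}"])
           (use m t YZ in \<open>auto intro!: open_Times\<close>)
      then show ?thesis by (auto simp: differentiable_def)
    qed
  qed
qed

text \<open>
  The form in which slow reparametrizations give differentiability at the boundary.
\<close>

lemma has_derivative_zero_if_quadratic:
  assumes "\<And>y. y \<in> S \<Longrightarrow> norm (g y) \<le> C * (norm (y - x))\<^sup>2" "x \<in> S"
  shows "(g has_derivative (\<lambda>_. 0)) (at x within S)"
proof -
  have gx: "g x = 0" using assms(1)[OF assms(2)] by simp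
  have "((\<lambda>y. C * norm (y - x)) \<longlongrightarrow> C * norm (x - x)) (at x within S)"
    by (intro tendsto_intros)
  then have lim: "((\<lambda>y. C * norm (y - x)) \<longlongrightarrow> 0) (at x within S)" by simp
  show ?thesis
    unfolding has_derivative_within
  proof (intro conjI)
    show "((\<lambda>y. (1 / norm (y - x)) *\<^sub>R (g y - (g x + 0))) \<longlongrightarrow> 0) (at x within S)"
    proof (rule tendsto_0_le[OF lim, where K=1])
      show "\<forall>\<^sub>F y in at x within S. norm ((1 / norm (y - x)) *\<^sub>R (g y - (g x + 0))) \<le> norm (C * norm (y - x)) * 1"
        unfolding eventually_at_topological
      proof (intro exI[of _ UNIV] conjI ballI impI open_UNIV UNIV_I)
        fix y assume y: "y \<noteq> x" "y \<in> S"
        have p: "0 < norm (y - x)" using y by simp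
        have "norm ((1 / norm (y - x)) *\<^sub>R (g y - (g x + 0))) = norm (g y) / norm (y - x)"
          by (simp add: gx divide_inverse mult.commute)
        also have "\<dots> \<le> C * (norm (y - x))\<^sup>2 / norm (y - x)"
          by (intro divide_right_mono assms(1) y) simp
        also have "\<dots> = C * norm (y - x)" using p by (simp add: power2_eq_square)
        also have "\<dots> \<le> norm (C * norm (y - x)) * 1" by simp
        finally show "norm ((1 / norm (y - x)) *\<^sub>R (g y - (g x + 0))) \<le> norm (C * norm (y - x)) * 1" .
      qed
    qed
  qed simp
qed

text \<open>
  On the open arc the imaginary part does not vanish, hence keeps its sign \<open>\<sigma>\<close>, and the angle can be
  recovered from the real part by the arccosine.
\<close>

lemma angular_coordinate_of_circle_arc:
  fixes u :: "real \<Rightarrow> complex"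
  assumes cont: "continuous_on {0..1} u" and n: "\<And>t. t \<in> {0..1} \<Longrightarrow> norm (u t) = 1"
    and u01: "u 0 = 1" "u 1 = -1" and inj: "inj_on u {0..1}"
  obtains \<sigma> :: real and \<xi> where "\<sigma> = 1 \<or> \<sigma> = -1" "continuous_on {0..1} \<xi>" "strict_mono_on {0..1} \<xi>"
    "\<xi> 0 = 0" "\<xi> 1 = (1::real)" "\<And>t. t \<in> {0..1} \<Longrightarrow> u t = Complex (cos (pi * \<xi> t)) (\<sigma> * sin (pi * \<xi> t))"
proof -
  have norm2: "(Re (u t))\<^sup>2 + (Im (u t))\<^sup>2 = 1" if "t \<in> {0..1}" for t
    using n[OF that] cmod_power2[of "u t"] by simp
  have Im0: "Im (u t) \<noteq> 0" if "t \<in> {0<..<1}" for t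
  proof
    assume "Im (u t) = 0"
    then have "(Re (u t))\<^sup>2 = 1" using norm2[of t] that by simp
    then have "Re (u t) = 1 \<or> Re (u t) = -1" by (simp add: power2_eq_1_iff)
    then have "u t = u 0 \<or> u t = u 1" using \<open>Im (u t) = 0\<close> u01 by (auto simp: complex_eq_iff)
    then show False using inj_onD[OF inj, of t 0] inj_onD[OF inj, of t 1] that by auto
  qed
  have contIm: "continuous_on {0..1} (\<lambda>t. Im (u t))" and contRe: "continuous_on {0..1} (\<lambda>t. Re (u t))"
    by (intro continuous_intros cont)+
  define \<sigma> where "\<sigma> = sgn (Im (u (1/2)))"
  have \<sigma>: "\<sigma> = 1 \<or> \<sigma> = -1" using Im0[of "1/2"] by (auto simp: \<sigma>_def sgn_real_def)
  have conn: "connected ((\<lambda>t. Im (u t)) ` {0<..<1})"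
    by (intro connected_continuous_image continuous_on_subset[OF contIm]) auto
  have sign: "0 < \<sigma> * Im (u t)" if t: "t \<in> {0<..<1}" for t
  proof (rule ccontr)
    assume "\<not> 0 < \<sigma> * Im (u t)"
    then have 1: "\<sigma> * Im (u t) \<le> 0" by simp
    have 2: "0 < \<sigma> * Im (u (1/2))" using Im0[of "1/2"] by (auto simp: \<sigma>_def sgn_real_def)
    have "0 \<in> (\<lambda>t. Im (u t)) ` {0<..<1}"
    proof (cases "Im (u t) \<le> 0")
      case True
      then have "0 \<le> Im (u (1/2))" using 1 2 \<sigma> Im0[OF t] by auto
      then show ?thesis using connectedD_interval[OF conn, of "Im (u t)" "Im (u (1/2))" 0] True t by auto
    next
      case False
      then have "Im (u (1/2)) \<le> 0" using 1 2 \<sigma> Im0[OF t] by auto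
      then show ?thesis using connectedD_interval[OF conn, of "Im (u (1/2))" "Im (u t)" 0] False t by auto
    qed
    then show False using Im0 by force
  qed
  define \<xi> where "\<xi> = (\<lambda>t. arccos (Re (u t)) / pi)"
  have Re1: "\<bar>Re (u t)\<bar> \<le> 1" if "t \<in> {0..1}" for t using abs_Re_le_cmod[of "u t"] n[OF that] by simp
  have pi\<xi>: "pi * \<xi> t = arccos (Re (u t))" for t by (simp add: \<xi>_def)
  have eq: "u t = Complex (cos (pi * \<xi> t)) (\<sigma> * sin (pi * \<xi> t))" if t: "t \<in> {0..1}" for t
  proof -
    have "cos (pi * \<xi> t) = Re (u t)" unfolding pi\<xi> using Re1[OF t] by (simp add: cos_arccos_abs)
    moreover have "sin (pi * \<xi> t) = \<sigma> * Im (u t)"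
    proof -
      have "sin (pi * \<xi> t) = sqrt (1 - (Re (u t))\<^sup>2)" unfolding pi\<xi> using Re1[OF t] by (simp add: sin_arccos_abs)
      also have "1 - (Re (u t))\<^sup>2 = (\<sigma> * Im (u t))\<^sup>2" using norm2[OF t] \<sigma> by (auto simp: power_mult_distrib)
      also have "sqrt ((\<sigma> * Im (u t))\<^sup>2) = \<sigma> * Im (u t)"
      proof -
        have "0 \<le> \<sigma> * Im (u t)"
          using sign[of t] t u01 by (cases "t = 0 \<or> t = 1") auto
        then show ?thesis by simp
      qed
      finally show ?thesis .
    qed
    ultimately show ?thesis using \<sigma> by (auto simp: complex_eq_iff)
  qed
  have con\<xi>: "continuous_on {0..1} \<xi>" unfolding \<xi>_def
    by (intro continuous_intros contRe) (use Re1 in \<open>auto simp: abs_le_iff\<close>)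
  have \<xi>01: "\<xi> 0 = 0" "\<xi> 1 = 1" by (auto simp: \<xi>_def u01)
  have "inj_on \<xi> {0..1}"
  proof (rule inj_onI)
    fix s t assume st: "s \<in> {0..1::real}" "t \<in> {0..1}" "\<xi> s = \<xi> t"
    then have "u s = u t" using eq by simp
    then show "s = t" using inj_onD[OF inj] st by blast
  qed
  moreover have "\<not> strict_antimono_on {0..1} \<xi>"
  proof
    assume "strict_antimono_on {0..1} \<xi>"
    then have "\<xi> 1 < \<xi> 0" by (rule monotone_onD) auto
    then show False using \<xi>01 by simp
  qed
  ultimately have "strict_mono_on {0..1} \<xi>"
    using injective_eq_monotone_map[OF _ con\<xi>] is_interval_cc by blast
  then show thesis using that[OF \<sigma> con\<xi> _ \<xi>01 eq] by blast
qed

text \<open>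
  Normalize the conformal map of the region so that the common ends of the arcs correspond to \<open>1\<close> and
  \<open>-1\<close>. The arcs then correspond to the two half circles, in angular coordinates given by increasing
  functions \<open>a\<close> and \<open>b\<close>. Vertical scaling of the disk sweeps one half circle to the other while the
  angular coordinate passes from \<open>a\<close> to \<open>b\<close> through smooth functions. Slow reparametrizations in both
  variables make the map differentiable up to the boundary, except that along the arcs it inherits the
  differentiability of \<open>\<alpha> \<circ> k\<close> and \<open>\<beta> \<circ> k\<close>; this is why the last property is stated relative to \<open>A\<close>.
\<close>

theorem strip_between_arcs:
  fixes \<alpha> \<beta> :: "real \<Rightarrow> complex"
  assumes arcs: "arc \<alpha>" "arc \<beta>" and ends: "pathstart \<beta> = pathstart \<alpha>" "pathfinish \<beta> = pathfinish \<alpha>"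
    and disj: "path_image \<alpha> \<inter> path_image \<beta> \<subseteq> {pathstart \<alpha>, pathfinish \<alpha>}"
  obtains k k' :: "real \<Rightarrow> real" and T :: "real \<times> real \<Rightarrow> complex" where "k 0 = 0" "k 1 = (1::real)" "strict_mono_on {0..1} k"
    "\<And>t. t \<in> {0..1} \<Longrightarrow> (k has_real_derivative k' t) (at t within {0..1})"
    "continuous_on ({0..1} \<times> {0..1}) T"
    "\<And>t. t \<in> {0..1} \<Longrightarrow> T (0, t) = \<alpha> (k t)" "\<And>t. t \<in> {0..1} \<Longrightarrow> T (1, t) = \<beta> (k t)"
    "\<And>s. s \<in> {0..1} \<Longrightarrow> T (s, 0) = pathstart \<alpha>" "\<And>s. s \<in> {0..1} \<Longrightarrow> T (s, 1) = pathfinish \<alpha>"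
    "\<And>A. \<lbrakk>A \<subseteq> {0..1}; (\<lambda>t. \<alpha> (k t)) differentiable_on A; (\<lambda>t. \<beta> (k t)) differentiable_on A\<rbrakk> \<Longrightarrow> T differentiable_on {0..1} \<times> A"
    "inj_on T ({0<..<1} \<times> {0<..<1})" "T ` ({0<..<1} \<times> {0<..<1}) \<subseteq> inside (path_image \<alpha> \<union> path_image \<beta>)"
proof -
  define P0 P1 where "P0 = pathstart \<alpha>" and "P1 = pathfinish \<alpha>"
  define j where "j = \<alpha> +++ reversepath \<beta>"
  define J where "J = path_image \<alpha> \<union> path_image \<beta>"
  have j: "simple_path j" "pathfinish j = pathstart j" "path_image j = J"
    unfolding j_def J_def using arcs ends disj
    by (auto intro!: simple_path_join_loop simp: arc_reversepath path_image_join)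
  have P: "P0 \<in> path_image j" "P1 \<in> path_image j" "P0 \<noteq> P1"
    using arc_distinct_ends[OF arcs(1)] by (auto simp: P0_def P1_def j(3) J_def)
  obtain R G where R: "homeomorphism (cball 0 1) (inside J \<union> J) R G"
    "R holomorphic_on ball 0 1" "R ` ball 0 1 = inside J" "R 1 = P0" "R (-1) = P1"
    using Caratheodory_Jordan_domain_two_points[OF j(1,2) P] unfolding j(3) by metis
  have contR: "continuous_on (cball 0 1) R" and contG: "continuous_on (inside J \<union> J) G"
    using R(1) by (auto simp: homeomorphism_def)
  have GR: "\<And>z. z \<in> cball 0 1 \<Longrightarrow> G (R z) = z" and RG: "\<And>w. w \<in> J \<Longrightarrow> R (G w) = w"
    using homeomorphism_apply1[OF R(1)] homeomorphism_apply2[OF R(1)] by blast+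
  have GJ: "norm (G w) = 1" if "w \<in> J" for w
  proof -
    have "G w \<in> cball 0 1" using homeomorphism_image2[OF R(1)] that by blast
    moreover have "G w \<notin> ball 0 1"
    proof
      assume "G w \<in> ball 0 1"
      then have "R (G w) \<in> inside J" using R(3) by blast
      then show False using RG[OF that] that inside_no_overlap[of J] by (metis IntI empty_iff)
    qed
    ultimately show ?thesis by simp
  qed
  have coord: "\<exists>\<sigma> \<xi>. (\<sigma> = 1 \<or> \<sigma> = -1) \<and> continuous_on {0..1} \<xi> \<and> strict_mono_on {0..1} \<xi> \<and> \<xi> 0 = 0 \<and> \<xi> 1 = (1::real) \<and>
      (\<forall>t\<in>{0..1}. G (\<gamma> t) = Complex (cos (pi * \<xi> t)) (\<sigma> * sin (pi * \<xi> t)))"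
    if \<gamma>: "arc \<gamma>" "path_image \<gamma> \<subseteq> J" "pathstart \<gamma> = P0" "pathfinish \<gamma> = P1" for \<gamma>
  proof -
    have in_J: "\<gamma> t \<in> J" if "t \<in> {0..1}" for t using \<gamma>(2) that by (auto simp: path_image_def)
    have "continuous_on {0..1} \<gamma>" using \<gamma>(1) by (auto simp: arc_def path_def)
    then have c: "continuous_on {0..1} (\<lambda>t. G (\<gamma> t))"
      by (rule continuous_on_compose2[OF contG]) (use in_J in auto)
    have "inj_on (\<lambda>t. G (\<gamma> t)) {0..1}"
    proof (rule inj_onI)
      fix s t assume st: "s \<in> {0..1::real}" "t \<in> {0..1}" "G (\<gamma> s) = G (\<gamma> t)"
      then have "\<gamma> s = \<gamma> t" using RG[OF in_J[OF st(1)]] RG[OF in_J[OF st(2)]] by metis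
      then show "s = t" using \<gamma>(1) st unfolding arc_def by (meson inj_onD)
    qed
    moreover have "G (\<gamma> 0) = 1" "G (\<gamma> 1) = -1"
      using \<gamma>(3,4) GR[of 1] GR[of "-1"] R(4,5) by (simp_all add: pathstart_def pathfinish_def)
    moreover have "norm (G (\<gamma> t)) = 1" if "t \<in> {0..1}" for t by (rule GJ[OF in_J[OF that]])
    ultimately show ?thesis
      by (rule_tac angular_coordinate_of_circle_arc[OF c]) (assumption | blast)+
  qed
  have inJ: "path_image \<alpha> \<subseteq> J" "path_image \<beta> \<subseteq> J" by (auto simp: J_def)
  obtain \<sigma> a where a: "\<sigma> = 1 \<or> \<sigma> = -1" "continuous_on {0..1} a" "strict_mono_on {0..1} a" "a 0 = 0" "a 1 = (1::real)"
      "\<And>t. t \<in> {0..1} \<Longrightarrow> G (\<alpha> t) = Complex (cos (pi * a t)) (\<sigma> * sin (pi * a t))"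
    using coord[OF arcs(1) inJ(1) P0_def[symmetric] P1_def[symmetric]] by blast
  obtain \<tau> b where b: "\<tau> = 1 \<or> \<tau> = -1" "continuous_on {0..1} b" "strict_mono_on {0..1} b" "b 0 = 0" "b 1 = (1::real)"
      "\<And>t. t \<in> {0..1} \<Longrightarrow> G (\<beta> t) = Complex (cos (pi * b t)) (\<tau> * sin (pi * b t))"
    using coord[OF arcs(2) inJ(2) ends[folded P0_def P1_def]] by blast
  have arcle: "0 \<le> x t \<and> x t \<le> 1" if "strict_mono_on {0..1} x" "x 0 = 0" "x 1 = (1::real)" "t \<in> {0..1::real}" for x t
    using that strict_mono_onD[OF that(1), of 0 t] strict_mono_onD[OF that(1), of t 1] by (cases "t = 0"; cases "t = 1") auto
  have sin0: "0 \<le> sin (pi * x)" if "0 \<le> x" "x \<le> 1" for x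
    using that by (intro sin_ge_zero) (auto simp: mult_left_le)
  \<comment> \<open>The two arcs are mapped to opposite semicircles, since together they cover the circle.\<close>
  have \<tau>: "\<tau> = - \<sigma>"
  proof -
    define z where "z = Complex 0 (- \<sigma>)"
    have nz: "norm z = 1" using a(1) by (auto simp: z_def cmod_def)
    then have "R z \<in> inside J \<union> J" using homeomorphism_image1[OF R(1)] by auto
    moreover have "R z \<notin> inside J"
    proof
      assume "R z \<in> inside J"
      then obtain z' where "z' \<in> ball 0 1" "R z' = R z" using R(3) by (metis imageE)
      then show False using GR[of z] GR[of z'] nz by auto
    qed
    ultimately consider t where "t \<in> {0..1}" "R z = \<alpha> t" | t where "t \<in> {0..1}" "R z = \<beta> t"
      unfolding J_def path_image_def by blast
    then show ?thesis
    proof cases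
      case 1
      then have "z = Complex (cos (pi * a t)) (\<sigma> * sin (pi * a t))" using GR[of z] nz a(6)[of t] by simp
      then have "- \<sigma> = \<sigma> * sin (pi * a t)" by (simp add: z_def)
      then have "sin (pi * a t) = -1" using a(1) by auto
      then show ?thesis using sin0[of "a t"] arcle[OF a(3,4,5) 1(1)] by simp
    next
      case 2
      then have "z = Complex (cos (pi * b t)) (\<tau> * sin (pi * b t))" using GR[of z] nz b(6)[of t] by simp
      then have *: "- \<sigma> = \<tau> * sin (pi * b t)" by (simp add: z_def)
      have "0 \<le> sin (pi * b t)" using sin0[of "b t"] arcle[OF b(3,4,5) 2(1)] by simp
      then show ?thesis using * a(1) b(1) by auto
    qed
  qed
  obtain Ya :: "real \<times> real \<Rightarrow> real" where Ya: "continuous_on ({0..1} \<times> {0..1}) Ya" "\<And>t. t \<in> {0..1} \<Longrightarrow> Ya (0, t) = a t"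
    "\<And>m. m \<in> {0..1} \<Longrightarrow> Ya (m, 0) = 0" "\<And>m. m \<in> {0..1} \<Longrightarrow> Ya (m, 1) = 1"
    "\<And>m. m \<in> {0..1} \<Longrightarrow> strict_mono_on {0..1} (\<lambda>t. Ya (m, t))"
    "\<And>m t. \<lbrakk>m \<in> {0<..<1}; t \<in> {0<..<1}\<rbrakk> \<Longrightarrow> Ya differentiable (at (m, t))"
    by (rule smoothed_homeomorphism[OF a(2-5)]) blast
  obtain Yb :: "real \<times> real \<Rightarrow> real" where Yb: "continuous_on ({0..1} \<times> {0..1}) Yb" "\<And>t. t \<in> {0..1} \<Longrightarrow> Yb (0, t) = b t"
    "\<And>m. m \<in> {0..1} \<Longrightarrow> Yb (m, 0) = 0" "\<And>m. m \<in> {0..1} \<Longrightarrow> Yb (m, 1) = 1"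
    "\<And>m. m \<in> {0..1} \<Longrightarrow> strict_mono_on {0..1} (\<lambda>t. Yb (m, t))"
    "\<And>m t. \<lbrakk>m \<in> {0<..<1}; t \<in> {0<..<1}\<rbrakk> \<Longrightarrow> Yb differentiable (at (m, t))"
    by (rule smoothed_homeomorphism[OF b(2-5)]) blast
  define \<mu> where "\<mu> = (\<lambda>v::real. v * (1 - v))"
  have \<mu>: "\<mu> v \<in> {0..1}" if "v \<in> {0..1}" for v using that by (auto simp: \<mu>_def mult_le_one)
  have \<mu>': "\<mu> v \<in> {0<..<1}" if "v \<in> {0<..<1}" for v
  proof -
    have "v * (1 - v) < 1 * 1" using that by (intro mult_strict_mono) auto
    then show ?thesis using that by (auto simp: \<mu>_def)
  qed
  \<comment> \<open>The width of the smoothing vanishes exactly at both ends of the sweep.\<close>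
  define X where "X = (\<lambda>x. (1 - fst x) * Ya (\<mu> (fst x), snd x) + fst x * Yb (\<mu> (fst x), snd x))"
  define p where "p = (\<lambda>x. Complex (cos (pi * X x)) (\<sigma> * (1 - 2 * fst x) * sin (pi * X x)))"
  define T0 where "T0 = (\<lambda>x. R (p x))"
  have X0: "X (v, 0) = 0" "X (v, 1) = 1" if "v \<in> {0..1}" for v
    using Ya(3,4)[OF \<mu>[OF that]] Yb(3,4)[OF \<mu>[OF that]] by (auto simp: X_def)
  have Xmono: "strict_mono_on {0..1} (\<lambda>t. X (v, t))" if v: "v \<in> {0..1}" for v
    unfolding strict_mono_on_def
  proof (intro allI impI)
    fix s t :: real assume st: "s \<in> {0..1} \<and> t \<in> {0..1} \<and> s < t"
    have 1: "Ya (\<mu> v, s) < Ya (\<mu> v, t)" "Yb (\<mu> v, s) < Yb (\<mu> v, t)"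
      using strict_mono_onD[OF Ya(5)[OF \<mu>[OF v]]] strict_mono_onD[OF Yb(5)[OF \<mu>[OF v]]] st by auto
    show "X (v, s) < X (v, t)"
    proof (cases "v = 1")
      case True then show ?thesis using 1 by (simp add: X_def)
    next
      case False
      then have "(1 - v) * Ya (\<mu> v, s) < (1 - v) * Ya (\<mu> v, t)" using 1 v by simp
      moreover have "v * Yb (\<mu> v, s) \<le> v * Yb (\<mu> v, t)" using 1 v by (intro mult_left_mono) auto
      ultimately show ?thesis by (simp add: X_def)
    qed
  qed
  have X01: "X (v, t) \<in> {0..1}" if "v \<in> {0..1}" "t \<in> {0..1}" for v t
    using arcle[OF Xmono[OF that(1)] X0[OF that(1)] that(2)] by simp
  have X01': "X (v, t) \<in> {0<..<1}" if "v \<in> {0..1}" "t \<in> {0<..<1}" for v t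
    using strict_mono_onD[OF Xmono[OF that(1)], of 0 t] strict_mono_onD[OF Xmono[OF that(1)], of t 1] X0[OF that(1)] that by simp
  have contX: "continuous_on ({0..1} \<times> {0..1}) X" unfolding X_def
    by (intro continuous_intros continuous_on_compose2[OF Ya(1)] continuous_on_compose2[OF Yb(1)])
       (use \<mu> in \<open>auto simp: \<mu>_def intro!: continuous_intros\<close>)
  have pcb: "p (v, t) \<in> cball 0 1" if "v \<in> {0..1}" for v t
  proof -
    have "(\<sigma> * (1 - 2 * v))\<^sup>2 \<le> 1" using a(1) that by (auto simp: power_le_one_iff abs_square_le_1)
    then have "(\<sigma> * (1 - 2 * v))\<^sup>2 * (sin (pi * X (v,t)))\<^sup>2 \<le> 1 * (sin (pi * X (v,t)))\<^sup>2" by (intro mult_right_mono) auto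
    then have "(norm (p (v, t)))\<^sup>2 \<le> 1" unfolding cmod_power2 p_def by (simp add: power_mult_distrib cos_squared_eq)
    then show ?thesis by (simp add: abs_square_le_1)
  qed
  have pb: "p (v, t) \<in> ball 0 1" if "v \<in> {0<..<1}" "t \<in> {0<..<1}" for v t
  proof -
    have "(\<sigma> * (1 - 2 * v))\<^sup>2 < 1" using a(1) that by (auto simp: abs_square_less_1)
    moreover have "0 < sin (pi * X (v, t))" using X01'[of v t] that by (intro sin_gt_zero) auto
    ultimately have "(\<sigma> * (1 - 2 * v))\<^sup>2 * (sin (pi * X (v,t)))\<^sup>2 < 1 * (sin (pi * X (v,t)))\<^sup>2"
      by (intro mult_strict_right_mono) auto
    then have "(norm (p (v, t)))\<^sup>2 < 1" unfolding cmod_power2 p_def by (simp add: power_mult_distrib cos_squared_eq)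
    then show ?thesis by (simp add: abs_square_less_1)
  qed
  have p_eq: "p x = of_real (cos (pi * X x)) + \<i> * of_real (\<sigma> * (1 - 2 * fst x) * sin (pi * X x))" for x
    by (simp add: p_def complex_eq_iff)
  have contp: "continuous_on ({0..1} \<times> {0..1}) p"
    unfolding p_eq by (intro continuous_intros contX)
  have contT0: "continuous_on ({0..1} \<times> {0..1}) T0" unfolding T0_def
    by (rule continuous_on_compose2[OF contR contp]) (use pcb in auto)
  have T00: "T0 (0, t) = \<alpha> t" "T0 (1, t) = \<beta> t" if t: "t \<in> {0..1}" for t
  proof -
    have J: "\<alpha> t \<in> J" "\<beta> t \<in> J" using t by (auto simp: J_def path_image_def)
    have "p (0, t) = G (\<alpha> t)" using Ya(2)[OF t] a(6)[OF t] by (simp add: p_def X_def \<mu>_def)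
    then show "T0 (0, t) = \<alpha> t" using RG[OF J(1)] by (simp add: T0_def)
    have "p (1, t) = G (\<beta> t)" using Yb(2)[OF t] b(6)[OF t] by (simp add: p_def X_def \<mu>_def \<tau>)
    then show "T0 (1, t) = \<beta> t" using RG[OF J(2)] by (simp add: T0_def)
  qed
  have T0e: "T0 (v, 0) = P0" "T0 (v, 1) = P1" if v: "v \<in> {0..1}" for v
  proof -
    have "p (v, 0) = 1" "p (v, 1) = -1" using X0[OF v] by (auto simp: p_def complex_eq_iff)
    then show "T0 (v, 0) = P0" "T0 (v, 1) = P1" using R(4,5) by (auto simp: T0_def)
  qed
  have injT0: "inj_on T0 ({0<..<1} \<times> {0<..<1})"
  proof (rule inj_onI, clarify)
    fix v t v' t' :: real assume v: "v \<in> {0<..<1}" "v' \<in> {0<..<1}" and t: "t \<in> {0<..<1}" "t' \<in> {0<..<1}"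
      and eq: "T0 (v, t) = T0 (v', t')"
    have "p (v, t) \<in> cball 0 1" "p (v', t') \<in> cball 0 1" using pcb v by auto
    then have "p (v, t) = p (v', t')" using GR eq unfolding T0_def by metis
    then have c: "cos (pi * X (v, t)) = cos (pi * X (v', t'))"
      and s: "\<sigma> * (1 - 2 * v) * sin (pi * X (v, t)) = \<sigma> * (1 - 2 * v') * sin (pi * X (v', t'))"
      by (auto simp: p_def)
    have x: "X (v, t) \<in> {0<..<1}" "X (v', t') \<in> {0<..<1}" using X01'[of v t] X01'[of v' t'] v t by auto
    have "pi * X (v, t) = pi * X (v', t')"
      by (rule cos_inj_pi[OF _ _ _ _ c]) (use x in \<open>auto simp: mult_left_le\<close>)
    then have XX: "X (v, t) = X (v', t')" by simp
    have "0 < sin (pi * X (v, t))" using x by (intro sin_gt_zero) auto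
    then have "v = v'" using s XX a(1) by auto
    then have "X (v, t) = X (v, t')" using XX by simp
    then have "t = t'"
      using strict_mono_onD[OF Xmono[of v], of t t'] strict_mono_onD[OF Xmono[of v], of t' t] v t
      by (cases t t' rule: linorder_cases) auto
    with \<open>v = v'\<close> show "v = v' \<and> t = t'" by simp
  qed
  have difX: "X differentiable (at (v, t))" if "v \<in> {0<..<1}" "t \<in> {0<..<1}" for v t
  proof -
    have q: "(\<lambda>x. (\<mu> (fst x), snd x)) differentiable (at (v, t))" for v t :: real
      unfolding \<mu>_def differentiable_def by (rule exI) (auto intro!: derivative_eq_intros)
    have "(\<lambda>x. Ya (\<mu> (fst x), snd x)) differentiable (at (v, t))" "(\<lambda>x. Yb (\<mu> (fst x), snd x)) differentiable (at (v, t))"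
      using differentiable_compose[of Ya "\<lambda>x. (\<mu> (fst x), snd x)" "(v, t)" UNIV]
        differentiable_compose[of Yb "\<lambda>x. (\<mu> (fst x), snd x)" "(v, t)" UNIV]
        Ya(6)[OF \<mu>'[OF that(1)] that(2)] Yb(6)[OF \<mu>'[OF that(1)] that(2)] q by simp_all
    moreover have "(\<lambda>x. fst x) differentiable (at (v, t))"
      by (intro bounded_linear_imp_differentiable bounded_linear_fst)
    ultimately show ?thesis unfolding X_def
      by (intro differentiable_add differentiable_mult differentiable_diff differentiable_const)
  qed
  have difT0: "T0 differentiable (at (v, t))" if vt: "v \<in> {0<..<1}" "t \<in> {0<..<1}" for v t
  proof -
    obtain X' where X': "(X has_derivative X') (at (v, t))" using difX[OF vt] by (auto simp: differentiable_def)
    have "p differentiable (at (v, t))"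
      unfolding p_eq differentiable_def by (rule exI) (auto intro!: derivative_eq_intros X')
    moreover have "R differentiable (at (p (v, t)))"
    proof -
      have "R field_differentiable (at (p (v, t)))"
        using R(2) pb[OF vt] by (simp add: holomorphic_on_imp_differentiable_at)
      then show ?thesis
        by (auto simp: field_differentiable_def differentiable_def has_field_derivative_def)
    qed
    ultimately show ?thesis unfolding T0_def
      using differentiable_compose[of R p "(v, t)" UNIV] by simp
  qed
  obtain h :: "real \<Rightarrow> real" and h' C where h: "h 0 = 0" "h 1 = (1::real)" "strict_mono_on {0..1} h"
    "\<And>s. s \<in> {0..1} \<Longrightarrow> (h has_real_derivative h' s) (at s within {0..1})"
    "\<And>s t. \<lbrakk>s \<in> {0..1}; t \<in> {0..1}\<rbrakk> \<Longrightarrow> norm (T0 (h s, t) - T0 (0, t)) \<le> C * s\<^sup>2"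
    "\<And>s t. \<lbrakk>s \<in> {0..1}; t \<in> {0..1}\<rbrakk> \<Longrightarrow> norm (T0 (h s, t) - T0 (1, t)) \<le> C * (1 - s)\<^sup>2"
    by (rule slow_reparametrization[OF contT0]) blast
  have "continuous_on ({0..1} \<times> {0..1}) (\<lambda>x. T0 (snd x, fst x))"
    by (rule continuous_on_compose2[OF contT0]) (auto intro!: continuous_intros)
  then obtain k :: "real \<Rightarrow> real" and k' D where k: "k 0 = 0" "k 1 = (1::real)" "strict_mono_on {0..1} k"
    "\<And>s. s \<in> {0..1} \<Longrightarrow> (k has_real_derivative k' s) (at s within {0..1})"
    "\<And>s t. \<lbrakk>s \<in> {0..1}; t \<in> {0..1}\<rbrakk> \<Longrightarrow> norm (T0 (t, k s) - T0 (t, 0)) \<le> D * s\<^sup>2"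
    "\<And>s t. \<lbrakk>s \<in> {0..1}; t \<in> {0..1}\<rbrakk> \<Longrightarrow> norm (T0 (t, k s) - T0 (t, 1)) \<le> D * (1 - s)\<^sup>2"
    by (rule slow_reparametrization[of "\<lambda>x. T0 (snd x, fst x)", unfolded fst_conv snd_conv]) blast
  define T where "T = (\<lambda>x. T0 (h (fst x), k (snd x)))"
  have h01: "h s \<in> {0..1}" and k01: "k s \<in> {0..1}" if "s \<in> {0..1}" for s
    using arcle[OF h(3,1,2) that] arcle[OF k(3,1,2) that] by auto
  have h01': "h s \<in> {0<..<1}" and k01': "k s \<in> {0<..<1}" if "s \<in> {0<..<1}" for s
    using strict_mono_onD[OF h(3), of 0 s] strict_mono_onD[OF h(3), of s 1] h(1,2)
      strict_mono_onD[OF k(3), of 0 s] strict_mono_onD[OF k(3), of s 1] k(1,2) that by auto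
  have inj: "inj_on h {0..1}" "inj_on k {0..1}" using h(3) k(3) strict_mono_on_imp_inj_on by blast+
  have conth: "continuous_on {0..1} h" by (rule DERIV_continuous_on[OF h(4)])
  have contk: "continuous_on {0..1} k" by (rule DERIV_continuous_on[OF k(4)])
  show thesis
  proof (rule that[of k k' T])
    show "continuous_on ({0..1} \<times> {0..1}) T" unfolding T_def
      by (rule continuous_on_compose2[OF contT0])
         (use h01 k01 in \<open>auto intro!: continuous_on_Pair continuous_on_compose2[OF conth] continuous_on_compose2[OF contk] continuous_intros\<close>)
    show "T (0, t) = \<alpha> (k t)" "T (1, t) = \<beta> (k t)" if "t \<in> {0..1}" for t
      using T00[OF k01[OF that]] h(1,2) by (auto simp: T_def)
    show "T (s, 0) = pathstart \<alpha>" "T (s, 1) = pathfinish \<alpha>" if "s \<in> {0..1}" for s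
      using T0e[OF h01[OF that]] k(1,2) by (auto simp: T_def P0_def P1_def)
    show "T ` ({0<..<1} \<times> {0<..<1}) \<subseteq> inside (path_image \<alpha> \<union> path_image \<beta>)"
    proof clarify
      fix s t :: real assume "s \<in> {0<..<1}" "t \<in> {0<..<1}"
      then have "p (h s, k t) \<in> ball 0 1" using pb h01' k01' by blast
      then show "T (s, t) \<in> inside (path_image \<alpha> \<union> path_image \<beta>)"
        using R(3) by (auto simp: T_def T0_def J_def)
    qed
    show "inj_on T ({0<..<1} \<times> {0<..<1})"
    proof (rule inj_onI, clarify)
      fix s t s' t' :: real assume st: "s \<in> {0<..<1}" "s' \<in> {0<..<1}" "t \<in> {0<..<1}" "t' \<in> {0<..<1}"
        and eq: "T (s, t) = T (s', t')"
      have "(h s, k t) = (h s', k t')"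
        by (rule inj_onD[OF injT0]) (use eq st h01' k01' in \<open>simp_all add: T_def\<close>)
      then have "h s = h s'" "k t = k t'" by auto
      then show "s = s' \<and> t = t'" using inj_onD[OF inj(1), of s s'] inj_onD[OF inj(2), of t t'] st by auto
    qed
    show "T differentiable_on {0..1} \<times> A"
      if A: "A \<subseteq> {0..1}" "(\<lambda>t. \<alpha> (k t)) differentiable_on A" "(\<lambda>t. \<beta> (k t)) differentiable_on A" for A
      unfolding differentiable_on_def
    proof
      fix x :: "real \<times> real" assume x: "x \<in> {0..1} \<times> A"
      obtain s t where st: "x = (s, t)" "s \<in> {0..1}" "t \<in> A" "t \<in> {0..1}" using x A(1) by auto
      have comp: "\<And>s t. (s, t) \<in> {0..1} \<times> A \<Longrightarrow> s \<in> {0..1} \<and> t \<in> {0..1}" using A(1) by auto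
      have d0: "norm (fst y - s) \<le> norm (y - x)" "norm (snd y - t) \<le> norm (y - x)" for y
      proof -
        have "y - x = (fst y - s, snd y - t)" by (simp add: st(1) prod_eq_iff)
        then show "norm (fst y - s) \<le> norm (y - x)" "norm (snd y - t) \<le> norm (y - x)"
          using norm_fst_le[of "fst y - s" "snd y - t"] norm_snd_le[of "snd y - t" "fst y - s"] by simp_all
      qed
      consider "t = 0" | "t = 1" | "s = 0" | "s = 1" | "s \<in> {0<..<1}" "t \<in> {0<..<1}" using st by force
      then show "T differentiable (at x within {0..1} \<times> A)"
      proof cases
        case 1
        have "((\<lambda>y. T y - P0) has_derivative (\<lambda>_. 0)) (at x within {0..1} \<times> A)"
        proof (rule has_derivative_zero_if_quadratic[OF _ x])
          fix y :: "real \<times> real" assume y: "y \<in> {0..1} \<times> A"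
          have y': "fst y \<in> {0..1}" "snd y \<in> {0..1}" using y A(1) by auto
          have "norm (T y - P0) \<le> D * (snd y)\<^sup>2"
            using k(5)[OF y'(2) h01[OF y'(1)]] T0e(1)[OF h01[OF y'(1)]] by (simp add: T_def)
          also have "\<dots> \<le> \<bar>D\<bar> * (norm (y - x))\<^sup>2"
            using d0(2)[of y] 1 by (intro mult_mono power2_le_iff_abs_le[THEN iffD2]) (auto simp: abs_le_square_iff[symmetric])
          finally show "norm (T y - P0) \<le> \<bar>D\<bar> * (norm (y - x))\<^sup>2" .
        qed
        from has_derivative_add_const[OF this, of P0] show ?thesis by (auto simp: differentiable_def)
      next
        case 2
        have "((\<lambda>y. T y - P1) has_derivative (\<lambda>_. 0)) (at x within {0..1} \<times> A)"
        proof (rule has_derivative_zero_if_quadratic[OF _ x])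
          fix y :: "real \<times> real" assume y: "y \<in> {0..1} \<times> A"
          have y': "fst y \<in> {0..1}" "snd y \<in> {0..1}" using y A(1) by auto
          have "norm (T y - P1) \<le> D * (1 - snd y)\<^sup>2"
            using k(6)[OF y'(2) h01[OF y'(1)]] T0e(2)[OF h01[OF y'(1)]] by (simp add: T_def)
          also have "\<dots> \<le> \<bar>D\<bar> * (norm (y - x))\<^sup>2"
            using d0(2)[of y] 2 by (intro mult_mono power2_le_iff_abs_le[THEN iffD2]) (auto simp: abs_le_square_iff[symmetric])
          finally show "norm (T y - P1) \<le> \<bar>D\<bar> * (norm (y - x))\<^sup>2" .
        qed
        from has_derivative_add_const[OF this, of P1] show ?thesis by (auto simp: differentiable_def)
      next
        case 3
        have "((\<lambda>y. T y - \<alpha> (k (snd y))) has_derivative (\<lambda>_. 0)) (at x within {0..1} \<times> A)"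
        proof (rule has_derivative_zero_if_quadratic[OF _ x])
          fix y :: "real \<times> real" assume y: "y \<in> {0..1} \<times> A"
          have y': "fst y \<in> {0..1}" "snd y \<in> {0..1}" using y A(1) by auto
          have "norm (T y - \<alpha> (k (snd y))) \<le> C * (fst y)\<^sup>2"
            using h(5)[OF y'(1) k01[OF y'(2)]] T00(1)[OF k01[OF y'(2)]] by (simp add: T_def)
          also have "\<dots> \<le> \<bar>C\<bar> * (norm (y - x))\<^sup>2"
            using d0(1)[of y] 3 by (intro mult_mono power2_le_iff_abs_le[THEN iffD2]) (auto simp: abs_le_square_iff[symmetric])
          finally show "norm (T y - \<alpha> (k (snd y))) \<le> \<bar>C\<bar> * (norm (y - x))\<^sup>2" .
        qed
        then have "(\<lambda>y. T y - \<alpha> (k (snd y))) differentiable (at x within {0..1} \<times> A)" by (auto simp: differentiable_def)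
        moreover have "(\<lambda>y. \<alpha> (k (snd y))) differentiable (at x within {0..1} \<times> A)"
        proof -
          have im: "snd ` ({0..1::real} \<times> A) = A" by (simp add: snd_image_times)
          have "(\<lambda>t. \<alpha> (k t)) differentiable (at (snd x) within snd ` ({0..1::real} \<times> A))"
            using A(2) st unfolding im by (simp add: differentiable_on_def)
          moreover have "snd differentiable (at x within {0..1} \<times> A)"
            by (intro bounded_linear_imp_differentiable bounded_linear_snd)
          ultimately show ?thesis using differentiable_chain_within[of snd x "{0..1} \<times> A" "\<lambda>t. \<alpha> (k t)"] by (simp add: o_def)
        qed
        ultimately have "(\<lambda>y. (T y - \<alpha> (k (snd y))) + \<alpha> (k (snd y))) differentiable (at x within {0..1} \<times> A)"
          by (rule differentiable_add)
        then show ?thesis by simp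
      next
        case 4
        have "((\<lambda>y. T y - \<beta> (k (snd y))) has_derivative (\<lambda>_. 0)) (at x within {0..1} \<times> A)"
        proof (rule has_derivative_zero_if_quadratic[OF _ x])
          fix y :: "real \<times> real" assume y: "y \<in> {0..1} \<times> A"
          have y': "fst y \<in> {0..1}" "snd y \<in> {0..1}" using y A(1) by auto
          have "norm (T y - \<beta> (k (snd y))) \<le> C * (1 - fst y)\<^sup>2"
            using h(6)[OF y'(1) k01[OF y'(2)]] T00(2)[OF k01[OF y'(2)]] by (simp add: T_def)
          also have "\<dots> \<le> \<bar>C\<bar> * (norm (y - x))\<^sup>2"
            using d0(1)[of y] 4 by (intro mult_mono power2_le_iff_abs_le[THEN iffD2]) (auto simp: abs_le_square_iff[symmetric])
          finally show "norm (T y - \<beta> (k (snd y))) \<le> \<bar>C\<bar> * (norm (y - x))\<^sup>2" .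
        qed
        then have "(\<lambda>y. T y - \<beta> (k (snd y))) differentiable (at x within {0..1} \<times> A)" by (auto simp: differentiable_def)
        moreover have "(\<lambda>y. \<beta> (k (snd y))) differentiable (at x within {0..1} \<times> A)"
        proof -
          have im: "snd ` ({0..1::real} \<times> A) = A" by (simp add: snd_image_times)
          have "(\<lambda>t. \<beta> (k t)) differentiable (at (snd x) within snd ` ({0..1::real} \<times> A))"
            using A(3) st unfolding im by (simp add: differentiable_on_def)
          moreover have "snd differentiable (at x within {0..1} \<times> A)"
            by (intro bounded_linear_imp_differentiable bounded_linear_snd)
          ultimately show ?thesis using differentiable_chain_within[of snd x "{0..1} \<times> A" "\<lambda>t. \<beta> (k t)"] by (simp add: o_def)
        qed
        ultimately have "(\<lambda>y. (T y - \<beta> (k (snd y))) + \<beta> (k (snd y))) differentiable (at x within {0..1} \<times> A)"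
          by (rule differentiable_add)
        then show ?thesis by simp
      next
        case 5
        have "(h has_real_derivative h' s) (at s)" "(k has_real_derivative k' t) (at t)"
          using h(4)[of s] k(4)[of t] 5 by (simp_all add: at_within_Icc_at)
        then have hk: "h differentiable (at s)" "k differentiable (at t)"
          by (auto simp: real_differentiable_def)
        have "(\<lambda>y. h (fst y)) differentiable (at (s, t))" "(\<lambda>y. k (snd y)) differentiable (at (s, t))"
          using differentiable_compose[of h fst "(s,t)" UNIV] differentiable_compose[of k snd "(s,t)" UNIV] hk
          by (simp_all add: bounded_linear_imp_differentiable bounded_linear_fst bounded_linear_snd)
        then have "(\<lambda>y. (h (fst y), k (snd y))) differentiable (at (s, t))"
          unfolding differentiable_def by (metis has_derivative_Pair)
        then have "T differentiable (at (s, t))"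
          using differentiable_compose[of T0 "\<lambda>y. (h (fst y), k (snd y))" "(s,t)" UNIV] difT0[OF h01'[OF 5(1)] k01'[OF 5(2)]]
          unfolding T_def by simp
        then show ?thesis unfolding st(1) by (rule differentiable_at_withinI)
      qed
    qed
  qed (use k in auto)
qed

section \<open>Degree and local indices\<close>

lemma winding_number_exp_path:
  assumes "path q" "\<And>t. t \<in> {0..1} \<Longrightarrow> g t = exp (q t)"
  shows "winding_number g 0 = (pathfinish q - pathstart q) / (2 * of_real pi * \<i>)"
proof -
  have "winding_number g 0 = winding_number (exp \<circ> q) 0"
    by (rule winding_number_cong) (use assms in auto)
  then show ?thesis using winding_number_compose_exp[OF assms(1)] by simp
qed

lemma injective_linear_bounded_below:
  fixes L :: "'a::euclidean_space \<Rightarrow> 'b::euclidean_space"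
  assumes "linear L" "inj L"
  obtains m where "m > 0" "\<And>x. m * norm x \<le> norm (L x)"
  using linear_inj_bounded_below_pos[OF assms] by (metis mult.commute)

text \<open>
  The multiplicative form of the approximation by the derivative: \<open>h w - h z\<close> and \<open>L (w - z)\<close> have
  asymptotically the same argument.
\<close>

lemma has_derivative_injective_quotient_tendsto:
  fixes h :: "complex \<Rightarrow> complex"
  assumes h: "(h has_derivative L) (at z within S)" and "inj L"
  shows "((\<lambda>w. (h w - h z) / L (w - z)) \<longlongrightarrow> 1) (at z within S)"
proof -
  have lin: "linear L" using h has_derivative_linear by blast
  obtain m where m: "m > 0" "\<And>x. m * norm x \<le> norm (L x)"
    using injective_linear_bounded_below[OF lin \<open>inj L\<close>] by blast
  have lim: "((\<lambda>w. norm (h w - h z - L (w - z)) / norm (w - z)) \<longlongrightarrow> 0) (at z within S)"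
    using h unfolding has_derivative_iff_norm by blast
  have "((\<lambda>w. (h w - h z) / L (w - z) - 1) \<longlongrightarrow> 0) (at z within S)"
  proof (rule tendsto_0_le[OF lim, where K="1/m"])
    show "\<forall>\<^sub>F w in at z within S. norm ((h w - h z) / L (w - z) - 1)
            \<le> norm (norm (h w - h z - L (w - z)) / norm (w - z)) * (1 / m)"
      unfolding eventually_at_filter
    proof (rule always_eventually, intro allI impI)
      fix w assume w: "w \<noteq> z" "w \<in> S"
      have p: "0 < norm (w - z)" using w by simp
      have q: "0 < m * norm (w - z)" using m p by simp
      have q': "0 < norm (L (w - z))" using q m(2)[of "w - z"] by linarith
      have "(h w - h z) / L (w - z) - 1 = (h w - h z - L (w - z)) / L (w - z)" using q' by (simp add: diff_divide_distrib)
      then have "norm ((h w - h z) / L (w - z) - 1) = norm (h w - h z - L (w - z)) / norm (L (w - z))" by (simp add: norm_divide)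
      also have "\<dots> \<le> norm (h w - h z - L (w - z)) / (m * norm (w - z))"
        using m(1) m(2)[of "w - z"] p q' by (intro divide_left_mono mult_pos_pos) auto
      also have "\<dots> = norm (norm (h w - h z - L (w - z)) / norm (w - z)) * (1 / m)" by simp
      finally show "norm ((h w - h z) / L (w - z) - 1) \<le> norm (norm (h w - h z - L (w - z)) / norm (w - z)) * (1 / m)" .
    qed
  qed
  then show ?thesis by (simp add: LIM_zero_iff)
qed

text \<open>
  Dividing \<open>h - x\<close> by the product of the factors \<open>L z (w - z)\<close> gives a function without zeros that extends
  continuously and without zeros to all of the convex set \<open>S\<close>. It has a continuous logarithm there, so
  its loop does not wind around \<open>0\<close> and the winding numbers of the factors add up.
\<close>

lemma winding_number_eq_sum_of_local_indices:
  fixes h :: "complex \<Rightarrow> complex"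
  assumes S: "convex S" and h: "continuous_on S h"
    and \<gamma>: "path \<gamma>" "pathfinish \<gamma> = pathstart \<gamma>" "path_image \<gamma> \<subseteq> S"
    and Z: "finite Z" "\<And>z. z \<in> S \<Longrightarrow> h z = x \<longleftrightarrow> z \<in> Z" "Z \<subseteq> S" "Z \<inter> path_image \<gamma> = {}"
    and L: "\<And>z. z \<in> Z \<Longrightarrow> (h has_derivative L z) (at z within S)" "\<And>z. z \<in> Z \<Longrightarrow> inj (L z)"
  shows "winding_number (h \<circ> \<gamma>) x = (\<Sum>z\<in>Z. winding_number (\<lambda>t. L z (\<gamma> t - z)) 0)"
proof -
  have lin: "linear (L z)" if "z \<in> Z" for z using L(1)[OF that] has_derivative_linear by blast
  have L0: "L z w = 0 \<longleftrightarrow> w = 0" if "z \<in> Z" for z w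
    using L(2)[OF that] lin[OF that] by (metis injD linear_0)
  have contL: "continuous_on A (\<lambda>w. L z (w - z))" if "z \<in> Z" for z A
    by (intro linear_continuous_on_compose[OF _ lin[OF that]] continuous_intros)
  define P where "P = (\<lambda>w. \<Prod>z\<in>Z. L z (w - z))"
  define P' where "P' = (\<lambda>z w. \<Prod>y\<in>Z-{z}. L y (w - y))"
  have Psplit: "P w = L z (w - z) * P' z w" if "z \<in> Z" for z w
    unfolding P_def P'_def using Z(1) that by (rule prod.remove)
  have P0: "P w \<noteq> 0" if "w \<notin> Z" for w using that Z(1) L0 by (auto simp: P_def)
  have P'0: "P' z z \<noteq> 0" if "z \<in> Z" for z using that Z(1) L0 by (auto simp: P'_def)
  have contP: "continuous_on A P" for A unfolding P_def by (intro continuous_intros contL)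
  have contP': "continuous_on A (P' z)" if "z \<in> Z" for A z unfolding P'_def by (intro continuous_intros contL) auto
  define G where "G = (\<lambda>w. if w \<in> Z then 1 / P' w w else (h w - x) / P w)"
  have G0: "G w \<noteq> 0" if "w \<in> S" for w using P0[of w] P'0[of w] Z(2)[OF that] by (auto simp: G_def)
  have "continuous_on S G"
    unfolding continuous_on_eq_continuous_within
  proof
    fix w assume w: "w \<in> S"
    show "continuous (at w within S) G"
    proof (cases "w \<in> Z")
      case False
      have "open (- Z)" using Z(1) by (simp add: finite_imp_closed open_Compl)
      have "continuous (at w within S) (\<lambda>w. (h w - x) / P w)"
        using h w contP[of S] P0[OF False] by (intro continuous_intros) (auto simp: continuous_on_eq_continuous_within)
      then show ?thesis
      proof (rule continuous_transform_within_openin[where T=S and S="S - Z"])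
        show "openin (top_of_set S) (S - Z)" using \<open>open (- Z)\<close> by (auto simp: openin_open)
        show "w \<in> S - Z" using w False by simp
      qed (auto simp: G_def)
    next
      case True
      have "h w = x" using Z(2)[OF w] True by simp
      have "((\<lambda>v. (h v - h w) / L w (v - w)) \<longlongrightarrow> 1) (at w within S)"
        by (rule has_derivative_injective_quotient_tendsto[OF L(1,2)[OF True]])
      moreover have "(P' w \<longlongrightarrow> P' w w) (at w within S)"
        using contP'[OF True, of UNIV] by (simp add: continuous_on_eq_continuous_at continuous_within[symmetric] continuous_at_imp_continuous_at_within)
      ultimately have "((\<lambda>v. (h v - h w) / L w (v - w) / P' w v) \<longlongrightarrow> 1 / P' w w) (at w within S)"
        by (rule tendsto_divide) (rule P'0[OF True])
      then have "(G \<longlongrightarrow> 1 / P' w w) (at w within S)"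
      proof (rule Lim_transform_eventually)
        have "open (- (Z - {w}))" using Z(1) by (intro open_Compl finite_imp_closed) auto
        from topological_tendstoD[OF tendsto_ident_at this, of w S]
        have "\<forall>\<^sub>F v in at w within S. v \<notin> Z - {w}" by (rule eventually_mono) auto
        then show "\<forall>\<^sub>F v in at w within S. (h v - h w) / L w (v - w) / P' w v = G v"
          by (rule eventually_elim2[OF _ eventually_neq_at_within[of w]])
             (auto simp: G_def Psplit[OF True] \<open>h w = x\<close>)
      qed
      then show ?thesis using True by (simp add: continuous_within G_def)
    qed
  qed
  then obtain lg where lg: "continuous_on S lg" "\<And>w. w \<in> S \<Longrightarrow> G w = exp (lg w)"
    using continuous_logarithm_on_contractible[of S G] convex_imp_contractible[OF S] G0 by metis
  have \<gamma>S: "\<gamma> t \<in> S" "\<gamma> t \<notin> Z" if "t \<in> {0..1}" for t using that \<gamma>(3) Z(4) by (auto simp: path_image_def)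
  have "\<exists>q. path q \<and> pathfinish q - pathstart q = 2 * of_real pi * \<i> * winding_number (\<lambda>t. L z (\<gamma> t - z)) 0 \<and>
       (\<forall>t\<in>{0..1}. L z (\<gamma> t - z) = exp (q t))" if z: "z \<in> Z" for z
  proof -
    have "path ((\<lambda>w. L z (w - z)) \<circ> \<gamma>)" by (rule path_continuous_image[OF \<gamma>(1) contL[OF z]])
    then have 1: "path (\<lambda>t. L z (\<gamma> t - z))" by (simp add: o_def)
    have 2: "0 \<notin> path_image (\<lambda>t. L z (\<gamma> t - z))"
    proof
      assume "0 \<in> path_image (\<lambda>t. L z (\<gamma> t - z))"
      then obtain t where t: "t \<in> {0..1}" "L z (\<gamma> t - z) = 0" by (auto simp: path_image_def)
      then show False using L0[OF z] \<gamma>S(2)[OF t(1)] z by auto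
    qed
    show ?thesis using winding_number_as_continuous_log[OF 1 2] by (metis add_0)
  qed
  then obtain q where q: "\<And>z. z \<in> Z \<Longrightarrow> path (q z)"
    "\<And>z. z \<in> Z \<Longrightarrow> pathfinish (q z) - pathstart (q z) = 2 * of_real pi * \<i> * winding_number (\<lambda>t. L z (\<gamma> t - z)) 0"
    "\<And>z t. z \<in> Z \<Longrightarrow> t \<in> {0..1} \<Longrightarrow> L z (\<gamma> t - z) = exp (q z t)"
    by metis
  define Q where "Q = (\<lambda>t. lg (\<gamma> t) + (\<Sum>z\<in>Z. q z t))"
  have "path Q" unfolding Q_def path_def
    using q(1) \<gamma>S(1) \<gamma>(1) by (intro continuous_intros continuous_on_compose2[OF lg(1)]) (auto simp: path_def)
  have "winding_number (h \<circ> \<gamma>) x = winding_number (\<lambda>t. (h \<circ> \<gamma>) t - x) 0" by (rule winding_number_offset)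
  also have "\<dots> = (pathfinish Q - pathstart Q) / (2 * of_real pi * \<i>)"
  proof (rule winding_number_exp_path[OF \<open>path Q\<close>])
    fix t :: real assume t: "t \<in> {0..1}"
    have "exp (Q t) = G (\<gamma> t) * (\<Prod>z\<in>Z. exp (q z t))"
      unfolding Q_def exp_add by (simp add: lg(2)[OF \<gamma>S(1)[OF t]] exp_sum[OF Z(1)])
    also have "(\<Prod>z\<in>Z. exp (q z t)) = P (\<gamma> t)" unfolding P_def using q(3) t by (intro prod.cong) auto
    also have "G (\<gamma> t) * P (\<gamma> t) = h (\<gamma> t) - x" using \<gamma>S(2)[OF t] P0 by (simp add: G_def)
    finally show "(h \<circ> \<gamma>) t - x = exp (Q t)" by simp
  qed
  also have "pathfinish Q - pathstart Q = (\<Sum>z\<in>Z. pathfinish (q z) - pathstart (q z))"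
    using \<gamma>(2) by (simp add: Q_def pathfinish_def pathstart_def sum_subtractf)
  also have "\<dots> = 2 * of_real pi * \<i> * (\<Sum>z\<in>Z. winding_number (\<lambda>t. L z (\<gamma> t - z)) 0)"
    using q(2) by (simp add: sum_distrib_left)
  finally show ?thesis by (simp add: o_def)
qed

text \<open>
  An invertible linear image of a simple loop is a simple loop.
\<close>

lemma norm_winding_number_linear_image_le_1:
  fixes \<gamma> :: "real \<Rightarrow> complex"
  assumes "simple_path \<gamma>" "pathfinish \<gamma> = pathstart \<gamma>" "z \<notin> path_image \<gamma>" and L: "linear L" "inj L"
  shows "norm (winding_number (\<lambda>t. L (\<gamma> t - z)) 0) \<le> 1"
proof -
  have "simple_path ((\<lambda>w. - z + w) \<circ> \<gamma>)" by (rule simple_path_translation_eq[THEN iffD2, OF assms(1)])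
  then have "simple_path (L \<circ> ((\<lambda>w. - z + w) \<circ> \<gamma>))" by (rule simple_path_linear_image_eq[OF L, THEN iffD2])
  then have "simple_path (\<lambda>t. L (\<gamma> t - z))" by (simp add: o_def)
  moreover have "pathfinish (\<lambda>t. L (\<gamma> t - z)) = pathstart (\<lambda>t. L (\<gamma> t - z))"
    using assms(2) by (simp add: pathfinish_def pathstart_def)
  moreover have "0 \<notin> path_image (\<lambda>t. L (\<gamma> t - z))"
  proof
    assume "0 \<in> path_image (\<lambda>t. L (\<gamma> t - z))"
    then obtain t where "t \<in> {0..1}" "L (\<gamma> t - z) = 0" by (auto simp: path_image_def)
    then have "\<gamma> t - z = 0" using L by (metis injD linear_0)
    then show False using assms(3) \<open>t \<in> {0..1}\<close> by (auto simp: path_image_def)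
  qed
  ultimately show ?thesis using simple_closed_path_winding_number_cases by fastforce
qed

lemma isolated_if_injective_derivative:
  fixes h :: "'a::euclidean_space \<Rightarrow> 'b::euclidean_space"
  assumes h: "(h has_derivative L) (at z)" and "inj L"
  shows "\<exists>e>0. \<forall>w. w \<noteq> z \<and> dist w z < e \<longrightarrow> h w \<noteq> h z"
proof -
  have lin: "linear L" using h has_derivative_linear by blast
  obtain m where m: "m > 0" "\<And>x. m * norm x \<le> norm (L x)"
    using injective_linear_bounded_below[OF lin \<open>inj L\<close>] by blast
  obtain d where d: "d > 0" "\<And>w. norm (w - z) < d \<Longrightarrow> norm (h w - h z - L (w - z)) \<le> (m / 2) * norm (w - z)"
    using h m(1) unfolding has_derivative_at_alt by (meson half_gt_zero)
  have "h w \<noteq> h z" if "w \<noteq> z" "dist w z < d" for w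
  proof
    assume "h w = h z"
    then have "norm (L (w - z)) \<le> (m / 2) * norm (w - z)" using d(2)[of w] that by (simp add: dist_norm)
    moreover have "(m / 2) * norm (w - z) < m * norm (w - z)" using m(1) that by (intro mult_strict_right_mono) auto
    ultimately show False using m(2)[of "w - z"] by linarith
  qed
  then show ?thesis using d(1) by blast
qed

text \<open>
  Sard's theorem in equal dimensions, transferred from \<open>real^2\<close>.
\<close>

lemma negligible_critical_values:
  fixes H :: "real \<times> real \<Rightarrow> complex"
  assumes der: "\<And>z. z \<in> D \<Longrightarrow> (H has_derivative L z) (at z)" and ninj: "\<And>z. z \<in> D \<Longrightarrow> \<not> inj (L z)"
  shows "negligible (H ` D)"
proof -
  define \<phi> where "\<phi> = (\<lambda>v::real^2. (v $ 1, v $ 2))"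
  define \<phi>' where "\<phi>' = (\<lambda>z::real \<times> real. vector [fst z, snd z] :: real^2)"
  define \<psi> where "\<psi> = (\<lambda>z::complex. vector [Re z, Im z] :: real^2)"
  define \<psi>' where "\<psi>' = (\<lambda>v::real^2. Complex (v $ 1) (v $ 2))"
  have \<phi>\<phi>': "\<phi> (\<phi>' z) = z" for z by (simp add: \<phi>_def \<phi>'_def)
  have \<psi>'\<psi>: "\<psi>' (\<psi> w) = w" for w by (simp add: \<psi>_def \<psi>'_def)
  have lin\<phi>: "linear \<phi>" unfolding \<phi>_def by (intro linearI) auto
  have lin\<psi>: "linear \<psi>" unfolding \<psi>_def by (intro linearI) (auto simp: vec_eq_iff forall_2)
  have lin\<psi>': "linear \<psi>'" unfolding \<psi>'_def by (intro linearI) (auto simp: complex_eq_iff)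
  define f where "f = \<psi> \<circ> H \<circ> \<phi>"
  define f' where "f' = (\<lambda>v. \<psi> \<circ> L (\<phi> v) \<circ> \<phi>)"
  have "negligible (f ` (\<phi>' ` D))"
  proof (rule baby_Sard)
    show "CARD(2) \<le> CARD(2)" by simp
    fix v assume "v \<in> \<phi>' ` D"
    then obtain z where z: "z \<in> D" "v = \<phi>' z" by auto
    then have \<phi>v: "\<phi> v = z" by (simp add: \<phi>\<phi>')
    have 1: "(\<phi> has_derivative \<phi>) (at v)" using lin\<phi> by (simp add: linear_imp_has_derivative linear_conv_bounded_linear bounded_linear_imp_has_derivative)
    have 2: "(H has_derivative L (\<phi> v)) (at (\<phi> v))" using der[OF z(1)] by (simp add: \<phi>v)
    have 3: "(\<psi> has_derivative \<psi>) (at w)" for w using lin\<psi> by (simp add: linear_conv_bounded_linear bounded_linear_imp_has_derivative)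
    have "(f has_derivative f' v) (at v)" unfolding f_def f'_def
      using diff_chain_at[OF diff_chain_at[OF 1 2] 3] by (simp add: o_assoc)
    then show fv: "(f has_derivative f' v) (at v within \<phi>' ` D)" by (rule has_derivative_at_withinI)
    have "linear (f' v)" using \<open>(f has_derivative f' v) (at v)\<close> has_derivative_linear by blast
    then have "(*v) (matrix (f' v)) = f' v" by (auto simp: matrix_works)
    moreover have "\<not> inj (f' v)"
    proof
      assume i: "inj (f' v)"
      have "inj (L z)"
      proof (rule injI)
        fix x y assume "L z x = L z y"
        then have "f' v (\<phi>' x) = f' v (\<phi>' y)" by (simp add: f'_def \<phi>v \<phi>\<phi>')
        then have "\<phi>' x = \<phi>' y" using i by (simp add: inj_eq)
        then show "x = y" using \<phi>\<phi>' by metis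
      qed
      then show False using ninj[OF z(1)] by simp
    qed
    ultimately show "rank (matrix (f' v)) < CARD(2)" unfolding less_rank_noninjective by simp
  qed
  moreover have "f ` (\<phi>' ` D) = \<psi> ` (H ` D)" by (auto simp: f_def \<phi>\<phi>' image_image)
  ultimately have neg: "negligible (\<psi> ` (H ` D))" by simp
  have "negligible (\<psi>' ` (\<psi> ` (H ` D)))"
  proof (rule negligible_differentiable_image_negligible[OF _ neg])
    show "DIM(real^2) \<le> DIM(complex)" by simp
    show "\<psi>' differentiable_on \<psi> ` (H ` D)" using lin\<psi>' by (rule linear_imp_differentiable_on)
  qed
  then show ?thesis by (simp add: image_image \<psi>'\<psi>)
qed

section \<open>The winding area as a lower bound\<close>

lemma AE_lborel_not_in_negligible:
  assumes "negligible N"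
  shows "AE x in lborel. x \<notin> N"
proof -
  have "N \<in> null_sets (completion lborel)" using assms by (simp add: negligible_iff_null_sets)
  then obtain N' where "N' \<in> null_sets lborel" "N \<subseteq> N'" by (auto simp: null_sets_completion_iff2)
  then show ?thesis by (intro AE_I'[of N']) auto
qed

lemma finite_if_isolated:
  fixes P :: "'a::heine_borel set"
  assumes "compact P" "\<And>z. z \<in> P \<Longrightarrow> \<exists>e>0. \<forall>w. w \<noteq> z \<and> dist w z < e \<longrightarrow> w \<notin> P"
  shows "finite P"
proof (rule ccontr)
  assume "infinite P"
  then obtain z where z: "z \<in> P" "z islimpt P"
    using assms(1) unfolding compact_eq_Bolzano_Weierstrass by blast
  obtain e where "e > 0" "\<forall>w. w \<noteq> z \<and> dist w z < e \<longrightarrow> w \<notin> P" using assms(2)[OF z(1)] by blast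
  then show False using z(2) unfolding islimpt_approachable by blast
qed

lemma card_components_finite:
  fixes P :: "'a::metric_space set"
  assumes "finite P"
  shows "card (components P) = card P"
proof -
  have "connected_component_set P z = {z}" if "z \<in> P" for z
  proof -
    have "finite (connected_component_set P z)" using assms connected_component_subset finite_subset by blast
    then have "connected_component_set P z = {} \<or> (\<exists>a. connected_component_set P z = {a})"
      using connected_finite_iff_sing[OF connected_connected_component] by blast
    moreover have z: "z \<in> connected_component_set P z" using that by (simp add: connected_component_refl)
    ultimately obtain a where a: "connected_component_set P z = {a}" by blast
    then have "z = a" using z unfolding a by blast
    then show ?thesis using a by (rule ssubst)
  qed
  then have "components P = (\<lambda>z. {z}) ` P" unfolding components_def by (intro image_cong) auto
  then show ?thesis by (simp add: card_image)
qed

lemma joinpaths_cong: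
  assumes "\<And>t. t \<in> {0..1} \<Longrightarrow> p t = p' t" "\<And>t. t \<in> {0..1} \<Longrightarrow> q t = q' t" "t \<in> {0..1}"
  shows "(p +++ q) t = (p' +++ q') t"
  using assms by (auto simp: joinpaths_def)

text \<open>
  Three sides of the square go to the base point; the remaining one is \<open>c\<close>, traversed backwards.
\<close>

lemma winding_number_boundary_of_null_homotopy:
  assumes c: "closed_curve c" and H: "null_homotopy c H" and x: "x \<notin> path_image c"
  shows "winding_number ((\<lambda>w. H (Re w, Im w)) \<circ> rectpath 0 (1 + \<i>)) x = - winding_number c x"
proof -
  define h where "h = (\<lambda>w. H (Re w, Im w))"
  define l where "l = linepath (c 0) (c 0)"
  have c0: "c 0 \<in> path_image c" by (auto simp: path_image_def)
  have pc: "path c" "c 1 = c 0" using c by (auto simp: closed_curve_def pathfinish_def pathstart_def)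
  have H': "\<And>t. t \<in> {0..1} \<Longrightarrow> H (0, t) = c t" "\<And>t. t \<in> {0..1} \<Longrightarrow> H (1, t) = c 0"
    "\<And>s. s \<in> {0..1} \<Longrightarrow> H (s, 0) = c 0" "\<And>s. s \<in> {0..1} \<Longrightarrow> H (s, 1) = c 0"
    using H by (auto simp: null_homotopy_def)
  have lt: "l t = c 0" for t by (simp add: l_def linepath_def)
  have "(h \<circ> rectpath 0 (1 + \<i>)) t = (l +++ (l +++ (l +++ reversepath c))) t" if t: "t \<in> {0..1}" for t
  proof -
    have eq: "h \<circ> rectpath 0 (1 + \<i>) = (h \<circ> linepath 0 1) +++ ((h \<circ> linepath 1 (1 + \<i>)) +++ ((h \<circ> linepath (1 + \<i>) \<i>) +++ (h \<circ> linepath \<i> 0)))"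
    proof -
      have "Complex (Re (1 + \<i>)) (Im 0) = 1" "Complex (Re 0) (Im (1 + \<i>)) = \<i>" by (auto simp: complex_eq_iff)
      then show ?thesis by (simp add: rectpath_def Let_def path_compose_join)
    qed
    have "((h \<circ> linepath 0 1) +++ ((h \<circ> linepath 1 (1 + \<i>)) +++ ((h \<circ> linepath (1 + \<i>) \<i>) +++ (h \<circ> linepath \<i> 0)))) t
      = (l +++ (l +++ (l +++ reversepath c))) t"
    proof (intro joinpaths_cong t)
      fix t :: real assume t: "t \<in> {0..1}"
      show "(h \<circ> linepath 0 1) t = l t" using H'(3)[OF t] by (simp add: h_def lt linepath_def)
      show "(h \<circ> linepath 1 (1 + \<i>)) t = l t" using H'(2)[OF t] by (simp add: h_def lt linepath_def)
      show "(h \<circ> linepath (1 + \<i>) \<i>) t = l t" using H'(4)[of "1 - t"] t by (simp add: h_def lt linepath_def)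
      show "(h \<circ> linepath \<i> 0) t = reversepath c t" using H'(1)[of "1 - t"] t by (simp add: h_def linepath_def reversepath_def)
    qed
    then show ?thesis unfolding eq .
  qed
  then have "winding_number (h \<circ> rectpath 0 (1 + \<i>)) x = winding_number (l +++ (l +++ (l +++ reversepath c))) x"
    by (intro winding_number_cong) (simp only: atLeastAtMost_iff)
  moreover have l: "path l" "pathstart l = c 0" "pathfinish l = c 0" "x \<notin> path_image l" "winding_number l x = 0"
  proof -
    have "c 0 \<noteq> x" using x c0 by blast
    then show "path l" "pathstart l = c 0" "pathfinish l = c 0" "x \<notin> path_image l" by (simp_all add: l_def)
    show "winding_number l x = 0" unfolding l_def by (rule winding_number_trivial[OF \<open>c 0 \<noteq> x\<close>[symmetric]])
  qed
  moreover have r: "path (reversepath c)" "pathstart (reversepath c) = c 0" "x \<notin> path_image (reversepath c)"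
    "winding_number (reversepath c) x = - winding_number c x"
    using pc x by (auto simp: winding_number_reversepath pathfinish_def)
  ultimately show ?thesis
    by (simp add: winding_number_join path_image_join h_def)
qed

text \<open>
  Almost every point has all its preimages inside the simplices of the triangulation and is a regular
  value there. Its preimages are then finite in number, so they are their own components, and each
  contributes at most \<open>1\<close> to the winding number of the image of the boundary of the square.
\<close>

theorem winding_area_le_homotopy_area:
  assumes c: "closed_curve c" and null: "negligible (path_image c)"
    and H: "null_homotopy c H" and pd: "piecewise_differentiable_square H"
  shows "winding_area c \<le> homotopy_area H"
proof -
  obtain \<T> where \<T>: "triangulation \<T>" "\<Union>\<T> = unit_square" "\<And>T. T \<in> \<T> \<Longrightarrow> H differentiable_on T"
    using pd unfolding piecewise_differentiable_square_def by blast
  have fin: "finite \<T>" and simplex: "\<And>T. T \<in> \<T> \<Longrightarrow> \<exists>n. n simplex T" using \<T>(1) by (auto simp: triangulation_def)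
  have T: "convex T" "closed T" if "T \<in> \<T>" for T
    using simplex[OF that] simplex_imp_polytope polytope_imp_convex polytope_imp_closed by blast+
  define D where "D = {z. H differentiable (at z) \<and> \<not> inj (frechet_derivative H (at z))}"
  define N where "N = path_image c \<union> ((\<Union>T\<in>\<T>. H ` frontier T) \<union> H ` D)"
  have "negligible (H ` frontier T)" if "T \<in> \<T>" for T
  proof (rule negligible_differentiable_image_negligible)
    show "DIM(real \<times> real) \<le> DIM(complex)" by simp
    show "negligible (frontier T)" by (rule negligible_convex_frontier[OF T(1)[OF that]])
    show "H differentiable_on frontier T"
      using \<T>(3)[OF that] T(2)[OF that] frontier_subset_closed differentiable_on_subset by blast
  qed
  moreover have "negligible (H ` D)"
    by (rule negligible_critical_values[of D H "\<lambda>z. frechet_derivative H (at z)"])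
       (auto simp: D_def frechet_derivative_works[symmetric])
  ultimately have negN: "negligible N" unfolding N_def using null fin by (intro negligible_Un negligible_Union) auto
  have main: "ennreal (cmod (winding_number c x)) \<le> num_preimage_components H x" if x: "x \<notin> N" for x
  proof -
    define P where "P = {z \<in> unit_square. H z = x}"
    have contH: "continuous_on unit_square H" using H by (simp add: null_homotopy_def)
    have xc: "x \<notin> path_image c" using x by (simp add: N_def)
    have int: "z \<in> interior unit_square \<and> (H has_derivative frechet_derivative H (at z)) (at z) \<and> inj (frechet_derivative H (at z))"
      if z: "z \<in> P" for z
    proof -
      obtain T where T': "T \<in> \<T>" "z \<in> T" using z \<T>(2) by (auto simp: P_def)
      have "z \<notin> frontier T" using x z T'(1) by (auto simp: N_def P_def)
      then have zi: "z \<in> interior T" using T'(2) by (simp add: frontier_def closure_def)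
      have "H differentiable (at z within T)" using \<T>(3)[OF T'(1)] T'(2) by (simp add: differentiable_on_def)
      then have d: "H differentiable (at z)" unfolding at_within_interior[OF zi] .
      have "H z = x" using z by (simp add: P_def)
      then have "z \<notin> D" using x unfolding N_def by blast
      then have "inj (frechet_derivative H (at z))" using d unfolding D_def by blast
      moreover have "z \<in> interior unit_square" using subsetD[OF interior_mono[OF Union_upper[OF T'(1)]] zi] unfolding \<T>(2) .
      ultimately show ?thesis using d[unfolded frechet_derivative_works] by (intro conjI)
    qed
    have "compact unit_square" unfolding unit_square_def by (intro compact_Times) auto
    have "closed (unit_square \<inter> H -` {x})"
      by (rule continuous_closed_preimage[OF contH]) (use \<open>compact unit_square\<close> compact_imp_closed in auto)
    then have "compact (unit_square \<inter> (unit_square \<inter> H -` {x}))"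
      by (rule compact_Int_closed[OF \<open>compact unit_square\<close>])
    moreover have "unit_square \<inter> (unit_square \<inter> H -` {x}) = P" by (auto simp: P_def)
    ultimately have "compact P" by (rule subst[rotated])
    then have finP: "finite P"
    proof (rule finite_if_isolated)
      fix z assume z: "z \<in> P"
      obtain e where e: "e > 0" "\<forall>w. w \<noteq> z \<and> dist w z < e \<longrightarrow> H w \<noteq> H z"
        using isolated_if_injective_derivative[of H _ z] int[OF z] by blast
      then show "\<exists>e>0. \<forall>w. w \<noteq> z \<and> dist w z < e \<longrightarrow> w \<notin> P" using z by (auto simp: P_def)
    qed
    define h where "h = (\<lambda>w. H (Re w, Im w))"
    define S where "S = cbox 0 (1 + \<i>)"
    have S: "w \<in> S \<longleftrightarrow> (Re w, Im w) \<in> unit_square" for w by (auto simp: S_def unit_square_def in_cbox_complex_iff)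
    define \<kappa> where "\<kappa> = (\<lambda>z::real \<times> real. Complex (fst z) (snd z))"
    define Z where "Z = \<kappa> ` P"
    define L where "L = (\<lambda>w v. frechet_derivative H (at (Re w, Im w)) (Re v, Im v))"
    define \<gamma> where "\<gamma> = rectpath 0 (1 + \<i>)"
    have Zin: "(Re w, Im w) \<in> P" if "w \<in> Z" for w using that by (auto simp: Z_def \<kappa>_def)
    have \<gamma>S: "path_image \<gamma> \<subseteq> S" unfolding \<gamma>_def S_def by (rule path_image_rectpath_subset_cbox) auto
    have Z\<gamma>: "Z \<inter> path_image \<gamma> = {}"
    proof (rule ccontr)
      assume "Z \<inter> path_image \<gamma> \<noteq> {}"
      then obtain w where w: "w \<in> Z" "w \<in> path_image \<gamma>" by blast
      have "interior unit_square = {0<..<1} \<times> {0<..<1}" by (simp add: unit_square_def interior_Times interior_atLeastAtMost_real)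
      then have "0 < Re w" "Re w < 1" "0 < Im w" "Im w < 1" using int[OF Zin[OF w(1)]] by auto
      then show False using w(2) by (auto simp: \<gamma>_def path_image_rectpath)
    qed
    have "winding_number (h \<circ> \<gamma>) x = (\<Sum>z\<in>Z. winding_number (\<lambda>t. L z (\<gamma> t - z)) 0)"
    proof (rule winding_number_eq_sum_of_local_indices)
      show "convex S" by (simp add: S_def)
      show "continuous_on S h" unfolding h_def
        by (rule continuous_on_compose2[OF contH]) (auto intro!: continuous_intros simp: S)
      show "path \<gamma>" "pathfinish \<gamma> = pathstart \<gamma>" by (simp_all add: \<gamma>_def)
      show "path_image \<gamma> \<subseteq> S" "Z \<inter> path_image \<gamma> = {}" by fact+
      show "finite Z" using finP by (simp add: Z_def)
      show "h w = x \<longleftrightarrow> w \<in> Z" if "w \<in> S" for w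
      proof
        assume "h w = x"
        then have "(Re w, Im w) \<in> P" using that S by (simp add: P_def h_def)
        then show "w \<in> Z" unfolding Z_def by (intro image_eqI[of _ _ "(Re w, Im w)"]) (auto simp: \<kappa>_def)
      next
        assume "w \<in> Z" then show "h w = x" using Zin by (auto simp: P_def h_def)
      qed
      show "Z \<subseteq> S" using Zin S by (auto simp: P_def)
      fix w assume w: "w \<in> Z"
      note i = int[OF Zin[OF w]]
      have "((\<lambda>w. (Re w, Im w)) has_derivative (\<lambda>v. (Re v, Im v))) (at w)"
        by (intro has_derivative_Pair bounded_linear_imp_has_derivative bounded_linear_Re bounded_linear_Im)
      then have "(h has_derivative L w) (at w)" unfolding h_def L_def
        using diff_chain_at[of "\<lambda>w. (Re w, Im w)" "\<lambda>v. (Re v, Im v)" w H] i unfolding o_def by blast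
      then show "(h has_derivative L w) (at w within S)" by (rule has_derivative_at_withinI)
      show "inj (L w)"
      proof (rule injI)
        fix u v assume "L w u = L w v"
        then have "(Re u, Im u) = (Re v, Im v)" using i unfolding L_def by (blast dest: injD)
        then show "u = v" by (simp add: complex_eq_iff)
      qed
    qed
    then have "winding_number c x = - (\<Sum>z\<in>Z. winding_number (\<lambda>t. L z (\<gamma> t - z)) 0)"
      using winding_number_boundary_of_null_homotopy[OF c H xc, folded h_def \<gamma>_def] by (metis minus_minus)
    then have "norm (winding_number c x) \<le> (\<Sum>z\<in>Z. norm (winding_number (\<lambda>t. L z (\<gamma> t - z)) 0))"
      by (simp add: norm_sum)
    also have "\<dots> \<le> (\<Sum>z\<in>Z. 1)"
    proof (rule sum_mono)
      fix z assume z: "z \<in> Z"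
      note i = int[OF Zin[OF z]]
      have "linear (frechet_derivative H (at (Re z, Im z)))" using i has_derivative_linear by blast
      then have "linear (L z)" unfolding L_def
        by (intro linear_compose[of "\<lambda>v. (Re v, Im v)" "frechet_derivative H (at (Re z, Im z))", unfolded o_def])
           (auto intro!: linearI)
      moreover have "inj (L z)"
      proof (rule injI)
        fix u v assume "L z u = L z v"
        then have "(Re u, Im u) = (Re v, Im v)" using i unfolding L_def by (blast dest: injD)
        then show "u = v" by (simp add: complex_eq_iff)
      qed
      ultimately show "norm (winding_number (\<lambda>t. L z (\<gamma> t - z)) 0) \<le> 1"
        using z Z\<gamma> by (intro norm_winding_number_linear_image_le_1) (auto simp: \<gamma>_def simple_path_rectpath)
    qed
    also have "\<dots> = card Z" by simp
    also have "\<dots> \<le> card P" unfolding Z_def using finP by (simp add: card_image_le)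
    finally have le: "norm (winding_number c x) \<le> card P" by simp
    have "num_preimage_components H x = of_nat (card P)"
    proof -
      have "finite (components P)" using finP by (simp add: components_def)
      then show ?thesis unfolding num_preimage_components_def P_def[symmetric]
        by (simp add: emeasure_count_space card_components_finite[OF finP])
    qed
    then show ?thesis using le by (simp add: ennreal_le_iff flip: ennreal_of_nat_eq_real_of_nat)
  qed
  show ?thesis unfolding winding_area_def homotopy_area_def
  proof (rule nn_integral_mono_AE)
    show "AE x in lborel. ennreal (cmod (winding_number c x)) * indicator (- path_image c) x \<le> num_preimage_components H x"
      using AE_lborel_not_in_negligible[OF negN]
    proof (rule eventually_mono)
      fix x assume "x \<notin> N"
      then show "ennreal (cmod (winding_number c x)) * indicator (- path_image c) x \<le> num_preimage_components H x"
        using main[of x] by (auto simp: indicator_def)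
    qed
  qed
qed

section \<open>Preimages under an immersed disk\<close>

text \<open>
  Every real linear map of the plane is \<open>w \<mapsto> a w + b (cnj w)\<close>; the larger of the two terms determines
  the winding number.
\<close>

lemma winding_number_real_linear_image_of_circle:
  fixes a b z :: complex
  assumes z: "norm z < 1"
  defines "g \<equiv> \<lambda>t. a * (circlepath 0 1 t - z) + b * cnj (circlepath 0 1 t - z)"
  shows "norm b < norm a \<Longrightarrow> winding_number g 0 = 1" "norm a < norm b \<Longrightarrow> winding_number g 0 = -1"
proof -
  define \<gamma> where "\<gamma> = circlepath 0 1"
  have \<gamma>: "path \<gamma>" "pathfinish \<gamma> = pathstart \<gamma>" "z \<notin> path_image \<gamma>" "winding_number \<gamma> z = 1"
    using z by (auto simp: \<gamma>_def winding_number_circlepath)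
  obtain q where q: "path q" "pathfinish q - pathstart q = 2 * of_real pi * \<i>" "\<And>t. t \<in> {0..1} \<Longrightarrow> \<gamma> t = z + exp (q t)"
    using winding_number_as_continuous_log[OF \<gamma>(1,3)] \<gamma>(4) by (metis mult.right_neutral)
  have \<gamma>z: "\<gamma> t - z = exp (q t)" if "t \<in> {0..1}" for t using q(3)[OF that] by simp
  have ne: "norm (\<gamma> t - z) > 0" if "t \<in> {0..1}" for t using \<gamma>z[OF that] by simp
  have cont: "continuous_on {0..1} \<gamma>" using \<gamma>(1) by (simp add: path_def)
  have \<gamma>01: "\<gamma> 1 = \<gamma> 0" using \<gamma>(2) by (simp add: pathfinish_def pathstart_def)
  have pathg: "path g" "pathfinish g = pathstart g" unfolding g_def \<gamma>_def[symmetric]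
    using cont \<gamma>01 by (auto simp: path_def pathfinish_def pathstart_def intro!: continuous_intros)
  show "winding_number g 0 = 1" if ab: "norm b < norm a"
  proof -
    have a0: "a \<noteq> 0" using ab by auto
    have "winding_number g 0 = winding_number (\<lambda>t. a * (\<gamma> t - z)) 0"
    proof (rule winding_number_nearby_loops_eq)
      show "path (\<lambda>t. a * (\<gamma> t - z))" using cont by (auto simp: path_def intro!: continuous_intros)
      show "pathfinish (\<lambda>t. a * (\<gamma> t - z)) = pathstart (\<lambda>t. a * (\<gamma> t - z))" using \<gamma>01 by (simp add: pathfinish_def pathstart_def)
      fix t :: real assume t: "t \<in> {0..1}"
      have "norm (g t - a * (\<gamma> t - z)) = norm b * norm (\<gamma> t - z)"
        unfolding g_def \<gamma>_def[symmetric] by (simp add: norm_mult del: complex_cnj_diff)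
      also have "\<dots> < norm a * norm (\<gamma> t - z)" using ab ne[OF t] by (rule mult_strict_right_mono)
      finally show "norm (g t - a * (\<gamma> t - z)) < norm (a * (\<gamma> t - z) - 0)" by (simp add: norm_mult)
    qed (use pathg in auto)
    also have "\<dots> = (pathfinish (\<lambda>t. Ln a + q t) - pathstart (\<lambda>t. Ln a + q t)) / (2 * of_real pi * \<i>)"
    proof (rule winding_number_exp_path)
      show "path (\<lambda>t. Ln a + q t)" using q(1) by (auto simp: path_def intro!: continuous_intros)
      show "a * (\<gamma> t - z) = exp (Ln a + q t)" if "t \<in> {0..1}" for t
        using \<gamma>z[OF that] a0 by (simp add: exp_add)
    qed
    also have "\<dots> = 1" using q(2) by (simp add: pathfinish_def pathstart_def)
    finally show ?thesis .
  qed
  show "winding_number g 0 = -1" if ab: "norm a < norm b"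
  proof -
    have b0: "b \<noteq> 0" using ab by auto
    have "winding_number g 0 = winding_number (\<lambda>t. b * cnj (\<gamma> t - z)) 0"
    proof (rule winding_number_nearby_loops_eq)
      show "path (\<lambda>t. b * cnj (\<gamma> t - z))" using cont by (auto simp: path_def intro!: continuous_intros)
      show "pathfinish (\<lambda>t. b * cnj (\<gamma> t - z)) = pathstart (\<lambda>t. b * cnj (\<gamma> t - z))" using \<gamma>01 by (simp add: pathfinish_def pathstart_def)
      fix t :: real assume t: "t \<in> {0..1}"
      have "norm (g t - b * cnj (\<gamma> t - z)) = norm a * norm (\<gamma> t - z)"
        unfolding g_def \<gamma>_def[symmetric] by (simp add: norm_mult del: complex_cnj_diff)
      also have "\<dots> < norm b * norm (\<gamma> t - z)" using ab ne[OF t] by (rule mult_strict_right_mono)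
      finally show "norm (g t - b * cnj (\<gamma> t - z)) < norm (b * cnj (\<gamma> t - z) - 0)" by (simp add: norm_mult del: complex_cnj_diff)
    qed (use pathg in auto)
    also have "\<dots> = (pathfinish (\<lambda>t. Ln b + cnj (q t)) - pathstart (\<lambda>t. Ln b + cnj (q t))) / (2 * of_real pi * \<i>)"
    proof (rule winding_number_exp_path)
      show "path (\<lambda>t. Ln b + cnj (q t))" using q(1) by (auto simp: path_def intro!: continuous_intros)
      show "b * cnj (\<gamma> t - z) = exp (Ln b + cnj (q t))" if "t \<in> {0..1}" for t
        using \<gamma>z[OF that] b0 by (simp add: exp_add exp_cnj del: complex_cnj_diff)
    qed
    also have "\<dots> = cnj (pathfinish q - pathstart q) / (2 * of_real pi * \<i>)"
      by (simp add: pathfinish_def pathstart_def)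
    also have "\<dots> = -1" unfolding q(2) by simp
    finally show ?thesis .
  qed
qed

text \<open>
  The derivative of an immersion is invertible everywhere, so that \<open>|a| - |b|\<close> has constant sign on the
  disk for its coefficients \<open>a\<close> and \<open>b\<close>, and all local indices are equal.
\<close>

theorem card_preimages_of_disk_immersion:
  assumes F: "disk_immersion F" and y: "y \<notin> F ` sphere 0 1"
  shows "finite {z \<in> cball 0 1. F z = y}"
    "real (card {z \<in> cball 0 1. F z = y}) = cmod (winding_number (\<lambda>t. F (cis (2 * pi * t))) y)"
proof -
  obtain F' :: "complex \<Rightarrow> complex \<Rightarrow>\<^sub>L complex" where F': "continuous_on (cball 0 1) F'"
    "\<And>z. z \<in> cball 0 1 \<Longrightarrow> (F has_derivative blinfun_apply (F' z)) (at z within cball 0 1)"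
    "\<And>z. z \<in> cball 0 1 \<Longrightarrow> inj (blinfun_apply (F' z))"
    using F unfolding disk_immersion_def by blast
  have contF: "continuous_on (cball 0 1) F" using F'(2) by (rule has_derivative_continuous_on)
  define a b where "a = (\<lambda>z. (F' z 1 - \<i> * F' z \<i>) / 2)" and "b = (\<lambda>z. (F' z 1 + \<i> * F' z \<i>) / 2)"
  have F'ab: "F' z w = a z * w + b z * cnj w" for z w
  proof -
    have "w = Re w *\<^sub>R 1 + Im w *\<^sub>R \<i>" by (simp add: complex_eq_iff)
    then have "F' z w = Re w *\<^sub>R F' z 1 + Im w *\<^sub>R F' z \<i>" by (metis blinfun.add_right blinfun.scaleR_right)
    also have "\<dots> = a z * w + b z * cnj w"
      unfolding a_def b_def by (simp add: complex_eq_iff field_simps)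
    finally show ?thesis .
  qed
  have ab_ne: "norm (a z) \<noteq> norm (b z)" if z: "z \<in> cball 0 1" for z
  proof
    assume eq: "norm (a z) = norm (b z)"
    have "\<exists>w. w \<noteq> 0 \<and> a z * w + b z * cnj w = 0"
    proof (cases "a z = 0")
      case True then show ?thesis using eq by (intro exI[of _ 1]) auto
    next
      case False
      define u where "u = - b z / a z"
      have nu: "norm u = 1" using eq False by (simp add: u_def norm_divide flip: eq)
      define w where "w = csqrt u"
      have "norm w = 1" using nu by (simp add: w_def norm_csqrt)
      then have "w * cnj w = 1" using complex_norm_square[of w] by simp
      have "w * w = u" by (simp add: w_def flip: power2_eq_square)
      have "w = w * (w * cnj w)" using \<open>w * cnj w = 1\<close> by simp
      also have "\<dots> = u * cnj w" using \<open>w * w = u\<close> by (simp flip: mult.assoc)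
      finally have "a z * w = a z * (u * cnj w)" by simp
      then have "a z * w + b z * cnj w = 0" using False by (simp add: u_def)
      moreover have "w \<noteq> 0" using \<open>norm w = 1\<close> by auto
      ultimately show ?thesis by blast
    qed
    then obtain w where "w \<noteq> 0" "F' z w = F' z 0" by (auto simp: F'ab)
    then show False using F'(3)[OF z] by (metis injD)
  qed
  have conta: "continuous_on (cball 0 1) a" and contb: "continuous_on (cball 0 1) b"
    unfolding a_def b_def using F'(1) by (intro continuous_intros; simp)+
  define d where "d = (\<lambda>z. norm (a z) - norm (b z))"
  have contd: "continuous_on (cball 0 1) d" unfolding d_def by (intro continuous_intros conta contb)
  have "connected (d ` cball 0 1)" by (intro connected_continuous_image contd) simp
  then have sign: "(\<forall>z\<in>cball 0 1. norm (b z) < norm (a z)) \<or> (\<forall>z\<in>cball 0 1. norm (a z) < norm (b z))"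
  proof -
    assume con: "connected (d ` cball 0 1)"
    show ?thesis
    proof (rule ccontr)
      assume "\<not> ?thesis"
      then obtain z z' where zz: "z \<in> cball 0 1" "z' \<in> cball 0 1" "d z \<le> 0" "0 \<le> d z'"
        by (auto simp: d_def not_less)
      then have "0 \<in> d ` cball 0 1" using connectedD_interval[OF con, of "d z" "d z'" 0] by auto
      then show False using ab_ne by (auto simp: d_def)
    qed
  qed
  define Z where "Z = {z \<in> cball 0 1. F z = y}"
  have Zball: "z \<in> ball 0 1" if "z \<in> Z" for z
  proof -
    have "z \<notin> sphere 0 1" using y that by (auto simp: Z_def)
    then show ?thesis using that by (auto simp: Z_def)
  qed
  have der: "(F has_derivative blinfun_apply (F' z)) (at z)" if "z \<in> Z" for z
  proof -
    have "z \<in> interior (cball 0 1)" using Zball[OF that] by simp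
    moreover have "z \<in> cball 0 1" using that by (simp add: Z_def)
    ultimately show ?thesis using F'(2)[of z] at_within_interior[of z "cball 0 1"] by metis
  qed
  have "closed (cball 0 1 \<inter> F -` {y})" by (rule continuous_closed_preimage[OF contF]) auto
  moreover have "Z = cball 0 1 \<inter> F -` {y}" by (auto simp: Z_def)
  ultimately have "closed Z" by simp
  moreover have "bounded Z" by (rule bounded_subset[OF bounded_cball[of 0 1]]) (auto simp: Z_def)
  ultimately have "compact Z" by (simp add: compact_eq_bounded_closed)
  then have finZ: "finite Z"
  proof (rule finite_if_isolated)
    fix z assume z: "z \<in> Z"
    then have "z \<in> cball 0 1" by (simp add: Z_def)
    then obtain e where e: "e > 0" "\<forall>w. w \<noteq> z \<and> dist w z < e \<longrightarrow> F w \<noteq> F z"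
      using isolated_if_injective_derivative[OF der[OF z] F'(3)] by blast
    then show "\<exists>e>0. \<forall>w. w \<noteq> z \<and> dist w z < e \<longrightarrow> w \<notin> Z" using z by (auto simp: Z_def)
  qed
  then show "finite {z \<in> cball 0 1. F z = y}" by (simp add: Z_def)
  define \<gamma> :: "real \<Rightarrow> complex" where "\<gamma> = circlepath 0 1"
  have "(\<lambda>t. F (cis (2 * pi * t))) = F \<circ> \<gamma>"
    by (rule ext) (simp add: \<gamma>_def circlepath cis_conv_exp mult_ac)
  moreover have "winding_number (F \<circ> \<gamma>) y = (\<Sum>z\<in>Z. winding_number (\<lambda>t. F' z (\<gamma> t - z)) 0)"
  proof (rule winding_number_eq_sum_of_local_indices)
    show "convex (cball (0::complex) 1)" "continuous_on (cball 0 1) F" by (simp_all add: contF)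
    show "path \<gamma>" "pathfinish \<gamma> = pathstart \<gamma>" "path_image \<gamma> \<subseteq> cball 0 1" by (auto simp: \<gamma>_def)
    show "finite Z" by fact
    show "\<And>z. z \<in> cball 0 1 \<Longrightarrow> F z = y \<longleftrightarrow> z \<in> Z" "Z \<subseteq> cball 0 1" by (auto simp: Z_def)
    show "Z \<inter> path_image \<gamma> = {}" using Zball by (force simp: \<gamma>_def)
    show "(F has_derivative blinfun_apply (F' z)) (at z within cball 0 1)" "inj (blinfun_apply (F' z))" if "z \<in> Z" for z
      using F'(2,3) that by (auto simp: Z_def)
  qed
  moreover have "cmod (\<Sum>z\<in>Z. winding_number (\<lambda>t. F' z (\<gamma> t - z)) 0) = real (card Z)"
    using sign
  proof
    assume s: "\<forall>z\<in>cball 0 1. norm (b z) < norm (a z)"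
    have "winding_number (\<lambda>t. F' z (\<gamma> t - z)) 0 = 1" if "z \<in> Z" for z
      unfolding F'ab \<gamma>_def using winding_number_real_linear_image_of_circle(1)[of z "b z" "a z"] s Zball[OF that] by simp
    then show ?thesis by simp
  next
    assume s: "\<forall>z\<in>cball 0 1. norm (a z) < norm (b z)"
    have "winding_number (\<lambda>t. F' z (\<gamma> t - z)) 0 = -1" if "z \<in> Z" for z
      unfolding F'ab \<gamma>_def using winding_number_real_linear_image_of_circle(2)[of z "a z" "b z"] s Zball[OF that] by simp
    then show ?thesis by (simp add: norm_minus_cancel)
  qed
  ultimately show "real (card {z \<in> cball 0 1. F z = y}) = cmod (winding_number (\<lambda>t. F (cis (2 * pi * t))) y)"
    by (simp add: Z_def)
qed

section \<open>Piecewise differentiable maps on strips\<close>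

text \<open>
  Being differentiable on all small rectangles between the breaks, rather than on the rectangles of one
  fixed subdivision, makes the notion stable under gluing: subdivisions only have to be united.
\<close>

definition piecewise_differentiable_strip :: "real \<Rightarrow> real \<Rightarrow> (real \<times> real \<Rightarrow> complex) \<Rightarrow> bool" where
  "piecewise_differentiable_strip a b H \<longleftrightarrow>
     (\<exists>X Y. finite X \<and> finite Y \<and>
        (\<forall>s s' t t'. 0 \<le> s \<and> s < s' \<and> s' \<le> 1 \<and> a \<le> t \<and> t < t' \<and> t' \<le> b \<and>
           {s<..<s'} \<inter> X = {} \<and> {t<..<t'} \<inter> Y = {} \<longrightarrow> H differentiable_on {s..s'} \<times> {t..t'}))"

lemma piecewise_differentiable_stripE:
  assumes "piecewise_differentiable_strip a b H"
  obtains X Y where "finite X" "finite Y"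
    "\<And>s s' t t'. \<lbrakk>0 \<le> s; s < s'; s' \<le> 1; a \<le> t; t < t'; t' \<le> b; {s<..<s'} \<inter> X = {}; {t<..<t'} \<inter> Y = {}\<rbrakk>
       \<Longrightarrow> H differentiable_on {s..s'} \<times> {t..t'}"
proof -
  from assms obtain X Y where XY: "finite X" "finite Y" and
    B: "\<forall>s s' t t'. 0 \<le> s \<and> s < s' \<and> s' \<le> 1 \<and> a \<le> t \<and> t < t' \<and> t' \<le> b \<and>
           {s<..<s'} \<inter> X = {} \<and> {t<..<t'} \<inter> Y = {} \<longrightarrow> H differentiable_on {s..s'} \<times> {t..t'}"
    unfolding piecewise_differentiable_strip_def by (elim exE conjE) (rule that; assumption)
  show thesis
    by (rule that[OF XY]) (rule B[rule_format]; intro conjI; assumption)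
qed

definition consecutive :: "real set \<Rightarrow> real \<Rightarrow> real \<Rightarrow> bool" where
  "consecutive X u v \<longleftrightarrow> u \<in> X \<and> v \<in> X \<and> u < v \<and> {u<..<v} \<inter> X = {}"

lemma consecutive_cover:
  assumes X: "finite X" "a \<in> X" "b \<in> X" and s: "a \<le> s" "s \<le> b" "a < b"
  shows "\<exists>u v. consecutive X u v \<and> u \<le> s \<and> s \<le> v"
proof (cases "s = b")
  case True
  define u where "u = Max {x \<in> X. x < b}"
  have fin: "finite {x \<in> X. x < b}" "{x \<in> X. x < b} \<noteq> {}" using X s by auto
  have u: "u \<in> X" "u < b" using Max_in[OF fin] by (auto simp: u_def)
  have "x \<le> u" if "x \<in> X" "x < b" for x using fin(1) that unfolding u_def by (intro Max_ge) auto
  then have "consecutive X u b" using u X by (force simp: consecutive_def)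
  then show ?thesis using True u by (intro exI[of _ u] exI[of _ b]) auto
next
  case False
  define u v where "u = Max {x \<in> X. x \<le> s}" and "v = Min {x \<in> X. s < x}"
  have f1: "finite {x \<in> X. x \<le> s}" "{x \<in> X. x \<le> s} \<noteq> {}" using X s by auto
  have f2: "finite {x \<in> X. s < x}" "{x \<in> X. s < x} \<noteq> {}" using X s False by force+
  have u: "u \<in> X" "u \<le> s" and v: "v \<in> X" "s < v"
    using Max_in[OF f1] Min_in[OF f2] by (auto simp: u_def v_def)
  have "x \<le> u" if "x \<in> X" "x \<le> s" for x using f1(1) that unfolding u_def by (intro Max_ge) auto
  moreover have "v \<le> x" if "x \<in> X" "s < x" for x using f2(1) that unfolding v_def by (intro Min_le) auto
  ultimately have "consecutive X u v" using u v by (force simp: consecutive_def)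
  then show ?thesis using u v by (intro exI[of _ u] exI[of _ v]) auto
qed

lemma consecutive_face:
  assumes "consecutive X u v" "consecutive X u' v'"
  shows "{u..v} \<inter> {u'..v'} face_of {u..v}"
proof -
  have ends: "{u} face_of {u..v}" "{v} face_of {u..v}"
    using assms(1) by (simp_all add: face_of_singleton extreme_point_of_segment consecutive_def
        flip: closed_segment_eq_real_ivl1)
  consider "u = u'" "v = v'" | "v < u'" | "v = u'" | "v' < u" | "v' = u"
    using assms unfolding consecutive_def disjoint_iff greaterThanLessThan_iff
    by (metis linorder_neqE_linordered_idom)
  then show ?thesis
  proof cases
    case 1 then show ?thesis by (simp add: face_of_refl)
  next
    case 2
    then have "{u..v} \<inter> {u'..v'} = {}" by auto
    then show ?thesis by simp
  next
    case 3
    then have "{u..v} \<inter> {u'..v'} = {v}" using assms by (auto simp: consecutive_def)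
    then show ?thesis using ends by simp
  next
    case 4
    then have "{u..v} \<inter> {u'..v'} = {}" by auto
    then show ?thesis by simp
  next
    case 5
    then have "{u..v} \<inter> {u'..v'} = {u}" using assms by (auto simp: consecutive_def)
    then show ?thesis using ends by simp
  qed
qed

text \<open>
  The rectangles between consecutive breaks form a cell complex, which has a triangulation refining it.
\<close>

lemma piecewise_differentiable_strip_imp_square:
  assumes "piecewise_differentiable_strip 0 1 H"
  shows "piecewise_differentiable_square H"
proof -
  obtain X0 Y0 where XY0: "finite X0" "finite Y0"
    "\<And>s s' t t'. \<lbrakk>0 \<le> s; s < s'; s' \<le> 1; 0 \<le> t; t < t'; t' \<le> 1; {s<..<s'} \<inter> X0 = {}; {t<..<t'} \<inter> Y0 = {}\<rbrakk>
       \<Longrightarrow> H differentiable_on {s..s'} \<times> {t..t'}"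
    by (rule piecewise_differentiable_stripE[OF assms]) (rule that; assumption)
  define X Y where "X = insert 0 (insert 1 (X0 \<inter> {0..1}))" and "Y = insert 0 (insert 1 (Y0 \<inter> {0..1}))"
  have X: "finite X" "0 \<in> X" "1 \<in> X" "X \<subseteq> {0..1}" and Y: "finite Y" "0 \<in> Y" "1 \<in> Y" "Y \<subseteq> {0..1}"
    using XY0 by (auto simp: X_def Y_def)
  define P where "P = {(s, s', t, t'). consecutive X s s' \<and> consecutive Y t t'}"
  define \<M> where "\<M> = (\<lambda>(s, s', t, t'). {s..s'} \<times> {t..t'}) ` P"
  have "P \<subseteq> X \<times> X \<times> Y \<times> Y" by (auto simp: P_def consecutive_def)
  then have "finite P" using X(1) Y(1) by (meson finite_SigmaI finite_subset)
  then have fin: "finite \<M>" by (simp add: \<M>_def)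
  have mem: "\<exists>s s' t t'. C = {s..s'} \<times> {t..t'} \<and> consecutive X s s' \<and> consecutive Y t t'" if "C \<in> \<M>" for C
    using that by (auto simp: \<M>_def P_def)
  have box: "{s..s'} \<times> {t..t'} = cbox (s, t) (s', t')" for s s' t t' :: real by (simp add: cbox_Pair_eq)
  have U: "\<Union>\<M> = unit_square"
  proof
    show "\<Union>\<M> \<subseteq> unit_square"
      using X(4) Y(4) by (auto simp: \<M>_def P_def unit_square_def consecutive_def) (meson atLeastAtMost_iff order_trans subsetD)+
    show "unit_square \<subseteq> \<Union>\<M>"
    proof
      fix z assume "z \<in> unit_square"
      then obtain s t where st: "z = (s, t)" "0 \<le> s" "s \<le> 1" "0 \<le> t" "t \<le> 1" by (auto simp: unit_square_def)
      obtain u u' where u: "consecutive X u u'" "u \<le> s" "s \<le> u'" using consecutive_cover[OF X(1-3), of s] st by auto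
      obtain v v' where v: "consecutive Y v v'" "v \<le> t" "t \<le> v'" using consecutive_cover[OF Y(1-3), of t] st by auto
      have "{u..u'} \<times> {v..v'} \<in> \<M>" using u v by (auto simp: \<M>_def P_def)
      moreover have "z \<in> {u..u'} \<times> {v..v'}" using u v st by auto
      ultimately show "z \<in> \<Union>\<M>" by blast
    qed
  qed
  have poly: "polytope C" if "C \<in> \<M>" for C using mem[OF that] by (auto simp: box polytope_interval)
  have aff: "aff_dim C = 2" if C: "C \<in> \<M>" for C
  proof -
    obtain s s' t t' where st: "C = {s..s'} \<times> {t..t'}" "s < s'" "t < t'" using mem[OF C] by (auto simp: consecutive_def)
    have "interior C = {s<..<s'} \<times> {t<..<t'}" by (simp add: st(1) interior_Times interior_atLeastAtMost_real)
    moreover have "((s + s') / 2, (t + t') / 2) \<in> {s<..<s'} \<times> {t<..<t'}" using st by simp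
    ultimately have "interior C \<noteq> {}" by blast
    then show ?thesis by (simp add: aff_dim_nonempty_interior)
  qed
  have face: "C1 \<inter> C2 face_of C1" if C: "C1 \<in> \<M>" "C2 \<in> \<M>" for C1 C2
  proof -
    obtain s s' t t' where st: "C1 = {s..s'} \<times> {t..t'}" "consecutive X s s'" "consecutive Y t t'" using mem[OF C(1)] by blast
    obtain u u' v v' where uv: "C2 = {u..u'} \<times> {v..v'}" "consecutive X u u'" "consecutive Y v v'" using mem[OF C(2)] by blast
    have "C1 \<inter> C2 = ({s..s'} \<inter> {u..u'}) \<times> ({t..t'} \<inter> {v..v'})" unfolding st uv by auto
    then show ?thesis unfolding st(1)
      using face_of_Times[OF consecutive_face[OF st(2) uv(2)] consecutive_face[OF st(3) uv(3)]] by simp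
  qed
  obtain \<T> where \<T>: "triangulation \<T>" "\<Union>\<T> = \<Union>\<M>" "\<And>k. k \<in> \<T> \<Longrightarrow> \<exists>C. C \<in> \<M> \<and> k \<subseteq> C"
    using fine_triangular_subdivision_of_cell_complex[OF zero_less_one fin poly aff face] by metis
  have "H differentiable_on T" if T: "T \<in> \<T>" for T
  proof -
    obtain C where C: "C \<in> \<M>" "T \<subseteq> C" using \<T>(3)[OF T] by blast
    obtain s s' t t' where st: "C = {s..s'} \<times> {t..t'}" "consecutive X s s'" "consecutive Y t t'" using mem[OF C(1)] by blast
    have b: "0 \<le> s" "s < s'" "s' \<le> 1" "0 \<le> t" "t < t'" "t' \<le> 1" using st X(4) Y(4) by (auto simp: consecutive_def)
    have "{s<..<s'} \<inter> X0 = {}" "{t<..<t'} \<inter> Y0 = {}"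
      using st b unfolding consecutive_def X_def Y_def by auto
    then have "H differentiable_on C" unfolding st(1) by (intro XY0(3) b)
    then show ?thesis using C(2) differentiable_on_subset by blast
  qed
  then show ?thesis unfolding piecewise_differentiable_square_def
    using \<T> U by (intro exI[of _ \<T>]) auto
qed

lemma differentiable_on_compose_Pair:
  assumes "H differentiable_on S" "f differentiable_on A" "g differentiable_on B"
    "\<And>x y. x \<in> A \<Longrightarrow> y \<in> B \<Longrightarrow> (f x, g y) \<in> S"
  shows "(\<lambda>z. H (f (fst z), g (snd z))) differentiable_on (A \<times> B)"
  unfolding differentiable_on_def
proof
  fix z assume z: "z \<in> A \<times> B"
  have "(\<lambda>z. f (fst z)) differentiable (at z within A \<times> B)"
  proof -
    have "f differentiable (at (fst z) within fst ` (A \<times> B))"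
      using assms(2) z by (auto simp: differentiable_on_def fst_image_times)
    moreover have "fst differentiable (at z within A \<times> B)" by (intro bounded_linear_imp_differentiable bounded_linear_fst)
    ultimately show ?thesis using differentiable_chain_within[of fst z "A \<times> B" f] by (simp add: o_def)
  qed
  moreover have "(\<lambda>z. g (snd z)) differentiable (at z within A \<times> B)"
  proof -
    have "g differentiable (at (snd z) within snd ` (A \<times> B))"
      using assms(3) z by (auto simp: differentiable_on_def snd_image_times)
    moreover have "snd differentiable (at z within A \<times> B)" by (intro bounded_linear_imp_differentiable bounded_linear_snd)
    ultimately show ?thesis using differentiable_chain_within[of snd z "A \<times> B" g] by (simp add: o_def)
  qed
  ultimately have "(\<lambda>z. (f (fst z), g (snd z))) differentiable (at z within A \<times> B)"
    unfolding differentiable_def by (metis has_derivative_Pair)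
  moreover have "H differentiable (at (f (fst z), g (snd z)) within (\<lambda>z. (f (fst z), g (snd z))) ` (A \<times> B))"
  proof -
    have "(\<lambda>z. (f (fst z), g (snd z))) ` (A \<times> B) \<subseteq> S" using assms(4) by auto
    then show ?thesis using assms(1) z by (meson differentiable_on_def differentiable_within_subset imageI subsetD)
  qed
  ultimately show "(\<lambda>z. H (f (fst z), g (snd z))) differentiable (at z within A \<times> B)"
    using differentiable_chain_within[of "\<lambda>z. (f (fst z), g (snd z))" z "A \<times> B" H] by (simp add: o_def)
qed

lemma differentiable_on_eq:
  assumes "f differentiable_on S" "\<And>x. x \<in> S \<Longrightarrow> f x = g x"
  shows "g differentiable_on S"
  unfolding differentiable_on_def
proof
  fix x assume x: "x \<in> S"
  then obtain f' where "(f has_derivative f') (at x within S)"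
    using assms(1) by (auto simp: differentiable_on_def differentiable_def)
  then have "(g has_derivative f') (at x within S)"
    by (rule has_derivative_transform[OF x, rotated]) (simp add: assms(2))
  then show "g differentiable (at x within S)" by (auto simp: differentiable_def)
qed

lemma differentiable_on_affine: "(\<lambda>x::real. m * x + c) differentiable_on A"
  by (intro differentiable_at_imp_differentiable_on) (auto intro!: derivative_intros)

text \<open>
  Concatenation in the homotopy parameter.
\<close>

definition glue_first :: "(real \<times> real \<Rightarrow> complex) \<Rightarrow> (real \<times> real \<Rightarrow> complex) \<Rightarrow> real \<times> real \<Rightarrow> complex" where
  "glue_first H K z = (if fst z \<le> 1/2 then H (2 * fst z, snd z) else K (2 * fst z - 1, snd z))"

lemma piecewise_differentiable_strip_glue_first:
  assumes H: "piecewise_differentiable_strip a b H" and K: "piecewise_differentiable_strip a b K"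
    and eq: "\<And>t. t \<in> {a..b} \<Longrightarrow> H (1, t) = K (0, t)"
  shows "piecewise_differentiable_strip a b (glue_first H K)"
proof -
  obtain X Y where XY: "finite X" "finite Y"
    "\<And>s s' t t'. \<lbrakk>0 \<le> s; s < s'; s' \<le> 1; a \<le> t; t < t'; t' \<le> b; {s<..<s'} \<inter> X = {}; {t<..<t'} \<inter> Y = {}\<rbrakk>
       \<Longrightarrow> H differentiable_on {s..s'} \<times> {t..t'}"
    by (rule piecewise_differentiable_stripE[OF H]) (rule that; assumption)
  obtain X' Y' where XY': "finite X'" "finite Y'"
    "\<And>s s' t t'. \<lbrakk>0 \<le> s; s < s'; s' \<le> 1; a \<le> t; t < t'; t' \<le> b; {s<..<s'} \<inter> X' = {}; {t<..<t'} \<inter> Y' = {}\<rbrakk>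
       \<Longrightarrow> K differentiable_on {s..s'} \<times> {t..t'}"
    by (rule piecewise_differentiable_stripE[OF K]) (rule that; assumption)
  define Z where "Z = insert (1/2) ((\<lambda>x. x / 2) ` X \<union> (\<lambda>x. (x + 1) / 2) ` X')"
  show ?thesis unfolding piecewise_differentiable_strip_def
  proof (rule exI[of _ Z], rule exI[of _ "Y \<union> Y'"], intro conjI allI impI)
    show "finite Z" "finite (Y \<union> Y')" using XY XY' by (auto simp: Z_def)
    fix s s' t t' assume st: "0 \<le> s \<and> s < s' \<and> s' \<le> 1 \<and> a \<le> t \<and> t < t' \<and> t' \<le> b \<and>
           {s<..<s'} \<inter> Z = {} \<and> {t<..<t'} \<inter> (Y \<union> Y') = {}"
    consider "s' \<le> 1/2" | "1/2 \<le> s" using st by (auto simp: Z_def)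
    then show "glue_first H K differentiable_on {s..s'} \<times> {t..t'}"
    proof cases
      case 1
      have "{2 * s<..<2 * s'} \<inter> X = {}"
      proof (rule ccontr)
        assume "\<not> ?thesis"
        then obtain x where x: "x \<in> X" "2 * s < x" "x < 2 * s'" by auto
        then have "x / 2 \<in> {s<..<s'} \<inter> Z" by (auto simp: Z_def)
        then show False using st by blast
      qed
      then have "H differentiable_on {2 * s..2 * s'} \<times> {t..t'}" using st 1 by (intro XY(3)) auto
      then have "(\<lambda>z. H (2 * fst z + 0, 1 * snd z + 0)) differentiable_on {s..s'} \<times> {t..t'}"
        by (rule differentiable_on_compose_Pair[OF _ differentiable_on_affine differentiable_on_affine]) auto
      then show ?thesis using 1 by (elim differentiable_on_eq) (auto simp: glue_first_def)
    next
      case 2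
      have "{2 * s - 1<..<2 * s' - 1} \<inter> X' = {}"
      proof (rule ccontr)
        assume "\<not> ?thesis"
        then obtain x where x: "x \<in> X'" "2 * s - 1 < x" "x < 2 * s' - 1" by auto
        then have "(x + 1) / 2 \<in> {s<..<s'} \<inter> Z" by (auto simp: Z_def)
        then show False using st by blast
      qed
      then have "K differentiable_on {2 * s - 1..2 * s' - 1} \<times> {t..t'}" using st 2 by (intro XY'(3)) auto
      then have "(\<lambda>z. K (2 * fst z + (-1), 1 * snd z + 0)) differentiable_on {s..s'} \<times> {t..t'}"
        by (rule differentiable_on_compose_Pair[OF _ differentiable_on_affine differentiable_on_affine]) auto
      moreover have "glue_first H K z = K (2 * fst z + (-1), 1 * snd z + 0)" if "z \<in> {s..s'} \<times> {t..t'}" for z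
      proof (cases "fst z = 1/2")
        case True
        then show ?thesis using that eq[of "snd z"] st unfolding glue_first_def True by (simp add: mem_Times_iff)
      next
        case False then show ?thesis using that 2 by (auto simp: glue_first_def)
      qed
      ultimately show ?thesis by (elim differentiable_on_eq) simp
    qed
  qed
qed

lemma continuous_on_glue_first:
  assumes H: "continuous_on ({0..1} \<times> {a..b}) H" and K: "continuous_on ({0..1} \<times> {a..b}) K"
    and eq: "\<And>t. t \<in> {a..b} \<Longrightarrow> H (1, t) = K (0, t)"
  shows "continuous_on ({0..1} \<times> {a..b}) (glue_first H K)"
proof -
  have "continuous_on ({0..1/2} \<times> {a..b} \<union> {1/2..1} \<times> {a..b}) (glue_first H K)"
  proof (intro continuous_on_closed_Un closed_Times closed_atLeastAtMost)
    have "continuous_on ({0..1/2} \<times> {a..b}) (\<lambda>z. H (2 * fst z, snd z))"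
      by (rule continuous_on_compose2[OF H]) (auto intro!: continuous_intros)
    then show "continuous_on ({0..1/2} \<times> {a..b}) (glue_first H K)"
      by (rule continuous_on_eq) (auto simp: glue_first_def)
    have "continuous_on ({1/2..1} \<times> {a..b}) (\<lambda>z. K (2 * fst z - 1, snd z))"
      by (rule continuous_on_compose2[OF K]) (auto intro!: continuous_intros)
    then show "continuous_on ({1/2..1} \<times> {a..b}) (glue_first H K)"
    proof (rule continuous_on_eq)
      fix z :: "real \<times> real" assume z: "z \<in> {1/2..1} \<times> {a..b}"
      show "K (2 * fst z - 1, snd z) = glue_first H K z"
      proof (cases "fst z = 1/2")
        case True
        then show ?thesis using z eq[of "snd z"] unfolding glue_first_def True by (simp add: mem_Times_iff)
      next
        case False then show ?thesis using z by (auto simp: glue_first_def)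
      qed
    qed
  qed
  moreover have "{0..1/2} \<times> {a..b} \<union> {1/2..1} \<times> {a..b} = {0..1::real} \<times> {a..b}" by auto
  ultimately show ?thesis by simp
qed

text \<open>
  Juxtaposition in the curve parameter, with common boundary at \<open>b\<close>.
\<close>

definition glue_second :: "real \<Rightarrow> (real \<times> real \<Rightarrow> complex) \<Rightarrow> (real \<times> real \<Rightarrow> complex) \<Rightarrow> real \<times> real \<Rightarrow> complex" where
  "glue_second b H K z = (if snd z \<le> b then H z else K z)"

lemma piecewise_differentiable_strip_glue_second:
  assumes H: "piecewise_differentiable_strip a b H" and K: "piecewise_differentiable_strip b c K"
    and eq: "\<And>s. s \<in> {0..1} \<Longrightarrow> H (s, b) = K (s, b)"
  shows "piecewise_differentiable_strip a c (glue_second b H K)"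
proof -
  obtain X Y where XY: "finite X" "finite Y"
    "\<And>s s' t t'. \<lbrakk>0 \<le> s; s < s'; s' \<le> 1; a \<le> t; t < t'; t' \<le> b; {s<..<s'} \<inter> X = {}; {t<..<t'} \<inter> Y = {}\<rbrakk>
       \<Longrightarrow> H differentiable_on {s..s'} \<times> {t..t'}"
    by (rule piecewise_differentiable_stripE[OF H]) (rule that; assumption)
  obtain X' Y' where XY': "finite X'" "finite Y'"
    "\<And>s s' t t'. \<lbrakk>0 \<le> s; s < s'; s' \<le> 1; b \<le> t; t < t'; t' \<le> c; {s<..<s'} \<inter> X' = {}; {t<..<t'} \<inter> Y' = {}\<rbrakk>
       \<Longrightarrow> K differentiable_on {s..s'} \<times> {t..t'}"
    by (rule piecewise_differentiable_stripE[OF K]) (rule that; assumption)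
  show ?thesis unfolding piecewise_differentiable_strip_def
  proof (rule exI[of _ "X \<union> X'"], rule exI[of _ "insert b (Y \<union> Y')"], intro conjI allI impI)
    show "finite (X \<union> X')" "finite (insert b (Y \<union> Y'))" using XY XY' by auto
    fix s s' t t' assume st: "0 \<le> s \<and> s < s' \<and> s' \<le> 1 \<and> a \<le> t \<and> t < t' \<and> t' \<le> c \<and>
           {s<..<s'} \<inter> (X \<union> X') = {} \<and> {t<..<t'} \<inter> insert b (Y \<union> Y') = {}"
    consider "t' \<le> b" | "b \<le> t" using st by auto
    then show "glue_second b H K differentiable_on {s..s'} \<times> {t..t'}"
    proof cases
      case 1
      have "H differentiable_on {s..s'} \<times> {t..t'}" using st 1 by (intro XY(3)) auto
      then show ?thesis using 1 by (elim differentiable_on_eq) (auto simp: glue_second_def)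
    next
      case 2
      have "K differentiable_on {s..s'} \<times> {t..t'}" using st 2 by (intro XY'(3)) auto
      moreover have "glue_second b H K z = K z" if "z \<in> {s..s'} \<times> {t..t'}" for z
        using that eq[of "fst z"] st 2 by (cases "snd z = b") (auto simp: glue_second_def)
      ultimately show ?thesis by (elim differentiable_on_eq) simp
    qed
  qed
qed

lemma continuous_on_glue_second:
  assumes H: "continuous_on ({0..1} \<times> {a..b}) H" and K: "continuous_on ({0..1} \<times> {b..c}) K"
    and eq: "\<And>s. s \<in> {0..1} \<Longrightarrow> H (s, b) = K (s, b)" and "a \<le> b" "b \<le> c"
  shows "continuous_on ({0..1} \<times> {a..c}) (glue_second b H K)"
proof -
  have "continuous_on ({0..1} \<times> {a..b} \<union> {0..1} \<times> {b..c}) (glue_second b H K)"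
  proof (intro continuous_on_closed_Un closed_Times closed_atLeastAtMost)
    show "continuous_on ({0..1} \<times> {a..b}) (glue_second b H K)"
      by (rule continuous_on_eq[OF H]) (auto simp: glue_second_def)
    show "continuous_on ({0..1} \<times> {b..c}) (glue_second b H K)"
    proof (rule continuous_on_eq[OF K])
      fix z assume "z \<in> {0..1::real} \<times> {b..c}"
      then show "K z = glue_second b H K z"
        using eq[of "fst z"] by (cases "snd z = b") (auto simp: glue_second_def)
    qed
  qed
  moreover have "{0..1::real} \<times> {a..b} \<union> {0..1} \<times> {b..c} = {0..1} \<times> {a..c}" using assms(4,5) by auto
  ultimately show ?thesis by simp
qed

lemma piecewise_differentiable_strip_compose:
  assumes H: "piecewise_differentiable_strip a b H" and \<rho>: "\<And>z. \<rho> differentiable (at z)"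
  shows "piecewise_differentiable_strip a b (\<lambda>z. \<rho> (H z))"
proof -
  have "(\<lambda>z. \<rho> (H z)) differentiable_on A" if "H differentiable_on A" for A
    using that \<rho> unfolding differentiable_on_def by (auto intro: differentiable_compose)
  then show ?thesis using H unfolding piecewise_differentiable_strip_def by meson
qed

lemma piecewise_differentiable_strip_reverse:
  assumes H: "piecewise_differentiable_strip a b H"
  shows "piecewise_differentiable_strip a b (\<lambda>z. H (1 - fst z, snd z))"
proof -
  obtain X Y where XY: "finite X" "finite Y"
    "\<And>s s' t t'. \<lbrakk>0 \<le> s; s < s'; s' \<le> 1; a \<le> t; t < t'; t' \<le> b; {s<..<s'} \<inter> X = {}; {t<..<t'} \<inter> Y = {}\<rbrakk>
       \<Longrightarrow> H differentiable_on {s..s'} \<times> {t..t'}"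
    by (rule piecewise_differentiable_stripE[OF H]) (rule that; assumption)
  show ?thesis unfolding piecewise_differentiable_strip_def
  proof (rule exI[of _ "(\<lambda>x. 1 - x) ` X"], rule exI[of _ Y], intro conjI allI impI)
    show "finite ((\<lambda>x. 1 - x) ` X)" "finite Y" using XY by auto
    fix s s' t t' assume st: "0 \<le> s \<and> s < s' \<and> s' \<le> 1 \<and> a \<le> t \<and> t < t' \<and> t' \<le> b \<and>
           {s<..<s'} \<inter> (\<lambda>x. 1 - x) ` X = {} \<and> {t<..<t'} \<inter> Y = {}"
    have "{1 - s'<..<1 - s} \<inter> X = {}"
    proof (rule ccontr)
      assume "\<not> ?thesis"
      then obtain x where x: "x \<in> X" "1 - s' < x" "x < 1 - s" by auto
      then have "1 - x \<in> {s<..<s'} \<inter> (\<lambda>x. 1 - x) ` X" by auto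
      then show False using st by blast
    qed
    then have "H differentiable_on {1 - s'..1 - s} \<times> {t..t'}" using st by (intro XY(3)) auto
    then have "(\<lambda>z. H ((-1) * fst z + 1, 1 * snd z + 0)) differentiable_on {s..s'} \<times> {t..t'}"
      by (rule differentiable_on_compose_Pair[OF _ differentiable_on_affine differentiable_on_affine]) auto
    then show "(\<lambda>z. H (1 - fst z, snd z)) differentiable_on {s..s'} \<times> {t..t'}" by simp
  qed
qed

section \<open>Counting preimages\<close>

text \<open>
  This majorizes the number of components and is subadditive under gluing.
\<close>

definition preimage_count :: "real \<Rightarrow> real \<Rightarrow> (real \<times> real \<Rightarrow> complex) \<Rightarrow> complex \<Rightarrow> ennreal" where
  "preimage_count a b H x = emeasure (count_space UNIV) {z \<in> {0..1} \<times> {a..b}. H z = x}"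

lemma count_image_le: "emeasure (count_space UNIV) (f ` A) \<le> emeasure (count_space UNIV) A"
  by (cases "finite A") (auto simp: emeasure_count_space card_image_le)

lemma count_Un_le: "emeasure (count_space UNIV) (A \<union> B) \<le> emeasure (count_space UNIV) A + emeasure (count_space UNIV) B"
  by (rule emeasure_subadditive) auto

lemma count_mono: "A \<subseteq> B \<Longrightarrow> emeasure (count_space UNIV) A \<le> emeasure (count_space UNIV) B"
  by (rule emeasure_mono) auto

lemma num_preimage_components_le: "num_preimage_components H x \<le> preimage_count 0 1 H x"
  unfolding num_preimage_components_def preimage_count_def components_def unit_square_def
  by (rule count_image_le)

lemma preimage_count_glue_first:
  "preimage_count a b (glue_first H K) x \<le> preimage_count a b H x + preimage_count a b K x"
proof -
  let ?f = "\<lambda>z::real \<times> real. (fst z / 2, snd z)" and ?g = "\<lambda>z::real \<times> real. ((fst z + 1) / 2, snd z)"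
  let ?A = "{z \<in> {0..1} \<times> {a..b}. H z = x}" and ?B = "{z \<in> {0..1} \<times> {a..b}. K z = x}"
  have "{z \<in> {0..1} \<times> {a..b}. glue_first H K z = x} \<subseteq> ?f ` ?A \<union> ?g ` ?B"
  proof
    fix z assume z: "z \<in> {z \<in> {0..1} \<times> {a..b}. glue_first H K z = x}"
    show "z \<in> ?f ` ?A \<union> ?g ` ?B"
    proof (cases "fst z \<le> 1/2")
      case True
      then have "(2 * fst z, snd z) \<in> ?A" using z by (auto simp: glue_first_def)
      then show ?thesis by (intro UnI1 image_eqI[of _ _ "(2 * fst z, snd z)"]) auto
    next
      case False
      then have "(2 * fst z - 1, snd z) \<in> ?B" using z by (auto simp: glue_first_def)
      then show ?thesis by (intro UnI2 image_eqI[of _ _ "(2 * fst z - 1, snd z)"]) auto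
    qed
  qed
  then have "preimage_count a b (glue_first H K) x \<le> emeasure (count_space UNIV) (?f ` ?A \<union> ?g ` ?B)"
    unfolding preimage_count_def by (rule count_mono)
  also have "\<dots> \<le> emeasure (count_space UNIV) (?f ` ?A) + emeasure (count_space UNIV) (?g ` ?B)" by (rule count_Un_le)
  also have "\<dots> \<le> preimage_count a b H x + preimage_count a b K x"
    unfolding preimage_count_def by (intro add_mono count_image_le)
  finally show ?thesis .
qed

lemma preimage_count_glue_second:
  "preimage_count a c (glue_second b H K) x \<le> preimage_count a b H x + preimage_count b c K x"
proof -
  have "{z \<in> {0..1} \<times> {a..c}. glue_second b H K z = x} \<subseteq>
    {z \<in> {0..1} \<times> {a..b}. H z = x} \<union> {z \<in> {0..1} \<times> {b..c}. K z = x}"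
    by (auto simp: glue_second_def split: if_splits)
  then show ?thesis unfolding preimage_count_def using count_mono count_Un_le order_trans by blast
qed

lemma preimage_count_reverse:
  "preimage_count a b (\<lambda>z. H (1 - fst z, snd z)) x \<le> preimage_count a b H x"
proof -
  have "{z \<in> {0..1} \<times> {a..b}. H (1 - fst z, snd z) = x} \<subseteq> (\<lambda>z. (1 - fst z, snd z)) ` {z \<in> {0..1} \<times> {a..b}. H z = x}"
  proof
    fix z assume "z \<in> {z \<in> {0..1} \<times> {a..b}. H (1 - fst z, snd z) = x}"
    then show "z \<in> (\<lambda>z. (1 - fst z, snd z)) ` {z \<in> {0..1} \<times> {a..b}. H z = x}"
      by (intro image_eqI[of _ _ "(1 - fst z, snd z)"]) auto
  qed
  then show ?thesis unfolding preimage_count_def using count_mono count_image_le order_trans by blast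
qed

lemma preimage_count_eq_0: "(\<And>z. z \<in> {0..1} \<times> {a..b} \<Longrightarrow> H z \<noteq> x) \<Longrightarrow> preimage_count a b H x = 0"
proof -
  assume "\<And>z. z \<in> {0..1} \<times> {a..b} \<Longrightarrow> H z \<noteq> x"
  then have "{z \<in> {0..1} \<times> {a..b}. H z = x} = {}" by blast
  then show ?thesis by (simp only: preimage_count_def emeasure_empty)
qed

section \<open>Thin rectilinear closings of arcs\<close>

definition piecewise_differentiable_path :: "(real \<Rightarrow> complex) \<Rightarrow> bool" where
  "piecewise_differentiable_path g \<longleftrightarrow>
     (\<exists>Y. finite Y \<and> (\<forall>t t'. 0 \<le> t \<and> t < t' \<and> t' \<le> 1 \<and> {t<..<t'} \<inter> Y = {} \<longrightarrow> g differentiable_on {t..t'}))"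

lemma differentiable_on_compose_affine:
  fixes g :: "real \<Rightarrow> complex"
  assumes "g differentiable_on S" "\<And>x. x \<in> A \<Longrightarrow> m * x + c \<in> S"
  shows "(\<lambda>x. g (m * x + c)) differentiable_on A"
  unfolding differentiable_on_def
proof
  fix x assume x: "x \<in> A"
  have "(\<lambda>x. m * x + c) differentiable (at x within A)" by (auto intro!: derivative_intros)
  moreover have "g differentiable (at (m * x + c) within (\<lambda>x. m * x + c) ` A)"
    using assms x by (meson differentiable_on_def differentiable_within_subset image_subsetI)
  ultimately show "(\<lambda>x. g (m * x + c)) differentiable (at x within A)"
    using differentiable_chain_within[of "\<lambda>x. m * x + c" x A g] by (simp add: o_def)
qed

lemma piecewise_differentiable_path_linepath: "piecewise_differentiable_path (linepath a b)"
proof -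
  have "linepath a b differentiable_on A" for A
    unfolding linepath_def by (intro differentiable_at_imp_differentiable_on) (auto intro!: derivative_intros)
  then show ?thesis unfolding piecewise_differentiable_path_def by (intro exI[of _ "{}"]) auto
qed

lemma piecewise_differentiable_path_subpath:
  assumes g: "piecewise_differentiable_path g" and u: "0 \<le> u" "u < v" "v \<le> 1"
  shows "piecewise_differentiable_path (subpath u v g)"
proof -
  obtain Y where Y: "finite Y" and
    d: "\<forall>t t'. 0 \<le> t \<and> t < t' \<and> t' \<le> 1 \<and> {t<..<t'} \<inter> Y = {} \<longrightarrow> g differentiable_on {t..t'}"
    using g unfolding piecewise_differentiable_path_def by (elim exE conjE) (rule that; assumption)
  define f where "f = (\<lambda>x. (v - u) * x + u)"
  have fmono: "f s < f t \<longleftrightarrow> s < t" "f s \<le> f t \<longleftrightarrow> s \<le> t" for s t using u by (auto simp: f_def)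
  have f01: "f 0 = u" "f 1 = v" by (auto simp: f_def)
  have "inj f" using u by (auto simp: inj_on_def f_def)
  show ?thesis unfolding piecewise_differentiable_path_def
  proof (intro exI[of _ "f -` Y"] conjI allI impI)
    show "finite (f -` Y)" using Y \<open>inj f\<close> by (simp add: finite_vimageI)
    fix t t' assume t: "0 \<le> t \<and> t < t' \<and> t' \<le> 1 \<and> {t<..<t'} \<inter> f -` Y = {}"
    have "{f t<..<f t'} \<inter> Y = {}"
    proof (rule ccontr)
      assume "\<not> ?thesis"
      then obtain y where y: "y \<in> Y" "f t < y" "y < f t'" by auto
      define x where "x = (y - u) / (v - u)"
      have "f x = y" using u by (simp add: x_def f_def)
      then have "x \<in> {t<..<t'} \<inter> f -` Y" using y fmono(1)[of t x] fmono(1)[of x t'] by auto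
      then show False using t by blast
    qed
    moreover have "0 \<le> f t" "f t < f t'" "f t' \<le> 1" using t u fmono(2)[of 0 t] fmono(2)[of t' 1] fmono(1)[of t t'] f01 by auto
    ultimately have "g differentiable_on {f t..f t'}" using d by blast
    then have "(\<lambda>x. g ((v - u) * x + u)) differentiable_on {t..t'}"
    proof (rule differentiable_on_compose_affine)
      fix x assume "x \<in> {t..t'}"
      then show "(v - u) * x + u \<in> {f t..f t'}" using fmono(2)[of t x] fmono(2)[of x t'] unfolding f_def by auto
    qed
    then show "subpath u v g differentiable_on {t..t'}" by (simp add: subpath_def)
  qed
qed

lemma piecewise_differentiable_path_join:
  assumes g: "piecewise_differentiable_path g" and h: "piecewise_differentiable_path h" and eq: "pathfinish g = pathstart h"
  shows "piecewise_differentiable_path (g +++ h)"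
proof -
  obtain Y where Y: "finite Y" and
    d: "\<forall>t t'. 0 \<le> t \<and> t < t' \<and> t' \<le> 1 \<and> {t<..<t'} \<inter> Y = {} \<longrightarrow> g differentiable_on {t..t'}"
    using g unfolding piecewise_differentiable_path_def by (elim exE conjE) (rule that; assumption)
  obtain Y' where Y': "finite Y'" and
    d': "\<forall>t t'. 0 \<le> t \<and> t < t' \<and> t' \<le> 1 \<and> {t<..<t'} \<inter> Y' = {} \<longrightarrow> h differentiable_on {t..t'}"
    using h unfolding piecewise_differentiable_path_def by (elim exE conjE) (rule that; assumption)
  define Z where "Z = insert (1/2) ((\<lambda>x. x / 2) ` Y \<union> (\<lambda>x. (x + 1) / 2) ` Y')"
  show ?thesis unfolding piecewise_differentiable_path_def
  proof (intro exI[of _ Z] conjI allI impI)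
    show "finite Z" using Y Y' by (auto simp: Z_def)
    fix t t' assume t: "0 \<le> t \<and> t < t' \<and> t' \<le> 1 \<and> {t<..<t'} \<inter> Z = {}"
    consider "t' \<le> 1/2" | "1/2 \<le> t" using t by (auto simp: Z_def)
    then show "g +++ h differentiable_on {t..t'}"
    proof cases
      case 1
      have "{2 * t<..<2 * t'} \<inter> Y = {}"
      proof (rule ccontr)
        assume "\<not> ?thesis"
        then obtain x where x: "x \<in> Y" "2 * t < x" "x < 2 * t'" by auto
        then have "x / 2 \<in> {t<..<t'} \<inter> Z" by (auto simp: Z_def)
        then show False using t by blast
      qed
      then have "g differentiable_on {2 * t..2 * t'}" using d t 1 by simp
      then have "(\<lambda>x. g (2 * x + 0)) differentiable_on {t..t'}"
        by (rule differentiable_on_compose_affine) auto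
      then show ?thesis by (rule differentiable_on_eq) (use 1 in \<open>auto simp: joinpaths_def\<close>)
    next
      case 2
      have "{2 * t - 1<..<2 * t' - 1} \<inter> Y' = {}"
      proof (rule ccontr)
        assume "\<not> ?thesis"
        then obtain x where x: "x \<in> Y'" "2 * t - 1 < x" "x < 2 * t' - 1" by auto
        then have "(x + 1) / 2 \<in> {t<..<t'} \<inter> Z" by (auto simp: Z_def)
        then show False using t by blast
      qed
      then have "h differentiable_on {2 * t - 1..2 * t' - 1}" using d' t 2 by simp
      then have "(\<lambda>x. h (2 * x + (-1))) differentiable_on {t..t'}"
        by (rule differentiable_on_compose_affine) auto
      then show ?thesis
      proof (rule differentiable_on_eq)
        fix x assume x: "x \<in> {t..t'}"
        show "h (2 * x + (-1)) = (g +++ h) x"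
        proof (cases "x = 1/2")
          case True then show ?thesis using eq unfolding joinpaths_def True by (simp add: pathstart_def pathfinish_def)
        next
          case False then show ?thesis using x 2 by (auto simp: joinpaths_def)
        qed
      qed
    qed
  qed
qed

definition grid_lines :: "real set \<Rightarrow> real set \<Rightarrow> complex set" where
  "grid_lines X Y = {z. Re z \<in> X \<or> Im z \<in> Y}"

definition rectilinear_arc :: "(real \<Rightarrow> complex) \<Rightarrow> bool" where
  "rectilinear_arc g \<longleftrightarrow> arc g \<and> piecewise_differentiable_path g \<and>
     (\<exists>X Y. finite X \<and> finite Y \<and> path_image g \<subseteq> grid_lines X Y)"

lemma rectilinear_arc_linepath:
  assumes "a \<noteq> b" "Re a = Re b \<or> Im a = Im b"
  shows "rectilinear_arc (linepath a b)"
proof -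
  have "closed_segment a b \<subseteq> grid_lines (if Re a = Re b then {Re a} else {}) (if Im a = Im b then {Im a} else {})"
    using assms(2) by (auto simp: grid_lines_def closed_segment_def left_diff_distrib)
  then show ?thesis using assms(1) unfolding rectilinear_arc_def
    by (intro conjI arc_linepath piecewise_differentiable_path_linepath exI) (auto split: if_splits)
qed

text \<open>
  The arc is cut where the segment, followed from \<open>y\<close>, first meets it, and continued from there along
  the segment.
\<close>

lemma rectilinear_arc_extend_by_segment:
  assumes g: "rectilinear_arc g" and z: "z \<in> path_image g" and seg: "Re y = Re z \<or> Im y = Im z"
    and a: "pathstart g \<notin> closed_segment y z"
  obtains h where "rectilinear_arc h" "pathstart h = pathstart g" "pathfinish h = y"
    "path_image h \<subseteq> path_image g \<union> closed_segment y z"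
proof -
  obtain X Y where XY: "arc g" "piecewise_differentiable_path g" "finite X" "finite Y" "path_image g \<subseteq> grid_lines X Y"
    using g unfolding rectilinear_arc_def by blast
  have sub: "rectilinear_arc (subpath 0 u g) \<and> path_image (subpath 0 u g) \<subseteq> path_image g" if u: "0 < u" "u \<le> 1" for u
  proof -
    have "path_image (subpath 0 u g) \<subseteq> path_image g" using u by (intro path_image_subpath_subset) auto
    then show ?thesis unfolding rectilinear_arc_def
      using XY u by (auto intro!: arc_subpath_arc piecewise_differentiable_path_subpath)
  qed
  show thesis
  proof (cases "y \<in> path_image g")
    case True
    then obtain u where u: "u \<in> {0..1}" "y = g u" by (auto simp: path_image_def)
    have "u \<noteq> 0" using a u by (auto simp: pathstart_def)
    then show thesis using sub[of u] u by (intro that[of "subpath 0 u g"]) (auto simp: pathstart_def pathfinish_def subpath_def)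
  next
    case False
    define P where "P = {t \<in> {0..1}. linepath y z t \<in> path_image g}"
    have "closed ({0..1} \<inter> linepath y z -` path_image g)"
      by (intro continuous_closed_preimage continuous_intros closed_arc_image XY(1) closed_atLeastAtMost)
    then have "closed P" by (simp add: P_def vimage_def Int_def)
    moreover have "bounded P" by (rule bounded_subset[of "{0..1}"]) (auto simp: P_def)
    ultimately have "compact P" by (simp add: compact_eq_bounded_closed)
    moreover have "1 \<in> P" using z by (simp add: P_def linepath_1')
    ultimately obtain \<tau> where \<tau>: "\<tau> \<in> P" "\<And>t. t \<in> P \<Longrightarrow> \<tau> \<le> t" using compact_attains_inf[of P] by blast
    define w where "w = linepath y z \<tau>"
    have \<tau>01: "0 \<le> \<tau>" "\<tau> \<le> 1" "w \<in> path_image g" using \<tau>(1) by (auto simp: P_def w_def)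
    have wseg: "w \<in> closed_segment y z" using \<tau>01 linepath_in_path[of \<tau> y z] by (simp add: w_def)
    have "w \<noteq> y" using \<tau>01 False by auto
    obtain u where u: "u \<in> {0..1}" "w = g u" using \<tau>01(3) by (auto simp: path_image_def)
    have u0: "u \<noteq> 0" using a u wseg by (auto simp: pathstart_def)
    have line: "Re w = Re y \<or> Im w = Im y"
      using seg by (auto simp: w_def linepath_def algebra_simps)
    have segsub: "closed_segment w y \<subseteq> closed_segment y z"
      using wseg by (simp add: subset_closed_segment)
    have first: "x = w" if x: "x \<in> closed_segment w y" "x \<in> path_image g" for x
    proof -
      obtain r where r: "0 \<le> r" "r \<le> 1" "x = (1 - r) *\<^sub>R y + r *\<^sub>R w"
      proof -
        have "x \<in> closed_segment y w" by (subst closed_segment_commute) (rule x(1))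
        then show ?thesis using that by (auto simp: closed_segment_def)
      qed
      have "x = linepath y z (r * \<tau>)" unfolding r(3) w_def linepath_def
        by (simp add: algebra_simps scaleR_conv_of_real)
      moreover have "r * \<tau> \<le> 1 * \<tau>" using r(2) \<tau>01(1) by (rule mult_right_mono)
      moreover have "0 \<le> r * \<tau>" using r(1) \<tau>01(1) by (rule mult_nonneg_nonneg)
      ultimately have "r * \<tau> \<in> P" using x(2) \<tau>01 by (auto simp: P_def)
      then have "\<tau> \<le> r * \<tau>" using \<tau>(2) by blast
      moreover have "0 < \<tau>" using \<tau>01 \<open>w \<noteq> y\<close> by (cases "\<tau> = 0") (auto simp: w_def linepath_0')
      ultimately have "r = 1" using r by simp
      then show ?thesis using r(3) by simp
    qed
    define g1 where "g1 = subpath 0 u g"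
    have g1: "rectilinear_arc g1" "path_image g1 \<subseteq> path_image g" "pathstart g1 = pathstart g" "pathfinish g1 = w"
      using sub[of u] u u0 by (auto simp: g1_def pathstart_def pathfinish_def subpath_def)
    have l1: "rectilinear_arc (linepath w y)" using \<open>w \<noteq> y\<close> line by (intro rectilinear_arc_linepath) auto
    obtain X1 Y1 where 1: "finite X1" "finite Y1" "path_image g1 \<subseteq> grid_lines X1 Y1" using g1(1) by (auto simp: rectilinear_arc_def)
    obtain X2 Y2 where 2: "finite X2" "finite Y2" "path_image (linepath w y) \<subseteq> grid_lines X2 Y2"
      using l1 unfolding rectilinear_arc_def by blast
    have im: "path_image (g1 +++ linepath w y) = path_image g1 \<union> closed_segment w y"
      using g1 by (simp add: path_image_join)
    have "arc (g1 +++ linepath w y)"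
    proof (rule arc_join)
      show "arc g1" "arc (linepath w y)" using g1(1) l1 by (auto simp: rectilinear_arc_def)
      show "path_image g1 \<inter> path_image (linepath w y) \<subseteq> {pathstart (linepath w y)}"
        using first g1(2) by auto
    qed (use g1 in auto)
    moreover have "piecewise_differentiable_path (g1 +++ linepath w y)"
      using g1 l1 by (intro piecewise_differentiable_path_join) (auto simp: rectilinear_arc_def)
    moreover have "path_image (g1 +++ linepath w y) \<subseteq> grid_lines (X1 \<union> X2) (Y1 \<union> Y2)"
      using 1 2 unfolding im by (auto simp: grid_lines_def)
    ultimately have "rectilinear_arc (g1 +++ linepath w y)"
      unfolding rectilinear_arc_def using 1 2 by blast
    then show thesis
      by (rule that) (use g1 segsub im in auto)
  qed
qed

text \<open>
  Two points of a small square in \<open>U\<close> are joined by a horizontal and a vertical segment in that square,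
  so reachability is locally constant on the connected set \<open>U\<close>.
\<close>

lemma rectilinear_arc_reaches:
  assumes U: "open U" "connected U" "a \<notin> U" and p: "p \<in> U" "q \<in> U"
    and g: "rectilinear_arc g" "pathstart g = a" "pathfinish g = p" "path_image g \<subseteq> insert a U"
  obtains h where "rectilinear_arc h" "pathstart h = a" "pathfinish h = q" "path_image h \<subseteq> insert a U"
proof -
  define R where "R = (\<lambda>x. \<exists>h. rectilinear_arc h \<and> pathstart h = a \<and> pathfinish h = x \<and> path_image h \<subseteq> insert a U)"
  have step: "R y" if Rx: "R x" "Re y = Re x \<or> Im y = Im x" "closed_segment y x \<subseteq> U" for x y
  proof -
    obtain h where h: "rectilinear_arc h" "pathstart h = a" "pathfinish h = x" "path_image h \<subseteq> insert a U"
      using Rx(1) unfolding R_def by blast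
    have "x \<in> path_image h" using h(3) by auto
    moreover have "pathstart h \<notin> closed_segment y x" using h(2) U(3) Rx(3) by auto
    ultimately obtain k where "rectilinear_arc k" "pathstart k = pathstart h" "pathfinish k = y"
      "path_image k \<subseteq> path_image h \<union> closed_segment y x"
      using rectilinear_arc_extend_by_segment[OF h(1) _ Rx(2)] by metis
    then show ?thesis unfolding R_def using h Rx(3) by (intro exI[of _ k]) auto
  qed
  have "R q"
  proof (rule connected_induction_simple[OF U(2) p])
    show "R p" using g by (auto simp: R_def)
    fix x assume "x \<in> U"
    then obtain e where e: "e > 0" "ball x e \<subseteq> U" using U(1) openE by blast
    define T where "T = box (x - Complex (e/2) (e/2)) (x + Complex (e/2) (e/2))"
    have T: "open T" "convex T" "x \<in> T" using e(1) by (auto simp: T_def in_box_complex_iff)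
    have TU: "T \<subseteq> U"
    proof
      fix y assume "y \<in> T"
      then have "\<bar>Re (y - x)\<bar> < e/2" "\<bar>Im (y - x)\<bar> < e/2" unfolding abs_less_iff by (auto simp: T_def in_box_complex_iff)
      then have "norm (y - x) < e" using cmod_le[of "y - x"] by linarith
      then show "y \<in> U" using e(2) by (auto simp: dist_norm norm_minus_commute)
    qed
    have "R y'" if "y \<in> T" "y' \<in> T" "R y" for y y'
    proof -
      define m where "m = Complex (Re y) (Im y')"
      have "m \<in> T" using that by (auto simp: T_def m_def in_box_complex_iff)
      then have "closed_segment m y \<subseteq> U" "closed_segment y' m \<subseteq> U"
        using that T(2) TU closed_segment_subset by (meson order_trans)+
      then have "R m" using step[of y m] that(3) by (simp add: m_def)
      then show ?thesis using step[of m y'] \<open>closed_segment y' m \<subseteq> U\<close> by (simp add: m_def)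
    qed
    then show "\<exists>T. openin (top_of_set U) T \<and> x \<in> T \<and> (\<forall>x\<in>T. \<forall>y\<in>T. R x \<longrightarrow> R y)"
      by (intro exI[of _ T] conjI open_subset[OF TU T(1)] T(3)) blast
  qed
  then show thesis using that by (auto simp: R_def)
qed

text \<open>
  A path in the complement from \<open>x\<close> to a far point keeps a positive distance from \<open>A\<close>.
\<close>

lemma outside_closed_neighbourhoods:
  fixes A :: "complex set"
  assumes A: "compact A" "A \<noteq> {}" "connected (- A)" and x: "x \<notin> A"
  shows "\<exists>n::nat. x \<in> outside {z. infdist z A \<le> 1 / Suc n}"
proof -
  define K where "K = (\<lambda>n::nat. {z. infdist z A \<le> 1 / Suc n})"
  obtain r where r: "r > 0" "K 0 \<subseteq> cball 0 r"
  proof -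
    have "bounded (K 0)"
      unfolding K_def using compact_infdist_le[OF A(2,1), of 1] by (simp add: compact_imp_bounded)
    from bounded_subset_ballD[OF this, of 0] obtain r where "r > 0" "K 0 \<subseteq> ball 0 r" by blast
    then show ?thesis using that[of r] ball_subset_cball[of 0 r] by blast
  qed
  have Kr: "K n \<subseteq> cball 0 r" for n
  proof -
    have le: "1 / real (Suc n) \<le> 1 / real (Suc 0)" by (simp add: frac_le)
    have "K n \<subseteq> K 0" unfolding K_def by (rule Collect_mono) (blast intro: order_trans[OF _ le])
    then show ?thesis using r by blast
  qed
  have AK: "A \<subseteq> K n" for n by (auto simp: K_def)
  define y where "y = complex_of_real (r + 1)"
  have yr: "y \<notin> cball 0 r" using r by (simp add: y_def)
  have "y \<notin> A" using yr AK Kr by blast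
  have "path_component (- A) x y"
    using A(3) x \<open>y \<notin> A\<close> A(1) compact_imp_closed
    by (subst open_path_connected_component) (auto simp: connected_iff_connected_component open_Compl)
  then obtain g where g: "path g" "path_image g \<subseteq> - A" "pathstart g = x" "pathfinish g = y"
    by (auto simp: path_component_def)
  have disj: "path_image g \<inter> A = {}" and cl: "compact (path_image g)" "closed A"
    using g A by (auto simp: compact_path_image compact_imp_closed)
  from separate_compact_closed[OF cl disj]
  obtain d where "d > 0" "\<forall>p\<in>path_image g. \<forall>q\<in>A. d \<le> dist p q" by blast
  then have d: "d > 0" "\<And>p q. p \<in> path_image g \<Longrightarrow> q \<in> A \<Longrightarrow> d \<le> dist p q" by blast+
  obtain n :: nat where n: "1 / Suc n < d" using nat_approx_posE[OF d(1)] by metis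
  have "p \<notin> K n" if "p \<in> path_image g" for p
  proof -
    have "d \<le> infdist p A" using A(2) d(2)[OF that] by (simp add: infdist_def cINF_greatest)
    then show ?thesis using n by (simp add: K_def)
  qed
  then have "path_image g \<subseteq> - K n" by blast
  then have "connected_component (- K n) y x"
    unfolding connected_component_def using g connected_path_image pathstart_in_path_image pathfinish_in_path_image by blast
  moreover have "y \<in> outside (K n)"
    using outside_subset_convex[OF convex_cball Kr] yr by blast
  ultimately have "x \<in> outside (K n)" by (rule outside_same_component)
  then show ?thesis unfolding K_def by blast
qed

text \<open>
  The filled neighbourhoods of the arc shrink to the arc and so have small area eventually. A tube
  around the arc minus the arc is connected, because the arc does not separate the plane and
  Janiszewski's theorem keeps that property inside the tube. So a rectilinear arc in the tube joins the
  ends of two short axis-parallel segments that leave the ends of the arc.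
\<close>

theorem thin_rectilinear_closing:
  assumes \<alpha>: "arc \<alpha>" and null: "emeasure lborel (path_image \<alpha>) = 0" and \<delta>: "\<delta> > 0"
    and d0: "d0 \<in> {1, -1, \<i>, -\<i>}" "r0 > 0" "\<And>s. 0 < s \<Longrightarrow> s \<le> r0 \<Longrightarrow> pathstart \<alpha> + of_real s * d0 \<notin> path_image \<alpha>"
    and d1: "d1 \<in> {1, -1, \<i>, -\<i>}" "r1 > 0" "\<And>s. 0 < s \<Longrightarrow> s \<le> r1 \<Longrightarrow> pathfinish \<alpha> + of_real s * d1 \<notin> path_image \<alpha>"
  obtains \<beta> where "rectilinear_arc \<beta>" "pathstart \<beta> = pathstart \<alpha>" "pathfinish \<beta> = pathfinish \<alpha>"
    "path_image \<alpha> \<inter> path_image \<beta> \<subseteq> {pathstart \<alpha>, pathfinish \<alpha>}"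
    "emeasure lborel (inside (path_image \<alpha> \<union> path_image \<beta>)) < ennreal \<delta>"
proof -
  define A where "A = path_image \<alpha>"
  define a b where "a = pathstart \<alpha>" and "b = pathfinish \<alpha>"
  have A: "compact A" "A \<noteq> {}" "connected A" "connected (- A)" "a \<in> A" "b \<in> A" "a \<noteq> b"
    using \<alpha> arc_distinct_ends[OF \<alpha>] pathstart_in_path_image[of \<alpha>] pathfinish_in_path_image[of \<alpha>]
    by (simp_all add: A_def a_def b_def compact_arc_image connected_arc_image connected_arc_complement)
  define K where "K = (\<lambda>n::nat. {z. infdist z A \<le> 1 / Suc n})"
  have K: "compact (K n)" for n unfolding K_def using compact_infdist_le[OF A(2,1)] by simp
  define F where "F = (\<lambda>n. - outside (K n))"
  have clF: "closed (F n)" for n unfolding F_def by (intro closed_Compl open_outside compact_imp_closed K)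
  have bF: "bounded (F n)" for n
    using cobounded_outside[OF compact_imp_bounded[OF K]] by (simp add: F_def)
  have "decseq F"
  proof (rule decseq_SucI)
    fix n
    have le: "1 / real (Suc (Suc n)) \<le> 1 / real (Suc n)" by (simp add: frac_le)
    have "K (Suc n) \<subseteq> K n" unfolding K_def by (rule Collect_mono) (blast intro: order_trans[OF _ le])
    then show "F (Suc n) \<subseteq> F n" unfolding F_def using outside_mono by blast
  qed
  then have "(\<lambda>n. emeasure lborel (F n)) \<longlonglongrightarrow> emeasure lborel (\<Inter>n. F n)"
    using clF bF emeasure_bounded_finite by (intro Lim_emeasure_decseq) (auto simp: less_top)
  moreover have "(\<Inter>n. F n) \<subseteq> A"
    using outside_closed_neighbourhoods[OF A(1,2,4)] by (auto simp: F_def K_def)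
  then have "emeasure lborel (\<Inter>n. F n) \<le> emeasure lborel A"
    using borel_closed[OF compact_imp_closed[OF A(1)]] by (intro emeasure_mono) simp_all
  ultimately have "(\<lambda>n. emeasure lborel (F n)) \<longlonglongrightarrow> 0" using null by (simp add: A_def)
  then have "\<forall>\<^sub>F n in sequentially. emeasure lborel (F n) < ennreal \<delta>"
    using \<delta> by (intro order_tendstoD) auto
  then obtain n where n: "emeasure lborel (F n) < ennreal \<delta>" by (auto simp: eventually_sequentially)
  define \<eta> where "\<eta> = 1 / real (Suc n)"
  have \<eta>: "\<eta> > 0" by (simp add: \<eta>_def)
  define V where "V = (\<Union>x\<in>A. ball x \<eta>)"
  have "open V" unfolding V_def by auto
  have VK: "V \<subseteq> K n"
  proof
    fix z assume "z \<in> V"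
    then obtain x where "x \<in> A" "dist x z < \<eta>" by (auto simp: V_def)
    then show "z \<in> K n" using infdist_le[of x A z] by (simp add: K_def \<eta>_def dist_commute)
  qed
  have AV: "A \<subseteq> V" using \<eta> by (auto simp: V_def)
  have conV: "connected V"
  proof -
    have "V = \<Union>((\<lambda>x. A \<union> ball x \<eta>) ` A)" using AV A(2) by (auto simp: V_def)
    moreover have "connected (\<Union>((\<lambda>x. A \<union> ball x \<eta>) ` A))"
    proof (rule connected_Union)
      show "\<And>S. S \<in> (\<lambda>x. A \<union> ball x \<eta>) ` A \<Longrightarrow> connected S"
        using A(3) \<eta> by (auto intro!: connected_Un)
      show "\<Inter> ((\<lambda>x. A \<union> ball x \<eta>) ` A) \<noteq> {}" using A(2) by auto
    qed
    ultimately show ?thesis by simp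
  qed
  define U where "U = V - A"
  have "open U" unfolding U_def using \<open>open V\<close> A(1) by (intro open_Diff compact_imp_closed)
  have "connected U"
    unfolding connected_iff_connected_component
  proof (intro ballI)
    fix p q assume pq: "p \<in> U" "q \<in> U"
    have "connected_component (- (A \<union> frontier V)) p q"
    proof (rule Janiszewski[OF A(1) frontier_closed])
      have "A \<inter> frontier V = {}" using AV \<open>open V\<close> by (auto simp: frontier_def interior_open)
      then show "connected (A \<inter> frontier V)" by simp
      show "connected_component (- A) p q" using A(4) pq by (auto simp: connected_iff_connected_component U_def)
      show "connected_component (- frontier V) p q"
        unfolding connected_component_def using conV pq \<open>open V\<close>
        by (intro exI[of _ V]) (auto simp: U_def frontier_def interior_open)
    qed
    then obtain C where C: "connected C" "C \<subseteq> - (A \<union> frontier V)" "p \<in> C" "q \<in> C"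
      by (auto simp: connected_component_def)
    have "C \<subseteq> V"
    proof (rule ccontr)
      assume "\<not> C \<subseteq> V"
      then have "C \<inter> frontier V \<noteq> {}" using connected_Int_frontier[OF C(1), of V] C(3) pq by (auto simp: U_def)
      then show False using C(2) by blast
    qed
    then show "connected_component U p q" unfolding connected_component_def U_def using C by blast
  qed
  have unit: "norm d0 = 1" "norm d1 = 1" "d0 \<noteq> 0" "d1 \<noteq> 0" using d0(1) d1(1) by auto
  have segU: "x + of_real s * d \<in> U"
    if "x \<in> A" "0 < s" "s \<le> \<eta> / 2" "norm d = 1" "x + of_real s * d \<notin> A" for x s d
  proof -
    have "dist x (x + of_real s * d) = s" using that by (simp add: dist_norm norm_mult)
    then have "x + of_real s * d \<in> ball x \<eta>" using that \<eta> by simp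
    then show ?thesis using that by (auto simp: U_def V_def)
  qed
  define s0 s1 where "s0 = min r0 (\<eta> / 2)" and "s1 = min r1 (\<eta> / 2)"
  have s01: "0 < s0" "0 < s1" using d0 d1 \<eta> by (auto simp: s0_def s1_def)
  define z0 z1 where "z0 = a + of_real s0 * d0" and "z1 = b + of_real s1 * d1"
  have seg: "closed_segment x (x + of_real s * d) \<subseteq> insert x U"
    if sd: "x \<in> A" "norm d = 1" "0 < s" "s \<le> \<eta>/2" "\<And>t. 0 < t \<Longrightarrow> t \<le> s \<Longrightarrow> x + of_real t * d \<notin> A" for x s d
  proof
    fix y assume "y \<in> closed_segment x (x + of_real s * d)"
    then obtain r where r: "0 \<le> r" "r \<le> 1" "y = (1 - r) *\<^sub>R x + r *\<^sub>R (x + of_real s * d)" by (auto simp: closed_segment_def)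
    have y: "y = x + of_real (r * s) * d" unfolding r(3) by (simp add: algebra_simps scaleR_conv_of_real)
    show "y \<in> insert x U"
    proof (cases "r = 0")
      case False
      have "r * s \<le> 1 * s" using r(2) less_imp_le[OF sd(3)] by (rule mult_right_mono)
      then have "r * s \<le> s" by simp
      moreover have "r * s \<le> \<eta> / 2" using \<open>r * s \<le> s\<close> sd(4) by (rule order_trans)
      moreover have "0 < r * s" using sd(3) r(1) False by simp
      ultimately have rs: "0 < r * s" "r * s \<le> s" "r * s \<le> \<eta> / 2" by blast+
      then have "y \<in> U" unfolding y using sd(5)[OF rs(1,2)] by (intro segU[OF sd(1)] sd(2)) auto
      then show ?thesis by simp
    qed (simp add: y)
  qed
  have s0le: "s0 \<le> \<eta> / 2" "s0 \<le> r0" and s1le: "s1 \<le> \<eta> / 2" "s1 \<le> r1" by (simp_all add: s0_def s1_def)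
  have off0: "a + of_real t * d0 \<notin> A" if "0 < t" "t \<le> s0" for t
    unfolding a_def A_def using that(1) order_trans[OF that(2) s0le(2)] by (rule d0(3))
  have off1: "b + of_real t * d1 \<notin> A" if "0 < t" "t \<le> s1" for t
    unfolding b_def A_def using that(1) order_trans[OF that(2) s1le(2)] by (rule d1(3))
  have g0: "closed_segment a z0 \<subseteq> insert a U" "z0 \<in> U" "closed_segment b z1 \<subseteq> insert b U" "z1 \<in> U"
    unfolding z0_def z1_def
    by (rule seg[OF A(5) unit(1) s01(1) s0le(1) off0], assumption+)
      (rule segU[OF A(5) s01(1) s0le(1) unit(1) off0[OF s01(1) order_refl]],
       rule seg[OF A(6) unit(2) s01(2) s1le(1) off1], assumption+,
       rule segU[OF A(6) s01(2) s1le(1) unit(2) off1[OF s01(2) order_refl]])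
  have axis: "Re a = Re z0 \<or> Im a = Im z0" "Re b = Re z1 \<or> Im b = Im z1"
    using d0(1) d1(1) by (auto simp: z0_def z1_def)
  have "a \<noteq> z0" using s01 unit by (auto simp: z0_def)
  have "a \<notin> U" "b \<notin> U" using A by (auto simp: U_def)
  obtain h where h: "rectilinear_arc h" "pathstart h = a" "pathfinish h = z1" "path_image h \<subseteq> insert a U"
  proof (rule rectilinear_arc_reaches[OF \<open>open U\<close> \<open>connected U\<close> \<open>a \<notin> U\<close> g0(2,4)])
    show "rectilinear_arc (linepath a z0)" using \<open>a \<noteq> z0\<close> axis by (intro rectilinear_arc_linepath) auto
  qed (use g0 in auto)
  have "pathstart h \<notin> closed_segment b z1" using h(2) g0(3) \<open>a \<notin> U\<close> A(7) by auto
  moreover have "z1 \<in> path_image h" using h(3) by auto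
  ultimately obtain \<beta> where \<beta>: "rectilinear_arc \<beta>" "pathstart \<beta> = pathstart h" "pathfinish \<beta> = b"
    "path_image \<beta> \<subseteq> path_image h \<union> closed_segment b z1"
    using rectilinear_arc_extend_by_segment[OF h(1) _ axis(2)] by metis
  have \<beta>im: "path_image \<beta> \<subseteq> insert a (insert b U)" using \<beta>(4) h(4) g0(3) by blast
  show thesis
  proof (rule that[OF \<beta>(1)])
    show "pathstart \<beta> = pathstart \<alpha>" "pathfinish \<beta> = pathfinish \<alpha>" using \<beta> h by (auto simp: a_def b_def)
    show "path_image \<alpha> \<inter> path_image \<beta> \<subseteq> {pathstart \<alpha>, pathfinish \<alpha>}"
      using \<beta>im by (auto simp: A_def U_def a_def b_def)
    have "path_image \<alpha> \<union> path_image \<beta> \<subseteq> K n" using \<beta>im AV VK A by (auto simp: A_def U_def)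
    then have "inside (path_image \<alpha> \<union> path_image \<beta>) \<subseteq> F n"
      unfolding F_def using outside_mono inside_Int_outside[of "path_image \<alpha> \<union> path_image \<beta>"] by blast
    then have "emeasure lborel (inside (path_image \<alpha> \<union> path_image \<beta>)) \<le> emeasure lborel (F n)"
      using clF by (intro emeasure_mono) auto
    then show "emeasure lborel (inside (path_image \<alpha> \<union> path_image \<beta>)) < ennreal \<delta>" using n by simp
  qed
qed

section \<open>Sweeping a normal curve onto a grid\<close>

text \<open>
  Near its start the arc stays close to the direction \<open>v\<close>, so that an axis direction with no positive
  component along \<open>v\<close> leaves it.
\<close>

lemma axis_direction_avoiding_arc:
  assumes \<alpha>: "arc \<alpha>" and v: "(\<alpha> has_vector_derivative v) (at 0 within {0..1})" "v \<noteq> 0"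
  obtains d r where "d \<in> {1, -1, \<i>, -\<i>}" "r > 0"
    "\<And>s. 0 < s \<Longrightarrow> s \<le> r \<Longrightarrow> pathstart \<alpha> + of_real s * d \<notin> path_image \<alpha>"
proof -
  have re: "((\<lambda>t. Re (\<alpha> t)) has_real_derivative Re v) (at 0 within {0..1})"
    using bounded_linear.has_vector_derivative[OF bounded_linear_Re v(1)]
    by (simp add: has_real_derivative_iff_has_vector_derivative)
  have im: "((\<lambda>t. Im (\<alpha> t)) has_real_derivative Im v) (at 0 within {0..1})"
    using bounded_linear.has_vector_derivative[OF bounded_linear_Im v(1)]
    by (simp add: has_real_derivative_iff_has_vector_derivative)
  have "\<exists>d\<in>{1,-1}. \<exists>e>0. \<forall>h s. 0 < h \<and> h < e \<and> h \<le> 1 \<and> 0 < s \<longrightarrow> \<alpha> h \<noteq> \<alpha> 0 + of_real s * d"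
  proof -
    have "Re v > 0 \<or> Re v < 0 \<or> Im v > 0 \<or> Im v < 0"
      using v(2) unfolding complex_eq_iff zero_complex.sel by linarith
    then consider "Re v > 0" | "Re v < 0" | "Im v > 0" | "Im v < 0" by blast
    then show ?thesis
    proof cases
      case 1
      obtain e where e: "e > 0" "\<And>h. h > 0 \<Longrightarrow> 0 + h \<in> {0..1} \<Longrightarrow> h < e \<Longrightarrow> Re (\<alpha> 0) < Re (\<alpha> (0 + h))"
        using has_real_derivative_pos_inc_right[OF re 1] by blast
      have "\<alpha> h \<noteq> \<alpha> 0 + of_real s * (-1)" if "0 < h \<and> h < e \<and> h \<le> 1 \<and> 0 < s" for h s
        using e(2)[of h] that by (auto simp: complex_eq_iff)
      then show ?thesis using e(1) by blast
    next
      case 2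
      obtain e where e: "e > 0" "\<And>h. h > 0 \<Longrightarrow> 0 + h \<in> {0..1} \<Longrightarrow> h < e \<Longrightarrow> Re (\<alpha> 0) > Re (\<alpha> (0 + h))"
        using has_real_derivative_neg_dec_right[OF re 2] by blast
      have "\<alpha> h \<noteq> \<alpha> 0 + of_real s * 1" if "0 < h \<and> h < e \<and> h \<le> 1 \<and> 0 < s" for h s
        using e(2)[of h] that by (auto simp: complex_eq_iff)
      then show ?thesis using e(1) by blast
    next
      case 3
      obtain e where e: "e > 0" "\<And>h. h > 0 \<Longrightarrow> 0 + h \<in> {0..1} \<Longrightarrow> h < e \<Longrightarrow> Im (\<alpha> 0) < Im (\<alpha> (0 + h))"
        using has_real_derivative_pos_inc_right[OF im 3] by blast
      have "\<alpha> h \<noteq> \<alpha> 0 + of_real s * 1" if "0 < h \<and> h < e \<and> h \<le> 1 \<and> 0 < s" for h s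
        using e(2)[of h] that by (auto simp: complex_eq_iff)
      then show ?thesis using e(1) by blast
    next
      case 4
      obtain e where e: "e > 0" "\<And>h. h > 0 \<Longrightarrow> 0 + h \<in> {0..1} \<Longrightarrow> h < e \<Longrightarrow> Im (\<alpha> 0) > Im (\<alpha> (0 + h))"
        using has_real_derivative_neg_dec_right[OF im 4] by blast
      have "\<alpha> h \<noteq> \<alpha> 0 + of_real s * 1" if "0 < h \<and> h < e \<and> h \<le> 1 \<and> 0 < s" for h s
        using e(2)[of h] that by (auto simp: complex_eq_iff)
      then show ?thesis using e(1) by blast
    qed
  qed
  then obtain d e where d: "d \<in> {1, -1}" "e > 0"
    and de: "\<And>h s. 0 < h \<and> h < e \<and> h \<le> 1 \<and> 0 < s \<Longrightarrow> \<alpha> h \<noteq> \<alpha> 0 + of_real s * d" by blast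
  have inj: "inj_on \<alpha> {0..1}" and cont: "continuous_on {0..1} \<alpha>" using \<alpha> by (auto simp: arc_def path_def)
  have "compact (\<alpha> ` {min e 1..1})"
    using d(2) by (intro compact_continuous_image continuous_on_subset[OF cont]) auto
  moreover have "\<alpha> 0 \<notin> \<alpha> ` {min e 1..1}"
  proof
    assume "\<alpha> 0 \<in> \<alpha> ` {min e 1..1}"
    then obtain h where h: "h \<in> {min e 1..1}" "\<alpha> 0 = \<alpha> h" by blast
    then have "0 = h" using d(2) by (intro inj_onD[OF inj h(2)]) auto
    then show False using h(1) d(2) by auto
  qed
  ultimately obtain r where r: "r > 0" "\<And>x. x \<in> \<alpha> ` {min e 1..1} \<Longrightarrow> r \<le> dist (\<alpha> 0) x"
    using separate_point_closed compact_imp_closed by metis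
  show thesis
  proof (rule that)
    show "d \<in> {1, -1, \<i>, -\<i>}" "r / 2 > 0" using d r by auto
    have nd: "norm d = 1" using d(1) by auto
    fix s :: real assume s: "0 < s" "s \<le> r / 2"
    show "pathstart \<alpha> + of_real s * d \<notin> path_image \<alpha>"
    proof
      assume "pathstart \<alpha> + of_real s * d \<in> path_image \<alpha>"
      then obtain h where h: "0 \<le> h" "h \<le> 1" "\<alpha> h = \<alpha> 0 + of_real s * d"
        unfolding path_image_def pathstart_def by force
      have "dist (\<alpha> 0) (\<alpha> h) = s" unfolding h(3) using s nd by (simp add: dist_norm norm_mult)
      moreover have "h \<noteq> 0" using h(3) s nd by auto
      moreover have "\<not> h < e" using de[of h s] h s \<open>h \<noteq> 0\<close> by linarith
      then have "\<alpha> h \<in> \<alpha> ` {min e 1..1}" using h(1,2) by (intro imageI) auto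
      ultimately show False using r(1) r(2)[of "\<alpha> h"] s by linarith
    qed
  qed
qed

lemma indicator_inside_locally_constant:
  fixes J :: "complex set"
  assumes "compact J" "x \<notin> J"
  shows "\<exists>e>0. \<forall>y\<in>ball x e. indicator (inside J) y = (indicator (inside J) x :: ennreal)"
proof -
  note op = open_inside[OF compact_imp_closed[OF assms(1)]] open_outside[OF compact_imp_closed[OF assms(1)]]
  show ?thesis
  proof (cases "x \<in> inside J")
    case True
    then obtain e where "e > 0" "ball x e \<subseteq> inside J" using op(1) unfolding open_contains_ball by blast
    then show ?thesis using True by (intro exI[of _ e]) (auto simp: indicator_def)
  next
    case False
    then have "x \<in> outside J" using assms(2) inside_Un_outside[of J] by blast
    then obtain e where e: "e > 0" "ball x e \<subseteq> outside J" using op(2) unfolding open_contains_ball by blast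
    then have "y \<notin> inside J" if "y \<in> ball x e" for y using that inside_Int_outside[of J] by blast
    then show ?thesis using False e(1) by (intro exI[of _ e]) (simp add: indicator_def)
  qed
qed

lemma piecewise_differentiable_strip_rescale:
  assumes H: "piecewise_differentiable_strip 0 1 H" and ab: "a < b"
  shows "piecewise_differentiable_strip a b (\<lambda>z. H (fst z, (snd z - a) / (b - a)))"
proof -
  obtain X Y where XY: "finite X" "finite Y"
    "\<And>s s' t t'. \<lbrakk>0 \<le> s; s < s'; s' \<le> 1; 0 \<le> t; t < t'; t' \<le> 1; {s<..<s'} \<inter> X = {}; {t<..<t'} \<inter> Y = {}\<rbrakk>
       \<Longrightarrow> H differentiable_on {s..s'} \<times> {t..t'}"
    by (rule piecewise_differentiable_stripE[OF H]) (rule that; assumption)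
  define f where "f = (\<lambda>t. (t - a) / (b - a))"
  define g where "g = (\<lambda>t. a + t * (b - a))"
  have fg: "f (g t) = t" "g (f t) = t" for t using ab by (simp_all add: f_def g_def)
  have flt: "f s < f t \<longleftrightarrow> s < t" "f s \<le> f t \<longleftrightarrow> s \<le> t" for s t using ab by (simp_all add: f_def divide_less_cancel divide_le_cancel)
  have f01: "f a = 0" "f b = 1" using ab by (simp_all add: f_def)
  show ?thesis unfolding piecewise_differentiable_strip_def
  proof (rule exI[of _ X], rule exI[of _ "g ` Y"], intro conjI allI impI)
    show "finite X" "finite (g ` Y)" using XY by auto
    fix s s' t t' assume st: "0 \<le> s \<and> s < s' \<and> s' \<le> 1 \<and> a \<le> t \<and> t < t' \<and> t' \<le> b \<and>
           {s<..<s'} \<inter> X = {} \<and> {t<..<t'} \<inter> g ` Y = {}"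
    have "{f t<..<f t'} \<inter> Y = {}"
    proof (rule ccontr)
      assume "\<not> ?thesis"
      then obtain y where y: "y \<in> Y" "f t < y" "y < f t'" by auto
      then have "t < g y" "g y < t'" using flt(1)[of t "g y"] flt(1)[of "g y" t'] by (simp_all add: fg)
      then have "g y \<in> {t<..<t'} \<inter> g ` Y" using y(1) by simp
      then show False using st by blast
    qed
    moreover have "0 \<le> f t" "f t < f t'" "f t' \<le> 1" using st flt(2)[of a t] flt(2)[of t' b] flt(1)[of t t'] by (simp_all add: f01)
    ultimately have "H differentiable_on {s..s'} \<times> {f t..f t'}" using st by (intro XY(3)) auto
    then have "(\<lambda>z. H (1 * fst z + 0, (1 / (b - a)) * snd z + (- a / (b - a)))) differentiable_on {s..s'} \<times> {t..t'}"
    proof (rule differentiable_on_compose_Pair[OF _ differentiable_on_affine differentiable_on_affine])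
      fix x y assume xy: "x \<in> {s..s'}" "y \<in> {t..t'}"
      have "1 / (b - a) * y + - a / (b - a) = f y" by (simp add: f_def diff_divide_distrib)
      then show "(1 * x + 0, 1 / (b - a) * y + - a / (b - a)) \<in> {s..s'} \<times> {f t..f t'}"
        using xy by (simp add: flt)
    qed
    moreover have "1 / (b - a) * y + - a / (b - a) = (y - a) / (b - a)" for y by (simp add: diff_divide_distrib)
    ultimately show "(\<lambda>z. H (fst z, (snd z - a) / (b - a))) differentiable_on {s..s'} \<times> {t..t'}" by simp
  qed
qed

lemma preimage_count_rescale:
  assumes ab: "a < b"
  shows "preimage_count a b (\<lambda>z. H (fst z, (snd z - a) / (b - a))) x \<le> preimage_count 0 1 H x"
proof -
  have "{z \<in> {0..1} \<times> {a..b}. H (fst z, (snd z - a) / (b - a)) = x}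
      \<subseteq> (\<lambda>z. (fst z, a + snd z * (b - a))) ` {z \<in> {0..1} \<times> {0..1}. H z = x}"
  proof
    fix z :: "real \<times> real" assume z: "z \<in> {z \<in> {0..1} \<times> {a..b}. H (fst z, (snd z - a) / (b - a)) = x}"
    then show "z \<in> (\<lambda>z. (fst z, a + snd z * (b - a))) ` {z \<in> {0..1} \<times> {0..1}. H z = x}"
      using ab by (intro image_eqI[of _ _ "(fst z, (snd z - a) / (b - a))"]) (auto simp: prod_eq_iff)
  qed
  then show ?thesis unfolding preimage_count_def using count_mono count_image_le order_trans by blast
qed

text \<open>
  The arc of \<open>c\<close> over \<open>{a..b}\<close> can be moved onto a grid such that its multiplicity is bounded by a
  function of integral at most \<open>\<delta>\<close>. Local constancy off the curve and the grid allows values of that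
  function to be read off at nearby points.
\<close>

definition sweepable :: "(real \<Rightarrow> complex) \<Rightarrow> real \<Rightarrow> real \<Rightarrow> ennreal \<Rightarrow> bool" where
  "sweepable c a b \<delta> \<longleftrightarrow> (\<exists>S X Y w. finite X \<and> finite Y \<and> w \<in> borel_measurable borel \<and> (\<integral>\<^sup>+x. w x \<partial>lborel) \<le> \<delta> \<and>
     continuous_on ({0..1} \<times> {a..b}) S \<and> piecewise_differentiable_strip a b S \<and>
     (\<forall>t\<in>{a..b}. S (0, t) = c t \<and> S (1, t) \<in> grid_lines X Y) \<and>
     (\<forall>s\<in>{0..1}. S (s, a) = c a \<and> S (s, b) = c b) \<and>
     (\<forall>x. x \<notin> path_image c \<union> grid_lines X Y \<longrightarrow>
        preimage_count a b S x \<le> w x \<and> (\<exists>e>0. \<forall>y\<in>ball x e. w y = w x)))"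

lemma sweepableE:
  assumes "sweepable c a b \<delta>"
  obtains S X Y w where "finite X" "finite Y" "w \<in> borel_measurable borel" "(\<integral>\<^sup>+x. w x \<partial>lborel) \<le> \<delta>"
    "continuous_on ({0..1} \<times> {a..b}) S" "piecewise_differentiable_strip a b S"
    "\<And>t. t \<in> {a..b} \<Longrightarrow> S (0, t) = c t" "\<And>t. t \<in> {a..b} \<Longrightarrow> S (1, t) \<in> grid_lines X Y"
    "\<And>s. s \<in> {0..1} \<Longrightarrow> S (s, a) = c a" "\<And>s. s \<in> {0..1} \<Longrightarrow> S (s, b) = c b"
    "\<And>x. x \<notin> path_image c \<union> grid_lines X Y \<Longrightarrow> preimage_count a b S x \<le> w x"
    "\<And>x. x \<notin> path_image c \<union> grid_lines X Y \<Longrightarrow> \<exists>e>0. \<forall>y\<in>ball x e. w y = w x"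
proof -
  obtain S X Y w where *: "finite X \<and> finite Y \<and> w \<in> borel_measurable borel \<and> (\<integral>\<^sup>+x. w x \<partial>lborel) \<le> \<delta> \<and>
     continuous_on ({0..1} \<times> {a..b}) S \<and> piecewise_differentiable_strip a b S \<and>
     (\<forall>t\<in>{a..b}. S (0, t) = c t \<and> S (1, t) \<in> grid_lines X Y) \<and>
     (\<forall>s\<in>{0..1}. S (s, a) = c a \<and> S (s, b) = c b) \<and>
     (\<forall>x. x \<notin> path_image c \<union> grid_lines X Y \<longrightarrow>
        preimage_count a b S x \<le> w x \<and> (\<exists>e>0. \<forall>y\<in>ball x e. w y = w x))"
    using assms unfolding sweepable_def by (elim exE) (rule that)
  show thesis by (rule that[of X Y w S]) (simp_all add: *)
qed

lemma sweepable_point: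
  assumes "x \<in> {0..1}"
  shows "sweepable c x x \<delta>"
  unfolding sweepable_def
proof (rule exI[of _ "\<lambda>_. c x"], rule exI[of _ "{Re (c x)}"], rule exI[of _ "{}"], rule exI[of _ "\<lambda>_. 0"], intro conjI ballI allI impI)
  show "piecewise_differentiable_strip x x (\<lambda>_. c x)" unfolding piecewise_differentiable_strip_def
    by (intro exI[of _ "{}"]) auto
  fix y assume "y \<notin> path_image c \<union> grid_lines {Re (c x)} {}"
  then have "c x \<noteq> y" using assms by (auto simp: path_image_def)
  then show "preimage_count x x (\<lambda>_. c x) y \<le> 0" by (simp add: preimage_count_eq_0)
  show "\<exists>e>0. \<forall>y'\<in>ball y e. (0::ennreal) = 0" by (rule exI[of _ 1]) simp
qed (auto simp: grid_lines_def)

lemma sweepable_combine: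
  assumes 1: "sweepable c a b \<delta>1" and 2: "sweepable c b d \<delta>2" and ab: "a \<le> b" "b \<le> d"
  shows "sweepable c a d (\<delta>1 + \<delta>2)"
proof -
  obtain S X Y w where S: "finite X" "finite Y" "w \<in> borel_measurable borel" "(\<integral>\<^sup>+x. w x \<partial>lborel) \<le> \<delta>1"
    "continuous_on ({0..1} \<times> {a..b}) S" "piecewise_differentiable_strip a b S"
    "\<And>t. t \<in> {a..b} \<Longrightarrow> S (0, t) = c t" "\<And>t. t \<in> {a..b} \<Longrightarrow> S (1, t) \<in> grid_lines X Y"
    "\<And>s. s \<in> {0..1} \<Longrightarrow> S (s, a) = c a" "\<And>s. s \<in> {0..1} \<Longrightarrow> S (s, b) = c b"
    "\<And>x. x \<notin> path_image c \<union> grid_lines X Y \<Longrightarrow> preimage_count a b S x \<le> w x"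
    "\<And>x. x \<notin> path_image c \<union> grid_lines X Y \<Longrightarrow> \<exists>e>0. \<forall>y\<in>ball x e. w y = w x"
    by (rule sweepableE[OF 1]) (rule that; assumption)
  obtain S' X' Y' w' where S': "finite X'" "finite Y'" "w' \<in> borel_measurable borel" "(\<integral>\<^sup>+x. w' x \<partial>lborel) \<le> \<delta>2"
    "continuous_on ({0..1} \<times> {b..d}) S'" "piecewise_differentiable_strip b d S'"
    "\<And>t. t \<in> {b..d} \<Longrightarrow> S' (0, t) = c t" "\<And>t. t \<in> {b..d} \<Longrightarrow> S' (1, t) \<in> grid_lines X' Y'"
    "\<And>s. s \<in> {0..1} \<Longrightarrow> S' (s, b) = c b" "\<And>s. s \<in> {0..1} \<Longrightarrow> S' (s, d) = c d"
    "\<And>x. x \<notin> path_image c \<union> grid_lines X' Y' \<Longrightarrow> preimage_count b d S' x \<le> w' x"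
    "\<And>x. x \<notin> path_image c \<union> grid_lines X' Y' \<Longrightarrow> \<exists>e>0. \<forall>y\<in>ball x e. w' y = w' x"
    by (rule sweepableE[OF 2]) (rule that; assumption)
  have agree: "S (s, b) = S' (s, b)" if "s \<in> {0..1}" for s using S(10)[OF that] S'(9)[OF that] by simp
  have sub: "grid_lines X Y \<subseteq> grid_lines (X \<union> X') (Y \<union> Y')" "grid_lines X' Y' \<subseteq> grid_lines (X \<union> X') (Y \<union> Y')"
    by (auto simp: grid_lines_def)
  show ?thesis unfolding sweepable_def
  proof (rule exI[of _ "glue_second b S S'"], rule exI[of _ "X \<union> X'"], rule exI[of _ "Y \<union> Y'"], rule exI[of _ "\<lambda>x. w x + w' x"], intro conjI ballI allI impI)
    show "finite (X \<union> X')" "finite (Y \<union> Y')" using S S' by auto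
    show "(\<lambda>x. w x + w' x) \<in> borel_measurable borel" using S(3) S'(3) by simp
    show "(\<integral>\<^sup>+x. w x + w' x \<partial>lborel) \<le> \<delta>1 + \<delta>2"
      using S(3,4) S'(3,4) by (subst nn_integral_add) (auto intro: add_mono)
    show "continuous_on ({0..1} \<times> {a..d}) (glue_second b S S')"
      by (rule continuous_on_glue_second[OF S(5) S'(5)]) (use agree ab in auto)
    show "piecewise_differentiable_strip a d (glue_second b S S')"
      by (rule piecewise_differentiable_strip_glue_second[OF S(6) S'(6)]) (use agree ab in auto)
    fix t assume t: "t \<in> {a..d}"
    show "glue_second b S S' (0, t) = c t" using S(7) S'(7) t by (auto simp: glue_second_def)
    show "glue_second b S S' (1, t) \<in> grid_lines (X \<union> X') (Y \<union> Y')"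
    proof (cases "t \<le> b")
      case True then show ?thesis using S(8)[of t] t sub(1) by (auto simp: glue_second_def)
    next
      case False then show ?thesis using S'(8)[of t] t sub(2) by (auto simp: glue_second_def)
    qed
  next
    fix s :: real assume s: "s \<in> {0..1}"
    show "glue_second b S S' (s, a) = c a" using S(9)[OF s] ab by (simp add: glue_second_def)
    show "glue_second b S S' (s, d) = c d" using S(10)[OF s] S'(10)[OF s] ab by (auto simp: glue_second_def)
  next
    fix x assume x: "x \<notin> path_image c \<union> grid_lines (X \<union> X') (Y \<union> Y')"
    then have x1: "x \<notin> path_image c \<union> grid_lines X Y" and x2: "x \<notin> path_image c \<union> grid_lines X' Y'" using sub by blast+
    show "preimage_count a d (glue_second b S S') x \<le> w x + w' x"
      by (rule order_trans[OF preimage_count_glue_second add_mono[OF S(11)[OF x1] S'(11)[OF x2]]])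
    obtain e where e: "e > 0" "\<forall>y\<in>ball x e. w y = w x" using S(12)[OF x1] by blast
    obtain e' where e': "e' > 0" "\<forall>y\<in>ball x e'. w' y = w' x" using S'(12)[OF x2] by blast
    show "\<exists>e>0. \<forall>y\<in>ball x e. w y + w' y = w x + w' x"
    proof (intro exI[of _ "min e e'"] conjI ballI)
      show "0 < min e e'" using e(1) e'(1) by simp
      fix y assume "y \<in> ball x (min e e')"
      then have "y \<in> ball x e" "y \<in> ball x e'" by simp_all
      then have "w y = w x" "w' y = w' x" using e(2) e'(2) by blast+
      then show "w y + w' y = w x + w' x" by (simp only:)
    qed
  qed
qed

text \<open>
  The arc is first reparametrized along itself, which covers only points of the curve, and then swept
  to a thin rectilinear closing. The second stage covers each point of the region in between at most once.
\<close>

lemma sweepable_arc: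
  assumes ab: "a < b" and inj: "inj_on c {a..b}" and d: "c differentiable_on {a..b}"
    and im: "c ` {a..b} \<subseteq> path_image c" and null: "emeasure lborel (c ` {a..b}) = 0"
    and va: "(c has_vector_derivative va) (at a within {a..b})" "va \<noteq> 0"
    and vb: "(c has_vector_derivative vb) (at b within {a..b})" "vb \<noteq> 0"
    and \<delta>: "\<delta> > 0"
  shows "sweepable c a b (ennreal \<delta>)"
proof -
  define \<alpha> where "\<alpha> = (\<lambda>t. c ((b - a) * t + a))"
  have in_ab: "(b - a) * t + a \<in> {a..b}" if "t \<in> {0..1}" for t
  proof -
    have "(b - a) * t \<le> (b - a) * 1" using that ab by (intro mult_left_mono) auto
    moreover have "0 \<le> (b - a) * t" using that ab by simp
    ultimately show ?thesis by simp
  qed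
  have \<alpha>d: "\<alpha> differentiable_on {0..1}" unfolding \<alpha>_def
    by (rule differentiable_on_compose_affine[OF d]) (rule in_ab)
  have "inj_on \<alpha> {0..1}"
  proof (rule inj_onI)
    fix x y assume xy: "x \<in> {0..1}" "y \<in> {0..1}" "\<alpha> x = \<alpha> y"
    have "(b - a) * x + a = (b - a) * y + a" using xy(3) unfolding \<alpha>_def
      by (intro inj_onD[OF inj]) (use in_ab xy in auto)
    then show "x = y" using ab by simp
  qed
  then have arc: "arc \<alpha>" using differentiable_imp_continuous_on[OF \<alpha>d] by (simp add: arc_def path_def)
  have pim: "path_image \<alpha> \<subseteq> c ` {a..b}" unfolding path_image_def \<alpha>_def using in_ab by blast
  have "emeasure lborel (path_image \<alpha>) \<le> emeasure lborel (c ` {a..b})"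
    using borel_closed[OF compact_imp_closed[OF compact_continuous_image[OF differentiable_imp_continuous_on[OF d] compact_Icc]]]
    by (intro emeasure_mono[OF pim]) simp
  then have null\<alpha>: "emeasure lborel (path_image \<alpha>) = 0" using null by simp
  have ends: "pathstart \<alpha> = c a" "pathfinish \<alpha> = c b" by (simp_all add: \<alpha>_def pathstart_def pathfinish_def)
  have dir0: "(\<alpha> has_vector_derivative (b - a) *\<^sub>R va) (at 0 within {0..1})"
  proof -
    have "((\<lambda>t. (b - a) * t + a) has_vector_derivative (b - a)) (at 0 within {0..1})"
      unfolding has_real_derivative_iff_has_vector_derivative[symmetric] by (auto intro!: derivative_eq_intros)
    moreover have "(c has_vector_derivative va) (at ((b - a) * 0 + a) within (\<lambda>t. (b - a) * t + a) ` {0..1})"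
    proof -
      have "(\<lambda>t. (b - a) * t + a) ` {0..1} \<subseteq> {a..b}" using in_ab by blast
      from has_vector_derivative_within_subset[OF va(1) this] show ?thesis by (simp only: mult_zero_right add_0_left)
    qed
    ultimately show ?thesis using vector_diff_chain_within[of "\<lambda>t. (b - a) * t + a" "b - a" 0 "{0..1}" c va]
      by (simp add: \<alpha>_def o_def)
  qed
  have dir1: "(reversepath \<alpha> has_vector_derivative (a - b) *\<^sub>R vb) (at 0 within {0..1})"
  proof -
    have "((\<lambda>t. (b - a) * (1 - t) + a) has_vector_derivative (a - b)) (at 0 within {0..1})"
      unfolding has_real_derivative_iff_has_vector_derivative[symmetric] by (auto intro!: derivative_eq_intros)
    moreover have "(c has_vector_derivative vb) (at ((b - a) * (1 - 0) + a) within (\<lambda>t. (b - a) * (1 - t) + a) ` {0..1})"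
    proof -
      have "(\<lambda>t. (b - a) * (1 - t) + a) ` {0..1} \<subseteq> {a..b}"
      proof (rule image_subsetI)
        fix t :: real assume "t \<in> {0..1}"
        then show "(b - a) * (1 - t) + a \<in> {a..b}" by (intro in_ab) simp
      qed
      from has_vector_derivative_within_subset[OF vb(1) this] show ?thesis
        by (simp only: diff_zero mult_1_right diff_add_cancel)
    qed
    ultimately show ?thesis using vector_diff_chain_within[of "\<lambda>t. (b - a) * (1 - t) + a" "a - b" 0 "{0..1}" c vb]
      by (simp add: \<alpha>_def o_def reversepath_def)
  qed
  have "(b - a) *\<^sub>R va \<noteq> 0" "(a - b) *\<^sub>R vb \<noteq> 0" using ab va vb by auto
  obtain d0 r0 where d0: "d0 \<in> {1, -1, \<i>, -\<i>}" "r0 > 0" "\<And>s. 0 < s \<Longrightarrow> s \<le> r0 \<Longrightarrow> pathstart \<alpha> + of_real s * d0 \<notin> path_image \<alpha>"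
    by (rule axis_direction_avoiding_arc[OF arc dir0 \<open>(b - a) *\<^sub>R va \<noteq> 0\<close>]) (rule that; assumption)
  obtain d1 r1 where d1: "d1 \<in> {1, -1, \<i>, -\<i>}" "r1 > 0" "\<And>s. 0 < s \<Longrightarrow> s \<le> r1 \<Longrightarrow> pathfinish \<alpha> + of_real s * d1 \<notin> path_image \<alpha>"
    by (rule axis_direction_avoiding_arc[OF arc_reversepath[OF arc] dir1 \<open>(a - b) *\<^sub>R vb \<noteq> 0\<close>, unfolded path_image_reversepath pathstart_reversepath])
      (rule that; assumption)
  obtain \<beta> where \<beta>: "rectilinear_arc \<beta>" "pathstart \<beta> = pathstart \<alpha>" "pathfinish \<beta> = pathfinish \<alpha>"
    "path_image \<alpha> \<inter> path_image \<beta> \<subseteq> {pathstart \<alpha>, pathfinish \<alpha>}"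
    "emeasure lborel (inside (path_image \<alpha> \<union> path_image \<beta>)) < ennreal \<delta>"
    by (rule thin_rectilinear_closing[OF arc null\<alpha> \<delta> d0 d1]) (assumption | rule that)+
  have arc\<beta>: "arc \<beta>" using \<beta>(1) by (simp add: rectilinear_arc_def)
  obtain X Y where XY: "finite X" "finite Y" "path_image \<beta> \<subseteq> grid_lines X Y" using \<beta>(1) unfolding rectilinear_arc_def by blast
  obtain B where B: "finite B" and \<beta>d: "\<And>t t'. 0 \<le> t \<and> t < t' \<and> t' \<le> 1 \<and> {t<..<t'} \<inter> B = {} \<Longrightarrow> \<beta> differentiable_on {t..t'}"
    using \<beta>(1) unfolding rectilinear_arc_def piecewise_differentiable_path_def by blast
  obtain k k' :: "real \<Rightarrow> real" and T :: "real \<times> real \<Rightarrow> complex" where k: "k 0 = 0" "k 1 = (1::real)" "strict_mono_on {0..1} k"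
    "\<And>t. t \<in> {0..1} \<Longrightarrow> (k has_real_derivative k' t) (at t within {0..1})"
    and T: "continuous_on ({0..1} \<times> {0..1}) T"
    "\<And>t. t \<in> {0..1} \<Longrightarrow> T (0, t) = \<alpha> (k t)" "\<And>t. t \<in> {0..1} \<Longrightarrow> T (1, t) = \<beta> (k t)"
    "\<And>s. s \<in> {0..1} \<Longrightarrow> T (s, 0) = pathstart \<alpha>" "\<And>s. s \<in> {0..1} \<Longrightarrow> T (s, 1) = pathfinish \<alpha>"
    "\<And>A. \<lbrakk>A \<subseteq> {0..1}; (\<lambda>t. \<alpha> (k t)) differentiable_on A; (\<lambda>t. \<beta> (k t)) differentiable_on A\<rbrakk> \<Longrightarrow> T differentiable_on {0..1} \<times> A"
    "inj_on T ({0<..<1} \<times> {0<..<1})" "T ` ({0<..<1} \<times> {0<..<1}) \<subseteq> inside (path_image \<alpha> \<union> path_image \<beta>)"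
    by (rule strip_between_arcs[OF arc arc\<beta> \<beta>(2,3,4)]) (rule that; assumption)
  have kmono: "k s \<le> k t" if "s \<in> {0..1}" "t \<in> {0..1}" "s \<le> t" for s t
    using strict_mono_on_leD[OF k(3)] that by blast
  have kless: "k s < k t" if "s \<in> {0..1}" "t \<in> {0..1}" "s < t" for s t
    using k(3) that by (auto simp: strict_mono_on_def)
  have k01: "k t \<in> {0..1}" if "t \<in> {0..1}" for t using kmono[of 0 t] kmono[of t 1] k(1,2) that by auto
  have kd: "k differentiable_on {0..1}" unfolding differentiable_on_def differentiable_def using k(4)[unfolded has_field_derivative_def] by blast
  have kcont: "continuous_on {0..1} k" using kd by (rule differentiable_imp_continuous_on)
  define Ha where "Ha = (\<lambda>z::real \<times> real. \<alpha> ((1 - fst z) * snd z + fst z * k (snd z)))"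
  have conv: "(1 - fst z) * snd z + fst z * k (snd z) \<in> {0..1}" if "z \<in> {0..1} \<times> {0..1}" for z :: "real \<times> real"
  proof -
    have s: "0 \<le> fst z" "fst z \<le> 1" "0 \<le> snd z" "snd z \<le> 1" "0 \<le> k (snd z)" "k (snd z) \<le> 1"
      using that k01[of "snd z"] by auto
    have "(1 - fst z) * snd z + fst z * k (snd z) \<le> 1"
      by (rule convex_bound_le) (use s in simp_all)
    moreover have "0 \<le> (1 - fst z) * snd z" "0 \<le> fst z * k (snd z)" using s by simp_all
    ultimately show ?thesis by simp
  qed
  have Ea: "Ha differentiable_on {0..1} \<times> {0..1}"
    unfolding differentiable_on_def
  proof
    fix z :: "real \<times> real" assume z: "z \<in> {0..1} \<times> {0..1}"
    have ks: "(\<lambda>z. k (snd z)) differentiable (at z within {0..1} \<times> {0..1})"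
    proof -
      have "k differentiable (at (snd z) within snd ` ({0..1::real} \<times> {0..1}))"
        using kd z by (auto simp: differentiable_on_def snd_image_times)
      moreover have "snd differentiable (at z within {0..1} \<times> {0..1})" by (intro bounded_linear_imp_differentiable bounded_linear_snd)
      ultimately show ?thesis using differentiable_chain_within[of snd z "{0..1} \<times> {0..1}" k] by (simp add: o_def)
    qed
    have fs: "fst differentiable (at z within {0..1} \<times> {0..1})" "snd differentiable (at z within {0..1} \<times> {0..1})"
      by (intro bounded_linear_imp_differentiable bounded_linear_fst bounded_linear_snd)+
    have "(\<lambda>z. (1 - fst z) * snd z + fst z * k (snd z)) differentiable (at z within {0..1} \<times> {0..1})"
      by (intro differentiable_add differentiable_mult differentiable_diff differentiable_const fs ks)
    moreover have "\<alpha> differentiable (at ((1 - fst z) * snd z + fst z * k (snd z)) within (\<lambda>z. (1 - fst z) * snd z + fst z * k (snd z)) ` ({0..1} \<times> {0..1}))"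
    proof (rule differentiable_within_subset)
      show "\<alpha> differentiable (at ((1 - fst z) * snd z + fst z * k (snd z)) within {0..1})"
        using \<alpha>d conv[OF z] unfolding differentiable_on_def by blast
      show "(\<lambda>z. (1 - fst z) * snd z + fst z * k (snd z)) ` ({0..1} \<times> {0..1}) \<subseteq> {0..1}" using conv by blast
    qed
    ultimately show "Ha differentiable (at z within {0..1} \<times> {0..1})"
      using differentiable_chain_within[of "\<lambda>z. (1 - fst z) * snd z + fst z * k (snd z)" z "{0..1} \<times> {0..1}" \<alpha>]
      by (simp add: o_def Ha_def)
  qed
  have pa: "piecewise_differentiable_strip 0 1 Ha" unfolding piecewise_differentiable_strip_def
    by (intro exI[of _ "{}"] conjI allI impI differentiable_on_subset[OF Ea]) auto
  have pT: "piecewise_differentiable_strip 0 1 T" unfolding piecewise_differentiable_strip_def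
  proof (rule exI[of _ "{}"], rule exI[of _ "{0..1} \<inter> k -` B"], intro conjI allI impI)
    have "inj_on k {0..1}" using k(3) strict_mono_on_imp_inj_on by blast
    then show "finite ({0..1} \<inter> k -` B)" using finite_vimage_IntI[OF B, of k "{0..1}"] by (simp add: Int_commute)
    fix s s' t t' :: real assume st: "0 \<le> s \<and> s < s' \<and> s' \<le> 1 \<and> 0 \<le> t \<and> t < t' \<and> t' \<le> 1 \<and>
           {s<..<s'} \<inter> {} = {} \<and> {t<..<t'} \<inter> ({0..1} \<inter> k -` B) = {}"
    have t: "t \<in> {0..1}" "t' \<in> {0..1}" using st by auto
    have sub: "{t..t'} \<subseteq> {0..1}" using t by auto
    have "{k t<..<k t'} \<inter> B = {}"
    proof (rule ccontr)
      assume "\<not> ?thesis"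
      then obtain y where y: "y \<in> B" "k t < y" "y < k t'" by auto
      obtain x where x: "t \<le> x" "x \<le> t'" "k x = y"
        using IVT'[of k t y t'] y st continuous_on_subset[OF kcont sub] by auto
      have "x \<noteq> t" "x \<noteq> t'" using x(3) y by auto
      then have "x \<in> {t<..<t'} \<inter> ({0..1} \<inter> k -` B)" using x y t by auto
      then show False using st by blast
    qed
    then have bd: "\<beta> differentiable_on {k t..k t'}" using k01[OF t(1)] k01[OF t(2)] kless[OF t] st by (intro \<beta>d) auto
    have kk: "k ` {t..t'} \<subseteq> {k t..k t'}" using kmono t by auto
    have chain: "(\<lambda>x. f (k x)) differentiable_on {t..t'}" if f: "f differentiable_on {k t..k t'}" for f :: "real \<Rightarrow> complex"
      unfolding differentiable_on_def
    proof
      fix x assume x: "x \<in> {t..t'}"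
      have "k differentiable (at x within {t..t'})"
        using differentiable_on_subset[OF kd sub] x unfolding differentiable_on_def by blast
      moreover have "f differentiable (at (k x) within k ` {t..t'})"
        using differentiable_on_subset[OF f kk] x unfolding differentiable_on_def by blast
      ultimately show "(\<lambda>x. f (k x)) differentiable (at x within {t..t'})"
        using differentiable_chain_within[of k x "{t..t'}" f] by (simp add: o_def)
    qed
    have "\<alpha> differentiable_on {k t..k t'}" by (rule differentiable_on_subset[OF \<alpha>d]) (use k01[OF t(1)] k01[OF t(2)] in auto)
    then have "T differentiable_on {0..1} \<times> {t..t'}" using T(6)[OF sub chain chain] bd by blast
    then show "T differentiable_on {s..s'} \<times> {t..t'}" by (rule differentiable_on_subset) (use st in auto)
  qed simp
  have agree: "Ha (1, t) = T (0, t)" if "t \<in> {0..1}" for t using T(2)[OF that] by (simp add: Ha_def)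
  define S where "S = glue_first Ha T"
  have Sd: "piecewise_differentiable_strip 0 1 S" unfolding S_def
    by (rule piecewise_differentiable_strip_glue_first[OF pa pT]) (use agree in auto)
  have Sc: "continuous_on ({0..1} \<times> {0..1}) S" unfolding S_def
    by (rule continuous_on_glue_first[OF differentiable_imp_continuous_on[OF Ea] T(1)]) (use agree in auto)
  define J where "J = path_image \<alpha> \<union> path_image \<beta>"
  have cJ: "compact J" unfolding J_def by (intro compact_Un compact_path_image arc_imp_path arc arc\<beta>)
  define w where "w = (indicator (inside J) :: complex \<Rightarrow> ennreal)"
  have Jsub: "J \<subseteq> path_image c \<union> grid_lines X Y" unfolding J_def using pim im XY(3) by blast
  have count: "preimage_count 0 1 S x \<le> w x" if x: "x \<notin> J" for x
  proof -
    have 0: "preimage_count 0 1 Ha x = 0"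
    proof (rule preimage_count_eq_0)
      fix z :: "real \<times> real" assume z: "z \<in> {0..1} \<times> {0..1}"
      have "Ha z \<in> path_image \<alpha>" unfolding Ha_def path_image_def using conv[OF z] by (rule imageI)
      then show "Ha z \<noteq> x" using x unfolding J_def by blast
    qed
    define P where "P = {z \<in> {0..1} \<times> {0..1}. T z = x}"
    have Psub: "P \<subseteq> {0<..<1} \<times> {0<..<1}"
    proof
      fix z assume "z \<in> P"
      then obtain s t where st: "z = (s, t)" "s \<in> {0..1}" "t \<in> {0..1}" "T (s, t) = x" unfolding P_def by blast
      have \<alpha>k: "\<alpha> (k t) \<in> J" "\<beta> (k t) \<in> J" unfolding J_def path_image_def using k01[OF st(3)] by blast+
      have e: "pathstart \<alpha> \<in> J" "pathfinish \<alpha> \<in> J" unfolding J_def by auto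
      have "s \<noteq> 0" using T(2)[OF st(3)] \<alpha>k(1) st(4) x by auto
      moreover have "s \<noteq> 1" using T(3)[OF st(3)] \<alpha>k(2) st(4) x by auto
      moreover have "t \<noteq> 0" using T(4)[OF st(2)] e(1) st(4) x by auto
      moreover have "t \<noteq> 1" using T(5)[OF st(2)] e(2) st(4) x by auto
      ultimately show "z \<in> {0<..<1} \<times> {0<..<1}" using st by auto
    qed
    have "preimage_count 0 1 T x \<le> w x"
    proof (cases "P = {}")
      case True
      then show ?thesis unfolding preimage_count_def P_def[symmetric] by simp
    next
      case False
      then obtain z where z: "z \<in> P" by blast
      have "P = {z}"
      proof (rule antisym[OF subsetI])
        fix z' assume z': "z' \<in> P"
        have "T z' = T z" using z z' by (simp add: P_def)
        then have "z' = z" by (rule inj_onD[OF T(7)]) (use Psub z z' in blast)+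
        then show "z' \<in> {z}" by simp
      qed (use z in blast)
      moreover have "x \<in> inside J" using T(8) z Psub unfolding J_def P_def by blast
      ultimately show ?thesis unfolding preimage_count_def P_def[symmetric] w_def by (simp add: emeasure_count_space)
    qed
    then have "preimage_count 0 1 S x \<le> 0 + w x" unfolding S_def
      by (rule order_trans[OF preimage_count_glue_first add_mono[OF eq_refl[OF 0]]])
    then show ?thesis by (simp only: add_0_left)
  qed
  define f where "f = (\<lambda>t. (t - a) / (b - a))"
  have f: "f t \<in> {0..1}" "(b - a) * f t + a = t" if "t \<in> {a..b}" for t using that ab by (auto simp: f_def)
  have fab: "f a = 0" "f b = 1" using ab by (auto simp: f_def)
  show ?thesis unfolding sweepable_def
  proof (rule exI[of _ "\<lambda>z. S (fst z, f (snd z))"], rule exI[of _ X], rule exI[of _ Y], rule exI[of _ w], intro conjI ballI allI impI)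
    show "finite X" "finite Y" by fact+
    have "open (inside J)" using cJ compact_imp_closed open_inside by blast
    then have m: "inside J \<in> sets borel" by (rule borel_open)
    then show "w \<in> borel_measurable borel" unfolding w_def by (rule borel_measurable_indicator)
    show "(\<integral>\<^sup>+x. w x \<partial>lborel) \<le> ennreal \<delta>" unfolding w_def
      using \<beta>(5) m by (simp add: J_def[symmetric] less_imp_le)
    show "continuous_on ({0..1} \<times> {a..b}) (\<lambda>z. S (fst z, f (snd z)))"
    proof (rule continuous_on_compose2[OF Sc])
      show "continuous_on ({0..1} \<times> {a..b}) (\<lambda>z. (fst z, f (snd z)))" unfolding f_def using ab by (intro continuous_intros) auto
      show "(\<lambda>z. (fst z, f (snd z))) ` ({0..1} \<times> {a..b}) \<subseteq> {0..1} \<times> {0..1}" using f(1) by force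
    qed
    show "piecewise_differentiable_strip a b (\<lambda>z. S (fst z, f (snd z)))"
      unfolding f_def by (rule piecewise_differentiable_strip_rescale[OF Sd ab])
    fix t assume t: "t \<in> {a..b}"
    show "S (fst (0::real, t), f (snd (0::real, t))) = c t" using f(2)[OF t] by (simp add: S_def glue_first_def Ha_def \<alpha>_def)
    have "S (1, f t) = \<beta> (k (f t))" using T(3)[OF f(1)[OF t]] by (simp add: S_def glue_first_def)
    also have "\<dots> \<in> grid_lines X Y" using XY(3) k01[OF f(1)[OF t]] unfolding path_image_def by blast
    finally show "S (fst (1::real, t), f (snd (1::real, t))) \<in> grid_lines X Y" by simp
  next
    fix s :: real assume s: "s \<in> {0..1}"
    have "2 * s - 1 \<in> {0..1}" if "\<not> s \<le> 1/2" using s that by auto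
    then show "S (fst (s, a), f (snd (s, a))) = c a" "S (fst (s, b), f (snd (s, b))) = c b"
      using T(4)[of "2 * s - 1"] T(5)[of "2 * s - 1"] s
      by (auto simp: fab S_def glue_first_def Ha_def k \<alpha>_def pathstart_def pathfinish_def)
  next
    fix x assume "x \<notin> path_image c \<union> grid_lines X Y"
    then have x: "x \<notin> J" using Jsub by blast
    show "preimage_count a b (\<lambda>z. S (fst z, f (snd z))) x \<le> w x" unfolding f_def
      using preimage_count_rescale[OF ab] count[OF x] by (rule order_trans)
    show "\<exists>e>0. \<forall>y\<in>ball x e. w y = w x" unfolding w_def by (rule indicator_inside_locally_constant[OF cJ x])
  qed
qed

lemma periodic_ext_eq:
  assumes "closed_curve c" "t \<in> {0..1}"
  shows "periodic_ext c t = c t"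
proof (cases "t = 1")
  case True
  then show ?thesis using assms(1) by (simp add: periodic_ext_def closed_curve_def pathstart_def pathfinish_def)
next
  case False
  then have "frac t = t" using assms(2) by (simp add: frac_eq)
  then show ?thesis by (simp add: periodic_ext_def)
qed

lemma piecewise_regular_one_sided_derivatives:
  assumes c: "piecewise_regular c" and ab: "0 \<le> a" "a < b" "b \<le> 1"
  obtains va vb where "(c has_vector_derivative va) (at a within {a..b})" "va \<noteq> 0"
    "(c has_vector_derivative vb) (at b within {a..b})" "vb \<noteq> 0"
proof -
  have cc: "closed_curve c" using c by (simp add: piecewise_regular_def)
  have eq: "c x = periodic_ext c x" if "x \<in> {a..b}" for x using periodic_ext_eq[OF cc, of x] that ab by simp
  obtain va where va: "va \<noteq> 0" "(periodic_ext c has_vector_derivative va) (at_right a)"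
    using c unfolding piecewise_regular_def by blast
  obtain vb where vb: "vb \<noteq> 0" "(periodic_ext c has_vector_derivative vb) (at_left b)"
    using c unfolding piecewise_regular_def by blast
  show thesis
  proof (rule that[OF _ va(1) _ vb(1)])
    show "(c has_vector_derivative va) (at a within {a..b})"
      by (rule has_vector_derivative_transform[OF _ eq])
         (use ab va(2) in \<open>simp_all add: at_within_Icc_at_right\<close>)
    show "(c has_vector_derivative vb) (at b within {a..b})"
      by (rule has_vector_derivative_transform[OF _ eq])
         (use ab vb(2) in \<open>simp_all add: at_within_Icc_at_left\<close>)
  qed
qed

lemma negligible_path_image_piecewise_regular:
  assumes "piecewise_regular c"
  shows "negligible (path_image c)"
proof -
  obtain S where S: "finite S" "\<And>x. x \<in> {0..1} - S \<Longrightarrow> c differentiable (at x within {0..1})"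
    using assms unfolding piecewise_regular_def piecewise_differentiable_on_def by blast
  have "c differentiable_on ({0..1} - S)" unfolding differentiable_on_def
    using S(2) differentiable_within_subset[of c _ "{0..1}" "{0..1} - S"] by blast
  then have "negligible (c ` ({0..1} - S))" by (intro negligible_differentiable_image_lowdim) simp_all
  then have "negligible (c ` ({0..1} - S) \<union> c ` S)" by (rule negligible_Un[OF _ negligible_finite[OF finite_imageI[OF S(1)]]])
  then show ?thesis by (rule negligible_subset) (auto simp: path_image_def)
qed

lemma emeasure_lborel_negligible_closed:
  fixes N :: "complex set"
  assumes "negligible N" "closed N"
  shows "emeasure lborel N = 0"
proof -
  have "emeasure lebesgue N = 0" using assms(1) by (simp add: negligible_iff_null_sets null_setsD1)
  moreover have "N \<in> sets lborel" using borel_closed[OF assms(2)] by simp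
  ultimately show ?thesis by simp
qed

lemma normal_curve_finite_multiple_parameters:
  assumes c: "normal_curve c"
  obtains E where "finite E" "\<And>s t. s \<in> {0..1} \<Longrightarrow> t \<in> {0..1} \<Longrightarrow> s \<noteq> t \<Longrightarrow> c s = c t \<Longrightarrow> s \<in> E"
proof -
  define E where "E = {0, 1} \<union> (\<Union>p\<in>intersection_points c. param_preimage c p)"
  have c01: "c 1 = c 0" "\<And>t. t \<in> {0<..<1} \<Longrightarrow> c t \<noteq> c 0"
    using c by (auto simp: normal_curve_def piecewise_regular_def closed_curve_def pathstart_def pathfinish_def)
  have "finite (param_preimage c p)" if p: "p \<in> intersection_points c" for p
  proof -
    have "simple_crossing_point c p" using c p unfolding normal_curve_def by blast
    then obtain t1 t2 where "param_preimage c p = {t1, t2}" unfolding simple_crossing_point_def by blast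
    then show ?thesis by simp
  qed
  then have fin: "finite E" using c unfolding E_def normal_curve_def by (intro finite_UnI finite_UN_I) auto
  show thesis
  proof (rule that[OF fin])
    fix s t :: real assume st: "s \<in> {0..1}" "t \<in> {0..1}" "s \<noteq> t" "c s = c t"
    show "s \<in> E"
    proof (cases "s = 0 \<or> s = 1")
      case True then show ?thesis by (auto simp: E_def)
    next
      case False
      then have s: "s \<in> {0<..<1}" using st(1) by auto
      then have "t \<noteq> 1" using c01 st(4) by metis
      then have "t \<in> param_preimage c (c s)" "s \<in> param_preimage c (c s)" using st s by (auto simp: param_preimage_def)
      moreover have "c s \<in> path_image c" using st(1) by (simp add: path_image_def)
      ultimately have "c s \<in> intersection_points c" unfolding intersection_points_def using st(3) by blast
      then show ?thesis unfolding E_def using \<open>s \<in> param_preimage c (c s)\<close> by blast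
    qed
  qed
qed

theorem normal_curve_sweepable:
  assumes c: "normal_curve c" and \<delta>: "\<delta> > 0"
  shows "sweepable c 0 1 (ennreal \<delta>)"
proof -
  have pr: "piecewise_regular c" using c by (simp add: normal_curve_def)
  obtain E where E: "finite E" "\<And>s t. s \<in> {0..1} \<Longrightarrow> t \<in> {0..1} \<Longrightarrow> s \<noteq> t \<Longrightarrow> c s = c t \<Longrightarrow> s \<in> E"
    by (rule normal_curve_finite_multiple_parameters[OF c]) (rule that; assumption)
  obtain D where D: "finite D" "\<And>x. x \<in> {0..1} - D \<Longrightarrow> c differentiable (at x within {0..1})"
    using pr unfolding piecewise_regular_def piecewise_differentiable_on_def by blast
  have cont: "continuous_on {0..1} c" using pr by (simp add: piecewise_regular_def closed_curve_def path_def)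
  define P where "P = (\<lambda>u v. 0 \<le> u \<and> v \<le> 1 \<longrightarrow> (\<forall>\<delta>>0. sweepable c u v (ennreal \<delta>)))"
  have PI: "P u v" if "\<And>\<delta>. 0 \<le> u \<Longrightarrow> v \<le> 1 \<Longrightarrow> 0 < \<delta> \<Longrightarrow> sweepable c u v (ennreal \<delta>)" for u v
    unfolding P_def using that by blast
  have comb: "P u w" if uvw: "P u v" "P v w" "u \<le> v" "v \<le> w" for u v w
  proof (rule PI)
    fix \<delta> :: real assume *: "0 \<le> u" "w \<le> 1" "0 < \<delta>"
    have "sweepable c u v (ennreal (\<delta> / 2))" "sweepable c v w (ennreal (\<delta> / 2))"
      using uvw * unfolding P_def by auto
    then have "sweepable c u w (ennreal (\<delta> / 2) + ennreal (\<delta> / 2))" by (rule sweepable_combine) fact+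
    moreover have "ennreal (\<delta> / 2) + ennreal (\<delta> / 2) = ennreal \<delta>" using * by (simp flip: ennreal_plus)
    ultimately show "sweepable c u w (ennreal \<delta>)" by simp
  qed
  \<comment> \<open>Each parameter has a neighbourhood without further corners or multiple parameters, where the arcs on
    either side of it can be swept; a bisection argument combines these local sweeps.\<close>
  have "P 0 1"
  proof (rule Bolzano[of 0 1 P])
    show "P a d" if "P a b" "P b d" "a \<le> b" "b \<le> d" for a b d using that by (rule comb)
    fix x :: real assume "0 \<le> x" "x \<le> 1"
    obtain d where d: "d > 0" "\<And>y. y \<in> E \<union> D \<Longrightarrow> y \<noteq> x \<Longrightarrow> d \<le> dist x y"
      using finite_set_avoid[of "E \<union> D" x] E(1) D(1) by auto
    have piece: "P u v" if uv: "u < v" "x = u \<or> x = v" "v - u < d" for u v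
    proof (rule PI)
      fix \<delta> :: real assume *: "0 \<le> u" "v \<le> 1" "0 < \<delta>"
      obtain va vb where v: "(c has_vector_derivative va) (at u within {u..v})" "va \<noteq> 0"
        "(c has_vector_derivative vb) (at v within {u..v})" "vb \<noteq> 0"
        by (rule piecewise_regular_one_sided_derivatives[OF pr *(1) uv(1) *(2)]) (rule that; assumption)
      have near: "y = x" if "y \<in> E \<union> D" "y \<in> {u..v}" for y
      proof (rule ccontr)
        assume "y \<noteq> x"
        then have "d \<le> dist x y" using d(2) that(1) by blast
        then show False using that(2) uv by (auto simp: dist_real_def)
      qed
      show "sweepable c u v (ennreal \<delta>)"
      proof (rule sweepable_arc[OF uv(1) _ _ _ _ v *(3)])
        show "inj_on c {u..v}"
        proof (rule inj_onI, rule ccontr)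
          fix s t assume st: "s \<in> {u..v}" "t \<in> {u..v}" "c s = c t" "s \<noteq> t"
          have 01: "s \<in> {0..1}" "t \<in> {0..1}" using st * by auto
          have "s = x" using E(2)[OF 01 st(4,3)] near st(1) by blast
          moreover have "t = x" using E(2)[OF 01(2,1)] st near by (metis UnI1)
          ultimately show False using st(4) by simp
        qed
        show "c differentiable_on {u..v}" unfolding differentiable_on_def
        proof
          fix y assume y: "y \<in> {u..v}"
          consider "y = u" | "y = v" | "u < y" "y < v" using y by fastforce
          then show "c differentiable (at y within {u..v})"
          proof cases
            case 1 then show ?thesis using v(1) by (auto intro: differentiableI_vector)
          next
            case 2 then show ?thesis using v(3) by (auto intro: differentiableI_vector)
          next
            case 3
            then have "y \<notin> D" using near y uv(2) by blast
            then have "c differentiable (at y within {0..1})" using D(2) y * by auto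
            then show ?thesis by (rule differentiable_within_subset) (use * in auto)
          qed
        qed
        have sub: "{u..v} \<subseteq> {0..1}" using * by auto
        show im: "c ` {u..v} \<subseteq> path_image c" unfolding path_image_def using sub by (rule image_mono)
        have "closed (c ` {u..v})" using continuous_on_subset[OF cont sub] by (intro compact_imp_closed compact_continuous_image) auto
        then show "emeasure lborel (c ` {u..v}) = 0"
          using negligible_subset[OF negligible_path_image_piecewise_regular[OF pr] im] by (intro emeasure_lborel_negligible_closed)
      qed
    qed
    have point: "P x x" by (rule PI) (rule sweepable_point, simp)
    show "\<exists>d>0. \<forall>a b. a \<le> x \<and> x \<le> b \<and> b - a < d \<longrightarrow> P a b"
    proof (intro exI[of _ d] conjI allI impI d(1))
      fix a b assume ab: "a \<le> x \<and> x \<le> b \<and> b - a < d"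
      have "P a x" proof (cases "a = x") case False then show ?thesis using ab by (intro piece) auto qed (use point in simp)
      moreover have "P x b" proof (cases "b = x") case False then show ?thesis using ab by (intro piece) auto qed (use point in simp)
      ultimately show "P a b" using ab comb by blast
    qed
  qed simp
  then show ?thesis using \<delta> unfolding P_def by simp
qed

section \<open>Grids and representatives of their cells\<close>

lemma nn_integral_complex:
  assumes [measurable]: "f \<in> borel_measurable borel"
  shows "(\<integral>\<^sup>+z. f z \<partial>lborel) = (\<integral>\<^sup>+x. \<integral>\<^sup>+y. f (Complex x y) \<partial>lborel \<partial>lborel)"
proof -
  define \<kappa> :: "real \<times> real \<Rightarrow> complex" where "\<kappa> = (\<lambda>z. Complex (fst z) (snd z))"
  have "continuous_on UNIV \<kappa>" unfolding \<kappa>_def Complex_eq by (intro continuous_intros)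
  then have [measurable]: "\<kappa> \<in> borel_measurable borel" by (rule borel_measurable_continuous_onI)
  have meas: "\<kappa> \<in> measurable (lborel :: (real \<times> real) measure) borel" by simp
  have eq: "lborel = distr (lborel :: (real \<times> real) measure) borel \<kappa>"
  proof (rule lborel_eqI)
    fix l u :: complex assume le: "\<And>b. b \<in> Basis \<Longrightarrow> l \<bullet> b \<le> u \<bullet> b"
    have lu: "Re l \<le> Re u" "Im l \<le> Im u" using le[of 1] le[of \<i>] by (simp_all add: Basis_complex_def)
    have "\<kappa> -` box l u = box (Re l, Im l) (Re u, Im u)"
    proof -
      have R: "(a, b) \<in> box (Re l, Im l) (Re u, Im u) \<longleftrightarrow> Re l < a \<and> a < Re u \<and> Im l < b \<and> b < Im u" for a b
        unfolding mem_box(1) Basis_prod_def by (auto simp: ball_Un)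
      show ?thesis by (auto simp only: \<kappa>_def in_box_complex_iff R vimage_eq fst_conv snd_conv complex.sel greaterThanLessThan_iff)
    qed
    then have "emeasure (distr lborel borel \<kappa>) (box l u) = emeasure lborel (box (Re l, Im l) (Re u, Im u))"
      using meas by (simp add: emeasure_distr)
    also have "\<dots> = (\<Prod>b\<in>Basis. ((Re u, Im u) - (Re l, Im l)) \<bullet> b)"
      by (rule emeasure_lborel_box) (use lu in \<open>auto simp: Basis_prod_def\<close>)
    also have "\<dots> = (\<Prod>b\<in>Basis. (u - l) \<bullet> b)"
    proof -
      have "(\<Prod>b\<in>Basis. ((Re u, Im u) - (Re l, Im l)) \<bullet> b) = (Re u - Re l) * (Im u - Im l)"
        by (simp add: Basis_prod_def)
      moreover have "(\<Prod>b\<in>Basis. (u - l) \<bullet> b) = (Re u - Re l) * (Im u - Im l)" by (simp add: Basis_complex_def)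
      ultimately show ?thesis by simp
    qed
    finally show "emeasure (distr lborel borel \<kappa>) (box l u) = (\<Prod>b\<in>Basis. (u - l) \<bullet> b)" .
  qed simp
  have "(\<integral>\<^sup>+z. f z \<partial>lborel) = (\<integral>\<^sup>+z. f (\<kappa> z) \<partial>lborel)"
    by (subst eq) (rule nn_integral_distr[OF meas], simp)
  also have "\<dots> = (\<integral>\<^sup>+z. f (\<kappa> z) \<partial>(lborel \<Otimes>\<^sub>M lborel))" by (simp add: lborel_prod)
  also have "\<dots> = (\<integral>\<^sup>+x. \<integral>\<^sup>+y. f (\<kappa> (x, y)) \<partial>lborel \<partial>lborel)"
  proof (rule lborel.nn_integral_fst[symmetric])
    have "(\<lambda>z. f (\<kappa> z)) \<in> borel_measurable borel" by measurable
    then show "(\<lambda>z. f (\<kappa> z)) \<in> borel_measurable (lborel \<Otimes>\<^sub>M lborel)" by (simp add: lborel_prod)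
  qed
  finally show ?thesis by (simp add: \<kappa>_def)
qed

lemma exists_point_le_average:
  fixes f :: "real \<Rightarrow> ennreal"
  assumes [measurable]: "f \<in> borel_measurable borel" and ab: "a < b"
  shows "\<exists>x\<in>{a<..<b}. ennreal (b - a) * f x \<le> (\<integral>\<^sup>+x. f x * indicator {a<..<b} x \<partial>lborel)"
proof (rule ccontr)
  define I where "I = (\<integral>\<^sup>+x. f x * indicator {a<..<b} x \<partial>lborel)"
  assume "\<not> ?thesis"
  then have less: "I < ennreal (b - a) * f x" if "x \<in> {a<..<b}" for x using that by (auto simp: I_def not_le)
  have "I < ennreal (b - a) * f ((a + b) / 2)" using ab by (intro less) auto
  then have fin: "I < \<infinity>" using order_less_le_trans top_greatest by (metis infinity_ennreal_def)
  have L: "(\<integral>\<^sup>+x. I * indicator {a<..<b} x \<partial>lborel) = I * ennreal (b - a)" using ab by (simp add: nn_integral_cmult_indicator)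
  have R: "(\<integral>\<^sup>+x. ennreal (b - a) * (f x * indicator {a<..<b} x) \<partial>lborel) = ennreal (b - a) * I"
    unfolding I_def by (rule nn_integral_cmult) simp
  have "(\<integral>\<^sup>+x. I * indicator {a<..<b} x \<partial>lborel) < (\<integral>\<^sup>+x. ennreal (b - a) * (f x * indicator {a<..<b} x) \<partial>lborel)"
  proof (rule nn_integral_less)
    show "(\<integral>\<^sup>+x. I * indicator {a<..<b} x \<partial>lborel) \<noteq> \<infinity>" unfolding L using fin by (simp add: ennreal_mult_eq_top_iff)
    show "AE x in lborel. I * indicator {a<..<b} x \<le> ennreal (b - a) * (f x * indicator {a<..<b} x)"
    proof (rule AE_I2)
      fix x show "I * indicator {a<..<b} x \<le> ennreal (b - a) * (f x * indicator {a<..<b} x)"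
        using less[of x] by (cases "x \<in> {a<..<b}") (auto simp: less_imp_le)
    qed
    show "\<not> (AE x in lborel. ennreal (b - a) * (f x * indicator {a<..<b} x) \<le> I * indicator {a<..<b} x)"
    proof
      assume "AE x in lborel. ennreal (b - a) * (f x * indicator {a<..<b} x) \<le> I * indicator {a<..<b} x"
      then have "AE x in lborel. x \<notin> {a<..<b}"
      proof (rule eventually_mono)
        fix x assume *: "ennreal (b - a) * (f x * indicator {a<..<b} x) \<le> I * indicator {a<..<b} x"
        show "x \<notin> {a<..<b}"
        proof
          assume x: "x \<in> {a<..<b}"
          then have "ennreal (b - a) * f x \<le> I" using * by simp
          then show False using less[OF x] by (simp add: not_le)
        qed
      qed
      then have "emeasure lborel {a<..<b} = 0" by (subst (asm) AE_iff_measurable[of "{a<..<b}"]) auto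
      then show False using ab by simp
    qed
  qed simp_all
  then show False unfolding L R by (simp add: mult.commute)
qed

lemma consecutive_unique: "consecutive X u v \<Longrightarrow> consecutive X u v' \<Longrightarrow> v = v'"
  unfolding consecutive_def by (metis IntI empty_iff greaterThanLessThan_iff linorder_neqE_linordered_idom)

lemma consecutive_overlap:
  assumes "consecutive X u v" "consecutive X u' v'" "x \<in> {u<..<v}" "x \<in> {u'<..<v'}"
  shows "u = u'" "v = v'"
proof -
  have *: "u = u'"
  proof (rule ccontr)
    assume "u \<noteq> u'"
    then consider "u < u'" | "u' < u" by linarith
    then show False
    proof cases
      case 1
      have "u' \<in> {u<..<v}" using 1 assms(3,4) by simp
      moreover have "u' \<in> X" using assms(2) by (simp add: consecutive_def)
      ultimately have "u' \<in> {u<..<v} \<inter> X" by (rule IntI)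
      then show False using assms(1) unfolding consecutive_def by blast
    next
      case 2
      have "u \<in> {u'<..<v'}" using 2 assms(3,4) by simp
      moreover have "u \<in> X" using assms(1) by (simp add: consecutive_def)
      ultimately have "u \<in> {u'<..<v'} \<inter> X" by (rule IntI)
      then show False using assms(2) unfolding consecutive_def by blast
    qed
  qed
  then show "u = u'" .
  show "v = v'" using assms(1,2) unfolding * by (rule consecutive_unique)
qed

definition gaps :: "real set \<Rightarrow> (real \<times> real) set" where
  "gaps X = {(u, v). consecutive X u v}"

lemma finite_gaps: "finite X \<Longrightarrow> finite (gaps X)"
  by (rule finite_subset[of _ "X \<times> X"]) (auto simp: gaps_def consecutive_def)

text \<open>
  In each gap there is a point at which \<open>f\<close> is at most its mean value over the gap.
\<close>

lemma exists_representatives_le_integral: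
  fixes f :: "real \<Rightarrow> ennreal"
  assumes [measurable]: "f \<in> borel_measurable borel" and X: "finite X"
  obtains \<xi> where "\<And>u v. consecutive X u v \<Longrightarrow> \<xi> u \<in> {u<..<v}"
    "(\<Sum>(u, v)\<in>gaps X. ennreal (v - u) * f (\<xi> u)) \<le> (\<integral>\<^sup>+x. f x \<partial>lborel)"
proof -
  have "\<exists>x. \<forall>v. consecutive X u v \<longrightarrow> x \<in> {u<..<v} \<and> ennreal (v - u) * f x \<le> (\<integral>\<^sup>+x. f x * indicator {u<..<v} x \<partial>lborel)" for u
  proof (cases "\<exists>v. consecutive X u v")
    case True
    then obtain v where v: "consecutive X u v" by blast
    then obtain x where x: "x \<in> {u<..<v}" "ennreal (v - u) * f x \<le> (\<integral>\<^sup>+x. f x * indicator {u<..<v} x \<partial>lborel)"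
      using exists_point_le_average[OF assms(1), of u v] by (auto simp: consecutive_def)
    show ?thesis
    proof (intro exI[of _ x] allI impI)
      fix v' assume "consecutive X u v'"
      then have "v' = v" using v consecutive_unique by blast
      then show "x \<in> {u<..<v'} \<and> ennreal (v' - u) * f x \<le> (\<integral>\<^sup>+x. f x * indicator {u<..<v'} x \<partial>lborel)" using x by simp
    qed
  qed blast
  then obtain \<xi> where \<xi>: "\<And>u v. consecutive X u v \<Longrightarrow> \<xi> u \<in> {u<..<v} \<and> ennreal (v - u) * f (\<xi> u) \<le> (\<integral>\<^sup>+x. f x * indicator {u<..<v} x \<partial>lborel)"
    by metis
  show thesis
  proof (rule that)
    show "\<xi> u \<in> {u<..<v}" if "consecutive X u v" for u v using \<xi>[OF that] by blast
    have "(\<Sum>(u, v)\<in>gaps X. ennreal (v - u) * f (\<xi> u)) \<le> (\<Sum>(u, v)\<in>gaps X. \<integral>\<^sup>+x. f x * indicator {u<..<v} x \<partial>lborel)"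
      by (rule sum_mono) (use \<xi> in \<open>auto simp: gaps_def\<close>)
    also have "\<dots> = (\<Sum>p\<in>gaps X. \<integral>\<^sup>+x. f x * indicator {fst p<..<snd p} x \<partial>lborel)"
      by (simp add: case_prod_unfold)
    also have "\<dots> = (\<integral>\<^sup>+x. (\<Sum>p\<in>gaps X. f x * indicator {fst p<..<snd p} x) \<partial>lborel)"
      by (rule nn_integral_sum[symmetric]) simp
    also have "\<dots> \<le> (\<integral>\<^sup>+x. f x \<partial>lborel)"
    proof (rule nn_integral_mono)
      fix x :: real
      show "(\<Sum>p\<in>gaps X. f x * indicator {fst p<..<snd p} x) \<le> f x"
      proof (cases "\<exists>p\<in>gaps X. x \<in> {fst p<..<snd p}")
        case False
        then have "(\<Sum>p\<in>gaps X. f x * indicator {fst p<..<snd p} x) = 0" by (intro sum.neutral) (auto simp: indicator_def)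
        then show ?thesis by simp
      next
        case True
        then obtain p where p: "p \<in> gaps X" "x \<in> {fst p<..<snd p}" by blast
        have uniq: "q = p" if "q \<in> gaps X" "x \<in> {fst q<..<snd q}" for q
          using consecutive_overlap[of X "fst q" "snd q" "fst p" "snd p" x] that p
          by (intro prod_eqI) (simp_all add: gaps_def case_prod_unfold)
        have "(\<Sum>q\<in>gaps X. f x * indicator {fst q<..<snd q} x) = (\<Sum>q\<in>gaps X. if q = p then f x else 0)"
        proof (intro sum.cong refl)
          fix q assume q: "q \<in> gaps X"
          show "f x * indicator {fst q<..<snd q} x = (if q = p then f x else 0)"
          proof (cases "q = p")
            case True then show ?thesis using p(2) by simp
          next
            case False
            then have "x \<notin> {fst q<..<snd q}" using uniq[OF q] by blast
            then show ?thesis using False by (simp only: indicator_simps if_False mult_zero_right simp_thms)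
          qed
        qed
        also have "\<dots> \<le> f x" using finite_gaps[OF X] p(1) by simp
        finally show ?thesis .
      qed
    qed
    finally show "(\<Sum>(u, v)\<in>gaps X. ennreal (v - u) * f (\<xi> u)) \<le> (\<integral>\<^sup>+x. f x \<partial>lborel)" .
  qed
qed

text \<open>
  The averaging argument in one variable is applied to the partial integrals of \<open>W\<close>, and then to the
  weighted sum of \<open>W\<close> over the abscissas obtained. The representatives thus form a product set.
\<close>

theorem exists_grid_representatives_le_integral:
  fixes W :: "complex \<Rightarrow> ennreal"
  assumes [measurable]: "W \<in> borel_measurable borel" and X: "finite X" and Y: "finite Y"
  obtains \<xi> \<upsilon> where "\<And>u v. consecutive X u v \<Longrightarrow> \<xi> u \<in> {u<..<v}" "\<And>u v. consecutive Y u v \<Longrightarrow> \<upsilon> u \<in> {u<..<v}"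
    "(\<Sum>(u', v')\<in>gaps Y. \<Sum>(u, v)\<in>gaps X. ennreal (v' - u') * (ennreal (v - u) * W (Complex (\<xi> u) (\<upsilon> u')))) \<le> (\<integral>\<^sup>+z. W z \<partial>lborel)"
proof -
  define \<kappa> :: "real \<times> real \<Rightarrow> complex" where "\<kappa> = (\<lambda>z. Complex (fst z) (snd z))"
  have "continuous_on UNIV \<kappa>" unfolding \<kappa>_def Complex_eq by (intro continuous_intros)
  then have "\<kappa> \<in> borel_measurable borel" by (rule borel_measurable_continuous_onI)
  then have m: "(\<lambda>z. W (\<kappa> z)) \<in> borel_measurable (lborel \<Otimes>\<^sub>M lborel)" by (simp add: lborel_prod)
  have mx: "(\<lambda>y. W (Complex x y)) \<in> borel_measurable borel" for x
  proof -
    have "continuous_on UNIV (\<lambda>y. Complex x y)" unfolding Complex_eq by (intro continuous_intros)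
    then have "(\<lambda>y. Complex x y) \<in> borel_measurable borel" by (rule borel_measurable_continuous_onI)
    then show ?thesis using assms(1) by (rule measurable_compose)
  qed
  define F where "F = (\<lambda>x. \<integral>\<^sup>+y. W (Complex x y) \<partial>lborel)"
  have "(\<lambda>x. \<integral>\<^sup>+y. W (\<kappa> (x, y)) \<partial>lborel) \<in> borel_measurable lborel"
    using lborel.borel_measurable_nn_integral_fst[OF m] by simp
  then have mF: "F \<in> borel_measurable borel" by (simp add: F_def \<kappa>_def)
  obtain \<xi> where \<xi>: "\<And>u v. consecutive X u v \<Longrightarrow> \<xi> u \<in> {u<..<v}"
    "(\<Sum>(u, v)\<in>gaps X. ennreal (v - u) * F (\<xi> u)) \<le> (\<integral>\<^sup>+x. F x \<partial>lborel)"
    by (rule exists_representatives_le_integral[OF mF X]) (rule that; assumption)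
  define G where "G = (\<lambda>y. \<Sum>p\<in>gaps X. ennreal (snd p - fst p) * W (Complex (\<xi> (fst p)) y))"
  have mG: "G \<in> borel_measurable borel" unfolding G_def
    by (intro borel_measurable_sum borel_measurable_times_ennreal borel_measurable_const mx)
  obtain \<upsilon> where \<upsilon>: "\<And>u v. consecutive Y u v \<Longrightarrow> \<upsilon> u \<in> {u<..<v}"
    "(\<Sum>(u, v)\<in>gaps Y. ennreal (v - u) * G (\<upsilon> u)) \<le> (\<integral>\<^sup>+y. G y \<partial>lborel)"
    by (rule exists_representatives_le_integral[OF mG Y]) (rule that; assumption)
  have mt: "(\<lambda>y. ennreal (snd p - fst p) * W (Complex (\<xi> (fst p)) y)) \<in> borel_measurable borel" for p
    by (intro borel_measurable_times_ennreal borel_measurable_const mx)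
  show thesis
  proof (rule that[of \<xi> \<upsilon>])
    have "(\<Sum>(u', v')\<in>gaps Y. \<Sum>(u, v)\<in>gaps X. ennreal (v' - u') * (ennreal (v - u) * W (Complex (\<xi> u) (\<upsilon> u'))))
        = (\<Sum>(u, v)\<in>gaps Y. ennreal (v - u) * G (\<upsilon> u))"
      by (simp add: G_def case_prod_unfold sum_distrib_left)
    also have "\<dots> \<le> (\<integral>\<^sup>+y. G y \<partial>lborel)" by (rule \<upsilon>(2))
    also have "\<dots> = (\<Sum>p\<in>gaps X. \<integral>\<^sup>+y. ennreal (snd p - fst p) * W (Complex (\<xi> (fst p)) y) \<partial>lborel)"
      unfolding G_def by (rule nn_integral_sum) (simp add: mt)
    also have "\<dots> = (\<Sum>p\<in>gaps X. ennreal (snd p - fst p) * F (\<xi> (fst p)))"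
      unfolding F_def by (intro sum.cong refl nn_integral_cmult) (simp add: mx)
    also have "\<dots> \<le> (\<integral>\<^sup>+x. F x \<partial>lborel)" using \<xi>(2) by (simp add: case_prod_unfold)
    also have "\<dots> = (\<integral>\<^sup>+z. W z \<partial>lborel)" unfolding F_def by (rule nn_integral_complex[symmetric]) simp
    finally show "(\<Sum>(u', v')\<in>gaps Y. \<Sum>(u, v)\<in>gaps X. ennreal (v' - u') * (ennreal (v - u) * W (Complex (\<xi> u) (\<upsilon> u')))) \<le> (\<integral>\<^sup>+z. W z \<partial>lborel)" .
  qed (use \<xi>(1) \<upsilon>(1) in auto)
qed

section \<open>Collapsing the plane onto a grid\<close>

text \<open>
  A quadratic spline; it rises from \<open>0\<close> to \<open>1\<close> on \<open>{-1..1}\<close> and is differentiable everywhere.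
\<close>

definition ramp :: "real \<Rightarrow> real" where
  "ramp t = ((max 0 (t + 1))\<^sup>2 - 2 * (max 0 t)\<^sup>2 + (max 0 (t - 1))\<^sup>2) / 2"

lemma differentiable_max_square: "(\<lambda>t::real. (max 0 t)\<^sup>2) differentiable (at x)"
proof -
  consider "x > 0" | "x < 0" | "x = 0" by linarith
  then have "\<exists>D. ((\<lambda>t::real. (max 0 t)\<^sup>2) has_field_derivative D) (at x)"
  proof cases
    case 1
    have "((\<lambda>t. t\<^sup>2) has_field_derivative 2 * x) (at x)" by (auto intro!: derivative_eq_intros)
    then have "((\<lambda>t. (max 0 t)\<^sup>2) has_field_derivative 2 * x) (at x)"
      by (rule has_field_derivative_transform_within_open[of _ _ _ "{0<..}"]) (use 1 in auto)
    then show ?thesis by blast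
  next
    case 2
    have "((\<lambda>t. 0) has_field_derivative 0) (at x)" by simp
    then have "((\<lambda>t. (max 0 t)\<^sup>2) has_field_derivative 0) (at x)"
      by (rule has_field_derivative_transform_within_open[of _ _ _ "{..<0}"]) (use 2 in auto)
    then show ?thesis by blast
  next
    case 3
    have "((\<lambda>y::real. max 0 y) \<longlongrightarrow> max 0 0) (at 0)" by (intro tendsto_intros)
    moreover have "(\<lambda>y. ((max 0 y)\<^sup>2 - (max 0 (0::real))\<^sup>2) / (y - 0)) = max 0"
      by (rule ext) (auto simp: max_def power2_eq_square)
    ultimately have "((\<lambda>t. (max 0 t)\<^sup>2) has_field_derivative max 0 0) (at (0::real))" unfolding has_field_derivative_iff by (simp only:)
    then show ?thesis using 3 by blast
  qed
  then show ?thesis by (auto simp: has_field_derivative_def differentiable_def)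
qed

lemma differentiable_ramp_affine: "(\<lambda>x. ramp ((x - m) / r)) differentiable (at x)"
proof -
  have 1: "(\<lambda>x. (max 0 ((x - m) / r + k))\<^sup>2) differentiable (at x)" for k
    using differentiable_chain_at[of "\<lambda>x. (x - m) / r + k" x "\<lambda>t. (max 0 t)\<^sup>2"] differentiable_max_square
    by (simp add: o_def divide_inverse)
  have "(\<lambda>x. ((max 0 ((x - m) / r + 1))\<^sup>2 - 2 * (max 0 ((x - m) / r + 0))\<^sup>2 + (max 0 ((x - m) / r + (-1)))\<^sup>2) * (1 / 2)) differentiable (at x)"
    by (intro differentiable_add differentiable_diff differentiable_mult differentiable_const 1)
  moreover have "(\<lambda>x. ((max 0 ((x - m) / r + 1))\<^sup>2 - 2 * (max 0 ((x - m) / r + 0))\<^sup>2 + (max 0 ((x - m) / r + (-1)))\<^sup>2) * (1 / 2)) = (\<lambda>x. ramp ((x - m) / r))"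
    by (rule ext) (simp add: ramp_def)
  ultimately show ?thesis by (simp only:)
qed

lemma ramp_values:
  "t \<le> -1 \<Longrightarrow> ramp t = 0" "t \<ge> 1 \<Longrightarrow> ramp t = 1" "-1 < t \<Longrightarrow> t < 1 \<Longrightarrow> 0 < ramp t \<and> ramp t < 1"
proof -
  show "ramp t = 0" if "t \<le> -1" using that by (simp add: ramp_def)
  show "ramp t = 1" if "t \<ge> 1" using that by (simp add: ramp_def power2_eq_square algebra_simps)
  show "0 < ramp t \<and> ramp t < 1" if t: "-1 < t" "t < 1"
  proof (cases "t \<le> 0")
    case True
    then have e: "ramp t = (t + 1)\<^sup>2 / 2" using t by (simp add: ramp_def)
    have "(t + 1)\<^sup>2 \<le> 1\<^sup>2" using True t by (intro power_mono) auto
    moreover have "0 < (t + 1)\<^sup>2" using t by simp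
    ultimately show ?thesis unfolding e by simp
  next
    case False
    then have e: "ramp t = 1 - (1 - t)\<^sup>2 / 2" using t by (simp add: ramp_def power2_eq_square field_simps)
    have "(1 - t)\<^sup>2 \<le> 1\<^sup>2" using False t by (intro power_mono) auto
    moreover have "0 < (1 - t)\<^sup>2" using t by simp
    ultimately show ?thesis unfolding e by simp
  qed
qed

lemma ramp_strict_mono:
  assumes "-1 \<le> s" "s < t" "t \<le> 1" shows "ramp s < ramp t"
proof -
  have low: "ramp x < ramp y" if "-1 \<le> x" "x < y" "y \<le> 0" for x y
  proof -
    have "(x + 1)\<^sup>2 < (y + 1)\<^sup>2" using that by (intro power_strict_mono) auto
    then show ?thesis using that by (simp add: ramp_def)
  qed
  have high: "ramp x < ramp y" if "0 \<le> x" "x < y" "y \<le> 1" for x y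
  proof -
    have "ramp x = 1 - (1 - x)\<^sup>2 / 2" "ramp y = 1 - (1 - y)\<^sup>2 / 2"
      using that by (simp_all add: ramp_def power2_eq_square field_simps)
    moreover have "(1 - y)\<^sup>2 < (1 - x)\<^sup>2" using that by (intro power_strict_mono) auto
    ultimately show ?thesis by simp
  qed
  consider "t \<le> 0" | "0 \<le> s" | "s < 0" "0 < t" by linarith
  then show ?thesis
  proof cases
    case 1 then show ?thesis using low assms by simp
  next
    case 2 then show ?thesis using high assms by simp
  next
    case 3
    then show ?thesis using low[of s 0] high[of 0 t] assms by simp
  qed
qed

text \<open>
  A sum of ramps, one for each gap of \<open>X\<close>. The last property only serves the induction, in which a new
  largest element adds one more ramp at the end.
\<close>

theorem staircase_function:
  fixes X :: "real set"
  assumes X: "finite X" "X \<noteq> {}" and r: "r > 0"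
    and gap: "\<And>u v. consecutive X u v \<Longrightarrow> u + 2 * r \<le> \<xi> u \<and> \<xi> u + 2 * r \<le> v"
  shows "\<exists>A. (\<forall>x. A differentiable (at x)) \<and>
    (\<forall>x. A x \<in> X \<or> (\<exists>u v. consecutive X u v \<and> \<bar>x - \<xi> u\<bar> < r \<and> A x \<in> {u<..<v})) \<and>
    (\<forall>u v. consecutive X u v \<longrightarrow> inj_on A {\<xi> u - r<..<\<xi> u + r}) \<and>
    (\<forall>p\<in>X. \<forall>x. \<bar>x - p\<bar> \<le> r \<longrightarrow> A x = p) \<and> (\<forall>x \<ge> Max X - r. A x = Max X)"
  using X(1,2) gap
proof (induction X rule: finite_linorder_max_induct)
  case empty then show ?case by simp
next
  case (insert b X)
  show ?case
  proof (cases "X = {}")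
    case True
    have nc: "\<not> consecutive {b} u v" for u v by (auto simp: consecutive_def)
    show ?thesis unfolding True using nc by (intro exI[of _ "\<lambda>_. b"]) simp
  next
    case False
    define M where "M = Max X"
    have M: "M \<in> X" "\<And>x. x \<in> X \<Longrightarrow> x \<le> M" "M < b" using insert(1,2) False by (auto simp: M_def)
    have cM: "consecutive (insert b X) M b" using M by (force simp: consecutive_def)
    have lift: "consecutive (insert b X) u v" if "consecutive X u v" for u v
      using that insert(2) unfolding consecutive_def by force
    have cases: "consecutive X u v \<or> (u = M \<and> v = b)" if c: "consecutive (insert b X) u v" for u v
    proof (cases "v = b")
      case True
      have "u \<in> X" using c True by (auto simp: consecutive_def)
      moreover have "\<not> u < M" using c M(1,3) True by (auto simp: consecutive_def)
      ultimately show ?thesis using M(2)[of u] True by simp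
    next
      case False
      then have "v \<in> X" using c by (auto simp: consecutive_def)
      moreover have "u < v" using c by (simp add: consecutive_def)
      then have "u \<in> X" using c insert(2) \<open>v \<in> X\<close> by (auto simp: consecutive_def)
      ultimately show ?thesis using c by (auto simp: consecutive_def)
    qed
    have gM: "M + 2 * r \<le> \<xi> M" "\<xi> M + 2 * r \<le> b" using insert(5)[OF cM] by auto
    obtain A where A: "\<And>x. A differentiable (at x)"
      "\<And>x. A x \<in> X \<or> (\<exists>u v. consecutive X u v \<and> \<bar>x - \<xi> u\<bar> < r \<and> A x \<in> {u<..<v})"
      "\<And>u v. consecutive X u v \<Longrightarrow> inj_on A {\<xi> u - r<..<\<xi> u + r}"
      "\<And>p x. p \<in> X \<Longrightarrow> \<bar>x - p\<bar> \<le> r \<Longrightarrow> A x = p" "\<And>x. x \<ge> M - r \<Longrightarrow> A x = M"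
      using insert(3)[OF False insert(5)[OF lift]] unfolding M_def by blast
    define B where "B = (\<lambda>x. A x + (b - M) * ramp ((x - \<xi> M) / r))"
    have B_low: "B x = A x" if "x \<le> \<xi> M - r" for x
    proof -
      have "(x - \<xi> M) / r \<le> -1" using that r by (simp add: divide_le_eq)
      then show ?thesis by (simp add: B_def ramp_values)
    qed
    have B_high: "B x = b" if "x \<ge> \<xi> M + r" for x
    proof -
      have "(x - \<xi> M) / r \<ge> 1" using that r by (simp add: le_divide_eq)
      moreover have "A x = M" using that gM r by (intro A(5)) simp
      ultimately show ?thesis by (simp add: B_def ramp_values)
    qed
    have B_mid: "B x = M + (b - M) * ramp ((x - \<xi> M) / r)" if "x > \<xi> M - r" for x
    proof -
      have "A x = M" using that gM r by (intro A(5)) simp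
      then show ?thesis by (simp add: B_def)
    qed
    have Mb: "Max (insert b X) = b" using insert(1,2) by (intro Max_eqI) (auto simp: less_imp_le)
    show ?thesis
    proof (intro exI[of _ B] conjI allI ballI impI)
      show "B differentiable (at x)" for x unfolding B_def
        by (intro differentiable_add A(1) differentiable_mult differentiable_const differentiable_ramp_affine)
      show "B x \<in> insert b X \<or> (\<exists>u v. consecutive (insert b X) u v \<and> \<bar>x - \<xi> u\<bar> < r \<and> B x \<in> {u<..<v})" for x
      proof -
        consider "x \<le> \<xi> M - r" | "x \<ge> \<xi> M + r" | "\<xi> M - r < x" "x < \<xi> M + r" by linarith
        then show ?thesis
        proof cases
          case 1
          have "A x \<in> insert b X \<or> (\<exists>u v. consecutive (insert b X) u v \<and> \<bar>x - \<xi> u\<bar> < r \<and> A x \<in> {u<..<v})"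
            using A(2)[of x] lift by blast
          then show ?thesis unfolding B_low[OF 1] .
        next
          case 2 then show ?thesis by (simp add: B_high)
        next
          case 3
          have t: "-1 < (x - \<xi> M) / r" "(x - \<xi> M) / r < 1" using 3 r by (simp_all add: less_divide_eq divide_less_eq)
          note R = ramp_values(3)[OF t]
          have "(b - M) * ramp ((x - \<xi> M) / r) < (b - M) * 1" using R M(3) by (intro mult_strict_left_mono) auto
          moreover have "0 < (b - M) * ramp ((x - \<xi> M) / r)" using R M(3) by simp
          ultimately have "B x \<in> {M<..<b}" unfolding B_mid[OF 3(1)] by simp
          moreover have "\<bar>x - \<xi> M\<bar> < r" using 3 by linarith
          ultimately show ?thesis using cM by blast
        qed
      qed
      show "inj_on B {\<xi> u - r<..<\<xi> u + r}" if c: "consecutive (insert b X) u v" for u v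
        using cases[OF c]
      proof
        assume c': "consecutive X u v"
        have "\<xi> u + 2 * r \<le> M" using insert(5)[OF c] M(2)[of v] c' by (auto simp: consecutive_def)
        then have eq: "B x = A x" if "x \<in> {\<xi> u - r<..<\<xi> u + r}" for x using that gM(1) r by (intro B_low) simp
        show ?thesis
        proof (rule inj_onI)
          fix x y assume xy: "x \<in> {\<xi> u - r<..<\<xi> u + r}" "y \<in> {\<xi> u - r<..<\<xi> u + r}" "B x = B y"
          have "A x = A y" using xy(3) eq[OF xy(1)] eq[OF xy(2)] by simp
          then show "x = y" using xy(1,2) by (rule inj_onD[OF A(3)[OF c']])
        qed
      next
        assume "u = M \<and> v = b"
        then have u: "u = M" by simp
        have less: "B x < B y" if "x \<in> {\<xi> u - r<..<\<xi> u + r}" "y \<in> {\<xi> u - r<..<\<xi> u + r}" "x < y" for x y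
        proof -
          have "ramp ((x - \<xi> M) / r) < ramp ((y - \<xi> M) / r)"
            by (rule ramp_strict_mono) (use that r u in \<open>simp_all add: le_divide_eq divide_le_eq divide_strict_right_mono\<close>)
          then have "(b - M) * ramp ((x - \<xi> M) / r) < (b - M) * ramp ((y - \<xi> M) / r)" using M(3) by simp
          then show ?thesis using that u by (simp add: B_mid)
        qed
        show ?thesis
        proof (rule inj_onI, rule ccontr)
          fix x y assume "x \<in> {\<xi> u - r<..<\<xi> u + r}" "y \<in> {\<xi> u - r<..<\<xi> u + r}" "B x = B y" "x \<noteq> y"
          then show False using less[of x y] less[of y x] by (cases "x < y") auto
        qed
      qed
      show "B x = p" if "p \<in> insert b X" "\<bar>x - p\<bar> \<le> r" for p x
      proof (cases "p = b")
        case True then show ?thesis using that gM by (simp add: B_high abs_le_iff)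
      next
        case False
        then have p: "p \<in> X" using that by simp
        have "x \<le> \<xi> M - r" using M(2)[OF p] that(2) gM(1) by linarith
        then show ?thesis using B_low A(4)[OF p that(2)] by simp
      qed
      show "B x = Max (insert b X)" if "x \<ge> Max (insert b X) - r" for x using that gM unfolding Mb by (intro B_high) simp
    qed
  qed
qed

text \<open>
  A staircase function in each coordinate. A point whose image is off the grid has both coordinates on
  ramps, and lies therefore in the box of one cell, where both staircases are injective.
\<close>

theorem grid_collapse:
  assumes X: "finite X" "X \<noteq> {}" and Y: "finite Y" "Y \<noteq> {}" and r: "r > 0"
    and gX: "\<And>u v. consecutive X u v \<Longrightarrow> u + 2 * r \<le> \<xi> u \<and> \<xi> u + 2 * r \<le> v"
    and gY: "\<And>u v. consecutive Y u v \<Longrightarrow> u + 2 * r \<le> \<upsilon> u \<and> \<upsilon> u + 2 * r \<le> v"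
  obtains \<rho> :: "complex \<Rightarrow> complex" where "\<And>z. \<rho> differentiable (at z)"
    "\<And>z s. z \<in> grid_lines X Y \<Longrightarrow> (1 - s) *\<^sub>R z + s *\<^sub>R \<rho> z \<in> grid_lines X Y"
    "\<And>z. \<rho> z \<notin> grid_lines X Y \<Longrightarrow> \<exists>u v u' v'. consecutive X u v \<and> consecutive Y u' v' \<and>
        z \<in> ball (Complex (\<xi> u) (\<upsilon> u')) (2 * r) \<and> \<rho> z \<in> box (Complex u u') (Complex v v')"
    "\<And>z z'. \<rho> z = \<rho> z' \<Longrightarrow> \<rho> z \<notin> grid_lines X Y \<Longrightarrow> z = z'"
    "\<And>p z. Re p \<in> X \<Longrightarrow> Im p \<in> Y \<Longrightarrow> dist z p \<le> r \<Longrightarrow> \<rho> z = p"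
proof -
  obtain A where A: "\<And>x. A differentiable (at x)"
    "\<And>x. A x \<in> X \<or> (\<exists>u v. consecutive X u v \<and> \<bar>x - \<xi> u\<bar> < r \<and> A x \<in> {u<..<v})"
    "\<And>u v. consecutive X u v \<Longrightarrow> inj_on A {\<xi> u - r<..<\<xi> u + r}"
    "\<And>p x. p \<in> X \<Longrightarrow> \<bar>x - p\<bar> \<le> r \<Longrightarrow> A x = p"
    using staircase_function[OF X r gX] by blast
  obtain B where B: "\<And>x. B differentiable (at x)"
    "\<And>x. B x \<in> Y \<or> (\<exists>u v. consecutive Y u v \<and> \<bar>x - \<upsilon> u\<bar> < r \<and> B x \<in> {u<..<v})"
    "\<And>u v. consecutive Y u v \<Longrightarrow> inj_on B {\<upsilon> u - r<..<\<upsilon> u + r}"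
    "\<And>p x. p \<in> Y \<Longrightarrow> \<bar>x - p\<bar> \<le> r \<Longrightarrow> B x = p"
    using staircase_function[OF Y r gY] by blast
  define \<rho> where "\<rho> = (\<lambda>z. Complex (A (Re z)) (B (Im z)))"
  have fixX: "A x = x" if "x \<in> X" for x using A(4)[OF that, of x] r by simp
  have fixY: "B x = x" if "x \<in> Y" for x using B(4)[OF that, of x] r by simp
  have A_off: "\<exists>u v. consecutive X u v \<and> \<bar>x - \<xi> u\<bar> < r \<and> A x \<in> {u<..<v}" if "A x \<notin> X" for x using A(2) that by blast
  have B_off: "\<exists>u v. consecutive Y u v \<and> \<bar>x - \<upsilon> u\<bar> < r \<and> B x \<in> {u<..<v}" if "B x \<notin> Y" for x using B(2) that by blast
  have A_inj: "x = y" if xy: "A x = A y" "A x \<notin> X" for x y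
  proof -
    obtain u v where u: "consecutive X u v" "\<bar>x - \<xi> u\<bar> < r" "A x \<in> {u<..<v}" using A_off[OF xy(2)] by blast
    have "A y \<notin> X" using xy by simp
    then obtain u' v' where u': "consecutive X u' v'" "\<bar>y - \<xi> u'\<bar> < r" "A y \<in> {u'<..<v'}" using A_off by blast
    have "u = u'" by (rule consecutive_overlap(1)[OF u(1) u'(1) u(3)]) (use u'(3) xy(1) in simp)
    then show "x = y" using u(2) u'(2) by (intro inj_onD[OF A(3)[OF u(1)] xy(1)]) (auto simp: abs_less_iff)
  qed
  have B_inj: "x = y" if xy: "B x = B y" "B x \<notin> Y" for x y
  proof -
    obtain u v where u: "consecutive Y u v" "\<bar>x - \<upsilon> u\<bar> < r" "B x \<in> {u<..<v}" using B_off[OF xy(2)] by blast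
    have "B y \<notin> Y" using xy by simp
    then obtain u' v' where u': "consecutive Y u' v'" "\<bar>y - \<upsilon> u'\<bar> < r" "B y \<in> {u'<..<v'}" using B_off by blast
    have "u = u'" by (rule consecutive_overlap(1)[OF u(1) u'(1) u(3)]) (use u'(3) xy(1) in simp)
    then show "x = y" using u(2) u'(2) by (intro inj_onD[OF B(3)[OF u(1)] xy(1)]) (auto simp: abs_less_iff)
  qed
  show thesis
  proof (rule that[of \<rho>])
    show "\<rho> differentiable (at z)" for z
    proof -
      have of: "complex_of_real differentiable (at x)" for x :: real by (rule bounded_linear_imp_differentiable[OF bounded_linear_of_real])
      have "(\<lambda>z. A (Re z)) differentiable (at z)"
        using differentiable_chain_at[OF bounded_linear_imp_differentiable[OF bounded_linear_Re, of "at z"] A(1)] by (simp only: o_def)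
      then have 1: "(\<lambda>z. complex_of_real (A (Re z))) differentiable (at z)"
        using differentiable_chain_at[of "\<lambda>z. A (Re z)" z complex_of_real] of by (simp only: o_def)
      have "(\<lambda>z. B (Im z)) differentiable (at z)"
        using differentiable_chain_at[OF bounded_linear_imp_differentiable[OF bounded_linear_Im, of "at z"] B(1)] by (simp only: o_def)
      then have 2: "(\<lambda>z. complex_of_real (B (Im z))) differentiable (at z)"
        using differentiable_chain_at[of "\<lambda>z. B (Im z)" z complex_of_real] of by (simp only: o_def)
      show ?thesis unfolding \<rho>_def Complex_eq
        by (intro differentiable_add differentiable_mult differentiable_const 1 2)
    qed
    fix z :: complex
    show "(1 - s) *\<^sub>R z + s *\<^sub>R \<rho> z \<in> grid_lines X Y" if z: "z \<in> grid_lines X Y" for s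
    proof (cases "Re z \<in> X")
      case True
      then have "Re ((1 - s) *\<^sub>R z + s *\<^sub>R \<rho> z) = Re z" by (simp add: \<rho>_def fixX algebra_simps)
      then show ?thesis using True unfolding grid_lines_def by (simp only: mem_Collect_eq simp_thms)
    next
      case False
      then have I: "Im z \<in> Y" using z by (simp add: grid_lines_def)
      then have "Im ((1 - s) *\<^sub>R z + s *\<^sub>R \<rho> z) = Im z" by (simp add: \<rho>_def fixY algebra_simps)
      then show ?thesis using I unfolding grid_lines_def by (simp only: mem_Collect_eq simp_thms)
    qed
    show "\<exists>u v u' v'. consecutive X u v \<and> consecutive Y u' v' \<and>
        z \<in> ball (Complex (\<xi> u) (\<upsilon> u')) (2 * r) \<and> \<rho> z \<in> box (Complex u u') (Complex v v')" if "\<rho> z \<notin> grid_lines X Y"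
    proof -
      have "A (Re z) \<notin> X" "B (Im z) \<notin> Y" using that by (auto simp: \<rho>_def grid_lines_def)
      then obtain u v u' v' where u: "consecutive X u v" "\<bar>Re z - \<xi> u\<bar> < r" "A (Re z) \<in> {u<..<v}"
        and u': "consecutive Y u' v'" "\<bar>Im z - \<upsilon> u'\<bar> < r" "B (Im z) \<in> {u'<..<v'}"
        using A_off B_off by meson
      have "dist (Complex (\<xi> u) (\<upsilon> u')) z \<le> \<bar>Re (Complex (\<xi> u) (\<upsilon> u') - z)\<bar> + \<bar>Im (Complex (\<xi> u) (\<upsilon> u') - z)\<bar>"
        unfolding dist_norm by (rule cmod_le)
      then have "z \<in> ball (Complex (\<xi> u) (\<upsilon> u')) (2 * r)" using u(2) u'(2) by simp
      moreover have "\<rho> z \<in> box (Complex u u') (Complex v v')" using u(3) u'(3) by (simp add: \<rho>_def in_box_complex_iff)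
      ultimately show ?thesis using u(1) u'(1) by blast
    qed
    show "z = z'" if "\<rho> z = \<rho> z'" "\<rho> z \<notin> grid_lines X Y" for z'
    proof (rule complex_eqI)
      have "A (Re z) = A (Re z')" "B (Im z) = B (Im z')" "A (Re z) \<notin> X" "B (Im z) \<notin> Y"
        using that by (auto simp: \<rho>_def grid_lines_def)
      then show "Re z = Re z'" "Im z = Im z'" using A_inj B_inj by blast+
    qed
    show "\<rho> z = p" if "Re p \<in> X" "Im p \<in> Y" "dist z p \<le> r" for p
    proof -
      have "\<bar>Re z - Re p\<bar> \<le> r" "\<bar>Im z - Im p\<bar> \<le> r"
        using that(3) abs_Re_le_cmod[of "z - p"] abs_Im_le_cmod[of "z - p"] by (simp_all add: dist_norm)
      then show ?thesis using A(4)[OF that(1)] B(4)[OF that(2)] by (simp add: \<rho>_def)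
    qed
  qed
qed

lemma finite_uniform_radius:
  assumes "finite I" "\<And>i. i \<in> I \<Longrightarrow> \<exists>e>0. \<forall>r. 0 < r \<and> r < e \<longrightarrow> P i r"
  shows "\<exists>e>0. \<forall>i\<in>I. \<forall>r. 0 < r \<and> r < e \<longrightarrow> P i (r::real)"
  using assms
proof (induction I rule: finite_induct)
  case empty then show ?case by (intro exI[of _ 1]) simp
next
  case (insert j I)
  obtain e where e: "e > 0" "\<forall>i\<in>I. \<forall>r. 0 < r \<and> r < e \<longrightarrow> P i r" using insert by blast
  obtain d where d: "d > 0" "\<forall>r. 0 < r \<and> r < d \<longrightarrow> P j r" using insert(4)[of j] by blast
  show ?case
  proof (intro exI[of _ "min e d"] conjI ballI allI impI)
    show "0 < min e d" using e(1) d(1) by simp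
    fix i r assume i: "i \<in> insert j I" and r: "0 < r \<and> r < min e d"
    then have "r < e" "r < d" by simp_all
    then show "P i r" using i r e(2) d(2) by blast
  qed
qed

section \<open>The null-homotopy of small area\<close>

lemma piecewise_differentiable_strip_straight_line:
  assumes H: "piecewise_differentiable_strip a b H" and K: "piecewise_differentiable_strip a b K"
  shows "piecewise_differentiable_strip a b (\<lambda>z. (1 - fst z) *\<^sub>R H z + fst z *\<^sub>R K z)"
proof -
  obtain X Y where XY: "finite X" "finite Y"
    "\<And>s s' t t'. \<lbrakk>0 \<le> s; s < s'; s' \<le> 1; a \<le> t; t < t'; t' \<le> b; {s<..<s'} \<inter> X = {}; {t<..<t'} \<inter> Y = {}\<rbrakk>
       \<Longrightarrow> H differentiable_on {s..s'} \<times> {t..t'}"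
    by (rule piecewise_differentiable_stripE[OF H]) (rule that; assumption)
  obtain X' Y' where XY': "finite X'" "finite Y'"
    "\<And>s s' t t'. \<lbrakk>0 \<le> s; s < s'; s' \<le> 1; a \<le> t; t < t'; t' \<le> b; {s<..<s'} \<inter> X' = {}; {t<..<t'} \<inter> Y' = {}\<rbrakk>
       \<Longrightarrow> K differentiable_on {s..s'} \<times> {t..t'}"
    by (rule piecewise_differentiable_stripE[OF K]) (rule that; assumption)
  show ?thesis unfolding piecewise_differentiable_strip_def
  proof (rule exI[of _ "X \<union> X'"], rule exI[of _ "Y \<union> Y'"], intro conjI allI impI)
    show "finite (X \<union> X')" "finite (Y \<union> Y')" using XY XY' by auto
    fix s s' t t' assume st: "0 \<le> s \<and> s < s' \<and> s' \<le> 1 \<and> a \<le> t \<and> t < t' \<and> t' \<le> b \<and>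
           {s<..<s'} \<inter> (X \<union> X') = {} \<and> {t<..<t'} \<inter> (Y \<union> Y') = {}"
    then have e: "{s<..<s'} \<inter> X = {}" "{s<..<s'} \<inter> X' = {}" "{t<..<t'} \<inter> Y = {}" "{t<..<t'} \<inter> Y' = {}" by blast+
    have Hd: "H differentiable_on {s..s'} \<times> {t..t'}" using st e by (intro XY(3)) auto
    have Kd: "K differentiable_on {s..s'} \<times> {t..t'}" using st e by (intro XY'(3)) auto
    show "(\<lambda>z. (1 - fst z) *\<^sub>R H z + fst z *\<^sub>R K z) differentiable_on {s..s'} \<times> {t..t'}"
      unfolding differentiable_on_def
    proof
      fix z :: "real \<times> real" assume z: "z \<in> {s..s'} \<times> {t..t'}"
      have f: "fst differentiable (at z within {s..s'} \<times> {t..t'})" by (rule bounded_linear_imp_differentiable[OF bounded_linear_fst])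
      show "(\<lambda>z. (1 - fst z) *\<^sub>R H z + fst z *\<^sub>R K z) differentiable (at z within {s..s'} \<times> {t..t'})"
        using Hd Kd z unfolding differentiable_on_def
        by (intro differentiable_add differentiable_scaleR differentiable_diff differentiable_const f) blast+
    qed
  qed
qed

text \<open>
  The rectangles of a subdivision that touch the top side are used on the whole strip.
\<close>

lemma piecewise_differentiable_strip_top:
  assumes H: "piecewise_differentiable_strip a b H"
  shows "piecewise_differentiable_strip a b (\<lambda>z. H (1, snd z))"
proof -
  obtain X Y where XY: "finite X" "finite Y"
    "\<And>s s' t t'. \<lbrakk>0 \<le> s; s < s'; s' \<le> 1; a \<le> t; t < t'; t' \<le> b; {s<..<s'} \<inter> X = {}; {t<..<t'} \<inter> Y = {}\<rbrakk>
       \<Longrightarrow> H differentiable_on {s..s'} \<times> {t..t'}"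
    by (rule piecewise_differentiable_stripE[OF H]) (rule that; assumption)
  define s0 where "s0 = Max (insert 0 {x \<in> X. x < 1 \<and> 0 \<le> x})"
  have fin: "finite (insert 0 {x \<in> X. x < 1 \<and> 0 \<le> x})" using XY(1) by simp
  have s0: "0 \<le> s0" "s0 < 1" using Max_in[OF fin] Max_ge[OF fin, of 0] by (auto simp: s0_def)
  have e: "{s0<..<1} \<inter> X = {}"
  proof (rule ccontr)
    assume "\<not> ?thesis"
    then obtain x where x: "x \<in> X" "s0 < x" "x < 1" by auto
    then have "0 \<le> x" using s0(1) by simp
    then have "x \<le> s0" unfolding s0_def using x(1,3) by (intro Max_ge[OF fin]) auto
    then show False using x by simp
  qed
  show ?thesis unfolding piecewise_differentiable_strip_def
  proof (rule exI[of _ "{}"], rule exI[of _ Y], intro conjI allI impI)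
    show "finite Y" "finite ({} :: real set)" using XY by auto
    fix s s' t t' :: real assume st: "0 \<le> s \<and> s < s' \<and> s' \<le> 1 \<and> a \<le> t \<and> t < t' \<and> t' \<le> b \<and>
           {s<..<s'} \<inter> {} = {} \<and> {t<..<t'} \<inter> Y = {}"
    have "H differentiable_on {s0..1} \<times> {t..t'}" using st s0 e by (intro XY(3)) auto
    then have "(\<lambda>z. H (0 * fst z + 1, 1 * snd z + 0)) differentiable_on {s..s'} \<times> {t..t'}"
      by (rule differentiable_on_compose_Pair[OF _ differentiable_on_affine differentiable_on_affine]) (use s0 in auto)
    then show "(\<lambda>z. H (1, snd z)) differentiable_on {s..s'} \<times> {t..t'}" by simp
  qed
qed

text \<open>
  In polar form around \<open>1\<close>, the point with parameters \<open>(s,t)\<close> has argument determined by \<open>t\<close> and distance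
  proportional to \<open>1 - s\<close>.
\<close>

lemma disk_contraction_injective:
  "inj_on (\<lambda>z::real \<times> real. of_real (1 - fst z) * cis (2 * pi * snd z) + of_real (fst z)) ({0<..<1} \<times> {0<..<1})"
proof (rule inj_onI)
  have double: "complex_of_real (1 - s) * cis (2 * x) + of_real s = 1 + of_real (2 * (1 - s) * sin x) * (\<i> * cis x)" for s x :: real
  proof (rule complex_eqI)
    have "(1 - s) * (1 - 2 * (sin x)\<^sup>2) + s = 1 - 2 * (1 - s) * sin x * sin x" by (simp add: power2_eq_square algebra_simps)
    then show "Re (complex_of_real (1 - s) * cis (2 * x) + of_real s) = Re (1 + of_real (2 * (1 - s) * sin x) * (\<i> * cis x))"
      by (simp add: cos_double_sin)
    show "Im (complex_of_real (1 - s) * cis (2 * x) + of_real s) = Im (1 + of_real (2 * (1 - s) * sin x) * (\<i> * cis x))"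
      by (simp add: sin_double)
  qed
  have polar: "complex_of_real (1 - s) * cis (2 * pi * t) + of_real s = 1 + of_real (2 * (1 - s) * sin (pi * t)) * (\<i> * cis (pi * t))" for s t
    using double[of s "pi * t"] by (simp only: mult.assoc)
  fix z z' :: "real \<times> real" assume z: "z \<in> {0<..<1} \<times> {0<..<1}" "z' \<in> {0<..<1} \<times> {0<..<1}"
    "of_real (1 - fst z) * cis (2 * pi * snd z) + of_real (fst z) = of_real (1 - fst z') * cis (2 * pi * snd z') + of_real (fst z')"
  define R R' where "R = 2 * (1 - fst z) * sin (pi * snd z)" and "R' = 2 * (1 - fst z') * sin (pi * snd z')"
  have t: "0 < pi * snd z" "pi * snd z < pi" "0 < pi * snd z'" "pi * snd z' < pi" using z(1,2) by auto
  have s: "0 < 1 - fst z" "0 < 1 - fst z'" using z(1,2) by auto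
  have pos: "0 < sin (pi * snd z)" "0 < sin (pi * snd z')" using t by (simp_all add: sin_gt_zero)
  have R: "0 < R" "0 < R'" unfolding R_def R'_def using s pos by simp_all
  have eq: "of_real R * (\<i> * cis (pi * snd z)) = of_real R' * (\<i> * cis (pi * snd z'))"
    using z(3) unfolding polar R_def R'_def by simp
  have "norm (of_real R * (\<i> * cis (pi * snd z))) = norm (of_real R' * (\<i> * cis (pi * snd z')))" using eq by (rule arg_cong)
  then have RR: "R = R'" using R by (simp add: norm_mult)
  then have "cis (pi * snd z) = cis (pi * snd z')" using eq R by simp
  then have "Re (cis (pi * snd z)) = Re (cis (pi * snd z'))" by (rule arg_cong)
  then have "cos (pi * snd z) = cos (pi * snd z')" by simp
  then have "pi * snd z = pi * snd z'" by (rule cos_inj_pi[rotated 4]) (use t in simp_all)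
  then have snd: "snd z = snd z'" by simp
  have "fst z = fst z'" using RR pos unfolding R_def R'_def snd by simp
  then show "z = z'" using snd by (rule prod_eqI)
qed

lemma disk_contraction_in_disk:
  fixes z :: "real \<times> real"
  assumes "z \<in> {0..1} \<times> {0..1}"
  shows "of_real (1 - fst z) * cis (2 * pi * snd z) + of_real (fst z) \<in> cball 0 1"
proof -
  have s: "0 \<le> fst z" "fst z \<le> 1" using assms by auto
  have "norm (of_real (1 - fst z) * cis (2 * pi * snd z) + of_real (fst z))
      \<le> norm (complex_of_real (1 - fst z) * cis (2 * pi * snd z)) + norm (complex_of_real (fst z))"
    by (rule norm_triangle_ineq)
  also have "\<dots> = 1" using s by (simp add: norm_mult del: of_real_diff)
  finally show ?thesis by simp
qed

lemma preimage_count_disk_contraction: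
  assumes F: "disk_immersion F" and y: "y \<notin> F ` sphere 0 1"
  shows "preimage_count 0 1 (\<lambda>z. F (of_real (1 - fst z) * cis (2 * pi * snd z) + of_real (fst z))) y
    \<le> ennreal (cmod (winding_number (\<lambda>t. F (cis (2 * pi * t))) y))"
proof -
  define \<phi> :: "real \<times> real \<Rightarrow> complex" where "\<phi> = (\<lambda>z. of_real (1 - fst z) * cis (2 * pi * snd z) + of_real (fst z))"
  define P where "P = {z \<in> {0..1} \<times> {0..1}. F (\<phi> z) = y}"
  define Z where "Z = {z \<in> cball 0 1. F z = y}"
  have one: "(1::complex) \<in> sphere 0 1" by simp
  have cb: "\<phi> z \<in> cball 0 1" if "z \<in> {0..1} \<times> {0..1}" for z
    unfolding \<phi>_def using that by (rule disk_contraction_in_disk)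
  have sub: "P \<subseteq> {0<..<1} \<times> {0<..<1}"
  proof
    fix z assume z: "z \<in> P"
    then have zs: "\<phi> z \<notin> sphere 0 1" and z01: "z \<in> {0..1} \<times> {0..1}" using y by (auto simp: P_def)
    have "fst z \<noteq> 0" using zs by (auto simp: \<phi>_def)
    moreover have "fst z \<noteq> 1" using zs by (auto simp: \<phi>_def)
    moreover have "snd z \<noteq> 0" using zs by (auto simp: \<phi>_def)
    moreover have "snd z \<noteq> 1"
    proof
      assume "snd z = 1"
      then have "\<phi> z = 1" by (simp add: \<phi>_def complex_eq_iff)
      then show False using zs one by simp
    qed
    ultimately show "z \<in> {0<..<1} \<times> {0<..<1}" using z01 by (cases z) auto
  qed
  have "inj_on \<phi> P" unfolding \<phi>_def by (rule inj_on_subset[OF disk_contraction_injective sub])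
  moreover have im: "\<phi> ` P \<subseteq> Z" unfolding Z_def using cb by (auto simp: P_def)
  moreover have finZ: "finite Z" unfolding Z_def by (rule card_preimages_of_disk_immersion(1)[OF F y])
  ultimately have "finite P" "card P \<le> card Z"
    using finite_imageD[OF finite_subset[OF im finZ]] card_inj_on_le[of \<phi> P Z] by blast+
  then have "emeasure (count_space UNIV) P \<le> of_nat (card Z)" by (simp add: emeasure_count_space)
  also have "\<dots> = ennreal (cmod (winding_number (\<lambda>t. F (cis (2 * pi * t))) y))"
    using card_preimages_of_disk_immersion(2)[OF F y] unfolding Z_def by (simp add: ennreal_of_nat_eq_real_of_nat)
  finally show ?thesis unfolding preimage_count_def P_def \<phi>_def .
qed

lemma glue_first_ends:
  "glue_first H K (0, t) = H (0, t)" "glue_first H K (1, t) = K (1, t)"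
  by (simp_all add: glue_first_def)

lemma glue_first_side:
  assumes "\<And>s. s \<in> {0..1} \<Longrightarrow> H (s, t) = p" "\<And>s. s \<in> {0..1} \<Longrightarrow> K (s, t) = p" "s \<in> {0..1}"
  shows "glue_first H K (s, t) = p"
  using assms(1)[of "2 * s"] assms(2)[of "2 * s - 1"] assms(3) by (auto simp: glue_first_def)

lemma negligible_grid_lines:
  assumes "finite X" "finite Y"
  shows "negligible (grid_lines X Y)"
proof -
  have "grid_lines X Y = (\<Union>a\<in>X. {z. 1 \<bullet> z = a}) \<union> (\<Union>b\<in>Y. {z. \<i> \<bullet> z = b})"
    by (auto simp: grid_lines_def inner_complex_def)
  moreover have "negligible {z. (1::complex) \<bullet> z = a}" "negligible {z. \<i> \<bullet> z = a}" for a
    by (rule negligible_hyperplane, simp)+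
  then have "negligible ((\<Union>a\<in>X. {z. 1 \<bullet> z = a}) \<union> (\<Union>b\<in>Y. {z. \<i> \<bullet> z = b}))"
    using assms by (intro negligible_Un negligible_Union) auto
  ultimately show ?thesis by (simp only:)
qed

text \<open>
  The regular case is covered by taking the curve itself as its approximation.
\<close>

lemma self_overlapping_approximation:
  assumes "normal_curve c" "self_overlapping c" "\<epsilon> > 0"
  obtains F where "disk_immersion F" "\<And>t. t \<in> {0..1} \<Longrightarrow> dist (F (cis (2 * pi * t))) (c t) < \<epsilon>"
proof (cases "regular_curve c \<and> normal_curve c")
  case True
  then have "bounds_immersed_disk c" using assms(2) by (simp add: self_overlapping_def)
  then obtain F where F: "disk_immersion F" "\<And>t. t \<in> {0..1} \<Longrightarrow> c t = F (cis (2 * pi * t))"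
    unfolding bounds_immersed_disk_def by blast
  show thesis by (rule that[OF F(1)]) (simp add: F(2)[symmetric] assms(3))
next
  case False
  then have "\<forall>\<epsilon>>0. \<exists>c'. regular_curve c' \<and> normal_curve c' \<and> bounds_immersed_disk c' \<and> (\<forall>t \<in> {0..1}. dist (c' t) (c t) < \<epsilon>)"
    using assms(2) unfolding self_overlapping_def by (simp only: if_False)
  then obtain c' where c': "bounds_immersed_disk c'" "\<forall>t \<in> {0..1}. dist (c' t) (c t) < \<epsilon>" using assms(3) by blast
  obtain F where F: "disk_immersion F" "\<And>t. t \<in> {0..1} \<Longrightarrow> c' t = F (cis (2 * pi * t))"
    using c'(1) unfolding bounds_immersed_disk_def by blast
  show thesis by (rule that[OF F(1)]) (use c'(2) in \<open>simp add: F(2)[symmetric]\<close>)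
qed

lemma piecewise_differentiable_strip_immersion:
  assumes F: "F differentiable_on cball 0 1" and g: "\<And>z. g differentiable (at z)"
    and im: "\<And>z. z \<in> {0..1} \<times> {0..1} \<Longrightarrow> g z \<in> cball 0 1"
  shows "piecewise_differentiable_strip 0 1 (\<lambda>z. F (g z))" "continuous_on ({0..1} \<times> {0..1}) (\<lambda>z. F (g z))"
proof -
  have D: "(\<lambda>z. F (g z)) differentiable_on {0..1} \<times> {0..1}"
    unfolding differentiable_on_def
  proof
    fix z :: "real \<times> real" assume z: "z \<in> {0..1} \<times> {0..1}"
    have "g differentiable (at z within {0..1} \<times> {0..1})" using g by (rule differentiable_at_withinI)
    moreover have "F differentiable (at (g z) within g ` ({0..1} \<times> {0..1}))"
    proof (rule differentiable_within_subset)
      show "F differentiable (at (g z) within cball 0 1)" using F im[OF z] unfolding differentiable_on_def by blast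
      show "g ` ({0..1} \<times> {0..1}) \<subseteq> cball 0 1" using im by blast
    qed
    ultimately show "(\<lambda>z. F (g z)) differentiable (at z within {0..1} \<times> {0..1})"
      using differentiable_chain_within[of g z "{0..1} \<times> {0..1}" F] by (simp only: o_def)
  qed
  show "continuous_on ({0..1} \<times> {0..1}) (\<lambda>z. F (g z))" using D by (rule differentiable_imp_continuous_on)
  show "piecewise_differentiable_strip 0 1 (\<lambda>z. F (g z))" unfolding piecewise_differentiable_strip_def
    by (intro exI[of _ "{}"] conjI allI impI differentiable_on_subset[OF D]) auto
qed

text \<open>
  The homotopy has five stages: the sweep \<open>S\<close> of \<open>c\<close> onto the grid; the straight homotopy to its image
  under \<open>\<rho>\<close>, inside the grid; the image of the sweep under \<open>\<rho>\<close>, run backwards to \<open>\<rho>(c)\<close>; the image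
  under \<open>\<rho>\<close> of the straight homotopy from \<open>c\<close> to the boundary of the immersed disk; and the contraction
  of the disk followed by \<open>\<rho>\<close>. The second and the fourth stage stay in the grid, the first has small
  area, and the third and the fifth are controlled by the value of \<open>w + |wn|\<close> at the centres of the boxes.
\<close>

theorem exists_small_null_homotopy:
  assumes c: "normal_curve c" and so: "self_overlapping c" and W_fin: "winding_area c < \<infinity>" and \<delta>: "\<delta> > 0"
  shows "\<exists>H. null_homotopy c H \<and> piecewise_differentiable_square H \<and>
    homotopy_area H \<le> winding_area c + ennreal \<delta> + ennreal \<delta>"
proof -
  have pr: "piecewise_regular c" using c by (simp add: normal_curve_def)
  have cc: "closed_curve c" using pr by (simp add: piecewise_regular_def)
  have pc: "path c" "pathfinish c = pathstart c" and c10: "c 1 = c 0"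
    using cc by (simp_all add: closed_curve_def pathfinish_def pathstart_def)
  have cont: "continuous_on {0..1} c" using pc(1) by (simp add: path_def)
  have clc: "closed (path_image c)" using pc(1) by (rule closed_path_image)
  have negc: "negligible (path_image c)" by (rule negligible_path_image_piecewise_regular[OF pr])
  have nullc: "emeasure lborel (path_image c) = 0" by (rule emeasure_lborel_negligible_closed[OF negc clc])
  define p0 where "p0 = c 0"
  obtain S X0 Y0 w where S: "finite X0" "finite Y0" "w \<in> borel_measurable borel" "(\<integral>\<^sup>+x. w x \<partial>lborel) \<le> ennreal \<delta>"
    "continuous_on ({0..1} \<times> {0..1}) S" "piecewise_differentiable_strip 0 1 S"
    "\<And>t. t \<in> {0..1} \<Longrightarrow> S (0, t) = c t" "\<And>t. t \<in> {0..1} \<Longrightarrow> S (1, t) \<in> grid_lines X0 Y0"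
    "\<And>s. s \<in> {0..1} \<Longrightarrow> S (s, 0) = c 0" "\<And>s. s \<in> {0..1} \<Longrightarrow> S (s, 1) = c 1"
    "\<And>x. x \<notin> path_image c \<union> grid_lines X0 Y0 \<Longrightarrow> preimage_count 0 1 S x \<le> w x"
    "\<And>x. x \<notin> path_image c \<union> grid_lines X0 Y0 \<Longrightarrow> \<exists>e>0. \<forall>y\<in>ball x e. w y = w x"
    by (rule sweepableE[OF normal_curve_sweepable[OF c \<delta>]]) (rule that; assumption)
  define X Y where "X = insert (Re p0) X0" and "Y = insert (Im p0) Y0"
  have X: "finite X" "X \<noteq> {}" "Re p0 \<in> X" and Y: "finite Y" "Y \<noteq> {}" "Im p0 \<in> Y" using S(1,2) by (auto simp: X_def Y_def)
  have grid_sub: "grid_lines X0 Y0 \<subseteq> grid_lines X Y" by (auto simp: grid_lines_def X_def Y_def)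
  define V where "V = (\<lambda>z. ennreal (cmod (winding_number c z)) * indicator (- path_image c) z)"
  have mV: "V \<in> borel_measurable borel"
  proof -
    have "continuous_on (- path_image c) (\<lambda>z. cmod (winding_number c z))"
      by (intro continuous_on_norm continuous_on_winding_number pc(1))
    then have "(\<lambda>z. indicator (- path_image c) z *\<^sub>R cmod (winding_number c z)) \<in> borel_measurable borel"
      by (rule borel_measurable_continuous_on_indicator[rotated]) (use clc in auto)
    then have "(\<lambda>z. ennreal (indicator (- path_image c) z *\<^sub>R cmod (winding_number c z))) \<in> borel_measurable borel"
      by (rule measurable_compose) simp
    moreover have "V = (\<lambda>z. ennreal (indicator (- path_image c) z *\<^sub>R cmod (winding_number c z)))"
      by (rule ext) (simp add: V_def indicator_def)
    ultimately show ?thesis by (simp only:)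
  qed
  have mc: "path_image c \<in> sets borel" using clc by (rule borel_closed)
  \<comment> \<open>The infinite term does not change the integral, but keeps the centres of the boxes off the curve.\<close>
  define W where "W = (\<lambda>z. (w z + V z) + \<infinity> * indicator (path_image c) z)"
  have mI: "(\<lambda>z. \<infinity> * indicator (path_image c) z :: ennreal) \<in> borel_measurable borel"
    using mc by (intro borel_measurable_times_ennreal borel_measurable_const borel_measurable_indicator)
  have mwV: "(\<lambda>z. w z + V z) \<in> borel_measurable borel" using S(3) mV by simp
  have mW: "W \<in> borel_measurable borel" unfolding W_def using mwV mI by simp
  have intW: "(\<integral>\<^sup>+z. W z \<partial>lborel) \<le> ennreal \<delta> + winding_area c"
  proof -
    have "(\<integral>\<^sup>+z. W z \<partial>lborel) = (\<integral>\<^sup>+z. w z + V z \<partial>lborel) + (\<integral>\<^sup>+z. \<infinity> * indicator (path_image c) z \<partial>lborel)"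
      unfolding W_def by (rule nn_integral_add) (use mwV mI in simp_all)
    also have "(\<integral>\<^sup>+z. \<infinity> * indicator (path_image c) z \<partial>lborel) = \<infinity> * emeasure lborel (path_image c)"
      by (rule nn_integral_cmult_indicator) (use mc in simp)
    also have "(\<integral>\<^sup>+z. w z + V z \<partial>lborel) = (\<integral>\<^sup>+z. w z \<partial>lborel) + (\<integral>\<^sup>+z. V z \<partial>lborel)"
      by (rule nn_integral_add) (use S(3) mV in simp_all)
    also have "(\<integral>\<^sup>+z. V z \<partial>lborel) = winding_area c" by (simp only: V_def winding_area_def)
    finally show ?thesis using S(4) nullc by (simp add: add_right_mono)
  qed
  obtain \<xi> \<upsilon> where rep: "\<And>u v. consecutive X u v \<Longrightarrow> \<xi> u \<in> {u<..<v}" "\<And>u v. consecutive Y u v \<Longrightarrow> \<upsilon> u \<in> {u<..<v}"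
    "(\<Sum>(u', v')\<in>gaps Y. \<Sum>(u, v)\<in>gaps X. ennreal (v' - u') * (ennreal (v - u) * W (Complex (\<xi> u) (\<upsilon> u')))) \<le> (\<integral>\<^sup>+z. W z \<partial>lborel)"
    by (rule exists_grid_representatives_le_integral[OF mW X(1) Y(1)]) (rule that; assumption)
  define \<zeta> :: "real \<times> real \<Rightarrow> real \<times> real \<Rightarrow> complex" where "\<zeta> = (\<lambda>p q. Complex (\<xi> (fst p)) (\<upsilon> (fst q)))"
  define E where "E = (\<lambda>p q. ennreal (snd q - fst q) * (ennreal (snd p - fst p) * W (\<zeta> p q)))"
  have sumE: "(\<Sum>q\<in>gaps Y. \<Sum>p\<in>gaps X. E p q) \<le> ennreal \<delta> + winding_area c"
    using order_trans[OF rep(3) intW] by (simp add: E_def \<zeta>_def case_prod_unfold)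
  have finXY: "finite (gaps X)" "finite (gaps Y)" using X(1) Y(1) by (simp_all add: finite_gaps)
  have off: "\<zeta> p q \<notin> path_image c" if p: "p \<in> gaps X" and q: "q \<in> gaps Y" for p q
  proof
    assume "\<zeta> p q \<in> path_image c"
    then have "W (\<zeta> p q) = \<infinity>" by (simp add: W_def)
    moreover have "0 < snd p - fst p" "0 < snd q - fst q" using p q by (auto simp: gaps_def consecutive_def)
    ultimately have "E p q = \<infinity>" by (simp add: E_def ennreal_mult_top)
    moreover have "E p q \<le> (\<Sum>p\<in>gaps X. E p q)" using p finXY by (intro member_le_sum) simp_all
    moreover have "(\<Sum>p\<in>gaps X. E p q) \<le> (\<Sum>q\<in>gaps Y. \<Sum>p\<in>gaps X. E p q)"
      using q finXY by (intro member_le_sum[of q "gaps Y" "\<lambda>q. \<Sum>p\<in>gaps X. E p q"]) simp_all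
    ultimately have "\<infinity> \<le> ennreal \<delta> + winding_area c" using sumE order_trans by metis
    then show False using W_fin by (simp add: top_unique)
  qed
  have inX: "fst p < \<xi> (fst p)" "\<xi> (fst p) < snd p" "consecutive X (fst p) (snd p)" if "p \<in> gaps X" for p
    using rep(1)[of "fst p" "snd p"] that by (auto simp: gaps_def)
  have inY: "fst q < \<upsilon> (fst q)" "\<upsilon> (fst q) < snd q" "consecutive Y (fst q) (snd q)" if "q \<in> gaps Y" for q
    using rep(2)[of "fst q" "snd q"] that by (auto simp: gaps_def)
  have off_grid: "\<zeta> p q \<notin> grid_lines X Y" if p: "p \<in> gaps X" and q: "q \<in> gaps Y" for p q
  proof -
    have "\<xi> (fst p) \<notin> X" using inX[OF p] unfolding consecutive_def by fastforce
    moreover have "\<upsilon> (fst q) \<notin> Y" using inY[OF q] unfolding consecutive_def by fastforce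
    ultimately show ?thesis by (simp add: \<zeta>_def grid_lines_def)
  qed
  obtain e1 where e1: "e1 > 0" "\<forall>p\<in>gaps X. \<forall>r. 0 < r \<and> r < e1 \<longrightarrow> fst p + 2 * r \<le> \<xi> (fst p) \<and> \<xi> (fst p) + 2 * r \<le> snd p"
  proof -
    have "\<exists>e>0. \<forall>p\<in>gaps X. \<forall>r. 0 < r \<and> r < e \<longrightarrow> fst p + 2 * r \<le> \<xi> (fst p) \<and> \<xi> (fst p) + 2 * r \<le> snd p"
    proof (rule finite_uniform_radius[OF finXY(1)])
      fix p assume p: "p \<in> gaps X"
      show "\<exists>e>0. \<forall>r. 0 < r \<and> r < e \<longrightarrow> fst p + 2 * r \<le> \<xi> (fst p) \<and> \<xi> (fst p) + 2 * r \<le> snd p"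
        using inX[OF p] by (intro exI[of _ "min (\<xi> (fst p) - fst p) (snd p - \<xi> (fst p)) / 2"]) (simp add: min_def field_simps)
    qed
    then show ?thesis using that by blast
  qed
  obtain e2 where e2: "e2 > 0" "\<forall>p\<in>gaps Y. \<forall>r. 0 < r \<and> r < e2 \<longrightarrow> fst p + 2 * r \<le> \<upsilon> (fst p) \<and> \<upsilon> (fst p) + 2 * r \<le> snd p"
  proof -
    have "\<exists>e>0. \<forall>p\<in>gaps Y. \<forall>r. 0 < r \<and> r < e \<longrightarrow> fst p + 2 * r \<le> \<upsilon> (fst p) \<and> \<upsilon> (fst p) + 2 * r \<le> snd p"
    proof (rule finite_uniform_radius[OF finXY(2)])
      fix p assume p: "p \<in> gaps Y"
      show "\<exists>e>0. \<forall>r. 0 < r \<and> r < e \<longrightarrow> fst p + 2 * r \<le> \<upsilon> (fst p) \<and> \<upsilon> (fst p) + 2 * r \<le> snd p"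
        using inY[OF p] by (intro exI[of _ "min (\<upsilon> (fst p) - fst p) (snd p - \<upsilon> (fst p)) / 2"]) (simp add: min_def field_simps)
    qed
    then show ?thesis using that by blast
  qed
  obtain e3 where e3: "e3 > 0" "\<forall>i\<in>gaps X \<times> gaps Y. \<forall>r. 0 < r \<and> r < e3 \<longrightarrow>
      ball (\<zeta> (fst i) (snd i)) (4 * r) \<inter> path_image c = {} \<and> (\<forall>y\<in>ball (\<zeta> (fst i) (snd i)) (4 * r). w y = w (\<zeta> (fst i) (snd i)))"
  proof -
    have "\<exists>e>0. \<forall>i\<in>gaps X \<times> gaps Y. \<forall>r. 0 < r \<and> r < e \<longrightarrow>
      ball (\<zeta> (fst i) (snd i)) (4 * r) \<inter> path_image c = {} \<and> (\<forall>y\<in>ball (\<zeta> (fst i) (snd i)) (4 * r). w y = w (\<zeta> (fst i) (snd i)))"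
    proof (rule finite_uniform_radius)
      show "finite (gaps X \<times> gaps Y)" using finXY by simp
      fix i assume "i \<in> gaps X \<times> gaps Y"
      then have pq: "fst i \<in> gaps X" "snd i \<in> gaps Y" by auto
      define z where "z = \<zeta> (fst i) (snd i)"
      have "z \<in> - path_image c" using off[OF pq] by (simp add: z_def)
      then obtain a where a: "a > 0" "ball z a \<subseteq> - path_image c"
        using open_contains_ball_eq[OF open_Compl[OF clc]] by blast
      have "z \<notin> path_image c \<union> grid_lines X0 Y0" using off[OF pq] off_grid[OF pq] grid_sub unfolding z_def by blast
      then obtain b where b: "b > 0" "\<forall>y\<in>ball z b. w y = w z" using S(12) by blast
      show "\<exists>e>0. \<forall>r. 0 < r \<and> r < e \<longrightarrow> ball (\<zeta> (fst i) (snd i)) (4 * r) \<inter> path_image c = {} \<and>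
          (\<forall>y\<in>ball (\<zeta> (fst i) (snd i)) (4 * r). w y = w (\<zeta> (fst i) (snd i)))"
        unfolding z_def[symmetric]
      proof (intro exI[of _ "min a b / 4"] conjI allI impI)
        show "0 < min a b / 4" using a(1) b(1) by simp
        fix r assume r: "0 < r \<and> r < min a b / 4"
        have "ball z (4 * r) \<subseteq> ball z a" "ball z (4 * r) \<subseteq> ball z b" using r by (auto intro!: subset_ball)
        then show "ball z (4 * r) \<inter> path_image c = {}" "\<forall>y\<in>ball z (4 * r). w y = w z" using a(2) b(2) by blast+
      qed
    qed
    then show ?thesis using that by blast
  qed
  define r where "r = min e1 (min e2 e3) / 2"
  have r: "0 < r" "r < e1" "r < e2" "r < e3" using e1(1) e2(1) e3(1) by (auto simp: r_def min_def)
  have gX: "u + 2 * r \<le> \<xi> u \<and> \<xi> u + 2 * r \<le> v" if "consecutive X u v" for u v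
    using e1(2) that r(1,2) unfolding gaps_def by force
  have gY: "u + 2 * r \<le> \<upsilon> u \<and> \<upsilon> u + 2 * r \<le> v" if "consecutive Y u v" for u v
    using e2(2) that r(1,3) unfolding gaps_def by force
  \<comment> \<open>The radius \<open>4 r\<close> leaves room for the boxes, for the approximation of the curve within \<open>r\<close>, and for
    comparing winding numbers of both curves.\<close>
  have far_wconst: "ball (\<zeta> p q) (4 * r) \<inter> path_image c = {} \<and> (\<forall>y\<in>ball (\<zeta> p q) (4 * r). w y = w (\<zeta> p q))"
    if "p \<in> gaps X" "q \<in> gaps Y" for p q
  proof -
    have "(p, q) \<in> gaps X \<times> gaps Y" using that by (rule SigmaI)
    from e3(2)[THEN bspec, OF this, THEN spec, THEN mp, OF conjI, OF r(1,4)] show ?thesis unfolding fst_conv snd_conv .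
  qed
  have far: "ball (\<zeta> p q) (4 * r) \<inter> path_image c = {}" if "p \<in> gaps X" "q \<in> gaps Y" for p q
    using far_wconst[OF that] by (rule conjunct1)
  have wconst: "w y = w (\<zeta> p q)" if "p \<in> gaps X" "q \<in> gaps Y" "y \<in> ball (\<zeta> p q) (4 * r)" for p q y
    using far_wconst[OF that(1,2), THEN conjunct2] that(3) by (rule bspec)
  obtain \<rho> where \<rho>: "\<And>z. \<rho> differentiable (at z)"
    "\<And>z s. z \<in> grid_lines X Y \<Longrightarrow> (1 - s) *\<^sub>R z + s *\<^sub>R \<rho> z \<in> grid_lines X Y"
    "\<And>z. \<rho> z \<notin> grid_lines X Y \<Longrightarrow> \<exists>u v u' v'. consecutive X u v \<and> consecutive Y u' v' \<and>
        z \<in> ball (Complex (\<xi> u) (\<upsilon> u')) (2 * r) \<and> \<rho> z \<in> box (Complex u u') (Complex v v')"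
    "\<And>z z'. \<rho> z = \<rho> z' \<Longrightarrow> \<rho> z \<notin> grid_lines X Y \<Longrightarrow> z = z'"
    "\<And>p z. Re p \<in> X \<Longrightarrow> Im p \<in> Y \<Longrightarrow> dist z p \<le> r \<Longrightarrow> \<rho> z = p"
    by (rule grid_collapse[OF X(1,2) Y(1,2) r(1) gX gY]) (assumption | rule that)+
  define Q where "Q = (\<lambda>p q. box (Complex (fst p) (fst q)) (Complex (snd p) (snd q)))"
  have cell: "\<exists>p\<in>gaps X. \<exists>q\<in>gaps Y. z \<in> ball (\<zeta> p q) (2 * r) \<and> \<rho> z \<in> Q p q" if z_off: "\<rho> z \<notin> grid_lines X Y" for z
  proof -
    obtain u v u' v' where "consecutive X u v" "consecutive Y u' v'"
      "z \<in> ball (Complex (\<xi> u) (\<upsilon> u')) (2 * r)" "\<rho> z \<in> box (Complex u u') (Complex v v')" using \<rho>(3)[OF z_off] by (elim exE conjE) (rule that; assumption)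
    then show ?thesis unfolding gaps_def \<zeta>_def Q_def
      by (intro bexI[of _ "(u, v)"] bexI[of _ "(u', v')"]) simp_all
  qed
  obtain F where F: "disk_immersion F" and near: "\<And>t. t \<in> {0..1} \<Longrightarrow> dist (F (cis (2 * pi * t))) (c t) < r"
    by (rule self_overlapping_approximation[OF c so r(1)]) (rule that; assumption)
  have Fd: "F differentiable_on cball 0 1" using F unfolding disk_immersion_def differentiable_on_def differentiable_def by blast
  define \<gamma> where "\<gamma> = (\<lambda>t. F (cis (2 * pi * t)))"
  define \<phi> :: "real \<times> real \<Rightarrow> complex" where "\<phi> = (\<lambda>z. of_real (1 - fst z) * cis (2 * pi * snd z) + of_real (fst z))"
  have \<phi>cb: "\<phi> z \<in> cball 0 1" if "z \<in> {0..1} \<times> {0..1}" for z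
    unfolding \<phi>_def using that by (rule disk_contraction_in_disk)
  have cisd: "(\<lambda>z::real \<times> real. cis (2 * pi * snd z)) differentiable (at z)" for z
  proof -
    have "((\<lambda>w. exp (\<i> * (2 * of_real pi * w))) has_field_derivative
        exp (\<i> * (2 * of_real pi * of_real (snd z))) * (\<i> * (2 * of_real pi))) (at (of_real (snd z)))"
      by (auto intro!: derivative_eq_intros)
    from has_vector_derivative_real_field[OF this]
    have "((\<lambda>t. cis (2 * pi * t)) has_vector_derivative
        exp (\<i> * (2 * of_real pi * of_real (snd z))) * (\<i> * (2 * of_real pi))) (at (snd z))"
      by (simp add: cis_conv_exp)
    then have "(\<lambda>t. cis (2 * pi * t)) differentiable (at (snd z))" by (rule differentiableI_vector)
    then show ?thesis
      using differentiable_chain_at[OF bounded_linear_imp_differentiable[OF bounded_linear_snd, of "at z"], of "\<lambda>t. cis (2 * pi * t)"]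
      by (simp only: o_def)
  qed
  have \<phi>d: "\<phi> differentiable (at z)" for z
  proof -
    have "(\<lambda>z. complex_of_real (fst z)) differentiable (at z)" for z :: "real \<times> real"
      by (rule bounded_linear_imp_differentiable) (rule bounded_linear_compose[OF bounded_linear_of_real bounded_linear_fst])
    then show ?thesis unfolding \<phi>_def of_real_diff
      by (intro differentiable_add differentiable_mult differentiable_diff differentiable_const cisd)
  qed
  define P2 P3 P4 P5 where "P2 = (\<lambda>z::real \<times> real. (1 - fst z) *\<^sub>R S (1, snd z) + fst z *\<^sub>R \<rho> (S (1, snd z)))"
    and "P3 = (\<lambda>z::real \<times> real. \<rho> (S (1 - fst z, snd z)))"
    and "P4 = (\<lambda>z::real \<times> real. \<rho> ((1 - fst z) *\<^sub>R S (0, snd z) + fst z *\<^sub>R \<gamma> (snd z)))"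
    and "P5 = (\<lambda>z. \<rho> (F (\<phi> z)))"
  have cont\<rho>: "continuous_on UNIV \<rho>"
    by (intro continuous_at_imp_continuous_on ballI differentiable_imp_continuous_within \<rho>(1))
  have contS: "continuous_on ({0..1} \<times> {0..1}) (\<lambda>z. S (f (fst z), snd z))"
    if f: "continuous_on {0..1} f" "\<And>x. x \<in> {0..1} \<Longrightarrow> f x \<in> {0..1}" for f
  proof (rule continuous_on_compose2[OF S(5)])
    show "continuous_on ({0..1} \<times> {0..1}) (\<lambda>z. (f (fst z), snd z))"
      by (intro continuous_on_Pair continuous_on_compose2[OF f(1)] continuous_on_fst continuous_on_snd continuous_on_id) auto
    show "(\<lambda>z. (f (fst z), snd z)) ` ({0..1} \<times> {0..1}) \<subseteq> {0..1} \<times> {0..1}" using f(2) by force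
  qed
  have cS1: "continuous_on ({0..1} \<times> {0..1}) (\<lambda>z::real \<times> real. S (1, snd z))"
    and cS0: "continuous_on ({0..1} \<times> {0..1}) (\<lambda>z::real \<times> real. S (0, snd z))"
    and cSr: "continuous_on ({0..1} \<times> {0..1}) (\<lambda>z. S (1 - fst z, snd z))"
    using contS[of "\<lambda>_. 1"] contS[of "\<lambda>_. 0"] contS[of "\<lambda>x. 1 - x"] by (simp_all add: continuous_on_diff)
  have \<gamma>strip: "piecewise_differentiable_strip 0 1 (\<lambda>z. \<gamma> (snd z))" and \<gamma>cont: "continuous_on ({0..1} \<times> {0..1}) (\<lambda>z::real \<times> real. \<gamma> (snd z))"
    unfolding \<gamma>_def using piecewise_differentiable_strip_immersion[OF Fd cisd] by simp_all
  have \<phi>strip: "piecewise_differentiable_strip 0 1 (\<lambda>z. F (\<phi> z))" "continuous_on ({0..1} \<times> {0..1}) (\<lambda>z. F (\<phi> z))"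
    by (rule piecewise_differentiable_strip_immersion[OF Fd \<phi>d], rule \<phi>cb, assumption)+
  have compc: "continuous_on ({0..1} \<times> {0..1}) (\<lambda>z::real \<times> real. \<rho> (f z))" if "continuous_on ({0..1} \<times> {0..1}) f" for f
    by (rule continuous_on_compose2[OF cont\<rho> that]) simp
  have d1: "piecewise_differentiable_strip 0 1 (\<lambda>z. S (1, snd z))" by (rule piecewise_differentiable_strip_top[OF S(6)])
  have d0: "piecewise_differentiable_strip 0 1 (\<lambda>z. S (0, snd z))"
    using piecewise_differentiable_strip_top[OF piecewise_differentiable_strip_reverse[OF S(6)]] by simp
  have P2: "piecewise_differentiable_strip 0 1 P2" "continuous_on ({0..1} \<times> {0..1}) P2"
    unfolding P2_def
    by (rule piecewise_differentiable_strip_straight_line[OF d1 piecewise_differentiable_strip_compose[OF d1 \<rho>(1)]])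
       (intro continuous_intros cS1 compc)
  have P3: "piecewise_differentiable_strip 0 1 P3" "continuous_on ({0..1} \<times> {0..1}) P3"
    unfolding P3_def
    by (rule piecewise_differentiable_strip_compose[OF piecewise_differentiable_strip_reverse[OF S(6)] \<rho>(1)])
       (rule compc[OF cSr])
  have P4: "piecewise_differentiable_strip 0 1 P4" "continuous_on ({0..1} \<times> {0..1}) P4"
    unfolding P4_def
    by (rule piecewise_differentiable_strip_compose[OF piecewise_differentiable_strip_straight_line[OF d0 \<gamma>strip] \<rho>(1)])
       (rule compc, intro continuous_intros cS0 \<gamma>cont)
  have P5: "piecewise_differentiable_strip 0 1 P5" "continuous_on ({0..1} \<times> {0..1}) P5"
    unfolding P5_def
    by (rule piecewise_differentiable_strip_compose[OF \<phi>strip(1) \<rho>(1)]) (rule compc[OF \<phi>strip(2)])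
  define H45 H35 H25 H where "H45 = glue_first P4 P5" and "H35 = glue_first P3 H45"
    and "H25 = glue_first P2 H35" and "H = glue_first S H25"
  have m45: "P4 (1, t) = P5 (0, t)" for t by (simp add: P4_def P5_def \<gamma>_def \<phi>_def)
  have H45: "piecewise_differentiable_strip 0 1 H45" "continuous_on ({0..1} \<times> {0..1}) H45"
    unfolding H45_def
    by (rule piecewise_differentiable_strip_glue_first[OF P4(1) P5(1)], rule m45)
       (rule continuous_on_glue_first[OF P4(2) P5(2)], rule m45)
  have m35: "P3 (1, t) = H45 (0, t)" for t by (simp add: P3_def P4_def H45_def glue_first_ends)
  have H35: "piecewise_differentiable_strip 0 1 H35" "continuous_on ({0..1} \<times> {0..1}) H35"
    unfolding H35_def
    by (rule piecewise_differentiable_strip_glue_first[OF P3(1) H45(1)], rule m35)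
       (rule continuous_on_glue_first[OF P3(2) H45(2)], rule m35)
  have m25: "P2 (1, t) = H35 (0, t)" for t by (simp add: P2_def P3_def H35_def glue_first_ends)
  have H25: "piecewise_differentiable_strip 0 1 H25" "continuous_on ({0..1} \<times> {0..1}) H25"
    unfolding H25_def
    by (rule piecewise_differentiable_strip_glue_first[OF P2(1) H35(1)], rule m25)
       (rule continuous_on_glue_first[OF P2(2) H35(2)], rule m25)
  have m15: "S (1, t) = H25 (0, t)" for t by (simp add: P2_def H25_def glue_first_ends)
  have Hd: "piecewise_differentiable_strip 0 1 H" and Hc: "continuous_on ({0..1} \<times> {0..1}) H"
    unfolding H_def
    by (rule piecewise_differentiable_strip_glue_first[OF S(6) H25(1)], rule m15)
       (rule continuous_on_glue_first[OF S(5) H25(2)], rule m15)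
  have \<rho>p0: "\<rho> z = p0" if "dist z p0 \<le> r" for z by (rule \<rho>(5)[OF X(3) Y(3) that])
  have \<gamma>0: "\<gamma> 0 = F 1" by (simp add: \<gamma>_def)
  have F1: "dist (F 1) p0 < r" using near[of 0] by (simp add: p0_def)
  have cis1: "cis (2 * pi * t) = 1" if "t = 0 \<or> t = 1" for t using that by (auto simp: complex_eq_iff)
  have side: "H (s, t) = p0" if s: "s \<in> {0..1}" and t: "t = 0 \<or> t = 1" for s t
  proof -
    have S1: "S (s, t) = p0" if "s \<in> {0..1}" for s using S(9)[OF that] S(10)[OF that] t c10 by (auto simp: p0_def)
    have \<rho>0: "\<rho> p0 = p0" using \<rho>p0[of p0] r(1) by simp
    have "P5 (s, t) = p0" for s
    proof -
      have "\<phi> (s, t) = 1" by (simp add: \<phi>_def cis1[OF t])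
      then show ?thesis using \<rho>p0[of "F 1"] F1 by (simp add: P5_def)
    qed
    moreover have "P4 (s, t) = p0" if s: "s \<in> {0..1}" for s
    proof -
      have \<gamma>t: "\<gamma> t = F 1" unfolding \<gamma>_def cis1[OF t] ..
      have "(1 - s) *\<^sub>R S (0, t) + s *\<^sub>R \<gamma> t - p0 = s *\<^sub>R (F 1 - p0)"
        using S1[of 0] \<gamma>t by (simp add: algebra_simps)
      then have "dist ((1 - s) *\<^sub>R S (0, t) + s *\<^sub>R \<gamma> t) p0 = s * dist (F 1) p0" using s by (simp add: dist_norm)
      also have "\<dots> \<le> 1 * r" using s F1 by (intro mult_mono) auto
      finally show ?thesis using \<rho>p0 by (simp add: P4_def)
    qed
    moreover have "P3 (s, t) = p0" if "s \<in> {0..1}" for s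
      using S1[of "1 - s"] that \<rho>0 by (simp add: P3_def)
    moreover have "P2 (s, t) = p0" for s
      using S1[of 1] \<rho>0 by (simp add: P2_def algebra_simps)
    ultimately show ?thesis unfolding H_def H25_def H35_def H45_def
      by (intro glue_first_side S1 s)
  qed
  have nh: "null_homotopy c H"
    unfolding null_homotopy_def unit_square_def
  proof (intro conjI ballI Hc)
    fix t :: real assume t: "t \<in> {0..1}"
    show "H (0, t) = c t" using S(7)[OF t] by (simp add: H_def glue_first_ends)
    have "\<phi> (1, t) = 1" by (simp add: \<phi>_def)
    then show "H (1, t) = c 0" using \<rho>p0[of "F 1"] F1
      by (simp add: H_def H25_def H35_def H45_def glue_first_ends P5_def p0_def)
    show "H (t, 0) = c 0" "H (t, 1) = c 0" using side[OF t] by (simp_all add: p0_def)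
  qed
  have count: "preimage_count 0 1 H x \<le> w x + (\<Sum>q\<in>gaps Y. \<Sum>p\<in>gaps X. W (\<zeta> p q) * indicator (Q p q) x)"
    if x: "x \<notin> path_image c \<union> grid_lines X Y" for x
  proof -
    have xg: "x \<notin> grid_lines X Y" using x by blast
    have "preimage_count 0 1 H x \<le> preimage_count 0 1 S x + preimage_count 0 1 H25 x"
      unfolding H_def by (rule preimage_count_glue_first)
    also have "\<dots> \<le> w x + (preimage_count 0 1 P2 x + preimage_count 0 1 H35 x)"
    proof (rule add_mono)
      show "preimage_count 0 1 S x \<le> w x" by (rule S(11)) (use x grid_sub in blast)
      show "preimage_count 0 1 H25 x \<le> preimage_count 0 1 P2 x + preimage_count 0 1 H35 x"
        unfolding H25_def by (rule preimage_count_glue_first)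
    qed
    also have "preimage_count 0 1 P2 x = 0"
    proof (rule preimage_count_eq_0)
      fix z :: "real \<times> real" assume z: "z \<in> {0..1} \<times> {0..1}"
      then have "S (1, snd z) \<in> grid_lines X Y" using S(8)[of "snd z"] grid_sub by auto
      then have "P2 z \<in> grid_lines X Y" unfolding P2_def by (rule \<rho>(2))
      then show "P2 z \<noteq> x" using xg by blast
    qed
    also have "preimage_count 0 1 H35 x \<le> preimage_count 0 1 P3 x + (preimage_count 0 1 P4 x + preimage_count 0 1 P5 x)"
      unfolding H35_def H45_def by (rule order_trans[OF preimage_count_glue_first add_left_mono[OF preimage_count_glue_first]])
    also have "preimage_count 0 1 P4 x = 0"
    proof (rule preimage_count_eq_0, rule notI)
      fix z :: "real \<times> real" assume z: "z \<in> {0..1} \<times> {0..1}" and eq: "P4 z = x"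
      have s: "0 \<le> fst z" "fst z \<le> 1" "snd z \<in> {0..1}" using z by auto
      define y where "y = (1 - fst z) *\<^sub>R S (0, snd z) + fst z *\<^sub>R \<gamma> (snd z)"
      have "\<rho> y \<notin> grid_lines X Y" using eq xg by (simp add: P4_def y_def)
      then obtain p q where pq: "p \<in> gaps X" "q \<in> gaps Y" "y \<in> ball (\<zeta> p q) (2 * r)" using cell by blast
      have "y - c (snd z) = fst z *\<^sub>R (\<gamma> (snd z) - c (snd z))" using S(7)[OF s(3)] by (simp add: y_def algebra_simps)
      then have "dist y (c (snd z)) = fst z * dist (\<gamma> (snd z)) (c (snd z))" using s by (simp add: dist_norm)
      also have "\<dots> \<le> 1 * r" using s near[OF s(3)] by (intro mult_mono) (auto simp: \<gamma>_def)
      finally have "dist (\<zeta> p q) (c (snd z)) < 4 * r" using pq(3) dist_triangle[of "\<zeta> p q" "c (snd z)" y] r(1) by simp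
      moreover have "c (snd z) \<in> path_image c" using s(3) by (simp add: path_image_def)
      ultimately show False using far[OF pq(1,2)] by (auto simp: disjoint_iff)
    qed
    finally have le: "preimage_count 0 1 H x \<le> w x + (preimage_count 0 1 P3 x + preimage_count 0 1 P5 x)"
      by (simp add: add_mono)
    have "preimage_count 0 1 P3 x + preimage_count 0 1 P5 x \<le> (\<Sum>q\<in>gaps Y. \<Sum>p\<in>gaps X. W (\<zeta> p q) * indicator (Q p q) x)"
    proof (cases "\<exists>y. \<rho> y = x")
      case False
      then have "preimage_count 0 1 P3 x = 0" "preimage_count 0 1 P5 x = 0"
        by (auto intro!: preimage_count_eq_0 simp: P3_def P5_def)
      then show ?thesis by simp
    next
      case True
      then obtain y where y: "\<rho> y = x" by blast
      have uniq: "y' = y" if "\<rho> y' = x" for y' using \<rho>(4)[of y' y] that y xg by simp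
      obtain p q where pq: "p \<in> gaps X" "q \<in> gaps Y" "y \<in> ball (\<zeta> p q) (2 * r)" "x \<in> Q p q"
        using cell[of y] y xg by blast
      have y4: "y \<in> ball (\<zeta> p q) (4 * r)" using pq(3) r(1) by simp
      have dist_c: "4 * r \<le> dist (\<zeta> p q) (c t)" if "t \<in> {0..1}" for t
      proof -
        have "c t \<in> path_image c" using that by (simp add: path_image_def)
        then have "c t \<notin> ball (\<zeta> p q) (4 * r)" using far[OF pq(1,2)] by blast
        then show ?thesis by simp
      qed
      \<comment> \<open>The same estimate separates \<open>y\<close> from the boundary of the immersed disk and makes the two curves homotopic
        off \<open>y\<close>.\<close>
      have dist_y: "2 * r < dist (c t) y" if "t \<in> {0..1}" for t
        using dist_c[OF that] pq(3) dist_triangle[of "\<zeta> p q" "c t" y] by (simp add: dist_commute)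
      have "y \<notin> grid_lines X Y" using \<rho>(2)[of y 1] y xg by auto
      moreover have yc: "y \<notin> path_image c" using far[OF pq(1,2)] y4 by blast
      ultimately have "y \<notin> path_image c \<union> grid_lines X0 Y0" using grid_sub by blast
      then have "preimage_count 0 1 S y \<le> w y" by (rule S(11))
      also have "w y = w (\<zeta> p q)" by (rule wconst[OF pq(1,2) y4])
      finally have "preimage_count 0 1 S y \<le> w (\<zeta> p q)" .
      moreover have "preimage_count 0 1 P3 x \<le> preimage_count 0 1 (\<lambda>z. S (1 - fst z, snd z)) y"
        unfolding preimage_count_def by (rule count_mono) (auto simp: P3_def intro: uniq)
      ultimately have 3: "preimage_count 0 1 P3 x \<le> w (\<zeta> p q)" using preimage_count_reverse order_trans by metis
      have "preimage_count 0 1 P5 x \<le> preimage_count 0 1 (\<lambda>z. F (\<phi> z)) y"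
        unfolding preimage_count_def by (rule count_mono) (auto simp: P5_def intro: uniq)
      also have "\<dots> \<le> ennreal (cmod (winding_number \<gamma> y))"
        unfolding \<phi>_def \<gamma>_def
      proof (rule preimage_count_disk_contraction[OF F])
        show "y \<notin> F ` sphere 0 1"
        proof
          assume "y \<in> F ` sphere 0 1"
          then obtain \<omega> where \<omega>: "\<omega> \<in> sphere 0 1" "y = F \<omega>" by blast
          then have "\<omega> \<in> path_image (circlepath 0 1)" by simp
          then obtain t where t: "t \<in> {0..1}" "\<omega> = circlepath 0 1 t" unfolding path_image_def by blast
          have "\<omega> = cis (2 * pi * t)" unfolding t(2) by (simp add: circlepath cis_conv_exp mult_ac)
          then have "dist y (c t) < r" using near[OF t(1)] \<omega>(2) by simp
          then show False using dist_y[OF t(1)] r(1) by (simp add: dist_commute)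
        qed
      qed
      also have "winding_number \<gamma> y = winding_number c y"
      proof (rule winding_number_nearby_loops_eq[OF pc(1) _ pc(2)])
        have "continuous_on {0..1} (\<lambda>t. (0::real, t))" by (intro continuous_intros)
        then have "continuous_on {0..1} (\<lambda>t. \<gamma> (snd (0::real, t)))"
          by (rule continuous_on_compose2[OF \<gamma>cont]) auto
        then show "path \<gamma>" by (simp add: path_def)
        show "pathfinish \<gamma> = pathstart \<gamma>" using cis1[of 1] by (simp add: pathfinish_def pathstart_def \<gamma>_def)
        fix t :: real assume t: "t \<in> {0..1}"
        show "norm (\<gamma> t - c t) < norm (c t - y)"
          using near[OF t] dist_y[OF t] r(1) unfolding \<gamma>_def dist_norm by linarith
      qed
      also have "winding_number c y = winding_number c (\<zeta> p q)"
        by (rule winding_number_eq[OF pc y4 _ connected_ball far[OF pq(1,2)]]) (use r(1) in simp)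
      also have "ennreal (cmod (winding_number c (\<zeta> p q))) = V (\<zeta> p q)" using off[OF pq(1,2)] by (simp add: V_def)
      finally have 5: "preimage_count 0 1 P5 x \<le> V (\<zeta> p q)" .
      have "preimage_count 0 1 P3 x + preimage_count 0 1 P5 x \<le> w (\<zeta> p q) + V (\<zeta> p q)" using 3 5 by (rule add_mono)
      also have "\<dots> = W (\<zeta> p q) * indicator (Q p q) x" using off[OF pq(1,2)] pq(4) by (simp add: W_def)
      also have "\<dots> \<le> (\<Sum>p\<in>gaps X. W (\<zeta> p q) * indicator (Q p q) x)"
        using pq(1) finXY by (intro member_le_sum[of p "gaps X" "\<lambda>p. W (\<zeta> p q) * indicator (Q p q) x"]) simp_all
      also have "\<dots> \<le> (\<Sum>q\<in>gaps Y. \<Sum>p\<in>gaps X. W (\<zeta> p q) * indicator (Q p q) x)"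
        using pq(2) finXY by (intro member_le_sum[of q "gaps Y" "\<lambda>q. \<Sum>p\<in>gaps X. W (\<zeta> p q) * indicator (Q p q) x"]) simp_all
      finally show ?thesis .
    qed
    then show ?thesis by (rule order_trans[OF le add_left_mono])
  qed
  have Qm: "Q p q \<in> sets lborel" for p q by (simp add: Q_def)
  have eQ: "emeasure lborel (Q p q) = ennreal (snd q - fst q) * ennreal (snd p - fst p)" if "p \<in> gaps X" "q \<in> gaps Y" for p q
  proof -
    have le: "fst p \<le> snd p" "fst q \<le> snd q" using that by (auto simp: gaps_def consecutive_def)
    have "emeasure lborel (Q p q) = ennreal (\<Prod>b\<in>Basis. (Complex (snd p) (snd q) - Complex (fst p) (fst q)) \<bullet> b)"
      unfolding Q_def by (rule emeasure_lborel_box) (use le in \<open>auto simp: Basis_complex_def\<close>)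
    also have "(\<Prod>b\<in>Basis. (Complex (snd p) (snd q) - Complex (fst p) (fst q)) \<bullet> b) = (snd q - fst q) * (snd p - fst p)"
      by (simp add: Basis_complex_def)
    finally show ?thesis using le by (simp add: ennreal_mult)
  qed
  have "homotopy_area H \<le> (\<integral>\<^sup>+x. w x + (\<Sum>q\<in>gaps Y. \<Sum>p\<in>gaps X. W (\<zeta> p q) * indicator (Q p q) x) \<partial>lborel)"
    unfolding homotopy_area_def
  proof (rule nn_integral_mono_AE)
    have "negligible (path_image c \<union> grid_lines X Y)" using negc negligible_grid_lines[OF X(1) Y(1)] by (rule negligible_Un)
    from AE_lborel_not_in_negligible[OF this]
    show "AE x in lborel. num_preimage_components H x \<le> w x + (\<Sum>q\<in>gaps Y. \<Sum>p\<in>gaps X. W (\<zeta> p q) * indicator (Q p q) x)"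
      by (rule eventually_mono) (rule order_trans[OF num_preimage_components_le count])
  qed
  also have "\<dots> = (\<integral>\<^sup>+x. w x \<partial>lborel) + (\<integral>\<^sup>+x. (\<Sum>q\<in>gaps Y. \<Sum>p\<in>gaps X. W (\<zeta> p q) * indicator (Q p q) x) \<partial>lborel)"
    by (rule nn_integral_add) (use S(3) Qm in \<open>auto intro!: borel_measurable_sum borel_measurable_times_ennreal borel_measurable_indicator\<close>)
  also have "(\<integral>\<^sup>+x. (\<Sum>q\<in>gaps Y. \<Sum>p\<in>gaps X. W (\<zeta> p q) * indicator (Q p q) x) \<partial>lborel)
      = (\<Sum>q\<in>gaps Y. \<integral>\<^sup>+x. (\<Sum>p\<in>gaps X. W (\<zeta> p q) * indicator (Q p q) x) \<partial>lborel)"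
    by (rule nn_integral_sum) (use Qm in \<open>auto intro!: borel_measurable_sum borel_measurable_times_ennreal borel_measurable_indicator\<close>)
  also have "\<dots> = (\<Sum>q\<in>gaps Y. \<Sum>p\<in>gaps X. \<integral>\<^sup>+x. W (\<zeta> p q) * indicator (Q p q) x \<partial>lborel)"
    by (intro sum.cong refl nn_integral_sum) (use Qm in \<open>auto intro!: borel_measurable_times_ennreal borel_measurable_indicator\<close>)
  also have "\<dots> = (\<Sum>q\<in>gaps Y. \<Sum>p\<in>gaps X. E p q)"
  proof (intro sum.cong refl)
    fix q p assume "q \<in> gaps Y" "p \<in> gaps X"
    then show "(\<integral>\<^sup>+x. W (\<zeta> p q) * indicator (Q p q) x \<partial>lborel) = E p q"
      using Qm by (simp add: nn_integral_cmult_indicator eQ E_def mult_ac)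
  qed
  also have "(\<integral>\<^sup>+x. w x \<partial>lborel) + (\<Sum>q\<in>gaps Y. \<Sum>p\<in>gaps X. E p q) \<le> ennreal \<delta> + (ennreal \<delta> + winding_area c)"
    by (rule add_mono[OF S(4) sumE])
  finally have "homotopy_area H \<le> winding_area c + ennreal \<delta> + ennreal \<delta>" by (simp add: ac_simps)
  moreover have "piecewise_differentiable_square H" by (rule piecewise_differentiable_strip_imp_square[OF Hd])
  ultimately show ?thesis using nh by blast
qed

theorem theorem5:
  fixes c :: "real \<Rightarrow> complex" and p0 :: complex
  assumes "normal_curve c" and "c 0 = p0" and "self_overlapping c"
  shows "min_homotopy_area c = winding_area c"
proof (rule antisym)
  have pr: "piecewise_regular c" using assms(1) by (simp add: normal_curve_def)
  then have cc: "closed_curve c" by (simp add: piecewise_regular_def)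
  show "winding_area c \<le> min_homotopy_area c"
    unfolding min_homotopy_area_def
    by (rule INF_greatest) (auto intro: winding_area_le_homotopy_area[OF cc negligible_path_image_piecewise_regular[OF pr]])
  show "min_homotopy_area c \<le> winding_area c"
  proof (rule ennreal_le_epsilon)
    fix e :: real assume e: "winding_area c < top" "0 < e"
    have "0 < e / 2" using e(2) by simp
    obtain H where H: "null_homotopy c H" "piecewise_differentiable_square H"
      "homotopy_area H \<le> winding_area c + ennreal (e / 2) + ennreal (e / 2)"
      using exists_small_null_homotopy[OF assms(1,3) _ \<open>0 < e / 2\<close>] e(1) by auto
    have "min_homotopy_area c \<le> homotopy_area H" unfolding min_homotopy_area_def using H(1,2) by (intro INF_lower) blast
    also have "\<dots> \<le> winding_area c + (ennreal (e / 2) + ennreal (e / 2))" using H(3) by (simp add: add.assoc)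
    also have "ennreal (e / 2) + ennreal (e / 2) = ennreal e" using e(2) by (simp flip: ennreal_plus)
    finally show "min_homotopy_area c \<le> winding_area c + ennreal e" .
  qed
qed

end
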